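(* Let $\mathfrak X_\times$ be one of $\mathcal C(\mathbb R_+^\times)$, $\mathcal C^\infty(\mathbb R_+^\times)$, $\mathcal C^\infty_{\rm poly}(\mathbb R_+^\times)$, $\mathbf S(\mathbb R_+^\times)^*$, and let $\mathfrak X_+$ be one of $\mathcal C(\mathbb R)$, $\mathcal C^\infty(\mathbb R)$, $\mathcal C^\infty_{\exp}(\mathbb R)$, $\mathbf S(\mathbb R)^*$. Let $f$ be a real-valued locally integrable function on $\mathbb R_+^\times$ of rapid decay as $x\to+\infty$ (i.e. $f(x)=O(x^{-A})$ for all $A>0$) and of polynomial order as $x\to0^+$ (i.e. $f(x)=O(x^{-A})$ for some $A>0$). Let $\epsilon\in\{1,-1\}$, $h_{f,\epsilon}(x)=f(x)-\epsilon x^{-1}f(x^{-1})$ and $H_{f,\epsilon}(t)=h_{f,\epsilon}(e^{-t})$. Let $\mathsf M(f)(s)=\int_0^{+\infty}f(x)x^s\,\frac{dx}{x}$, defined for $\mathrm{Re}(s)\gg0$. (a) If $h_{f,\epsilon}$ is $\mathfrak X_\times$-mean-periodic, then $\mathsf M(f)(s)$ admits a meromorphic continuation to $\mathbb C$ and satisfies $\mathsf M(f)(s)=\epsilon\,\mathsf M(f)(1-s)$. More precisely, $$\mathsf M(f)(s)=\int_1^{+\infty}f(x)x^s\frac{dx}{x}+\epsilon\int_1^{+\infty}f(x)x^{1-s}\frac{dx}{x}+\omega_{f,\epsilon}(s),$$ where $\omega_{f,\epsilon}(s)$ coincides for $\mathrm{Re}(s)\gg0$ with $\int_0^1h_{f,\epsilon}(x)x^s\frac{dx}{x}$,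 admits a meromorphic continuation to $\mathbb C$ given by the Mellin--Carleman transform $\mathsf{MC}(h_{f,\epsilon})(s)$, and satisfies $\omega_{f,\epsilon}(s)=\epsilon\,\omega_{f,\epsilon}(1-s)$. (b) If $H_{f,\epsilon}$ is $\mathfrak X_+$-mean-periodic, then $\mathsf M(f)(s)$ admits a meromorphic continuation to $\mathbb C$ and satisfies $\mathsf M(f)(s)=\epsilon\,\mathsf M(f)(1-s)$. More precisely, the same decomposition of $\mathsf M(f)(s)$ holds, where $\omega_{f,\epsilon}(s)$ coincides for $\mathrm{Re}(s)\gg0$ with the Laplace transform $\int_0^{+\infty}H_{f,\epsilon}(t)e^{-st}\,dt$, admits a meromorphic continuation to $\mathbb C$ given by the Laplace--Carleman transform $\mathsf{LC}(H_{f,\epsilon})(s)$, and satisfies $\omega_{f,\epsilon}(s)=\epsilon\,\omega_{f,\epsilon}(1-s)$.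
   Context: Notation: $\mathbb R_+^\times=(0,\infty)$. Spaces. $\mathcal C(\mathbb R)$, $\mathcal C^\infty(\mathbb R)$: continuous, resp. smooth, complex functions on $\mathbb R$ with the topology of uniform convergence on compacta (of all derivatives in the smooth case); their duals are the compactly supported Radon measures, resp. distributions. $\mathcal C^\infty_{\exp}(\mathbb R)=\bigcup_{m\ge1}F_m$, where $F_m$ is the Fréchet space of smooth $f$ with $\sup_x|f^{(n)}(x)|e^{-m|x|}<\infty$ for all $n\ge0$, with the inductive limit topology. $\mathbf S(\mathbb R_+^\times)$: the Fréchet space of smooth $f$ on $\mathbb R_+^\times$ with $\sup_{x>0}|x^mf^{(n)}(x)|<\infty$ for all $m\in\mathbb Z$, $n\ge0$. The spaces $\mathcal C(\mathbb R_+^\times),\mathcal C^\infty(\mathbb R_+^\times),\mathcal C^\infty_{\rm poly}(\mathbb R_+^\times)$ correspond to $\mathcal C(\mathbb R),\mathcal C^\infty(\mathbb R),\mathcal C^\infty_{\exp}(\mathbb R)$, and $\mathbf S(\mathbb R)$ corresponds to $\mathbf S(\mathbb R_+^\times)$, through the change of variable $x=e^{-t}$ (functions and topologies are transported). $X^*$ is the topological dual of $X$; the dual of $\mathbf S^*$ (with its weak-$*$ topology) is identified with $\mathbf S$. A locally integrable function of at most polynomial growth at $0^+$ and $+\infty$ (resp. at most exponential growth on $\mathbb R$) is viewed as an element $h$ of $\mathbf S(\mathbb R_+^\times)^*$ (resp. $\mathbf S(\mathbb R)^*$) via $g\mapsto\int_0^\infty g(x)h(x)\frac{dx}x$ (resp.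 $\int_{\mathbb R} gh\,dt$). Convolution. Additive: $(f\ast_+\varphi)(x)=\langle f(x-\cdot),\varphi\rangle$; multiplicative: $(f\ast_\times\varphi)(x)=\langle f(x/\cdot),\varphi\rangle$; for functions, $(f\ast_\times h)(x)=\int_0^\infty f(x/y)h(y)\frac{dy}y$. Mean-periodicity. For $X$ one of these spaces, $f\in X$ is $X$-mean-periodic if there is a nonzero $\varphi\in X^*$ with $f\ast\varphi=0$ ($\ast=\ast_+$ on $\mathbb R$, $\ast=\ast_\times$ on $\mathbb R_+^\times$). Carleman transforms. Let $f$ be a mean-periodic function on $\mathbb R$ and $\varphi\in X^*\setminus\{0\}$ with $f\ast_+\varphi=0$. Put $f^+=f\cdot 1_{[0,\infty)}$, $f^-=f\cdot 1_{(-\infty,0)}$ and $\mathsf L_\pm(\psi)(s)=\langle e^{-st},\psi\rangle$ (two-sided Laplace transform, $=\int_{\mathbb R}\psi(t)e^{-st}dt$ for functions). Then $\mathsf{LC}(f)(s)=\mathsf L_\pm(f^+\ast_+\varphi)(s)/\mathsf L_\pm(\varphi)(s)=-\mathsf L_\pm(f^-\ast_+\varphi)(s)/\mathsf L_\pm(\varphi)(s)$ (convolutions in the distribution sense); it does not depend on $\varphi$. For a mean-periodic function $h$ on $\mathbb R_+^\times$, $\mathsf{MC}(h)(s)$ is the Laplace--Carleman transform of $t\mapsto h(e^{-t})$; equivalently $\mathsf{MC}(h)=\mathsf M(g\ast_\times h^+)/\mathsf M(g)$ where $g\ne0$, $g\ast_\times h=0$, $h^+=h\cdot1_{(0,1)}$.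 *)

theory Defs
  imports "HOL-Complex_Analysis.Complex_Analysis" "HOL-Library.Landau_Symbols"
begin

section \<open>Locally convex function spaces\<close>

text \<open>
  A function space is represented by its topology, whose \<^const>\<open>topspace\<close> is the underlying
  vector space of functions. Functions on the multiplicative group of positive reals are functions
  \<^typ>\<open>real \<Rightarrow> complex\<close> whose values outside \<open>{0<..}\<close> are irrelevant: neither the carriers nor the
  topologies below depend on them, hence neither do continuous functionals.
\<close>

definition seminorm_topology ::
  "(real \<Rightarrow> complex) set \<Rightarrow> ((real \<Rightarrow> complex) \<Rightarrow> real) set \<Rightarrow> (real \<Rightarrow> complex) topology" where
  "seminorm_topology V P =
     topology_generated_by {{g \<in> V. p (\<lambda>x. g x - f x) < r} | p f r. p \<in> P \<and> f \<in> V \<and> 0 < r}"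

definition is_seminorm :: "(real \<Rightarrow> complex) set \<Rightarrow> ((real \<Rightarrow> complex) \<Rightarrow> real) \<Rightarrow> bool" where
  "is_seminorm V p \<longleftrightarrow>
     (\<forall>f\<in>V. \<forall>g\<in>V. p (\<lambda>x. f x + g x) \<le> p f + p g) \<and>
     (\<forall>f\<in>V. \<forall>c::complex. p (\<lambda>x. c * f x) = norm c * p f)"

definition top_dual :: "(real \<Rightarrow> complex) topology \<Rightarrow> ((real \<Rightarrow> complex) \<Rightarrow> complex) set" where
  "top_dual T = {\<phi>. continuous_map T euclidean \<phi> \<and>
     (\<forall>f\<in>topspace T. \<forall>g\<in>topspace T. \<forall>a b. \<phi> (\<lambda>x. a * f x + b * g x) = a * \<phi> f + b * \<phi> g)}"

definition iter_deriv :: "nat \<Rightarrow> (real \<Rightarrow> complex) \<Rightarrow> real \<Rightarrow> complex" where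
  "iter_deriv n f = ((\<lambda>g x. vector_derivative g (at x)) ^^ n) f"

text \<open>To be used for open \<open>S\<close>, where \<^const>\<open>iter_deriv\<close> depends only on the values of \<open>f\<close> on \<open>S\<close>.\<close>

definition smooth_fun_on :: "real set \<Rightarrow> (real \<Rightarrow> complex) \<Rightarrow> bool" where
  "smooth_fun_on S f \<longleftrightarrow> (\<forall>n. \<forall>x\<in>S. iter_deriv n f differentiable (at x))"

definition C_top :: "(real \<Rightarrow> complex) topology" where
  "C_top = seminorm_topology {f. continuous_on UNIV f}
     {\<lambda>f. SUP x\<in>K. norm (f x) | K. compact K \<and> K \<noteq> {}}"

definition Cinf_top :: "(real \<Rightarrow> complex) topology" where
  "Cinf_top = seminorm_topology {f. smooth_fun_on UNIV f}
     {\<lambda>f. SUP x\<in>K. norm (iter_deriv n f x) | n K. compact K \<and> K \<noteq> {}}"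

definition F_top :: "nat \<Rightarrow> (real \<Rightarrow> complex) topology" where
  "F_top m = seminorm_topology
     {f. smooth_fun_on UNIV f \<and>
         (\<forall>n. bdd_above (range (\<lambda>x. norm (iter_deriv n f x) * exp (- (real m * \<bar>x\<bar>)))))}
     {\<lambda>f. SUP x. norm (iter_deriv n f x) * exp (- (real m * \<bar>x\<bar>)) | n. True}"

text \<open>
  The locally convex inductive limit of the spaces \<open>F_m\<close>: its topology is generated by all
  seminorms whose restriction to every step is continuous.
\<close>

definition Cexp_top :: "(real \<Rightarrow> complex) topology" where
  "Cexp_top = (let V = (\<Union>m\<in>{1..}. topspace (F_top m)) in
     seminorm_topology V
       {p. is_seminorm V p \<and> (\<forall>m\<ge>1. continuous_map (F_top m) euclideanreal p)})"

definition Schwartz_mult_top :: "(real \<Rightarrow> complex) topology" where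
  "Schwartz_mult_top = seminorm_topology
     {f. smooth_fun_on {0<..} f \<and>
         (\<forall>(m::int) n. bdd_above ((\<lambda>x. x powi m * norm (iter_deriv n f x)) ` {0<..}))}
     {\<lambda>f. SUP x\<in>{0<..}. x powi m * norm (iter_deriv n f x) | (m::int) n. True}"

text \<open>Transport of functions and topologies through the change of variable \<open>x = exp (- t)\<close>.\<close>

definition mult_of_add :: "(real \<Rightarrow> complex) topology \<Rightarrow> (real \<Rightarrow> complex) topology" where
  "mult_of_add T = pullback_topology UNIV (\<lambda>h t. h (exp (- t))) T"

definition Schwartz_add_top :: "(real \<Rightarrow> complex) topology" where
  "Schwartz_add_top = pullback_topology UNIV (\<lambda>g x. g (- ln x)) Schwartz_mult_top"


section \<open>Convolution and mean-periodicity\<close>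

text \<open>
  For a function \<open>f\<close> and a functional \<open>\<phi>\<close> these are the convolutions of \<open>f\<close> with \<open>\<phi>\<close>. For an element
  \<open>F\<close> of the dual of a Schwartz space and \<open>g\<close> in that Schwartz space (identified with the dual of
  the weak-* dual), the convolution of \<open>F\<close> with \<open>g\<close> is \<open>conv_add g F\<close> resp. \<open>conv_mult g F\<close>.
\<close>

definition conv_add :: "(real \<Rightarrow> complex) \<Rightarrow> ((real \<Rightarrow> complex) \<Rightarrow> complex) \<Rightarrow> real \<Rightarrow> complex" where
  "conv_add f \<phi> x = \<phi> (\<lambda>y. f (x - y))"

definition conv_mult :: "(real \<Rightarrow> complex) \<Rightarrow> ((real \<Rightarrow> complex) \<Rightarrow> complex) \<Rightarrow> real \<Rightarrow> complex" where
  "conv_mult f \<phi> x = \<phi> (\<lambda>y. f (x / y))"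

definition annihilators_add ::
  "(real \<Rightarrow> complex) topology \<Rightarrow> (real \<Rightarrow> complex) \<Rightarrow> ((real \<Rightarrow> complex) \<Rightarrow> complex) set" where
  "annihilators_add T f =
     {\<phi> \<in> top_dual T. (\<exists>g\<in>topspace T. \<phi> g \<noteq> 0) \<and> (\<forall>x. conv_add f \<phi> x = 0)}"

definition annihilators_mult ::
  "(real \<Rightarrow> complex) topology \<Rightarrow> (real \<Rightarrow> complex) \<Rightarrow> ((real \<Rightarrow> complex) \<Rightarrow> complex) set" where
  "annihilators_mult T h =
     {\<phi> \<in> top_dual T. (\<exists>g\<in>topspace T. \<phi> g \<noteq> 0) \<and> (\<forall>x>0. conv_mult h \<phi> x = 0)}"

definition Schwartz_annihilators_add ::
  "((real \<Rightarrow> complex) \<Rightarrow> complex) \<Rightarrow> (real \<Rightarrow> complex) set" where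
  "Schwartz_annihilators_add F =
     {g \<in> topspace Schwartz_add_top. (\<exists>x. g x \<noteq> 0) \<and> (\<forall>x. conv_add g F x = 0)}"

definition Schwartz_annihilators_mult ::
  "((real \<Rightarrow> complex) \<Rightarrow> complex) \<Rightarrow> (real \<Rightarrow> complex) set" where
  "Schwartz_annihilators_mult F =
     {g \<in> topspace Schwartz_mult_top. (\<exists>x>0. g x \<noteq> 0) \<and> (\<forall>x>0. conv_mult g F x = 0)}"

text \<open>
  Embedding of locally integrable functions of at most exponential growth (resp. of at most
  polynomial growth at both ends of \<open>{0<..}\<close>) into the dual of the Schwartz space.
\<close>

definition regular_add :: "(real \<Rightarrow> complex) \<Rightarrow> (real \<Rightarrow> complex) \<Rightarrow> complex" where
  "regular_add f g = (LINT t|lebesgue. g t * f t)"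

definition regular_mult :: "(real \<Rightarrow> complex) \<Rightarrow> (real \<Rightarrow> complex) \<Rightarrow> complex" where
  "regular_mult h g = (LINT x:{0<..}|lebesgue. g x * h x / complex_of_real x)"

text \<open>
  The four admissible pairs of spaces; \<open>Cinf_growth\<close> stands for smooth functions of exponential
  growth on the line, resp. of polynomial growth on the positive reals.
\<close>

datatype mp_space = Cont | Cinf | Cinf_growth | Schwartz_dual

fun mean_periodic_add :: "mp_space \<Rightarrow> (real \<Rightarrow> complex) \<Rightarrow> bool" where
  "mean_periodic_add Cont f \<longleftrightarrow> f \<in> topspace C_top \<and> annihilators_add C_top f \<noteq> {}"
| "mean_periodic_add Cinf f \<longleftrightarrow> f \<in> topspace Cinf_top \<and> annihilators_add Cinf_top f \<noteq> {}"
| "mean_periodic_add Cinf_growth f \<longleftrightarrow>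
     f \<in> topspace Cexp_top \<and> annihilators_add Cexp_top f \<noteq> {}"
| "mean_periodic_add Schwartz_dual f \<longleftrightarrow>
     regular_add f \<in> top_dual Schwartz_add_top \<and>
     Schwartz_annihilators_add (regular_add f) \<noteq> {}"

fun mean_periodic_mult :: "mp_space \<Rightarrow> (real \<Rightarrow> complex) \<Rightarrow> bool" where
  "mean_periodic_mult Cont h \<longleftrightarrow>
     h \<in> topspace (mult_of_add C_top) \<and> annihilators_mult (mult_of_add C_top) h \<noteq> {}"
| "mean_periodic_mult Cinf h \<longleftrightarrow>
     h \<in> topspace (mult_of_add Cinf_top) \<and> annihilators_mult (mult_of_add Cinf_top) h \<noteq> {}"
| "mean_periodic_mult Cinf_growth h \<longleftrightarrow>
     h \<in> topspace (mult_of_add Cexp_top) \<and> annihilators_mult (mult_of_add Cexp_top) h \<noteq> {}"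
| "mean_periodic_mult Schwartz_dual h \<longleftrightarrow>
     regular_mult h \<in> top_dual Schwartz_mult_top \<and>
     Schwartz_annihilators_mult (regular_mult h) \<noteq> {}"


section \<open>Carleman transforms\<close>

definition plus_part :: "(real \<Rightarrow> complex) \<Rightarrow> real \<Rightarrow> complex" where
  "plus_part f t = (if 0 \<le> t then f t else 0)"

definition test_functions :: "(real \<Rightarrow> complex) set" where
  "test_functions = {g. smooth_fun_on UNIV g \<and> (\<exists>K. compact K \<and> (\<forall>x. x \<notin> K \<longrightarrow> g x = 0))}"

text \<open>
  The distribution obtained by convolving a (possibly discontinuous) function \<open>u\<close> with \<open>\<phi>\<close>,
  evaluated at a test function \<open>g\<close>.
\<close>

definition conv_distr ::
  "(real \<Rightarrow> complex) \<Rightarrow> ((real \<Rightarrow> complex) \<Rightarrow> complex) \<Rightarrow> (real \<Rightarrow> complex) \<Rightarrow> complex" where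
  "conv_distr u \<phi> g = \<phi> (\<lambda>y. LINT t|lebesgue. u t * g (t + y))"

text \<open>
  Two-sided Laplace transform of an element of the dual of \<^const>\<open>Cexp_top\<close> (which contains all
  compactly supported measures and distributions), of a distribution, and of a function.
  A distribution is paired with exponentials through its extension to a continuous functional on
  \<^const>\<open>Cexp_top\<close>; that extension is unique, test functions being dense there.
\<close>

definition Laplace_functional :: "((real \<Rightarrow> complex) \<Rightarrow> complex) \<Rightarrow> complex \<Rightarrow> complex" where
  "Laplace_functional \<psi> s = \<psi> (\<lambda>t. exp (- (s * complex_of_real t)))"

definition Laplace_distr :: "((real \<Rightarrow> complex) \<Rightarrow> complex) \<Rightarrow> complex \<Rightarrow> complex" where
  "Laplace_distr \<psi> =
     Laplace_functional (SOME \<Psi>. \<Psi> \<in> top_dual Cexp_top \<and> (\<forall>g\<in>test_functions. \<Psi> g = \<psi> g))"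

definition Laplace_fun :: "(real \<Rightarrow> complex) \<Rightarrow> complex \<Rightarrow> complex" where
  "Laplace_fun \<psi> s = (LINT t|lebesgue. \<psi> t * exp (- (s * complex_of_real t)))"

text \<open>
  The Carleman transforms are quotients of entire functions, normalised by \<^const>\<open>remove_sings\<close> so
  that removable singularities are filled in and the value at a pole is \<open>0\<close>. The resulting function
  does not depend on the chosen annihilator.
\<close>

definition Laplace_Carleman_fun ::
  "(real \<Rightarrow> complex) topology \<Rightarrow> (real \<Rightarrow> complex) \<Rightarrow> complex \<Rightarrow> complex" where
  "Laplace_Carleman_fun T f = (let \<phi> = (SOME \<phi>. \<phi> \<in> annihilators_add T f) in
     remove_sings (\<lambda>s. Laplace_distr (conv_distr (plus_part f) \<phi>) s / Laplace_functional \<phi> s))"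

definition Laplace_Carleman_Schwartz :: "(real \<Rightarrow> complex) \<Rightarrow> complex \<Rightarrow> complex" where
  "Laplace_Carleman_Schwartz f =
     (let g = (SOME g. g \<in> Schwartz_annihilators_add (regular_add f)) in
      remove_sings (\<lambda>s.
        Laplace_fun (\<lambda>x. LINT y|lebesgue. plus_part f (x - y) * g y) s / Laplace_fun g s))"

fun Laplace_Carleman :: "mp_space \<Rightarrow> (real \<Rightarrow> complex) \<Rightarrow> complex \<Rightarrow> complex" where
  "Laplace_Carleman Cont f = Laplace_Carleman_fun C_top f"
| "Laplace_Carleman Cinf f = Laplace_Carleman_fun Cinf_top f"
| "Laplace_Carleman Cinf_growth f = Laplace_Carleman_fun Cexp_top f"
| "Laplace_Carleman Schwartz_dual f = Laplace_Carleman_Schwartz f"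

definition Mellin_Carleman :: "mp_space \<Rightarrow> (real \<Rightarrow> complex) \<Rightarrow> complex \<Rightarrow> complex" where
  "Mellin_Carleman X h = Laplace_Carleman X (\<lambda>t. h (exp (- t)))"


section \<open>Mellin and Laplace integrals\<close>

definition mellin_integrable :: "real set \<Rightarrow> (real \<Rightarrow> complex) \<Rightarrow> complex \<Rightarrow> bool" where
  "mellin_integrable A f s \<longleftrightarrow>
     set_integrable lebesgue A (\<lambda>x. f x * complex_of_real x powr s / complex_of_real x)"

definition mellin :: "real set \<Rightarrow> (real \<Rightarrow> complex) \<Rightarrow> complex \<Rightarrow> complex" where
  "mellin A f s = (LINT x:A|lebesgue. f x * complex_of_real x powr s / complex_of_real x)"

definition laplace_integrable :: "(real \<Rightarrow> complex) \<Rightarrow> complex \<Rightarrow> bool" where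
  "laplace_integrable H s \<longleftrightarrow>
     set_integrable lebesgue {0..} (\<lambda>t. H t * exp (- (s * complex_of_real t)))"

definition laplace :: "(real \<Rightarrow> complex) \<Rightarrow> complex \<Rightarrow> complex" where
  "laplace H s = (LINT t:{0..}|lebesgue. H t * exp (- (s * complex_of_real t)))"

definition h_fun :: "(real \<Rightarrow> real) \<Rightarrow> real \<Rightarrow> real \<Rightarrow> complex" where
  "h_fun f \<epsilon> x = complex_of_real (f x - \<epsilon> * (inverse x * f (inverse x)))"

definition H_fun :: "(real \<Rightarrow> real) \<Rightarrow> real \<Rightarrow> real \<Rightarrow> complex" where
  "H_fun f \<epsilon> t = h_fun f \<epsilon> (exp (- t))"

end

theory Submission
  imports Defs "HOL-Real_Asymp.Real_Asymp"
begin

text \<open>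
  In the variable \<open>t = - ln x\<close> the function \<open>H\<close> satisfies \<open>H (- t) = - \<epsilon> exp (- t) H t\<close>. If \<open>\<phi>\<close>
  annihilates \<open>H\<close>, then \<open>H\<^sup>+ * \<phi> = - H\<^sup>- * \<phi>\<close> has an entire Laplace transform \<open>N\<close>, equal to
  \<open>L(H\<^sup>+) L(\<phi>)\<close> far to the right and to \<open>- L(H\<^sup>-) L(\<phi>)\<close> far to the left. Hence the quotient \<open>N / L(\<phi>)\<close>
  continues the Laplace transform \<open>L(H\<^sup>+)\<close>, and since \<open>- L(H\<^sup>-)(s) = \<epsilon> L(H\<^sup>+)(1 - s)\<close> by the
  symmetry of \<open>H\<close>, the identity theorem gives the functional equation. Splitting the Mellin
  integral of \<open>f\<close> at \<open>1\<close> does the rest.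

  Since \<open>H\<close> has at most exponential growth, everything except the relation \<open>H * \<phi> = 0\<close> only involves
  the restriction of \<open>\<phi>\<close> to smooth functions of exponential growth; so the three spaces of functions
  are treated together, and only the tempered case needs Fubini's theorem.
\<close>

section \<open>Continuity in seminorm topologies\<close>

text \<open>The definition of the transform pairs a distribution with exponentials through an
  unspecified continuous extension to \<open>Cexp_top\<close>, whereas
  \<open>H\<^sup>+ * \<phi>\<close> is given only on test functions. So one extension has to be
  exhibited and proved continuous: a smooth step truncates \<open>H\<^sup>+\<close>, the other half
  of \<open>H\<close> pays for it, and density of test functions makes every other choice agree on
  exponentials. Nor is \<open>\<phi>\<close> represented by an integral. Pulling it through an
  integral over translates of \<open>H\<close> is avoided by differentiating in a cut point, and
  holomorphy of \<open>\<phi>\<close> along a family comes from Cauchy difference quotients. That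
  the denominator is not identically 0 rests on Liouville's theorem instead of Fourier inversion.
  Finally the equations are asserted at every complex number, poles included. They survive there
  because a pole has value 0 and reflection carries poles to poles.\<close>

lemma is_seminormD:
  assumes "is_seminorm V p"
  shows "f \<in> V \<Longrightarrow> g \<in> V \<Longrightarrow> p (\<lambda>x. f x + g x) \<le> p f + p g"
    and "f \<in> V \<Longrightarrow> p (\<lambda>x. c * f x) = norm (c::complex) * p f"
  using assms by (simp_all add: is_seminorm_def)

lemma topspace_seminorm_topology:
  assumes "P \<noteq> {}"
  shows "topspace (seminorm_topology V P) = V"
proof -
  obtain p where p: "p \<in> P" using assms by blast
  let ?S = "{{g \<in> V. p (\<lambda>x. g x - f x) < r} | p f r. p \<in> P \<and> f \<in> V \<and> 0 < r}"
  have "g \<in> \<Union>?S" if g: "g \<in> V" for g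
  proof (rule UnionI)
    \<comment> \<open>\<open>p\<close> is arbitrary at this point, so \<open>p\<close> of the zero
      function need not be 0; the radius is chosen to exceed it.\<close>
    let ?r = "\<bar>p (\<lambda>x. g x - g x)\<bar> + 1"
    show "{k \<in> V. p (\<lambda>x. k x - g x) < ?r} \<in> ?S"
      using p g by (intro CollectI exI[of _ p] exI[of _ g] exI[of _ ?r]) auto
    show "g \<in> {k \<in> V. p (\<lambda>x. k x - g x) < ?r}" using g by simp
  qed
  then show ?thesis
    unfolding seminorm_topology_def topology_generated_by_topspace by blast
qed

text \<open>The subbasic balls have arbitrary centres. By induction on the generated topology it
  suffices to shrink one such ball containing 0 to a ball centred at 0, which is the triangle
  inequality.\<close>

lemma seminorm_topology_nhds_0:
  assumes "openin (seminorm_topology V P) U" "(\<lambda>_. 0) \<in> U"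
    and V: "\<And>f g a b. f \<in> V \<Longrightarrow> g \<in> V \<Longrightarrow> (\<lambda>x. a * f x + b * g x) \<in> V"
    and P: "\<And>p. p \<in> P \<Longrightarrow> is_seminorm V p"
  obtains P' \<delta> where "finite P'" "P' \<subseteq> P" "\<delta> > 0" "{g \<in> V. \<forall>p\<in>P'. p g < \<delta>} \<subseteq> U"
proof -
  have "generate_topology_on {{g \<in> V. p (\<lambda>x. g x - f x) < r} | p f r. p \<in> P \<and> f \<in> V \<and> 0 < r} U"
    using assms(1) unfolding seminorm_topology_def by (rule openin_topology_generated_by)
  then have "(\<lambda>_. 0) \<in> U \<longrightarrow> (\<exists>P' \<delta>. finite P' \<and> P' \<subseteq> P \<and> \<delta> > 0 \<and> {g \<in> V. \<forall>p\<in>P'. p g < \<delta>} \<subseteq> U)"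
  proof induction
    case Empty
    then show ?case by simp
  next
    case (Int a b)
    show ?case
    proof
      assume "(\<lambda>_. 0) \<in> a \<inter> b"
      with Int.IH obtain P1 d1 P2 d2 where
        1: "finite P1" "P1 \<subseteq> P" "d1 > 0" "{g \<in> V. \<forall>p\<in>P1. p g < d1} \<subseteq> a" and
        2: "finite P2" "P2 \<subseteq> P" "d2 > 0" "{g \<in> V. \<forall>p\<in>P2. p g < d2} \<subseteq> b"
        by auto
      show "\<exists>P' \<delta>. finite P' \<and> P' \<subseteq> P \<and> \<delta> > 0 \<and> {g \<in> V. \<forall>p\<in>P'. p g < \<delta>} \<subseteq> a \<inter> b"
        using 1 2 by (intro exI[of _ "P1 \<union> P2"] exI[of _ "min d1 d2"]) auto
    qed
  next
    case (UN K)
    show ?case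
    proof
      assume "(\<lambda>_. 0) \<in> \<Union>K"
      then obtain k where "k \<in> K" "(\<lambda>_. 0) \<in> k" by blast
      with UN.IH[of k] show "\<exists>P' \<delta>. finite P' \<and> P' \<subseteq> P \<and> \<delta> > 0 \<and> {g \<in> V. \<forall>p\<in>P'. p g < \<delta>} \<subseteq> \<Union>K"
        by (meson Sup_upper order_trans)
    qed
  next
    case (Basis s)
    then obtain p f r where s: "s = {g \<in> V. p (\<lambda>x. g x - f x) < r}" "p \<in> P" "f \<in> V" "0 < r"
      by blast
    show ?case
    proof
      assume 0: "(\<lambda>_. 0) \<in> s"
      \<comment> \<open>\<open>p (g - f) \<le> p g + p (- f)\<close>, so this is what remains of
        \<open>r\<close>; it is positive because 0 lies in the ball.\<close>
      let ?\<delta> = "r - p (\<lambda>x. - f x)"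
      have "?\<delta> > 0" using 0 by (auto simp: s)
      moreover have "{g \<in> V. \<forall>p\<in>{p}. p g < ?\<delta>} \<subseteq> s"
      proof
        fix g assume g: "g \<in> {g \<in> V. \<forall>p\<in>{p}. p g < ?\<delta>}"
        have "(\<lambda>x. - f x) \<in> V" using V[OF s(3) s(3), of "-1" 0] by simp
        then have "p (\<lambda>x. g x + - f x) \<le> p g + p (\<lambda>x. - f x)"
          using g by (intro is_seminormD(1)[OF P[OF s(2)]]) auto
        then show "g \<in> s" using g by (auto simp: s)
      qed
      ultimately show "\<exists>P' \<delta>. finite P' \<and> P' \<subseteq> P \<and> \<delta> > 0 \<and> {g \<in> V. \<forall>p\<in>P'. p g < \<delta>} \<subseteq> s"
        using s(2) by (intro exI[of _ "{p}"] exI[of _ ?\<delta>]) auto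
    qed
  qed
  with assms(2) that show ?thesis by blast
qed

text \<open>From \<open>0 = p (f - f) \<le> p f + p (- f) = 2 * p f\<close>.\<close>

lemma is_seminorm_nonneg:
  assumes "is_seminorm V p" "f \<in> V" "\<And>f g a b. f \<in> V \<Longrightarrow> g \<in> V \<Longrightarrow> (\<lambda>x. a * f x + b * g x) \<in> V"
  shows "p f \<ge> 0"
proof -
  have m: "(\<lambda>x. (-1) * f x) \<in> V" using assms(3)[OF assms(2) assms(2), of "-1" 0] by simp
  note h = is_seminormD(2)[OF assms(1,2)]
  from h[of 0] h[of "-1"] have "p (\<lambda>x. 0) = 0" "p (\<lambda>x. (-1) * f x) = p f" by simp_all
  moreover have "p (\<lambda>x. f x + (-1) * f x) \<le> p f + p (\<lambda>x. (-1) * f x)"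
    by (rule is_seminormD(1)[OF assms(1,2) m])
  ultimately show ?thesis by simp
qed

text \<open>Continuity gives \<open>q < 1\<close> on a neighbourhood of 0, and homogeneity spreads
  this to all of \<open>V\<close>. For a functional on the inductive limit it serves twice: for the
  norm of the functional, and for each seminorm of the limit restricted to one step.\<close>

lemma continuous_homogeneous_bound:
  assumes q: "continuous_map (seminorm_topology V P) euclideanreal q"
    and hom: "\<And>c f. f \<in> V \<Longrightarrow> q (\<lambda>x. c * f x) = norm (c::complex) * q f"
    and "P \<noteq> {}"
    and V: "\<And>f g a b. f \<in> V \<Longrightarrow> g \<in> V \<Longrightarrow> (\<lambda>x. a * f x + b * g x) \<in> V"
    and P: "\<And>p. p \<in> P \<Longrightarrow> is_seminorm V p"
  obtains P' C where "finite P'" "P' \<subseteq> P" "C \<ge> 0" "\<And>g. g \<in> V \<Longrightarrow> q g \<le> C * (\<Sum>p\<in>P'. p g)"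
proof (cases "V = {}")
  case True
  with that[of "{}" 0] show ?thesis by auto
next
  case False
  then obtain f0 where f0: "f0 \<in> V" by blast
  have 0: "(\<lambda>_. 0) \<in> V" using V[OF f0 f0, of 0 0] by simp
  have q0: "q (\<lambda>_. 0) = 0" using hom[OF f0, of 0] by simp
  let ?U = "{g \<in> topspace (seminorm_topology V P). q g \<in> {..<1}}"
  have "openin (seminorm_topology V P) ?U"
    by (rule openin_continuous_map_preimage[OF q]) auto
  moreover have "(\<lambda>_. 0) \<in> ?U"
    using 0 q0 by (simp add: topspace_seminorm_topology[OF \<open>P \<noteq> {}\<close>])
  ultimately obtain P' \<delta> where P': "finite P'" "P' \<subseteq> P" "\<delta> > 0" "{g \<in> V. \<forall>p\<in>P'. p g < \<delta>} \<subseteq> ?U"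
    using V P by (rule seminorm_topology_nhds_0)
  show ?thesis
  proof (rule that[OF P'(1,2), of "1 / \<delta>"])
    fix g assume g: "g \<in> V"
    let ?S = "\<Sum>p\<in>P'. p g"
    have nn: "p g \<ge> 0" if "p \<in> P'" for p
      using is_seminorm_nonneg[OF P g V] that P'(2) by blast
    \<comment> \<open>Scaling by a number \<open>r\<close> above the sum and not by the sum itself,
      which may be 0; the infimum over \<open>r\<close> is taken afterwards.\<close>
    have le: "q g \<le> r / \<delta>" if r: "r > ?S" for r
    proof -
      have rpos: "r > 0" using r sum_nonneg[of P' "\<lambda>p. p g"] nn by fastforce
      let ?g = "\<lambda>x. complex_of_real (\<delta> / r) * g x"
      have gV: "?g \<in> V" using V[OF g g, of "complex_of_real (\<delta> / r)" 0] by simp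
      have "p ?g < \<delta>" if p: "p \<in> P'" for p
      proof -
        have "p ?g = norm (complex_of_real (\<delta> / r)) * p g"
          using P p P'(2) g by (intro is_seminormD(2)[of V]) auto
        also have "\<dots> = \<delta> / r * p g" using rpos P'(3) by (simp only: norm_of_real) simp
        also have "p g \<le> ?S" using nn p P'(1) by (intro member_le_sum) auto
        with r have "p g < r" by linarith
        then have "\<delta> / r * p g < \<delta>" using rpos P'(3) by (simp add: field_simps)
        finally show ?thesis .
      qed
      then have "q ?g < 1" using gV P'(4) by blast
      moreover have "q ?g = \<delta> / r * q g"
        using hom[OF g, of "complex_of_real (\<delta> / r)"] rpos P'(3) by (simp only: norm_of_real) simp
      ultimately have "\<delta> / r * q g < 1" by simp
      then have "\<delta> * q g < r" using rpos by (simp add: divide_simps)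
      then show ?thesis using P'(3) by (simp add: field_simps)
    qed
    have "q g * \<delta> \<le> ?S"
    proof (rule dense_ge)
      fix r assume "r > ?S"
      from le[OF this] show "q g * \<delta> \<le> r" using P'(3) by (simp add: pos_le_divide_eq)
    qed
    then show "q g \<le> 1 / \<delta> * ?S" using P'(3) by (simp add: pos_le_divide_eq)
  qed (use P'(3) in auto)
qed

lemma continuous_map_seminorm_topologyI:
  fixes q :: "(real \<Rightarrow> complex) \<Rightarrow> 'b::metric_space"
  assumes P': "finite P'" "P' \<subseteq> P" "P \<noteq> {}" and zero: "\<And>p. p \<in> P' \<Longrightarrow> p (\<lambda>_. 0) = 0"
    and C: "C \<ge> 0"
    and bound: "\<And>f g. f \<in> V \<Longrightarrow> g \<in> V \<Longrightarrow> dist (q g) (q f) \<le> C * (\<Sum>p\<in>P'. p (\<lambda>x. g x - f x))"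
  shows "continuous_map (seminorm_topology V P) euclidean q"
  unfolding continuous_map_def
proof (intro conjI allI impI)
  let ?T = "seminorm_topology V P"
  have top: "topspace ?T = V" using P'(3) by (rule topspace_seminorm_topology)
  fix U :: "'b set" assume "openin euclidean U"
  then have U: "open U" by simp
  show "openin ?T {f \<in> topspace ?T. q f \<in> U}"
  proof (subst openin_subopen, intro ballI)
    fix f assume f: "f \<in> {f \<in> topspace ?T. q f \<in> U}"
    then obtain e where e: "e > 0" "\<And>y. dist y (q f) < e \<Longrightarrow> y \<in> U"
      using U unfolding open_dist by blast
    \<comment> \<open>The 1 keeps the denominator positive when \<open>C\<close> or the number of
      seminorms is 0, and makes the final estimate strict.\<close>
    define r where "r = e / (C * card P' + 1)"
    have r: "r > 0" using e C by (simp add: r_def add_nonneg_pos)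
    let ?W = "(\<Inter>p\<in>P'. {g \<in> V. p (\<lambda>x. g x - f x) < r}) \<inter> topspace ?T"
    have "openin ?T {g \<in> V. p (\<lambda>x. g x - f x) < r}" if "p \<in> P'" for p
      unfolding seminorm_topology_def
      by (rule topology_generated_by_Basis) (use that P' f r top in auto)
    then have "openin ?T ?W" using P'(1) by (intro openin_INT) auto
    moreover have "f \<in> ?W" using f top r by (simp add: zero)
    moreover have "?W \<subseteq> {f \<in> topspace ?T. q f \<in> U}"
    proof
      fix g assume g: "g \<in> ?W"
      then have gV: "g \<in> V" using top by auto
      have "dist (q g) (q f) \<le> C * (\<Sum>p\<in>P'. p (\<lambda>x. g x - f x))"
        using bound gV f top by auto
      also have "\<dots> \<le> C * (\<Sum>p\<in>P'. r)"
        using g C by (intro mult_left_mono sum_mono) auto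
      also have "\<dots> = (C * card P') * r" by simp
      also have "\<dots> < (C * card P' + 1) * r" using r by (intro mult_strict_right_mono) auto
      also have "\<dots> = e" using C unfolding r_def by (simp add: add_nonneg_pos add_nonneg_eq_0_iff)
      finally show "g \<in> {f \<in> topspace ?T. q f \<in> U}" using e gV top by auto
    qed
    ultimately show "\<exists>W. openin ?T W \<and> f \<in> W \<and> W \<subseteq> {f \<in> topspace ?T. q f \<in> U}" by blast
  qed
qed simp

section \<open>Iterated derivatives\<close>

abbreviation smooth :: "(real \<Rightarrow> complex) \<Rightarrow> bool" where
  "smooth f \<equiv> smooth_fun_on UNIV f"

lemma iter_deriv_0 [simp]: "iter_deriv 0 f = f"
  by (simp add: iter_deriv_def)

lemma iter_deriv_Suc: "iter_deriv (Suc n) f x = vector_derivative (iter_deriv n f) (at x)"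
  by (simp add: iter_deriv_def)

lemma smooth_has_vector_derivative:
  "smooth f \<Longrightarrow> (iter_deriv n f has_vector_derivative iter_deriv (Suc n) f x) (at x)"
  by (simp add: smooth_fun_on_def iter_deriv_Suc vector_derivative_works[symmetric])

text \<open>Iterated derivatives are computed by guessing the whole sequence: each closure property
  below exhibits a sequence \<open>d\<close> in which \<open>d (Suc n)\<close> is the derivative of
  \<open>d n\<close>, and \<open>smoothI\<close> yields smoothness from the same data.\<close>

lemma iter_deriv_eqI:
  assumes "\<And>n x. (d n has_vector_derivative d (Suc n) x) (at x)"
  shows "iter_deriv n (d 0) = d n"
proof (induction n)
  case (Suc n)
  then show ?case
    by (intro ext) (simp add: iter_deriv_Suc vector_derivative_at[OF assms])
qed simp

lemma smoothI:
  assumes "\<And>n x. (d n has_vector_derivative d (Suc n) x) (at x)"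
  shows "smooth (d 0)"
proof -
  have "iter_deriv n (d 0) = d n" for n by (rule iter_deriv_eqI) (rule assms)
  then show ?thesis
    unfolding smooth_fun_on_def using assms by (metis differentiableI_vector)
qed

lemma smooth_continuous_on: "smooth f \<Longrightarrow> continuous_on A (iter_deriv n f)"
  by (meson smooth_has_vector_derivative continuous_at_imp_continuous_on has_vector_derivative_continuous)

lemma smooth_borel_measurable [measurable_dest]:
  assumes "smooth f"
  shows "iter_deriv n f \<in> borel_measurable borel" "f \<in> borel_measurable borel"
  using smooth_continuous_on[OF assms, of UNIV n] smooth_continuous_on[OF assms, of UNIV 0]
  by (auto intro: borel_measurable_continuous_onI)

lemma smooth_iter_deriv: "smooth f \<Longrightarrow> smooth (iter_deriv m f)"
  using smoothI[of "\<lambda>n. iter_deriv (m + n) f"] smooth_has_vector_derivative[of f] by simp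

lemma
  assumes "smooth f" "smooth g"
  shows smooth_lincomb: "smooth (\<lambda>x. a * f x + b * g x)"
    and iter_deriv_lincomb:
      "iter_deriv n (\<lambda>x. a * f x + b * g x) = (\<lambda>x. a * iter_deriv n f x + b * iter_deriv n g x)"
proof -
  let ?d = "\<lambda>n x. a * iter_deriv n f x + b * iter_deriv n g x"
  have "(?d n has_vector_derivative ?d (Suc n) x) (at x)" for n x
    by (intro has_vector_derivative_add has_vector_derivative_mult_right smooth_has_vector_derivative assms)
  from smoothI[of ?d, OF this] iter_deriv_eqI[of ?d, OF this]
  show "smooth (\<lambda>x. a * f x + b * g x)" 
    "iter_deriv n (\<lambda>x. a * f x + b * g x) = (\<lambda>x. a * iter_deriv n f x + b * iter_deriv n g x)"
    by simp_all
qed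

lemma
  assumes "smooth f" "smooth g"
  shows smooth_diff: "smooth (\<lambda>x. f x - g x)"
    and iter_deriv_diff: "iter_deriv n (\<lambda>x. f x - g x) = (\<lambda>x. iter_deriv n f x - iter_deriv n g x)"
    and iter_deriv_add: "iter_deriv n (\<lambda>x. f x + g x) = (\<lambda>x. iter_deriv n f x + iter_deriv n g x)"
  using smooth_lincomb[OF assms, of 1 "-1"] iter_deriv_lincomb[OF assms, of n 1 "-1"]
    iter_deriv_lincomb[OF assms, of n 1 1] by simp_all

lemma
  assumes "smooth f"
  shows smooth_cmult: "smooth (\<lambda>x. a * f x)"
    and iter_deriv_cmult: "iter_deriv n (\<lambda>x. a * f x) = (\<lambda>x. a * iter_deriv n f x)"
  using smooth_lincomb[OF assms assms, of a 0] iter_deriv_lincomb[OF assms assms, of n a 0] by simp_all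

lemma
  assumes "smooth f"
  shows smooth_affine: "smooth (\<lambda>x. f (c * x + b))"
    and iter_deriv_affine:
      "iter_deriv n (\<lambda>x. f (c * x + b)) = (\<lambda>x. complex_of_real c ^ n * iter_deriv n f (c * x + b))"
proof -
  let ?d = "\<lambda>n x. complex_of_real c ^ n * iter_deriv n f (c * x + b)"
  have "(?d n has_vector_derivative ?d (Suc n) x) (at x)" for n x
  proof -
    have "((\<lambda>x. iter_deriv n f (c * x + b)) has_vector_derivative c *\<^sub>R iter_deriv (Suc n) f (c * x + b)) (at x)"
    proof -
      have "((\<lambda>x. c * x + b) has_vector_derivative c) (at x)"
        by (auto intro!: derivative_eq_intros)
      from vector_diff_chain_at[OF this smooth_has_vector_derivative[OF assms]]
      show ?thesis by (simp add: o_def)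
    qed
    from has_vector_derivative_mult_right[OF this, of "complex_of_real c ^ n"]
    show ?thesis by (simp add: scaleR_conv_of_real mult_ac)
  qed
  from smoothI[of ?d, OF this] iter_deriv_eqI[of ?d, OF this]
  show "smooth (\<lambda>x. f (c * x + b))"
    "iter_deriv n (\<lambda>x. f (c * x + b)) = (\<lambda>x. complex_of_real c ^ n * iter_deriv n f (c * x + b))"
    by simp_all
qed

lemma
  shows smooth_exp: "smooth (\<lambda>t. exp (- (s * complex_of_real t)))"
    and iter_deriv_exp: "iter_deriv n (\<lambda>t. exp (- (s * complex_of_real t))) =
       (\<lambda>t. (- s) ^ n * exp (- (s * complex_of_real t)))"
proof -
  let ?d = "\<lambda>n t. (- s) ^ n * exp (- (s * complex_of_real t))"
  have "(?d n has_vector_derivative ?d (Suc n) x) (at x)" for n x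
    by (auto intro!: derivative_eq_intros has_vector_derivative_real_field)
  from smoothI[of ?d, OF this] iter_deriv_eqI[of ?d, OF this]
  show "smooth (\<lambda>t. exp (- (s * complex_of_real t)))"
    "iter_deriv n (\<lambda>t. exp (- (s * complex_of_real t))) =
       (\<lambda>t. (- s) ^ n * exp (- (s * complex_of_real t)))"
    by simp_all
qed

lemma
  assumes "smooth f" "smooth g"
  shows smooth_mult: "smooth (\<lambda>x. f x * g x)"
    and iter_deriv_mult: "iter_deriv n (\<lambda>x. f x * g x) =
      (\<lambda>x. \<Sum>j\<le>n. of_nat (n choose j) * (iter_deriv j f x * iter_deriv (n - j) g x))"
proof -
  \<comment> \<open>Leibniz' formula as the candidate sequence.\<close>
  define d where
    "d = (\<lambda>n x. \<Sum>j\<le>n. of_nat (n choose j) * (iter_deriv j f x * iter_deriv (n - j) g x))"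
  have d: "(d n has_vector_derivative d (Suc n) x) (at x)" for n x
  proof -
    let ?d = "\<lambda>n x. \<Sum>j\<le>n. of_nat (n choose j) * (iter_deriv j f x * iter_deriv (n - j) g x)"
    let ?a = "\<lambda>j. iter_deriv j f x" and ?b = "\<lambda>j. iter_deriv j g x"
    have "(?d n has_vector_derivative
        (\<Sum>j\<le>n. of_nat (n choose j) * (?a j * ?b (Suc (n - j)) + ?a (Suc j) * ?b (n - j)))) (at x)"
      by (intro has_vector_derivative_sum has_vector_derivative_mult_right has_vector_derivative_mult
            smooth_has_vector_derivative assms)
    also have "(\<Sum>j\<le>n. of_nat (n choose j) * (?a j * ?b (Suc (n - j)) + ?a (Suc j) * ?b (n - j))) =
      (\<Sum>j\<le>n. of_nat (n choose j) * (?a j * ?b (Suc n - j))) +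
      (\<Sum>j\<le>n. of_nat (n choose j) * (?a (Suc j) * ?b (n - j)))"
      by (simp add: distrib_left sum.distrib Suc_diff_le)
    also have "\<dots> = d (Suc n) x"
    proof -
      \<comment> \<open>Split off the index 0, shift the rest and apply Pascal's rule; one of the
        two resulting sums reassembles with the term split off.\<close>
      have "d (Suc n) x = ?a 0 * ?b (Suc n) +
          (\<Sum>j\<le>n. of_nat (Suc n choose Suc j) * (?a (Suc j) * ?b (n - j)))"
        unfolding d_def by (subst sum.atMost_Suc_shift) simp
      also have "\<dots> = ?a 0 * ?b (Suc n) + (\<Sum>j\<le>n. of_nat (n choose Suc j) * (?a (Suc j) * ?b (n - j)))
           + (\<Sum>j\<le>n. of_nat (n choose j) * (?a (Suc j) * ?b (n - j)))"
        by (simp add: distrib_right sum.distrib add_ac)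
      also have "?a 0 * ?b (Suc n) + (\<Sum>j\<le>n. of_nat (n choose Suc j) * (?a (Suc j) * ?b (n - j))) =
          (\<Sum>j\<le>Suc n. of_nat (n choose j) * (?a j * ?b (Suc n - j)))"
        by (subst sum.atMost_Suc_shift) simp
      finally show ?thesis by (simp add: d_def)
    qed
    finally show ?thesis by (simp add: d_def)
  qed
  have d0: "d 0 = (\<lambda>x. f x * g x)" by (simp add: d_def)
  show "smooth (\<lambda>x. f x * g x)"
    using smoothI[of d, OF d] unfolding d0 .
  show "iter_deriv n (\<lambda>x. f x * g x) =
      (\<lambda>x. \<Sum>j\<le>n. of_nat (n choose j) * (iter_deriv j f x * iter_deriv (n - j) g x))"
  proof -
    have "iter_deriv n (d 0) = d n" by (rule iter_deriv_eqI) (rule d)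
    then show ?thesis unfolding d0 by (simp add: d_def)
  qed
qed

lemma smooth_0: "smooth (\<lambda>_. 0)" and iter_deriv_const_0: "iter_deriv n (\<lambda>_. 0) = (\<lambda>_. 0)"
  using smooth_cmult[OF smooth_exp, of 0] iter_deriv_cmult[OF smooth_exp, of n 0] by simp_all

section \<open>Locality of iterated derivatives\<close>

lemma iter_deriv_cong_open:
  assumes "open S" "\<And>x. x \<in> S \<Longrightarrow> f x = g x" "x \<in> S"
  shows "iter_deriv n f x = iter_deriv n g x"
  using assms(3)
proof (induction n arbitrary: x)
  case (Suc n)
  have "\<forall>\<^sub>F y in nhds x. iter_deriv n f y = iter_deriv n g y"
    using eventually_nhds_in_open[OF assms(1) Suc.prems] Suc.IH by (rule eventually_mono)
  then show ?case
    unfolding iter_deriv_Suc by (intro vector_derivative_cong_eq) (auto simp: eventually_nhds_x_imp_x)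
qed (use assms in simp)

lemma iter_deriv_zero_outside:
  assumes "closed K" "\<And>x. x \<notin> K \<Longrightarrow> g x = 0" "x \<notin> K"
  shows "iter_deriv n g x = 0"
proof -
  have "iter_deriv n g x = iter_deriv n (\<lambda>_. 0) x"
    by (rule iter_deriv_cong_open[of "- K"]) (use assms in \<open>auto intro: open_Compl\<close>)
  then show ?thesis by (simp add: iter_deriv_const_0)
qed

lemma smooth_fun_on_cong:
  assumes "open S" "\<And>x. x \<in> S \<Longrightarrow> f x = g x" "smooth_fun_on S f"
  shows "smooth_fun_on S g"
  unfolding smooth_fun_on_def
proof (intro allI ballI)
  fix n x assume x: "x \<in> S"
  have "iter_deriv n f differentiable (at x)" using assms(3) x by (simp add: smooth_fun_on_def)
  then obtain F where F: "(iter_deriv n f has_derivative F) (at x)" by (auto simp: differentiable_def)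
  have "(iter_deriv n g has_derivative F) (at x)"
    by (rule has_derivative_transform_within_open[OF F assms(1) x])
      (rule iter_deriv_cong_open[OF assms(1,2)])
  then show "iter_deriv n g differentiable (at x)" by (auto simp: differentiable_def)
qed

section \<open>The dual of the space of smooth functions of exponential growth\<close>

definition exp_space :: "nat \<Rightarrow> (real \<Rightarrow> complex) set" where
  "exp_space m = {f. smooth f \<and> (\<forall>n. \<exists>C. \<forall>x. norm (iter_deriv n f x) \<le> C * exp (real m * \<bar>x\<bar>))}"

definition F_norm :: "nat \<Rightarrow> nat \<Rightarrow> (real \<Rightarrow> complex) \<Rightarrow> real" where
  "F_norm m n f = (SUP x. norm (iter_deriv n f x) * exp (- (real m * \<bar>x\<bar>)))"

lemma weighted_le_iff: "a * exp (- (b::real)) \<le> C \<longleftrightarrow> a \<le> C * exp b"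
  by (simp add: exp_minus field_simps)

lemma bdd_above_weighted_iff:
  "bdd_above (range (\<lambda>x::real. a x * exp (- (real m * \<bar>x\<bar>)))) \<longleftrightarrow> (\<exists>C. \<forall>x. a x \<le> C * exp (real m * \<bar>x\<bar>))"
  unfolding bdd_above_def by (simp add: weighted_le_iff)

lemma F_top_eq: "F_top m = seminorm_topology (exp_space m) (range (F_norm m))"
  unfolding F_top_def exp_space_def bdd_above_weighted_iff F_norm_def[abs_def]
  by (simp add: full_SetCompr_eq)

lemma topspace_F_top: "topspace (F_top m) = exp_space m"
  unfolding F_top_eq by (rule topspace_seminorm_topology) simp

lemma norm_le_F_norm:
  assumes "f \<in> exp_space m"
  shows "norm (iter_deriv n f x) \<le> F_norm m n f * exp (real m * \<bar>x\<bar>)"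
  unfolding weighted_le_iff[symmetric] F_norm_def
  by (rule cSUP_upper) (use assms in \<open>auto simp: exp_space_def bdd_above_weighted_iff\<close>)

lemma F_norm_le:
  assumes "\<And>x. norm (iter_deriv n f x) \<le> C * exp (real m * \<bar>x\<bar>)"
  shows "F_norm m n f \<le> C"
  unfolding F_norm_def by (rule cSUP_least) (use assms in \<open>auto simp: weighted_le_iff\<close>)

lemma exp_spaceD:
  assumes "f \<in> exp_space m"
  shows "smooth f" "\<exists>C. \<forall>x. norm (iter_deriv n f x) \<le> C * exp (real m * \<bar>x\<bar>)"
  using assms by (auto simp: exp_space_def)

lemma exp_space_mono: "m \<le> k \<Longrightarrow> exp_space m \<subseteq> exp_space k"
proof
  fix f assume mk: "m \<le> k" and f: "f \<in> exp_space m"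
  show "f \<in> exp_space k"
    unfolding exp_space_def
  proof (intro CollectI conjI allI)
    fix n
    obtain C where C: "\<And>x. norm (iter_deriv n f x) \<le> C * exp (real m * \<bar>x\<bar>)"
      using exp_spaceD(2)[OF f] by blast
    have "C \<ge> 0" using order_trans[OF norm_ge_zero C[of 0]] by simp
    then have "C * exp (real m * \<bar>x\<bar>) \<le> C * exp (real k * \<bar>x\<bar>)" for x
      using mk by (intro mult_left_mono) (auto intro: mult_right_mono)
    with C show "\<exists>C. \<forall>x. norm (iter_deriv n f x) \<le> C * exp (real k * \<bar>x\<bar>)"
      by (meson order_trans)
  qed (rule exp_spaceD(1)[OF f])
qed

lemma exp_space_lincomb:
  assumes f: "f \<in> exp_space m" and g: "g \<in> exp_space m"
  shows "(\<lambda>x. a * f x + b * g x) \<in> exp_space m"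
  unfolding exp_space_def
proof (intro CollectI conjI allI)
  show "smooth (\<lambda>x. a * f x + b * g x)"
    by (intro smooth_lincomb exp_spaceD(1)[OF f] exp_spaceD(1)[OF g])
  fix n
  have "norm (iter_deriv n (\<lambda>x. a * f x + b * g x) x)
      \<le> (norm a * F_norm m n f + norm b * F_norm m n g) * exp (real m * \<bar>x\<bar>)" for x
  proof -
    have "norm (iter_deriv n (\<lambda>x. a * f x + b * g x) x)
        \<le> norm a * norm (iter_deriv n f x) + norm b * norm (iter_deriv n g x)"
      unfolding iter_deriv_lincomb[OF exp_spaceD(1)[OF f] exp_spaceD(1)[OF g]]
      by (metis norm_mult norm_triangle_ineq)
    also have "\<dots> \<le> norm a * (F_norm m n f * exp (real m * \<bar>x\<bar>)) + norm b * (F_norm m n g * exp (real m * \<bar>x\<bar>))"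
      by (intro add_mono mult_left_mono norm_le_F_norm f g) auto
    finally show ?thesis by (simp add: algebra_simps)
  qed
  then show "\<exists>C. \<forall>x. norm (iter_deriv n (\<lambda>x. a * f x + b * g x) x) \<le> C * exp (real m * \<bar>x\<bar>)"
    by blast
qed

lemma is_seminorm_F_norm: "is_seminorm (exp_space m) (F_norm m n)"
  unfolding is_seminorm_def
proof (intro conjI ballI allI)
  fix f g assume f: "f \<in> exp_space m" and g: "g \<in> exp_space m"
  show "F_norm m n (\<lambda>x. f x + g x) \<le> F_norm m n f + F_norm m n g"
  proof (rule F_norm_le)
    fix x
    have "norm (iter_deriv n (\<lambda>x. f x + g x) x) \<le> norm (iter_deriv n f x) + norm (iter_deriv n g x)"
      unfolding iter_deriv_add[OF exp_spaceD(1)[OF f] exp_spaceD(1)[OF g]] by (rule norm_triangle_ineq)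
    also have "\<dots> \<le> F_norm m n f * exp (real m * \<bar>x\<bar>) + F_norm m n g * exp (real m * \<bar>x\<bar>)"
      by (intro add_mono norm_le_F_norm f g)
    finally show "norm (iter_deriv n (\<lambda>x. f x + g x) x) \<le> (F_norm m n f + F_norm m n g) * exp (real m * \<bar>x\<bar>)"
      by (simp add: algebra_simps)
  qed
next
  fix f and c :: complex assume f: "f \<in> exp_space m"
  have cf: "(\<lambda>x. c * f x) \<in> exp_space m" for c using exp_space_lincomb[OF f f, of c 0] by simp
  have le: "F_norm m n (\<lambda>x. c * f x) \<le> norm c * F_norm m n f" if f: "f \<in> exp_space m" for c f
  proof (rule F_norm_le)
    fix x
    show "norm (iter_deriv n (\<lambda>x. c * f x) x) \<le> norm c * F_norm m n f * exp (real m * \<bar>x\<bar>)"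
      unfolding iter_deriv_cmult[OF exp_spaceD(1)[OF f]] norm_mult mult.assoc
      by (intro mult_left_mono norm_le_F_norm f) auto
  qed
  show "F_norm m n (\<lambda>x. c * f x) = norm c * F_norm m n f"
  proof (cases "c = 0")
    case True
    then show ?thesis
      using iter_deriv_const_0 by (simp add: F_norm_def)
  next
    case False
    have "norm c * F_norm m n f = norm c * F_norm m n (\<lambda>x. inverse c * (c * f x))"
      using False by (simp add: mult.assoc[symmetric])
    also have "\<dots> \<le> norm c * (norm (inverse c) * F_norm m n (\<lambda>x. c * f x))"
      by (intro mult_left_mono le cf) auto
    also have "\<dots> = F_norm m n (\<lambda>x. c * f x)" using False by (simp add: norm_inverse)
    finally show ?thesis using le[OF f, of c] by simp
  qed
qed

lemma F_norm_nonneg: "f \<in> exp_space m \<Longrightarrow> F_norm m n f \<ge> 0"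
  by (rule is_seminorm_nonneg[OF is_seminorm_F_norm _ exp_space_lincomb])

lemma exp_space_0: "(\<lambda>_. 0) \<in> exp_space m"
  by (auto simp: exp_space_def smooth_0 iter_deriv_const_0 intro!: exI[of _ 0])

lemma F_norm_0: "F_norm m n (\<lambda>_. 0) = 0"
  using is_seminormD(2)[OF is_seminorm_F_norm exp_space_0, of m n 0] by simp

section \<open>The inductive limit and its dual\<close>

lemma Cexp_top_eq: "Cexp_top = seminorm_topology (\<Union>m. exp_space m)
     {p. is_seminorm (\<Union>m. exp_space m) p \<and> (\<forall>m\<ge>1. continuous_map (F_top m) euclideanreal p)}"
proof -
  have "(\<Union>m\<in>{1..}. exp_space m) = (\<Union>m. exp_space m)"
  proof (intro equalityI subsetI)
    fix f assume "f \<in> (\<Union>m. exp_space m)"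
    then obtain m where "f \<in> exp_space m" by blast
    \<comment> \<open>The limit is taken over \<open>m \<ge> 1\<close>; since the spaces increase,
      admitting \<open>m = 0\<close> adds nothing.\<close>
    then have "f \<in> exp_space (max 1 m)" using exp_space_mono[of m "max 1 m"] by auto
    then show "f \<in> (\<Union>m\<in>{1..}. exp_space m)" by (intro UN_I[of "max 1 m"]) auto
  qed auto
  then show ?thesis by (simp add: Cexp_top_def Let_def topspace_F_top)
qed

lemma topspace_Cexp_top: "topspace Cexp_top = (\<Union>m. exp_space m)"
  unfolding Cexp_top_eq
  by (rule topspace_seminorm_topology) (auto simp: is_seminorm_def intro!: exI[of _ "\<lambda>_. 0"])

lemma Cexp_lincomb:
  assumes "f \<in> topspace Cexp_top" "g \<in> topspace Cexp_top"
  shows "(\<lambda>x. a * f x + b * g x) \<in> topspace Cexp_top"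
proof -
  obtain m k where "f \<in> exp_space m" "g \<in> exp_space k" using assms by (auto simp: topspace_Cexp_top)
  then have "f \<in> exp_space (max m k)" "g \<in> exp_space (max m k)"
    using exp_space_mono[of m "max m k"] exp_space_mono[of k "max m k"] by auto
  from exp_space_lincomb[OF this] show ?thesis by (auto simp: topspace_Cexp_top)
qed

text \<open>
  The steps of the inductive limit are metrizable, so boundedness on bounded sequences amounts to
  continuity; it spares the bookkeeping of finitely many seminorms.
\<close>

locale exp_functional =
  fixes \<Phi> :: "(real \<Rightarrow> complex) \<Rightarrow> complex"
  assumes lincomb: "\<And>f g a b. f \<in> topspace Cexp_top \<Longrightarrow> g \<in> topspace Cexp_top \<Longrightarrow>
      \<Phi> (\<lambda>x. a * f x + b * g x) = a * \<Phi> f + b * \<Phi> g"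
    and bounded: "\<And>m g. (\<And>j::nat. smooth (g j)) \<Longrightarrow>
      (\<And>n. \<exists>C. \<forall>j x. norm (iter_deriv n (g j) x) \<le> C * exp (real m * \<bar>x\<bar>)) \<Longrightarrow>
      \<exists>C. \<forall>j. norm (\<Phi> (g j)) \<le> C"
begin

lemma cmult: "f \<in> topspace Cexp_top \<Longrightarrow> \<Phi> (\<lambda>x. a * f x) = a * \<Phi> f"
  using lincomb[of f f a 0] by simp

lemma add: "f \<in> topspace Cexp_top \<Longrightarrow> g \<in> topspace Cexp_top \<Longrightarrow> \<Phi> (\<lambda>x. f x + g x) = \<Phi> f + \<Phi> g"
  using lincomb[of f g 1 1] by simp

lemma diff: "f \<in> topspace Cexp_top \<Longrightarrow> g \<in> topspace Cexp_top \<Longrightarrow> \<Phi> (\<lambda>x. f x - g x) = \<Phi> f - \<Phi> g"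
  using lincomb[of f g 1 "-1"] by simp

lemma zero: "\<Phi> (\<lambda>_. 0) = 0"
proof -
  have "(\<lambda>_. 0) \<in> topspace Cexp_top" by (auto simp: topspace_Cexp_top exp_space_0)
  from cmult[OF this, of 0] show ?thesis by simp
qed

text \<open>Makes the qualitative axiom quantitative: a sequence violating every constant, divided
  by its sizes \<open>e k\<close>, would be bounded in one step of the limit although
  \<open>\<Phi>\<close> is unbounded along it.\<close>

lemma bounded_family:
  assumes smooth: "\<And>k. k \<in> K \<Longrightarrow> smooth (g k)" and e: "\<And>k. k \<in> K \<Longrightarrow> e k \<ge> 0"
    and bound: "\<And>n. \<exists>C. \<forall>k\<in>K. \<forall>x. norm (iter_deriv n (g k) x) \<le> C * e k * exp (real m * \<bar>x\<bar>)"
  obtains C where "C \<ge> 0" "\<And>k. k \<in> K \<Longrightarrow> norm (\<Phi> (g k)) \<le> C * e k"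
proof -
  have "\<exists>C\<ge>0. \<forall>k\<in>K. norm (\<Phi> (g k)) \<le> C * e k"
  proof (rule ccontr)
    assume neg: "\<not> ?thesis"
    have "\<exists>k. k \<in> K \<and> norm (\<Phi> (g k)) > real j * e k" for j :: nat
      using neg by (meson not_le of_nat_0_le_iff)
    then obtain \<kappa> where \<kappa>: "\<And>j. \<kappa> j \<in> K" "\<And>j. norm (\<Phi> (g (\<kappa> j))) > real j * e (\<kappa> j)"
      by metis
    \<comment> \<open>Where \<open>e\<close> vanishes, the bound of order 0 forces \<open>g\<close>
      to be 0, and then \<open>\<Phi>\<close> gives 0.\<close>
    have epos: "e (\<kappa> j) > 0" for j
    proof (rule ccontr)
      assume "\<not> e (\<kappa> j) > 0"
      with e[OF \<kappa>(1)] have e0: "e (\<kappa> j) = 0" by (meson antisym not_le)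
      obtain C where "\<forall>k\<in>K. \<forall>x. norm (iter_deriv 0 (g k) x) \<le> C * e k * exp (real m * \<bar>x\<bar>)"
        using bound by blast
      then have "\<forall>x. norm (iter_deriv 0 (g (\<kappa> j)) x) \<le> C * e (\<kappa> j) * exp (real m * \<bar>x\<bar>)"
        using \<kappa>(1) by blast
      then have "g (\<kappa> j) = (\<lambda>_. 0)" using e0 by auto
      then show False using \<kappa>(2)[of j] zero e0 by simp
    qed
    define g' where "g' j x = complex_of_real (1 / e (\<kappa> j)) * g (\<kappa> j) x" for j x
    have sm: "smooth (g' j)" for j
      unfolding g'_def by (intro smooth_cmult smooth \<kappa>)
    have bd: "\<exists>C. \<forall>j x. norm (iter_deriv n (g' j) x) \<le> C * exp (real m * \<bar>x\<bar>)" for n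
    proof -
      obtain C where C: "\<forall>k\<in>K. \<forall>x. norm (iter_deriv n (g k) x) \<le> C * e k * exp (real m * \<bar>x\<bar>)"
        using bound by blast
      have "norm (iter_deriv n (g' j) x) \<le> C * exp (real m * \<bar>x\<bar>)" for j x
      proof -
        have "norm (iter_deriv n (g' j) x) = norm (iter_deriv n (g (\<kappa> j)) x) / e (\<kappa> j)"
          unfolding g'_def iter_deriv_cmult[OF smooth[OF \<kappa>(1)]]
          using epos[of j] by (simp add: norm_mult norm_divide)
        then show ?thesis
          using C \<kappa>(1)[of j] epos[of j] by (simp add: divide_le_eq mult_ac)
      qed
      then show ?thesis by blast
    qed
    obtain C where C: "\<And>j. norm (\<Phi> (g' j)) \<le> C"
      using bounded[OF sm bd] by blast
    obtain j :: nat where j: "real j > C" using reals_Archimedean2 by blast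
    have "g (\<kappa> j) \<in> exp_space m"
      unfolding exp_space_def using smooth[OF \<kappa>(1)] bound \<kappa>(1) by (fastforce)
    then have "\<Phi> (g' j) = complex_of_real (1 / e (\<kappa> j)) * \<Phi> (g (\<kappa> j))"
      unfolding g'_def by (intro cmult) (auto simp: topspace_Cexp_top)
    then have "norm (\<Phi> (g' j)) = norm (\<Phi> (g (\<kappa> j))) / e (\<kappa> j)"
      using epos[of j] by (simp add: norm_mult norm_divide)
    moreover have "\<dots> > real j" using \<kappa>(2)[of j] epos[of j] by (simp add: field_simps)
    ultimately show False using C[of j] j by linarith
  qed
  with that show ?thesis by blast
qed

end

text \<open>Boundedness on bounded sequences gives, by a diagonal choice, control by finitely many
  seminorms on each step. The norm of \<open>\<Phi>\<close> is then itself one of the seminorms that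
  generate the limit topology.\<close>

lemma exp_functional_imp_top_dual:
  assumes "exp_functional \<Phi>"
  shows "\<Phi> \<in> top_dual Cexp_top"
proof -
  interpret exp_functional \<Phi> by fact
  have F_bound: "\<exists>N C. C \<ge> 0 \<and> (\<forall>g\<in>exp_space m. norm (\<Phi> g) \<le> C * (\<Sum>n\<le>N. F_norm m n g))" for m
  proof (rule ccontr)
    assume neg: "\<not> ?thesis"
    have "\<exists>g\<in>exp_space m. norm (\<Phi> g) > real j * (\<Sum>n\<le>j. F_norm m n g)" for j :: nat
      using neg by (meson not_le of_nat_0_le_iff)
    then obtain g where g: "\<And>j. g j \<in> exp_space m" "\<And>j. norm (\<Phi> (g j)) > real j * (\<Sum>n\<le>j. F_norm m n (g j))"
      by metis
    \<comment> \<open>Witness \<open>j\<close> defeats the seminorms of orders up to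
      \<open>j\<close> with constant \<open>j\<close>; relative to their sum, every single seminorm
      stays bounded along the sequence.\<close>
    define e where "e j = (\<Sum>n\<le>j. F_norm m n (g j))" for j
    have e: "F_norm m n (g j) \<le> e j" if "n \<le> j" for n j
      unfolding e_def using that by (intro member_le_sum F_norm_nonneg g) auto
    have e0: "e j \<ge> 0" for j unfolding e_def by (intro sum_nonneg F_norm_nonneg g)
    obtain C where C: "C \<ge> 0" "\<And>j. j \<in> UNIV \<Longrightarrow> norm (\<Phi> (g j)) \<le> C * e j"
    proof (rule bounded_family[of UNIV g e m])
      fix n
      have epos: "e j > 0" for j
      proof (rule ccontr)
        assume "\<not> e j > 0"
        with e0[of j] e[of 0 j] have "F_norm m 0 (g j) \<le> 0" by simp
        then have "norm (g j x) \<le> 0" for x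
          using norm_le_F_norm[OF g(1), of 0 j x] mult_nonpos_nonneg[OF _ exp_ge_zero, of "F_norm m 0 (g j)" "real m * \<bar>x\<bar>"]
          unfolding iter_deriv_0 by linarith
        then have "g j = (\<lambda>_. 0)" by auto
        then show False using g(2)[of j] zero by (simp add: F_norm_0)
      qed
      \<comment> \<open>For \<open>j \<ge> n\<close> the seminorm of order \<open>n\<close> is a
        summand of \<open>e j\<close>; the finitely many earlier quotients are simply added
        up.\<close>
      define C where "C = 1 + (\<Sum>j<n. F_norm m n (g j) / e j)"
      have "F_norm m n (g j) \<le> C * e j" for j
      proof (cases "n \<le> j")
        case True
        have "1 \<le> C" unfolding C_def using epos by (auto intro!: sum_nonneg divide_nonneg_pos F_norm_nonneg g)
        then have "1 * e j \<le> C * e j" using e0 by (intro mult_right_mono)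
        then show ?thesis using e[OF True] by simp
      next
        case False
        then have "F_norm m n (g j) / e j \<le> (\<Sum>j<n. F_norm m n (g j) / e j)"
          using epos by (intro member_le_sum divide_nonneg_pos F_norm_nonneg g) auto
        then have "F_norm m n (g j) / e j \<le> C" by (simp add: C_def)
        then show ?thesis using epos[of j] by (simp add: divide_le_eq)
      qed
      then have "norm (iter_deriv n (g j) x) \<le> C * e j * exp (real m * \<bar>x\<bar>)" for j x
        using norm_le_F_norm[OF g(1), of n j x] by (meson exp_ge_zero mult_right_mono order_trans)
      then show "\<exists>C. \<forall>k\<in>UNIV. \<forall>x. norm (iter_deriv n (g k) x) \<le> C * e k * exp (real m * \<bar>x\<bar>)"
        by blast
    qed (use exp_spaceD(1)[OF g(1)] e0 in auto)
    obtain j :: nat where "real j > C" using reals_Archimedean2 by blast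
    then have "C * e j \<le> real j * e j" using e0 by (intro mult_right_mono) auto
    then show False using C(2)[of j] g(2)[of j] by (simp add: e_def)
  qed
  have sn: "is_seminorm (\<Union>m. exp_space m) (\<lambda>f. norm (\<Phi> f))"
    unfolding is_seminorm_def
  proof (intro conjI ballI allI)
    fix f g assume "f \<in> (\<Union>m. exp_space m)" "g \<in> (\<Union>m. exp_space m)"
    then show "norm (\<Phi> (\<lambda>x. f x + g x)) \<le> norm (\<Phi> f) + norm (\<Phi> g)"
      by (subst add) (simp_all add: topspace_Cexp_top norm_triangle_ineq)
  next
    fix f c assume "f \<in> (\<Union>m. exp_space m)"
    then show "norm (\<Phi> (\<lambda>x. c * f x)) = norm c * norm (\<Phi> f)"
      by (subst cmult) (simp_all add: topspace_Cexp_top norm_mult)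
  qed
  have cont: "continuous_map (F_top m) euclideanreal (\<lambda>f. norm (\<Phi> f))" for m
  proof -
    obtain N C where NC: "C \<ge> 0" "\<And>g. g \<in> exp_space m \<Longrightarrow> norm (\<Phi> g) \<le> C * (\<Sum>n\<le>N. F_norm m n g)"
      using F_bound by blast
    \<comment> \<open>Different orders might give the same functional, so the sum over the set of
      seminorms could be smaller than the sum over the orders; the number of orders
      compensates.\<close>
    have NC': "C * (\<Sum>n\<le>N. F_norm m n g) \<le> C * (real (Suc N) * (\<Sum>p\<in>F_norm m ` {..N}. p g))"
      if g: "g \<in> exp_space m" for g
    proof (intro mult_left_mono NC)
      have "(\<Sum>n\<le>N. F_norm m n g) \<le> (\<Sum>n\<le>N. (\<Sum>p\<in>F_norm m ` {..N}. p g))"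
        by (intro sum_mono member_le_sum[where f = "\<lambda>p. p g"]) (auto intro: F_norm_nonneg g)
      then show "(\<Sum>n\<le>N. F_norm m n g) \<le> real (Suc N) * (\<Sum>p\<in>F_norm m ` {..N}. p g)" by simp
    qed
    show ?thesis
      unfolding F_top_eq
    proof (rule continuous_map_seminorm_topologyI[where P' = "F_norm m ` {..N}" and C = "C * real (Suc N)"])
      fix f g assume f: "f \<in> exp_space m" and g: "g \<in> exp_space m"
      have fg: "(\<lambda>x. g x - f x) \<in> exp_space m" using exp_space_lincomb[OF g f, of 1 "-1"] by simp
      have "dist (norm (\<Phi> g)) (norm (\<Phi> f)) \<le> norm (\<Phi> g - \<Phi> f)"
        by (simp add: dist_norm norm_triangle_ineq3)
      also have "\<Phi> g - \<Phi> f = \<Phi> (\<lambda>x. g x - f x)"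
        using f g by (subst diff) (auto simp: topspace_Cexp_top)
      also have "norm \<dots> \<le> C * real (Suc N) * (\<Sum>p\<in>F_norm m ` {..N}. p (\<lambda>x. g x - f x))"
        using order_trans[OF NC(2) NC', OF fg fg] by (simp only: mult.assoc)
      finally show "dist (norm (\<Phi> g)) (norm (\<Phi> f)) \<le> C * real (Suc N) * (\<Sum>p\<in>F_norm m ` {..N}. p (\<lambda>x. g x - f x))" .
    qed (use NC in \<open>auto simp: F_norm_0\<close>)
  qed
  have "continuous_map Cexp_top euclidean \<Phi>"
    unfolding Cexp_top_eq
  proof (rule continuous_map_seminorm_topologyI[where P' = "{\<lambda>f. norm (\<Phi> f)}" and C = 1])
    fix f g assume "f \<in> (\<Union>m. exp_space m)" "g \<in> (\<Union>m. exp_space m)"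
    then show "dist (\<Phi> g) (\<Phi> f) \<le> 1 * (\<Sum>p\<in>{\<lambda>f. norm (\<Phi> f)}. p (\<lambda>x. g x - f x))"
      by (simp add: dist_norm diff topspace_Cexp_top)
  qed (use sn cont zero in auto)
  then show ?thesis by (simp add: top_dual_def lincomb)
qed

text \<open>The norm of \<open>\<Phi>\<close> is dominated by finitely many seminorms of the limit,
  and each of these, on a fixed step, by finitely many \<open>F_norm\<close>; the latter are bounded
  along the sequence.\<close>

lemma top_dual_imp_exp_functional:
  assumes "\<Phi> \<in> top_dual Cexp_top"
  shows "exp_functional \<Phi>"
proof
  show lc: "\<Phi> (\<lambda>x. a * f x + b * g x) = a * \<Phi> f + b * \<Phi> g"
    if "f \<in> topspace Cexp_top" "g \<in> topspace Cexp_top" for f g a b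
    using assms that by (auto simp: top_dual_def)
  have cm: "continuous_map Cexp_top euclidean \<Phi>" using assms by (auto simp: top_dual_def)
  fix m and g :: "nat \<Rightarrow> real \<Rightarrow> complex"
  assume g: "\<And>j. smooth (g j)" "\<And>n. \<exists>C. \<forall>j x. norm (iter_deriv n (g j) x) \<le> C * exp (real m * \<bar>x\<bar>)"
  \<comment> \<open>The seminorms of the limit are required to be continuous only on the steps from
    1 on.\<close>
  define k where "k = max 1 m"
  have gk: "\<exists>C. \<forall>j x. norm (iter_deriv n (g j) x) \<le> C * exp (real k * \<bar>x\<bar>)" for n
  proof -
    obtain C where C: "\<And>j x. norm (iter_deriv n (g j) x) \<le> C * exp (real m * \<bar>x\<bar>)" using g(2) by blast
    have "C \<ge> 0" using order_trans[OF norm_ge_zero C[of 0 0]] by simp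
    then have "C * exp (real m * \<bar>x\<bar>) \<le> C * exp (real k * \<bar>x\<bar>)" for x
      by (intro mult_left_mono) (auto simp: k_def intro!: mult_right_mono)
    with C show ?thesis by (meson order_trans)
  qed
  have gV: "g j \<in> exp_space k" for j
    unfolding exp_space_def using g(1) gk by blast
  define P where "P = {p. is_seminorm (\<Union>m. exp_space m) p \<and> (\<forall>m\<ge>1. continuous_map (F_top m) euclideanreal p)}"
  obtain P' C where P': "finite P'" "P' \<subseteq> P" "C \<ge> 0"
    "\<And>g. g \<in> (\<Union>m. exp_space m) \<Longrightarrow> norm (\<Phi> g) \<le> C * (\<Sum>p\<in>P'. p g)"
  proof (rule continuous_homogeneous_bound[of "\<Union>m. exp_space m" P "\<lambda>f. norm (\<Phi> f)"])
    have "continuous_map euclidean euclideanreal (norm :: complex \<Rightarrow> real)"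
      by (simp add: continuous_on_norm)
    from continuous_map_compose[OF cm this]
    show "continuous_map (seminorm_topology (\<Union>m. exp_space m) P) euclideanreal (\<lambda>f. norm (\<Phi> f))"
      by (simp add: Cexp_top_eq P_def o_def)
    show "norm (\<Phi> (\<lambda>x. c * f x)) = norm c * norm (\<Phi> f)" if "f \<in> (\<Union>m. exp_space m)" for c f
      using lc[of f f c 0] that by (simp add: topspace_Cexp_top norm_mult)
    have "(\<lambda>_. 0) \<in> P" by (simp add: P_def is_seminorm_def)
    then show "P \<noteq> {}" by blast
    show "(\<lambda>x. a * f x + b * g x) \<in> (\<Union>m. exp_space m)"
      if "f \<in> (\<Union>m. exp_space m)" "g \<in> (\<Union>m. exp_space m)" for f g a b
      using Cexp_lincomb that unfolding topspace_Cexp_top .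
  qed (auto simp: P_def)
  have "\<exists>B. \<forall>j. p (g j) \<le> B" if p: "p \<in> P'" for p
  proof -
    have cp: "continuous_map (F_top k) euclideanreal p" and sp: "is_seminorm (\<Union>m. exp_space m) p"
      using p P'(2) by (auto simp: P_def k_def)
    obtain Q C where Q: "finite Q" "Q \<subseteq> range (F_norm k)" "C \<ge> 0" "\<And>g. g \<in> exp_space k \<Longrightarrow> p g \<le> C * (\<Sum>q\<in>Q. q g)"
    proof (rule continuous_homogeneous_bound[OF cp[unfolded F_top_eq]])
      show "p (\<lambda>x. c * f x) = norm c * p f" if "f \<in> exp_space k" for c f
        using is_seminormD(2)[OF sp] that by blast
    qed (use exp_space_lincomb is_seminorm_F_norm in auto)
    have "\<exists>B. \<forall>j. q (g j) \<le> B" if "q \<in> Q" for q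
    proof -
      obtain n where n: "q = F_norm k n" using Q(2) \<open>q \<in> Q\<close> by blast
      obtain B where "\<And>j x. norm (iter_deriv n (g j) x) \<le> B * exp (real k * \<bar>x\<bar>)" using gk by blast
      then show ?thesis unfolding n by (intro exI[of _ B] allI F_norm_le)
    qed
    then obtain B where B: "\<And>q j. q \<in> Q \<Longrightarrow> q (g j) \<le> B q" by metis
    have "p (g j) \<le> C * (\<Sum>q\<in>Q. B q)" for j
      using Q(4)[OF gV] by (rule order_trans) (intro mult_left_mono sum_mono B Q)
    then show ?thesis by blast
  qed
  then obtain B where B: "\<And>p j. p \<in> P' \<Longrightarrow> p (g j) \<le> B p" by metis
  have "norm (\<Phi> (g j)) \<le> C * (\<Sum>p\<in>P'. B p)" for j
  proof -
    have "norm (\<Phi> (g j)) \<le> C * (\<Sum>p\<in>P'. p (g j))" using gV by (intro P') blast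
    also have "\<dots> \<le> C * (\<Sum>p\<in>P'. B p)" by (intro mult_left_mono sum_mono B P')
    finally show ?thesis .
  qed
  then show "\<exists>C. \<forall>j. norm (\<Phi> (g j)) \<le> C" by blast
qed

section \<open>Entire families\<close>

text \<open>The estimate depends on \<open>w\<close> only through its bound on the unit disc. A
  weight contained in \<open>M\<close> is therefore inherited, which gives weighted estimates
  uniform in the real variable of a family.\<close>

lemma difference_quotient_bound:
  assumes hol: "w holomorphic_on UNIV" and M: "\<And>z. norm (z - s) \<le> 1 \<Longrightarrow> norm (w z) \<le> M"
    and h: "0 < norm h" "norm h \<le> 1/2"
  shows "norm ((w (s + h) - w s) / h - deriv w s) \<le> 13 * M * norm h"
proof -
  have M0: "M \<ge> 0" using order_trans[OF norm_ge_zero M[of s]] by simp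
  \<comment> \<open>Radius 3/5 for \<open>s + h\<close> and 2/5 for Cauchy's inequality add up to
    the unit disc; \<open>2 / (2/5)\<^sup>2 = 12.5\<close> is rounded up to 13.\<close>
  have d2: "norm (deriv (deriv w) x) \<le> 13 * M" if x: "x \<in> ball s (3/5)" for x
  proof -
    have "norm ((deriv ^^ 2) w x) \<le> fact 2 * M / (2/5) ^ 2"
    proof (rule Cauchy_inequality)
      fix y assume "norm (x - y) = 2/5"
      moreover have "norm (y - s) \<le> norm (x - s) + norm (x - y)"
        using norm_triangle_ineq[of "x - s" "y - x"] by (simp add: norm_minus_commute)
      ultimately show "norm (w y) \<le> M" using x by (intro M) (simp add: dist_norm norm_minus_commute)
    qed (auto intro: holomorphic_on_subset[OF hol] holomorphic_on_imp_continuous_on)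
    also have "\<dots> \<le> 13 * M" using M0 by (simp add: power2_eq_square)
    finally show ?thesis by (simp add: numeral_2_eq_2)
  qed
  have "norm ((deriv ^^ 0) w (s + h) - (\<Sum>i\<le>1. (deriv ^^ i) w s * (s + h - s) ^ i / fact i))
      \<le> 13 * M * norm (s + h - s) ^ Suc 1 / fact 1"
  proof (rule field_Taylor[of "ball s (3/5)"])
    fix i x
    have "(deriv ^^ i) w holomorphic_on UNIV" by (intro holomorphic_higher_deriv hol) auto
    then show "((deriv ^^ i) w has_field_derivative (deriv ^^ Suc i) w x) (at x within ball s (3/5))"
      by (auto intro!: DERIV_subset[OF holomorphic_derivI[of _ UNIV]])
  next
    fix x assume "x \<in> ball s (3/5)"
    from d2[OF this] show "norm ((deriv ^^ Suc 1) w x) \<le> 13 * M" by simp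
  qed (use h in \<open>auto simp: dist_norm\<close>)
  then have "norm (w (s + h) - w s - deriv w s * h) \<le> 13 * M * norm h * norm h"
    by (simp add: algebra_simps)
  moreover have "(w (s + h) - w s) / h - deriv w s = (w (s + h) - w s - deriv w s * h) / h"
    using h by (simp add: field_simps)
  ultimately show ?thesis using h by (simp add: norm_divide divide_le_eq)
qed

text \<open>The difference quotients \<open>Q h\<close> are compared with each other and not with a
  presumed derivative. The pointwise derivative in \<open>s\<close> serves only as an intermediate
  number, so nothing has to be shown about it as a function of \<open>x\<close>.\<close>

lemma (in exp_functional) holomorphic_family:
  assumes smooth: "\<And>s. smooth (q s)"
    and hol: "\<And>n x. (\<lambda>s. iter_deriv n (q s) x) holomorphic_on UNIV"
    and bound: "\<And>R. \<exists>m. \<forall>n. \<exists>C. \<forall>s x. norm s \<le> R \<longrightarrow>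
      norm (iter_deriv n (q s) x) \<le> C * exp (real m * \<bar>x\<bar>)"
  shows "(\<lambda>s. \<Phi> (q s)) holomorphic_on UNIV"
proof -
  have E: "q s \<in> topspace Cexp_top" for s
  proof -
    obtain m where "\<And>n. \<exists>C. \<forall>z x. norm z \<le> norm s \<longrightarrow> norm (iter_deriv n (q z) x) \<le> C * exp (real m * \<bar>x\<bar>)"
      using bound by metis
    then have "q s \<in> exp_space m" unfolding exp_space_def using smooth by (blast intro: order_refl)
    then show ?thesis by (auto simp: topspace_Cexp_top)
  qed
  have "\<exists>L. ((\<lambda>s. \<Phi> (q s)) has_field_derivative L) (at s)" for s
  proof -
    obtain m where m: "\<And>n. \<exists>C. \<forall>z x. norm z \<le> norm s + 1 \<longrightarrow>
        norm (iter_deriv n (q z) x) \<le> C * exp (real m * \<bar>x\<bar>)"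
      using bound by metis
    define Q where "Q h x = inverse h * q (s + h) x + (- inverse h) * q s x" for h x
    have smQ: "smooth (Q h)" for h
      unfolding Q_def by (intro smooth_lincomb smooth)
    have EQ: "Q h \<in> topspace Cexp_top" for h
      unfolding Q_def by (intro Cexp_lincomb E)
    have PQ: "\<Phi> (Q h) = (\<Phi> (q (s + h)) - \<Phi> (q s)) / h" for h
      unfolding Q_def lincomb[OF E E] by (simp add: divide_inverse algebra_simps)
    define K where "K = {h::complex. 0 < norm h \<and> norm h \<le> 1/2}"
    \<comment> \<open>In every derivative the difference of two quotients is of the size of the two
      increments, with one and the same weight.\<close>
    have "\<exists>C\<ge>0. \<forall>k\<in>K \<times> K. norm (\<Phi> (\<lambda>x. Q (fst k) x - Q (snd k) x)) \<le> C * (norm (fst k) + norm (snd k))"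
    proof -
      have "\<exists>C. \<forall>k\<in>K \<times> K. \<forall>x. norm (iter_deriv n (\<lambda>x. Q (fst k) x - Q (snd k) x) x)
          \<le> C * (norm (fst k) + norm (snd k)) * exp (real m * \<bar>x\<bar>)" for n
      proof -
        obtain C where C: "\<And>z x. norm z \<le> norm s + 1 \<Longrightarrow> norm (iter_deriv n (q z) x) \<le> C * exp (real m * \<bar>x\<bar>)"
          using m by blast
        have *: "norm (iter_deriv n (Q h) x - deriv (\<lambda>s. iter_deriv n (q s) x) s)
            \<le> 13 * (C * exp (real m * \<bar>x\<bar>)) * norm h" if "h \<in> K" for h x
        proof -
          have "iter_deriv n (Q h) x = (iter_deriv n (q (s + h)) x - iter_deriv n (q s) x) / h"
            unfolding Q_def iter_deriv_lincomb[OF smooth smooth] by (simp add: divide_inverse algebra_simps)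
          moreover have "norm z \<le> norm s + 1" if "norm (z - s) \<le> 1" for z
            using norm_triangle_ineq2[of z s] that by linarith
          ultimately show ?thesis
            using difference_quotient_bound[OF hol[of n x], of s "C * exp (real m * \<bar>x\<bar>)" h] C that
            by (simp add: K_def)
        qed
        have "norm (iter_deriv n (\<lambda>x. Q (fst k) x - Q (snd k) x) x)
          \<le> 13 * C * (norm (fst k) + norm (snd k)) * exp (real m * \<bar>x\<bar>)" if "k \<in> K \<times> K" for k x
        proof -
          have "norm (iter_deriv n (\<lambda>x. Q (fst k) x - Q (snd k) x) x) \<le>
            norm (iter_deriv n (Q (fst k)) x - deriv (\<lambda>s. iter_deriv n (q s) x) s) +
            norm (iter_deriv n (Q (snd k)) x - deriv (\<lambda>s. iter_deriv n (q s) x) s)"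
            unfolding iter_deriv_diff[OF smQ smQ] by norm
          also have "\<dots> \<le> 13 * (C * exp (real m * \<bar>x\<bar>)) * norm (fst k) + 13 * (C * exp (real m * \<bar>x\<bar>)) * norm (snd k)"
            using that by (intro add_mono *) auto
          finally show ?thesis by (simp add: algebra_simps)
        qed
        then show ?thesis by blast
      qed
      then show ?thesis
        by (rule bounded_family[where g = "\<lambda>k x. Q (fst k) x - Q (snd k) x", rotated 2])
          (auto intro: smooth_diff smQ)
    qed
    then obtain C where C: "C \<ge> 0" "\<And>h h'. h \<in> K \<Longrightarrow> h' \<in> K \<Longrightarrow>
        norm (\<Phi> (Q h) - \<Phi> (Q h')) \<le> C * (norm h + norm h')"
      by (auto simp: diff[OF EQ EQ])
    \<comment> \<open>A sequence of increments tending to 0 produces the limit \<open>L\<close>; the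
      Cauchy estimate then compares every increment with it.\<close>
    define \<delta> where "\<delta> j = complex_of_real (1 / (real j + 2))" for j :: nat
    have n\<delta>: "norm (\<delta> j) = 1 / (real j + 2)" for j by (simp only: \<delta>_def norm_of_real) simp
    have \<delta>K: "\<delta> j \<in> K" for j unfolding K_def mem_Collect_eq n\<delta> by auto
    have \<delta>0: "(\<lambda>j. norm (\<delta> j)) \<longlonglongrightarrow> 0"
      unfolding n\<delta> by real_asymp
    have "Cauchy (\<lambda>j. \<Phi> (Q (\<delta> j)))"
    proof (rule metric_CauchyI)
      fix e :: real assume "e > 0"
      have "(\<lambda>j. 2 * C * norm (\<delta> j)) \<longlonglongrightarrow> 0" using tendsto_mult_right_zero[OF \<delta>0] by simp
      then obtain N where N: "\<And>j. j \<ge> N \<Longrightarrow> 2 * C * norm (\<delta> j) < e"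
        using \<open>e > 0\<close> by (metis eventually_sequentially order_tendstoD(2))
      show "\<exists>M. \<forall>m\<ge>M. \<forall>n\<ge>M. dist (\<Phi> (Q (\<delta> m))) (\<Phi> (Q (\<delta> n))) < e"
      proof (intro exI allI impI)
        fix i j assume "i \<ge> N" "j \<ge> N"
        then show "dist (\<Phi> (Q (\<delta> i))) (\<Phi> (Q (\<delta> j))) < e"
          using C(2)[OF \<delta>K[of i] \<delta>K[of j]] N[of i] N[of j] by (simp add: dist_norm algebra_simps)
      qed
    qed
    then obtain L where L: "(\<lambda>j. \<Phi> (Q (\<delta> j))) \<longlonglongrightarrow> L" using Cauchy_convergent_iff convergent_def by blast
    have "norm (\<Phi> (Q h) - L) \<le> C * norm h" if "h \<in> K" for h
    proof (rule tendsto_le[OF sequentially_bot])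
      show "(\<lambda>j. C * (norm h + norm (\<delta> j))) \<longlonglongrightarrow> C * norm h"
        using tendsto_mult_left[OF tendsto_add[OF tendsto_const \<delta>0], of C "norm h"] by simp
      show "(\<lambda>j. norm (\<Phi> (Q h) - \<Phi> (Q (\<delta> j)))) \<longlonglongrightarrow> norm (\<Phi> (Q h) - L)"
        by (intro tendsto_intros L)
    qed (use C(2)[OF that \<delta>K] in auto)
    moreover have "\<forall>\<^sub>F h in at 0. h \<in> K"
      unfolding eventually_at by (intro exI[of _ "1/2"]) (auto simp: K_def)
    ultimately have ev: "\<forall>\<^sub>F h in at 0. norm (\<Phi> (Q h) - L) \<le> C * norm h"
      by (auto elim: eventually_mono)
    have "((\<lambda>h. C * norm h) \<longlongrightarrow> 0) (at (0::complex))" by (auto intro!: tendsto_eq_intros)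
    from Lim_null_comparison[OF ev this] have "((\<lambda>h. \<Phi> (Q h)) \<longlongrightarrow> L) (at 0)"
      by (simp add: LIM_zero_iff)
    then show ?thesis unfolding DERIV_def PQ by blast
  qed
  then show ?thesis
    unfolding holomorphic_on_def field_differentiable_def by blast
qed

section \<open>Differentiation under the integral sign\<close>

text \<open>A continuous parameter is reduced to sequences. The bounds are required only near
  \<open>h0\<close>, whence the shift of the sequence by \<open>N\<close>.\<close>

lemma integral_dominated_convergence_at:
  fixes k :: "'p::metric_space \<Rightarrow> 'a \<Rightarrow> 'b::{banach, second_countable_topology}"
  assumes d: "d > 0"
    and meas: "\<And>h. h \<noteq> h0 \<Longrightarrow> dist h h0 < d \<Longrightarrow> k h \<in> borel_measurable M" "a \<in> borel_measurable M"
    and lim: "\<And>t. t \<in> space M \<Longrightarrow> ((\<lambda>h. k h t) \<longlongrightarrow> a t) (at h0)"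
    and bound: "\<And>h t. h \<noteq> h0 \<Longrightarrow> dist h h0 < d \<Longrightarrow> t \<in> space M \<Longrightarrow> norm (k h t) \<le> b t"
    and b: "integrable M b"
  shows "((\<lambda>h. integral\<^sup>L M (k h)) \<longlongrightarrow> integral\<^sup>L M a) (at h0)"
  unfolding tendsto_at_iff_sequentially comp_def
proof (intro allI impI)
  fix X assume X: "\<forall>i. X i \<in> UNIV - {h0}" "X \<longlonglongrightarrow> h0"
  obtain N where N: "\<And>i. i \<ge> N \<Longrightarrow> dist (X i) h0 < d"
    using metric_LIMSEQ_D[OF X(2) d] by blast
  have "(\<lambda>i. integral\<^sup>L M (k (X (i + N)))) \<longlonglongrightarrow> integral\<^sup>L M a"
  proof (rule integral_dominated_convergence[where w = b])
    have *: "filterlim X (at h0) sequentially"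
      using X by (auto simp: filterlim_at)
    show "AE t in M. (\<lambda>i. k (X (i + N)) t) \<longlonglongrightarrow> a t"
      by (intro AE_I2 LIMSEQ_ignore_initial_segment filterlim_compose[OF lim *])
  qed (use X N meas bound b in auto)
  then show "(\<lambda>i. integral\<^sup>L M (k (X i))) \<longlonglongrightarrow> integral\<^sup>L M a"
    by (rule LIMSEQ_offset)
qed

lemma borel_imp_lebesgue_measurable:
  "f \<in> borel_measurable borel \<Longrightarrow> f \<in> borel_measurable lebesgue"
  by (intro measurable_completion) simp

text \<open>The integrands at the two real shifts of \<open>s\<close> by \<open>2 * \<delta>\<close>
  dominate the difference quotients, so mere integrability over an open set of abscissas allows
  differentiation under the integral.\<close>

lemma laplace_integral_holomorphic:
  assumes I: "open I"
    and int: "\<And>s. Re s \<in> I \<Longrightarrow> integrable lebesgue (\<lambda>t. u t * exp (- (s * complex_of_real t)))"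
  shows "(\<lambda>s. LINT t|lebesgue. u t * exp (- (s * complex_of_real t))) holomorphic_on {s. Re s \<in> I}"
proof -
  have o: "open {s. Re s \<in> I}"
    using continuous_open_vimage[OF I, of Re] by (simp add: vimage_def continuous_intros)
  have "((\<lambda>s. LINT t|lebesgue. u t * exp (- (s * complex_of_real t))) has_field_derivative
      (LINT t|lebesgue. u t * exp (- (s * complex_of_real t)) * (- complex_of_real t))) (at s)"
    if s: "Re s \<in> I" for s
  proof -
    obtain e where e: "e > 0" "ball (Re s) e \<subseteq> I" using I s open_contains_ball by blast
    define \<delta> where "\<delta> = e / 3"
    have \<delta>: "\<delta> > 0" using e by (simp add: \<delta>_def)
    have in_I: "Re s + x \<in> I" if "\<bar>x\<bar> \<le> 2 * \<delta>" for x
      using that e by (intro subsetD[OF e(2)]) (auto simp: \<delta>_def dist_norm)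
    define w where "w s t = u t * exp (- (s * complex_of_real t))" for s t
    have intw: "integrable lebesgue (w z)" if "Re z \<in> I" for z
      using int[OF that] by (simp add: w_def[abs_def])
    \<comment> \<open>From \<open>norm (exp z - 1) \<le> norm z * exp (norm z)\<close>,
      \<open>\<delta> * \<bar>t\<bar> \<le> exp (\<delta> * \<bar>t\<bar>)\<close> and \<open>exp (2
      * \<delta> * \<bar>t\<bar>) \<le> exp (2 * \<delta> * t) + exp (- (2 * \<delta> *
      t))\<close>.\<close>
    define b where "b t = (norm (w (s - 2 * \<delta>) t) + norm (w (s + 2 * \<delta>) t)) / \<delta>" for t
    have w_add: "w (s + h) t = w s t * exp (- (h * complex_of_real t))" for h t
      by (simp add: w_def distrib_right mult_exp_exp mult.assoc)
    have "((\<lambda>h. LINT t|lebesgue. (w (s + h) t - w s t) / h) \<longlongrightarrow> (LINT t|lebesgue. w s t * (- complex_of_real t))) (at 0)"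
    proof (rule integral_dominated_convergence_at[OF \<delta>, where b = b])
      fix h :: complex assume h: "h \<noteq> 0" "dist h 0 < \<delta>"
      have "\<bar>Re h\<bar> < \<delta>" using abs_Re_le_cmod[of h] h by simp
      then have "integrable lebesgue (w (s + h))" "integrable lebesgue (w s)"
        using in_I[of "Re h"] s \<delta> by (auto intro!: intw)
      then show "(\<lambda>t. (w (s + h) t - w s t) / h) \<in> borel_measurable lebesgue" by measurable
      fix t
      have "norm (w (s + h) t - w s t) = norm (w s t) * norm (exp (- (h * complex_of_real t)) - 1)"
        unfolding w_add by (simp add: norm_mult[symmetric] algebra_simps)
      also have "norm (exp (- (h * complex_of_real t)) - 1) \<le> exp (norm (h * complex_of_real t)) * norm (h * complex_of_real t)"
        using Taylor_exp_field[of "- (h * complex_of_real t)" 0] by simp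
      also have "\<dots> \<le> exp (\<delta> * \<bar>t\<bar>) * (norm h * \<bar>t\<bar>)"
        using h by (intro mult_mono) (auto simp: norm_mult intro!: mult_right_mono)
      also have "\<dots> \<le> exp (\<delta> * \<bar>t\<bar>) * (norm h * (exp (\<delta> * \<bar>t\<bar>) / \<delta>))"
      proof (intro mult_left_mono)
        have "\<delta> * \<bar>t\<bar> \<le> exp (\<delta> * \<bar>t\<bar>)" using exp_ge_add_one_self[of "\<delta> * \<bar>t\<bar>"] by linarith
        then show "\<bar>t\<bar> \<le> exp (\<delta> * \<bar>t\<bar>) / \<delta>" using \<delta> by (simp add: field_simps)
      qed auto
      also have "\<dots> = norm h * exp (2 * \<delta> * \<bar>t\<bar>) / \<delta>" by (simp add: mult_exp_exp algebra_simps)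
      finally have 1: "norm (w (s + h) t - w s t) \<le> norm (w s t) * (norm h * exp (2 * \<delta> * \<bar>t\<bar>) / \<delta>)"
        by (simp add: mult_left_mono)
      have "exp (2 * \<delta> * \<bar>t\<bar>) \<le> exp (2 * \<delta> * t) + exp (- (2 * \<delta> * t))"
        by (cases "t \<ge> 0") (auto simp: add_increasing add_increasing2)
      then have "norm (w s t) * exp (2 * \<delta> * \<bar>t\<bar>) \<le> norm (w s t) * (exp (2 * \<delta> * t) + exp (- (2 * \<delta> * t)))"
        by (intro mult_left_mono) auto
      also have "\<dots> = norm (w (s - 2 * \<delta>) t) + norm (w (s + 2 * \<delta>) t)"
        using w_add[of "- 2 * \<delta>" t] w_add[of "2 * \<delta>" t] by (simp add: norm_mult algebra_simps)
      finally have "norm (w (s + h) t - w s t) \<le> norm h * b t"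
        using \<delta> by (intro order_trans[OF 1]) (auto simp: b_def divide_simps mult_ac intro!: mult_left_mono)
      then show "norm ((w (s + h) t - w s t) / h) \<le> b t"
        using h by (simp add: norm_divide divide_le_eq mult_ac)
    next
      fix t
      have "((\<lambda>s. w s t) has_field_derivative w s t * (- complex_of_real t)) (at s)"
        unfolding w_def by (auto intro!: derivative_eq_intros)
      then show "((\<lambda>h. (w (s + h) t - w s t) / h) \<longlongrightarrow> w s t * (- complex_of_real t)) (at 0)"
        by (simp add: DERIV_def)
    next
      have [measurable]: "w s \<in> borel_measurable lebesgue" using intw[OF s] by measurable
      have [measurable]: "(\<lambda>t. complex_of_real t) \<in> borel_measurable lebesgue"
        by (intro borel_imp_lebesgue_measurable) simp
      show "(\<lambda>t. w s t * (- complex_of_real t)) \<in> borel_measurable lebesgue" by measurable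
      have "integrable lebesgue (w (s - 2 * \<delta>))" "integrable lebesgue (w (s + 2 * \<delta>))"
        using in_I[of "2 * \<delta>"] in_I[of "- 2 * \<delta>"] \<delta> by (auto intro!: intw)
      then show "integrable lebesgue b" unfolding b_def by (intro integrable_divide Bochner_Integration.integrable_add integrable_norm)
    qed
    moreover have "\<forall>\<^sub>F h in at 0. (LINT t|lebesgue. (w (s + h) t - w s t) / h) =
        ((LINT t|lebesgue. w (s + h) t) - (LINT t|lebesgue. w s t)) / h"
      unfolding eventually_at
    proof (intro exI[of _ \<delta>] conjI \<delta> ballI impI)
      fix h :: complex assume h: "h \<noteq> 0 \<and> dist h 0 < \<delta>"
      have "\<bar>Re h\<bar> < \<delta>" using abs_Re_le_cmod[of h] h by simp
      then have "integrable lebesgue (w (s + h))" "integrable lebesgue (w s)"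
        using in_I[of "Re h"] s \<delta> by (auto intro!: intw)
      then show "(LINT t|lebesgue. (w (s + h) t - w s t) / h) =
        ((LINT t|lebesgue. w (s + h) t) - (LINT t|lebesgue. w s t)) / h" by simp
    qed
    ultimately have "((\<lambda>h. ((LINT t|lebesgue. w (s + h) t) - (LINT t|lebesgue. w s t)) / h)
        \<longlongrightarrow> (LINT t|lebesgue. w s t * (- complex_of_real t))) (at 0)"
      by (rule Lim_transform_eventually)
    then show ?thesis unfolding DERIV_def w_def .
  qed
  then show ?thesis
    unfolding holomorphic_on_def field_differentiable_def using o by (metis (mono_tags, lifting) at_within_open mem_Collect_eq)
qed

lemma has_vector_derivativeI_quotient:
  fixes F :: "real \<Rightarrow> 'a::real_normed_vector"
  assumes "((\<lambda>h. (F (y + h) - F y) /\<^sub>R h) \<longlongrightarrow> F') (at 0)"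
  shows "(F has_vector_derivative F') (at y)"
  unfolding has_vector_derivative_def has_derivative_at
proof (intro conjI bounded_linear_scaleR_left)
  have "((\<lambda>h. norm ((F (y + h) - F y) /\<^sub>R h - F')) \<longlongrightarrow> 0) (at 0)"
    using assms by (simp add: tendsto_norm_zero_iff LIM_zero_iff)
  moreover have "norm ((F (y + h) - F y) /\<^sub>R h - F') = norm (F (y + h) - F y - h *\<^sub>R F') / norm h" if "h \<noteq> 0" for h
  proof -
    have "(F (y + h) - F y) /\<^sub>R h - F' = (F (y + h) - F y - h *\<^sub>R F') /\<^sub>R h"
      using that by (simp add: scaleR_diff_right)
    then show ?thesis by (simp add: divide_inverse_commute)
  qed
  ultimately show "(\<lambda>h. norm (F (y + h) - F y - h *\<^sub>R F') / norm h) \<midarrow>0\<rightarrow> 0"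
    by (elim Lim_transform_eventually) (auto simp: eventually_at_filter)
qed

lemma vector_mvt_bound:
  fixes f :: "real \<Rightarrow> complex"
  assumes "\<And>x. x \<in> closed_segment a b \<Longrightarrow> (f has_vector_derivative f' x) (at x)"
    and "\<And>x. x \<in> closed_segment a b \<Longrightarrow> norm (f' x) \<le> C"
  shows "norm (f b - f a) \<le> C * \<bar>b - a\<bar>"
  unfolding real_norm_def[symmetric]
proof (rule differentiable_bound[of "closed_segment a b" f "\<lambda>x h. h *\<^sub>R f' x"])
  fix x assume x: "x \<in> closed_segment a b"
  show "(f has_derivative (\<lambda>h. h *\<^sub>R f' x)) (at x within closed_segment a b)"
    using assms(1)[OF x] unfolding has_vector_derivative_def by (rule has_derivative_at_withinI)
  show "onorm (\<lambda>h. h *\<^sub>R f' x) \<le> C"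
    by (rule onorm_le) (use mult_right_mono[OF assms(2)[OF x] abs_ge_zero] in \<open>simp add: mult.commute\<close>)
qed auto

text \<open>\<open>\<phi> (correlation u g)\<close> is the convolution of \<open>u\<close> with \<open>\<phi>\<close>, evaluated at \<open>g\<close>.\<close>

definition correlation :: "(real \<Rightarrow> complex) \<Rightarrow> (real \<Rightarrow> complex) \<Rightarrow> real \<Rightarrow> complex" where
  "correlation u g y = (LINT t|lebesgue. u t * g (t + y))"

section \<open>Correlation with functions integrable against an exponential weight\<close>

lemma smooth_lebesgue_measurable_shift:
  assumes "smooth g"
  shows "(\<lambda>t. iter_deriv n g (t + y)) \<in> borel_measurable lebesgue"
  by (intro borel_imp_lebesgue_measurable measurable_compose[OF _ smooth_borel_measurable(1)[OF assms]]) simp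

text \<open>\<open>B\<close> may have either sign: nonnegative for \<open>H\<close>, 0 for bounded
  functions of bounded support, negative for Schwartz functions, which absorb exponential
  growth.\<close>

locale weighted_function =
  fixes u :: "real \<Rightarrow> complex" and B :: real
  assumes u_meas [measurable]: "u \<in> borel_measurable lebesgue"
    and u_int: "integrable lebesgue (\<lambda>t. norm (u t) * exp (- (B * \<bar>t\<bar>)))"
begin

definition W :: real where "W = (LINT t|lebesgue. norm (u t) * exp (- (B * \<bar>t\<bar>)))"

lemma integrable_weighted:
  assumes k: "k \<in> borel_measurable lebesgue" and "\<And>t. u t \<noteq> 0 \<Longrightarrow> norm (k t) \<le> C * exp (- (B * \<bar>t\<bar>))"
  shows "integrable lebesgue (\<lambda>t. u t * k t)" "norm (LINT t|lebesgue. u t * k t) \<le> C * W"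
proof -
  have le: "norm (u t * k t) \<le> C * (norm (u t) * exp (- (B * \<bar>t\<bar>)))" for t
    using mult_left_mono[OF assms(2)[of t], of "norm (u t)"] by (cases "u t = 0") (auto simp: norm_mult mult_ac)
  note k[measurable]
  show 1: "integrable lebesgue (\<lambda>t. u t * k t)"
  proof (rule Bochner_Integration.integrable_bound)
    show "integrable lebesgue (\<lambda>t. C * (norm (u t) * exp (- (B * \<bar>t\<bar>))))"
      by (intro integrable_mult_right u_int)
    show "AE t in lebesgue. norm (u t * k t) \<le> norm (C * (norm (u t) * exp (- (B * \<bar>t\<bar>))))"
      using le by (intro AE_I2) (metis abs_ge_self order_trans real_norm_def)
  qed measurable
  have "norm (LINT t|lebesgue. u t * k t) \<le> (LINT t|lebesgue. norm (u t * k t))" by (rule integral_norm_bound)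
  also have "\<dots> \<le> (LINT t|lebesgue. C * (norm (u t) * exp (- (B * \<bar>t\<bar>))))"
    by (intro integral_mono integrable_norm 1 integrable_mult_right u_int le)
  also have "\<dots> = C * W" unfolding W_def by simp
  finally show "norm (LINT t|lebesgue. u t * k t) \<le> C * W" .
qed

text \<open>The bound is asked only where \<open>u\<close> is nonzero, so that for a one-sided
  \<open>u\<close> the function may grow on the other side. Uniformity for \<open>y\<close> in
  bounded sets is what dominated convergence in \<open>y\<close> uses.\<close>

definition admissible :: "(real \<Rightarrow> complex) \<Rightarrow> bool" where
  "admissible g \<longleftrightarrow> smooth g \<and> (\<forall>n R. \<exists>C. \<forall>t y. u t \<noteq> 0 \<longrightarrow> \<bar>y\<bar> \<le> R \<longrightarrow>
     norm (iter_deriv n g (t + y)) \<le> C * exp (- (B * \<bar>t\<bar>)))"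

lemma admissible_integrable:
  assumes "admissible g"
  shows "integrable lebesgue (\<lambda>t. u t * iter_deriv n g (t + y))"
proof -
  obtain C where "\<And>t. u t \<noteq> 0 \<Longrightarrow> norm (iter_deriv n g (t + y)) \<le> C * exp (- (B * \<bar>t\<bar>))"
    using assms unfolding admissible_def by (meson order_refl)
  then show ?thesis
    using assms by (intro integrable_weighted smooth_lebesgue_measurable_shift) (auto simp: admissible_def)
qed

lemma correlation_has_vector_derivative:
  assumes g: "admissible g"
  shows "(correlation u (iter_deriv n g) has_vector_derivative correlation u (iter_deriv (Suc n) g) y) (at y)"
proof (rule has_vector_derivativeI_quotient)
  have sm: "smooth g" using g by (simp add: admissible_def)
  \<comment> \<open>The margin 1 covers all points between \<open>t + y\<close> and
    \<open>t + (y + h)\<close> for increments below 1.\<close>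
  obtain C where C: "\<And>t z. u t \<noteq> 0 \<Longrightarrow> \<bar>z\<bar> \<le> \<bar>y\<bar> + 1 \<Longrightarrow>
      norm (iter_deriv (Suc n) g (t + z)) \<le> C * exp (- (B * \<bar>t\<bar>))"
    using g unfolding admissible_def by meson
  have [measurable]: "(\<lambda>t. iter_deriv n g (t + z)) \<in> borel_measurable lebesgue" for n z
    by (rule smooth_lebesgue_measurable_shift[OF sm])
  let ?q = "\<lambda>h t. (u t * iter_deriv n g (t + (y + h)) - u t * iter_deriv n g (t + y)) /\<^sub>R h"
  have "((\<lambda>h. LINT t|lebesgue. ?q h t) \<longlongrightarrow> (LINT t|lebesgue. u t * iter_deriv (Suc n) g (t + y))) (at 0)"
  proof (rule integral_dominated_convergence_at[where d = 1 and b = "\<lambda>t. C * (norm (u t) * exp (- (B * \<bar>t\<bar>)))"])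
    fix h t :: real assume h: "h \<noteq> 0" "dist h 0 < 1"
    show "norm (?q h t) \<le> C * (norm (u t) * exp (- (B * \<bar>t\<bar>)))"
    proof (cases "u t = 0")
      case False
      have "norm (iter_deriv n g (t + (y + h)) - iter_deriv n g (t + y)) \<le> (C * exp (- (B * \<bar>t\<bar>))) * \<bar>t + (y + h) - (t + y)\<bar>"
      proof (rule vector_mvt_bound[OF smooth_has_vector_derivative[OF sm]])
        fix x assume "x \<in> closed_segment (t + y) (t + (y + h))"
        then have "\<bar>x - t\<bar> \<le> \<bar>y\<bar> + 1" using h by (auto simp: closed_segment_eq_real_ivl split: if_splits)
        from C[OF False this] show "norm (iter_deriv (Suc n) g x) \<le> C * exp (- (B * \<bar>t\<bar>))" by simp
      qed
      from mult_left_mono[OF this, of "norm (u t) / \<bar>h\<bar>"]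
      have "norm (u t) / \<bar>h\<bar> * norm (iter_deriv n g (t + (y + h)) - iter_deriv n g (t + y))
          \<le> C * (norm (u t) * exp (- (B * \<bar>t\<bar>)))"
        using h by (simp add: mult.left_commute)
      then show ?thesis
        by (simp add: norm_mult right_diff_distrib[symmetric] divide_inverse mult_ac)
    qed simp
  next
    fix t
    have "((\<lambda>z. u t * iter_deriv n g (t + z)) has_vector_derivative u t * iter_deriv (Suc n) g (t + y)) (at y)"
    proof (rule has_vector_derivative_mult_right)
      have "((\<lambda>z. t + z) has_vector_derivative 1) (at y)" by (auto intro!: derivative_eq_intros)
      from vector_diff_chain_at[OF this smooth_has_vector_derivative[OF sm]]
      show "((\<lambda>z. iter_deriv n g (t + z)) has_vector_derivative iter_deriv (Suc n) g (t + y)) (at y)"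
        by (simp add: o_def)
    qed
    then have "((\<lambda>h. norm (u t * iter_deriv n g (t + (y + h)) - u t * iter_deriv n g (t + y)
        - h *\<^sub>R (u t * iter_deriv (Suc n) g (t + y))) / norm h) \<longlongrightarrow> 0) (at 0)"
      unfolding has_vector_derivative_def has_derivative_at by simp
    then have "((\<lambda>h. norm (?q h t - u t * iter_deriv (Suc n) g (t + y))) \<longlongrightarrow> 0) (at 0)"
    proof (rule Lim_transform_eventually)
      show "\<forall>\<^sub>F h in at 0. norm (u t * iter_deriv n g (t + (y + h)) - u t * iter_deriv n g (t + y)
        - h *\<^sub>R (u t * iter_deriv (Suc n) g (t + y))) / norm h = norm (?q h t - u t * iter_deriv (Suc n) g (t + y))"
        unfolding eventually_at_filter
      proof (intro always_eventually allI impI)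
        fix h :: real assume "h \<noteq> 0"
        then have "?q h t - u t * iter_deriv (Suc n) g (t + y) = (u t * iter_deriv n g (t + (y + h)) - u t * iter_deriv n g (t + y)
          - h *\<^sub>R (u t * iter_deriv (Suc n) g (t + y))) /\<^sub>R h" by (simp add: scaleR_diff_right)
        then show "norm (u t * iter_deriv n g (t + (y + h)) - u t * iter_deriv n g (t + y)
          - h *\<^sub>R (u t * iter_deriv (Suc n) g (t + y))) / norm h = norm (?q h t - u t * iter_deriv (Suc n) g (t + y))"
          by (simp add: divide_inverse_commute)
      qed
    qed
    then show "((\<lambda>h. ?q h t) \<longlongrightarrow> u t * iter_deriv (Suc n) g (t + y)) (at 0)"
      by (simp add: tendsto_norm_zero_iff LIM_zero_iff)
  next
    show "integrable lebesgue (\<lambda>t. C * (norm (u t) * exp (- (B * \<bar>t\<bar>))))"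
      by (intro integrable_mult_right u_int)
  qed measurable
  note lim = this
  have eq: "(LINT t|lebesgue. ?q h t) = (correlation u (iter_deriv n g) (y + h) - correlation u (iter_deriv n g) y) /\<^sub>R h" for h
    unfolding correlation_def using admissible_integrable[OF g, of n] by simp
  show "((\<lambda>h. (correlation u (iter_deriv n g) (y + h) - correlation u (iter_deriv n g) y) /\<^sub>R h)
      \<longlongrightarrow> correlation u (iter_deriv (Suc n) g) y) (at 0)"
    using lim unfolding eq by (simp only: correlation_def)
qed

lemma
  assumes "admissible g"
  shows smooth_correlation: "smooth (correlation u g)"
    and iter_deriv_correlation: "iter_deriv n (correlation u g) = correlation u (iter_deriv n g)"
  using smoothI[of "\<lambda>n. correlation u (iter_deriv n g)", OF correlation_has_vector_derivative[OF assms]]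
    iter_deriv_eqI[of "\<lambda>n. correlation u (iter_deriv n g)", OF correlation_has_vector_derivative[OF assms]]
  by simp_all

lemma correlation_diff:
  assumes "admissible f" "admissible g"
  shows "correlation u (\<lambda>x. f x - g x) = (\<lambda>y. correlation u f y - correlation u g y)"
  using admissible_integrable[OF assms(1), of 0] admissible_integrable[OF assms(2), of 0]
  by (simp add: correlation_def fun_eq_iff right_diff_distrib)

lemma correlation_lincomb:
  assumes "admissible f" "admissible g"
  shows "correlation u (\<lambda>x. a * f x + b * g x) = (\<lambda>y. a * correlation u f y + b * correlation u g y)"
proof
  fix y
  have i: "integrable lebesgue (\<lambda>t. u t * f (t + y))" "integrable lebesgue (\<lambda>t. u t * g (t + y))"
    using admissible_integrable[OF assms(1), of 0] admissible_integrable[OF assms(2), of 0] by simp_all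
  have "correlation u (\<lambda>x. a * f x + b * g x) y = (LINT t|lebesgue. a * (u t * f (t + y)) + b * (u t * g (t + y)))"
    unfolding correlation_def by (intro Bochner_Integration.integral_cong) (auto simp: algebra_simps)
  also have "\<dots> = a * correlation u f y + b * correlation u g y"
    unfolding correlation_def using i by simp
  finally show "correlation u (\<lambda>x. a * f x + b * g x) y = a * correlation u f y + b * correlation u g y" .
qed

lemma admissibleI:
  assumes "smooth g"
    and "\<And>n. \<exists>C. \<forall>t y. u t \<noteq> 0 \<longrightarrow> norm (iter_deriv n g (t + y)) \<le> C * exp (- (B * \<bar>t\<bar>)) * exp (real m * \<bar>y\<bar>)"
  shows "admissible g"
  unfolding admissible_def
proof (intro conjI allI assms(1))
  fix n R
  obtain C where C: "\<And>t y. u t \<noteq> 0 \<Longrightarrow> norm (iter_deriv n g (t + y)) \<le> C * exp (- (B * \<bar>t\<bar>)) * exp (real m * \<bar>y\<bar>)"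
    using assms(2) by blast
  have "norm (iter_deriv n g (t + y)) \<le> (\<bar>C\<bar> * exp (real m * R)) * exp (- (B * \<bar>t\<bar>))"
    if "u t \<noteq> 0" "\<bar>y\<bar> \<le> R" for t y
  proof -
    have "C * exp (- (B * \<bar>t\<bar>)) * exp (real m * \<bar>y\<bar>) \<le> \<bar>C\<bar> * exp (- (B * \<bar>t\<bar>)) * exp (real m * R)"
      using that by (intro mult_mono mult_right_mono) (auto intro: mult_left_mono)
    from order_trans[OF C[OF that(1), of y] this] show ?thesis by (simp only: mult_ac)
  qed
  then show "\<exists>C. \<forall>t y. u t \<noteq> 0 \<longrightarrow> \<bar>y\<bar> \<le> R \<longrightarrow> norm (iter_deriv n g (t + y)) \<le> C * exp (- (B * \<bar>t\<bar>))"
    by blast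
qed

lemma correlation_bound:
  assumes g: "admissible g"
    and "\<And>t y. u t \<noteq> 0 \<Longrightarrow> norm (iter_deriv n g (t + y)) \<le> C * exp (- (B * \<bar>t\<bar>)) * exp (real m * \<bar>y\<bar>)"
  shows "norm (iter_deriv n (correlation u g) y) \<le> C * W * exp (real m * \<bar>y\<bar>)"
proof -
  have "norm (correlation u (iter_deriv n g) y) \<le> (C * exp (real m * \<bar>y\<bar>)) * W"
    unfolding correlation_def
    using g assms(2)[of _ y] by (intro integrable_weighted smooth_lebesgue_measurable_shift) (auto simp: admissible_def mult_ac)
  then show ?thesis by (simp add: iter_deriv_correlation[OF g] mult_ac)
qed

end

section \<open>Smooth cutoff functions\<close>

text \<open>A class of functions closed under differentiation and containing \<open>exp (- 1 / x)\<close>.\<close>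

definition exp_poly :: "real poly \<Rightarrow> real \<Rightarrow> real" where
  "exp_poly p x = (if x > 0 then poly p (1 / x) * exp (- (1 / x)) else 0)"

lemma poly_times_exp_tendsto_0: "((\<lambda>y::real. poly p y * exp (- y)) \<longlongrightarrow> 0) at_top"
proof -
  have "((\<lambda>y::real. \<Sum>i\<le>degree p. coeff p i * (y ^ i * exp (- y))) \<longlongrightarrow> (\<Sum>i\<le>degree p. coeff p i * 0)) at_top"
  proof (intro tendsto_sum tendsto_mult tendsto_const)
    fix i show "((\<lambda>y::real. y ^ i * exp (- y)) \<longlongrightarrow> 0) at_top"
      using tendsto_power_div_exp_0[of i] by (simp add: exp_minus divide_inverse)
  qed
  then show ?thesis by (simp add: poly_altdef sum_distrib_right mult.assoc)
qed

text \<open>With \<open>y = 1 / x\<close> the chain rule gives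
  \<open>y\<^sup>2 * (p y - p' y) * exp (- y)\<close>, whence the polynomial. At 0 the right
  difference quotient is \<open>y * p y * exp (- y)\<close>, which tends to 0.\<close>

lemma exp_poly_deriv:
  "(exp_poly p has_field_derivative exp_poly ([:0, 0, 1:] * (p - pderiv p)) x) (at x)"
proof -
  consider "x > 0" | "x < 0" | "x = 0" by linarith
  then show ?thesis
  proof cases
    case 1
    have "((\<lambda>x. poly p (1 / x) * exp (- (1 / x))) has_field_derivative
        (poly (pderiv p) (1 / x) * (- 1 / x ^ 2)) * exp (- (1 / x)) + poly p (1 / x) * (exp (- (1 / x)) * (1 / x ^ 2))) (at x)"
      using 1 by (auto intro!: derivative_eq_intros simp: power2_eq_square)
    moreover have "(poly (pderiv p) (1 / x) * (- 1 / x ^ 2)) * exp (- (1 / x)) + poly p (1 / x) * (exp (- (1 / x)) * (1 / x ^ 2))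
        = exp_poly ([:0, 0, 1:] * (p - pderiv p)) x"
      using 1 by (simp add: exp_poly_def power2_eq_square field_simps)
    ultimately show ?thesis
      by (rule_tac has_field_derivative_transform_within_open[where S = "{0<..}"]) (use 1 in \<open>auto simp: exp_poly_def\<close>)
  next
    case 2
    have "((\<lambda>x. 0) has_field_derivative 0) (at x)" by simp
    then show ?thesis
      by (rule_tac has_field_derivative_transform_within_open[where S = "{..<0}"]) (use 2 in \<open>auto simp: exp_poly_def\<close>)
  next
    case 3
    have "((\<lambda>h. (exp_poly p h - exp_poly p 0) / (h - 0)) \<longlongrightarrow> 0) (at 0)"
    proof (rule filterlim_split_at)
      show "((\<lambda>h. (exp_poly p h - exp_poly p 0) / (h - 0)) \<longlongrightarrow> 0) (at_left 0)"
        by (rule tendsto_eventually) (auto simp: exp_poly_def eventually_at_filter)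
      have "((\<lambda>h. poly ([:0, 1:] * p) (inverse h) * exp (- inverse h)) \<longlongrightarrow> 0) (at_right (0::real))"
        by (rule filterlim_compose[OF poly_times_exp_tendsto_0 filterlim_inverse_at_top_right])
      then show "((\<lambda>h. (exp_poly p h - exp_poly p 0) / (h - 0)) \<longlongrightarrow> 0) (at_right 0)"
        by (rule Lim_transform_eventually) (auto simp: exp_poly_def eventually_at_filter divide_inverse mult_ac)
    qed
    then show ?thesis using 3 by (simp add: has_field_derivative_iff exp_poly_def)
  qed
qed

definition bump0 :: "real \<Rightarrow> complex" where
  "bump0 x = complex_of_real (exp_poly 1 x)"

lemma smooth_bump0: "smooth bump0"
proof -
  define P where "P n = ((\<lambda>p. [:0, 0, 1:] * (p - pderiv p)) ^^ n) (1 :: real poly)" for n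
  have "((\<lambda>x. complex_of_real (exp_poly (P n) x)) has_vector_derivative complex_of_real (exp_poly (P (Suc n)) x)) (at x)" for n x
    by (intro has_vector_derivative_of_real)
      (use exp_poly_deriv[of "P n" x] in \<open>simp add: P_def has_real_derivative_iff_has_vector_derivative\<close>)
  from smoothI[of "\<lambda>n x. complex_of_real (exp_poly (P n) x)", OF this]
  show ?thesis by (simp add: P_def bump0_def[abs_def])
qed

definition bump_real :: "real \<Rightarrow> real" where
  "bump_real x = exp_poly 1 x * exp_poly 1 (1 - x)"

lemma bump_real_pos: "0 < x \<Longrightarrow> x < 1 \<Longrightarrow> bump_real x > 0"
  and bump_real_zero: "x \<le> 0 \<or> x \<ge> 1 \<Longrightarrow> bump_real x = 0"
  by (auto simp: bump_real_def exp_poly_def)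

lemma smooth_bump: "smooth (\<lambda>x. complex_of_real (bump_real x))"
proof -
  have "smooth (\<lambda>x. bump0 x * bump0 ((-1) * x + 1))"
    by (intro smooth_mult smooth_affine smooth_bump0)
  then show ?thesis by (simp add: bump0_def bump_real_def)
qed

lemma bump_bounded: "\<exists>C. \<forall>x. norm (iter_deriv n (\<lambda>x. complex_of_real (bump_real x)) x) \<le> C"
proof -
  let ?b = "\<lambda>x. complex_of_real (bump_real x)"
  have "compact (iter_deriv n ?b ` {0..1})"
    by (intro compact_continuous_image smooth_continuous_on smooth_bump) auto
  from compact_imp_bounded[OF this]
  obtain C where C: "\<And>x. x \<in> {0..1} \<Longrightarrow> norm (iter_deriv n ?b x) \<le> C"
    unfolding bounded_iff by blast
  have "iter_deriv n ?b x = 0" if "x \<notin> {0..1}" for x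
    by (rule iter_deriv_zero_outside[OF _ _ that]) (auto simp: bump_real_zero)
  then have "norm (iter_deriv n ?b x) \<le> max C 0" for x
    using C[of x] by (cases "x \<in> {0..1}") auto
  then show ?thesis by blast
qed

lemma smooth_step_exists:
  "\<exists>\<theta>. smooth \<theta> \<and> (\<forall>x\<le>0. \<theta> x = 0) \<and> (\<forall>x\<ge>1. \<theta> x = 1) \<and> (\<forall>n. \<exists>C. \<forall>x. norm (iter_deriv n \<theta> x) \<le> C)"
proof -
  \<comment> \<open>The primitive starts at -1, left of the support of the bump, so that every
    \<open>x \<ge> 0\<close> is an interior point of \<open>{-1..x+1}\<close>.\<close>
  define F where "F x = integral {-1..x} bump_real" for x
  have cont: "continuous_on A bump_real" for A
  proof -
    have "exp_poly 1 differentiable (at x)" for x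
      using exp_poly_deriv by (auto simp: real_differentiable_def)
    then have c: "continuous_on A (exp_poly 1)" for A
      by (meson continuous_at_imp_continuous_on differentiable_imp_continuous_within)
    show ?thesis
      unfolding bump_real_def by (intro continuous_intros c continuous_on_compose2[OF c[of UNIV]]) auto
  qed
  have F0: "F x = 0" if "x \<le> 0" for x
    unfolding F_def using that by (subst integral_cong[where g = "\<lambda>_. 0"]) (auto simp: bump_real_zero)
  have F': "(F has_field_derivative bump_real x) (at x)" for x
  proof (cases "x < 0")
    case True
    have "((\<lambda>x. 0) has_field_derivative bump_real x) (at x)" using True by (simp add: bump_real_zero)
    then show ?thesis
      by (rule has_field_derivative_transform_within_open[where S = "{..<0}"]) (use True F0 in auto)
  next
    case False
    have "((\<lambda>u. integral {-1..u} bump_real) has_vector_derivative bump_real x) (at x within {-1..x+1})"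
      by (intro integral_has_vector_derivative cont) (use False in auto)
    moreover have "at x within {-1..x+1} = at x"
      using False by (intro at_within_interior) auto
    ultimately show ?thesis by (simp add: F_def[abs_def] has_real_derivative_iff_has_vector_derivative)
  qed
  obtain \<xi> where "0 < \<xi>" "\<xi> < 1" "F 1 - F 0 = (1 - 0) * bump_real \<xi>"
    using MVT2[of 0 1 F bump_real] F' by auto
  then have F1: "F 1 > 0" using bump_real_pos F0[of 0] by simp
  have F1': "F x = F 1" if "x \<ge> 1" for x
  proof (cases "x = 1")
    case False
    then have "1 < x" using that by simp
    from MVT2[OF this F'] obtain z where "1 < z" "F x - F 1 = (x - 1) * bump_real z" by blast
    then show ?thesis by (simp add: bump_real_zero)
  qed simp
  \<comment> \<open>Beyond order 0 the derivatives of the step are those of the bump divided by its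
    mass \<open>F 1\<close>, hence bounded.\<close>
  define d where "d n = (case n of 0 \<Rightarrow> (\<lambda>x. complex_of_real (F x / F 1))
     | Suc k \<Rightarrow> (\<lambda>x. inverse (complex_of_real (F 1)) * iter_deriv k (\<lambda>x. complex_of_real (bump_real x)) x))" for n
  have d: "(d n has_vector_derivative d (Suc n) x) (at x)" for n x
  proof (cases n)
    case 0
    from has_vector_derivative_of_real[OF DERIV_cdivide[OF F'], where 'a = complex]
    show ?thesis by (simp add: 0 d_def field_simps)
  next
    case (Suc k)
    then show ?thesis
      unfolding d_def by (auto intro!: has_vector_derivative_mult_right smooth_has_vector_derivative smooth_bump)
  qed
  have "\<exists>C. \<forall>x. norm (d n x) \<le> C" for n
  proof (cases n)
    case 0
    have "norm (F x / F 1) \<le> 1" for x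
    proof -
      have mono: "F x \<le> F y" if "x \<le> y" for x y
        using that F' bump_real_pos bump_real_zero
        by (intro DERIV_nonneg_imp_nondecreasing[of x y F]) (metis less_eq_real_def linorder_le_less_linear)+
      show ?thesis using mono[of 0 x] mono[of x 0] mono[of x 1] mono[of 1 x] F0[of 0] F0[of x] F1 F1'[of x]
        by (cases "x \<le> 0"; cases "x \<ge> 1") auto
    qed
    then show ?thesis by (auto simp: 0 d_def norm_divide intro!: exI[of _ 1])
  next
    case (Suc k)
    obtain C where "\<And>x. norm (iter_deriv k (\<lambda>x. complex_of_real (bump_real x)) x) \<le> C"
      using bump_bounded by blast
    then have "norm (d n x) \<le> norm (inverse (complex_of_real (F 1))) * C" for x
      by (simp add: Suc d_def norm_mult mult_left_mono)
    then show ?thesis by blast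
  qed
  note bd = this
  show ?thesis
  proof (intro exI[of _ "d 0"] conjI allI impI)
    show "smooth (d 0)" by (rule smoothI) (rule d)
    show "d 0 x = 0" if "x \<le> 0" for x using F0[OF that] by (simp add: d_def)
    show "d 0 x = 1" if "x \<ge> 1" for x using F1'[OF that] F1 by (simp add: d_def)
    show "\<exists>C. \<forall>x. norm (iter_deriv n (d 0) x) \<le> C" for n
      using bd[of n] iter_deriv_eqI[of d n, OF d] by simp
  qed
qed

definition smooth_step :: "real \<Rightarrow> complex" where
  "smooth_step = (SOME \<theta>. smooth \<theta> \<and> (\<forall>x\<le>0. \<theta> x = 0) \<and> (\<forall>x\<ge>1. \<theta> x = 1) \<and>
     (\<forall>n. \<exists>C. \<forall>x. norm (iter_deriv n \<theta> x) \<le> C))"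

lemma smooth_step:
  "smooth smooth_step" "x \<le> 0 \<Longrightarrow> smooth_step x = 0" "x \<ge> 1 \<Longrightarrow> smooth_step x = 1"
  "\<exists>C. \<forall>x. norm (iter_deriv n smooth_step x) \<le> C"
  using someI_ex[OF smooth_step_exists] unfolding smooth_step_def[symmetric] by blast+

lemma iter_deriv_mult_bound:
  assumes "smooth f" "smooth g"
    and A: "\<And>j. j \<le> n \<Longrightarrow> norm (iter_deriv j f x) \<le> A j"
    and B: "\<And>j. j \<le> n \<Longrightarrow> norm (iter_deriv j g x) \<le> B j * w"
  shows "norm (iter_deriv n (\<lambda>x. f x * g x) x) \<le> (\<Sum>j\<le>n. real (n choose j) * A j * B (n - j)) * w"
proof -
  have "norm (iter_deriv n (\<lambda>x. f x * g x) x) \<le> (\<Sum>j\<le>n. real (n choose j) * (A j * (B (n - j) * w)))"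
    unfolding iter_deriv_mult[OF assms(1,2)]
  proof (rule sum_norm_le)
    fix j assume "j \<in> {..n}"
    then have "norm (iter_deriv j f x) * norm (iter_deriv (n - j) g x) \<le> A j * (B (n - j) * w)"
      by (intro mult_mono A B) (auto intro: order_trans[OF norm_ge_zero A])
    then show "norm (of_nat (n choose j) * (iter_deriv j f x * iter_deriv (n - j) g x))
        \<le> real (n choose j) * (A j * (B (n - j) * w))"
      by (simp add: norm_mult mult_left_mono)
  qed
  also have "\<dots> = (\<Sum>j\<le>n. real (n choose j) * A j * B (n - j)) * w"
    by (simp add: sum_distrib_right mult.assoc)
  finally show ?thesis .
qed

section \<open>Cutoffs and the density of test functions\<close>

definition cutoff :: "nat \<Rightarrow> real \<Rightarrow> complex" where
  "cutoff N x = smooth_step (x + (real N + 1)) * smooth_step ((-1) * x + (real N + 1))"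

lemma smooth_cutoff: "smooth (cutoff N)"
  unfolding cutoff_def[abs_def]
  using smooth_affine[OF smooth_step(1), of 1 "real N + 1"] smooth_affine[OF smooth_step(1), of "-1" "real N + 1"]
  by (intro smooth_mult) simp_all

lemma cutoff_eq_1: "\<bar>x\<bar> \<le> real N \<Longrightarrow> cutoff N x = 1"
  and cutoff_eq_0: "\<bar>x\<bar> \<ge> real N + 1 \<Longrightarrow> cutoff N x = 0"
  by (auto simp: cutoff_def smooth_step abs_le_iff) (auto simp: abs_if smooth_step split: if_splits)

text \<open>Uniform in \<open>N\<close> because the two factors are translates of one fixed step and
  of its reflection.\<close>

lemma cutoff_bounded: "\<exists>C. \<forall>N x. norm (iter_deriv n (cutoff N) x) \<le> C"
proof -
  obtain A where A: "\<And>n x. norm (iter_deriv n smooth_step x) \<le> A n" using smooth_step(4) by metis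
  have "norm (iter_deriv n (cutoff N) x) \<le> (\<Sum>j\<le>n. real (n choose j) * A j * A (n - j)) * 1" for N x
    unfolding cutoff_def[abs_def]
  proof (rule iter_deriv_mult_bound)
    show "smooth (\<lambda>x. smooth_step (x + (real N + 1)))" "smooth (\<lambda>x. smooth_step (- 1 * x + (real N + 1)))"
      using smooth_affine[OF smooth_step(1), of 1 "real N + 1"] smooth_affine[OF smooth_step(1), of "-1" "real N + 1"]
      by simp_all
    show "norm (iter_deriv j (\<lambda>x. smooth_step (x + (real N + 1))) x) \<le> A j" for j
      using iter_deriv_affine[OF smooth_step(1), of j 1 "real N + 1"] A by simp
    show "norm (iter_deriv j (\<lambda>x. smooth_step (- 1 * x + (real N + 1))) x) \<le> A j * 1" for j
      using iter_deriv_affine[OF smooth_step(1), of j "-1" "real N + 1"] A by (simp add: norm_mult norm_power)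
  qed
  then show ?thesis by blast
qed

lemma smooth_1: "smooth (\<lambda>_. 1)" and iter_deriv_const_1: "iter_deriv n (\<lambda>_. 1) = (\<lambda>_. if n = 0 then 1 else 0)"
  using smooth_exp[of 0] iter_deriv_exp[of n 0] by (auto simp: power_0_left)

lemma smooth_cutoff_mult: "smooth g \<Longrightarrow> smooth (\<lambda>x. cutoff N x * g x)"
  by (intro smooth_mult smooth_cutoff)

text \<open>The remainder vanishes for \<open>\<bar>x\<bar> < N\<close>, and elsewhere
  \<open>1 \<le> exp (\<bar>x\<bar> - N)\<close>: one unit of exponent buys the factor
  \<open>exp (- N)\<close>. For decaying \<open>g\<close> the rate \<open>\<kappa>\<close> is
  negative.\<close>

lemma cutoff_remainder_bound:
  assumes g: "smooth g" and bound: "\<And>n. \<exists>C. \<forall>x. norm (iter_deriv n g x) \<le> C * exp (\<kappa> * \<bar>x\<bar>)"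
  shows "\<exists>C. \<forall>N x. norm (iter_deriv n (\<lambda>x. g x - cutoff N x * g x) x) \<le> C * exp (- real N) * exp ((\<kappa> + 1) * \<bar>x\<bar>)"
proof -
  obtain B where B: "\<And>n x. norm (iter_deriv n g x) \<le> B n * exp (\<kappa> * \<bar>x\<bar>)" using bound by metis
  obtain A where A: "\<And>n N x. norm (iter_deriv n (cutoff N) x) \<le> A n" using cutoff_bounded by metis
  have eq: "(\<lambda>x. g x - cutoff N x * g x) = (\<lambda>x. (1 - cutoff N x) * g x)" for N
    by (simp add: fun_eq_iff algebra_simps)
  have A': "norm (iter_deriv n (\<lambda>x. 1 - cutoff N x) x) \<le> 1 + A n" for n N x
    unfolding iter_deriv_diff[OF smooth_1 smooth_cutoff] iter_deriv_const_1
    by (rule order_trans[OF norm_triangle_ineq4], rule add_mono[OF _ A]) simp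
  define C where "C = (\<Sum>j\<le>n. real (n choose j) * (1 + A j) * B (n - j))"
  have le: "norm (iter_deriv n (\<lambda>x. g x - cutoff N x * g x) x) \<le> C * exp (\<kappa> * \<bar>x\<bar>)" for N x
    unfolding eq C_def
    by (intro iter_deriv_mult_bound g smooth_diff smooth_1 smooth_cutoff A' B)
  have C0: "C \<ge> 0" using order_trans[OF norm_ge_zero le[of 0 0]] by simp
  have "norm (iter_deriv n (\<lambda>x. g x - cutoff N x * g x) x) \<le> C * exp (- real N) * exp ((\<kappa> + 1) * \<bar>x\<bar>)" for N x
  proof (cases "\<bar>x\<bar> < real N")
    case True
    have "iter_deriv n (\<lambda>x. g x - cutoff N x * g x) x = iter_deriv n (\<lambda>_. 0) x"
      by (rule iter_deriv_cong_open[of "{- real N<..<real N}"]) (use True in \<open>auto simp: cutoff_eq_1\<close>)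
    then show ?thesis using C0 by (simp add: iter_deriv_const_0)
  next
    case False
    have "norm (iter_deriv n (\<lambda>x. g x - cutoff N x * g x) x) \<le> C * exp (\<kappa> * \<bar>x\<bar>)" by (rule le)
    also have "\<dots> \<le> C * (exp (- real N) * exp ((\<kappa> + 1) * \<bar>x\<bar>))"
      using False C0 by (intro mult_left_mono) (auto simp: mult_exp_exp algebra_simps)
    finally show ?thesis by (simp add: mult.assoc)
  qed
  then show ?thesis by blast
qed

lemma test_function_bounded:
  assumes "g \<in> test_functions"
  shows "smooth g" "\<exists>C. \<forall>x. norm (iter_deriv n g x) \<le> C * exp (- (\<kappa> * \<bar>x\<bar>))"
proof -
  show sm: "smooth g" using assms by (simp add: test_functions_def)
  obtain K where K: "compact K" "\<And>x. x \<notin> K \<Longrightarrow> g x = 0" using assms by (auto simp: test_functions_def)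
  have "compact ((\<lambda>x. iter_deriv n g x * exp (\<kappa> * \<bar>x\<bar>)) ` K)"
    by (intro compact_continuous_image continuous_intros smooth_continuous_on sm K)
  from compact_imp_bounded[OF this]
  obtain C where C: "\<And>x. x \<in> K \<Longrightarrow> norm (iter_deriv n g x * exp (\<kappa> * \<bar>x\<bar>)) \<le> C"
    unfolding bounded_iff by (auto simp: norm_mult)
  have "iter_deriv n g x = 0" if "x \<notin> K" for x
    by (rule iter_deriv_zero_outside[OF compact_imp_closed[OF K(1)] K(2) that])
  then have "norm (iter_deriv n g x) * exp (\<kappa> * \<bar>x\<bar>) \<le> max C 0" for x
    using C[of x] by (cases "x \<in> K") (auto simp: norm_mult)
  then have "norm (iter_deriv n g x) \<le> max C 0 * exp (- (\<kappa> * \<bar>x\<bar>))" for x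
    by (simp add: exp_minus field_simps)
  then show "\<exists>C. \<forall>x. norm (iter_deriv n g x) \<le> C * exp (- (\<kappa> * \<bar>x\<bar>))" by blast
qed

lemma cutoff_test_function: "smooth g \<Longrightarrow> (\<lambda>x. cutoff N x * g x) \<in> test_functions"
  unfolding test_functions_def
  by (auto intro!: smooth_cutoff_mult exI[of _ "{- (real N + 1)..real N + 1}"] cutoff_eq_0)

lemma test_functions_subset_exp_space: "test_functions \<subseteq> exp_space 0"
proof
  fix g assume g: "g \<in> test_functions"
  show "g \<in> exp_space 0"
    unfolding exp_space_def using test_function_bounded(1)[OF g] test_function_bounded(2)[OF g, of _ 0] by simp
qed

lemma test_functions_subset: "test_functions \<subseteq> topspace Cexp_top"
  using test_functions_subset_exp_space by (auto simp: topspace_Cexp_top)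

lemma (in exp_functional) tendsto_0_family:
  assumes "\<And>N::nat. smooth (g N)"
    and "\<And>n. \<exists>C. \<forall>N x. norm (iter_deriv n (g N) x) \<le> C * exp (- real N) * exp (real m * \<bar>x\<bar>)"
  shows "(\<lambda>N. \<Phi> (g N)) \<longlonglongrightarrow> 0"
proof -
  obtain C where C: "C \<ge> 0" "\<And>N. N \<in> UNIV \<Longrightarrow> norm (\<Phi> (g N)) \<le> C * exp (- real N)"
    by (rule bounded_family[of UNIV g "\<lambda>N. exp (- real N)" m]) (use assms in auto)
  have "(\<lambda>N. exp (- real N)) \<longlonglongrightarrow> 0" by real_asymp
  from tendsto_mult_left[OF this, of C] have "(\<lambda>N. C * exp (- real N)) \<longlonglongrightarrow> 0" by simp
  then show ?thesis
    by (rule Lim_null_comparison[rotated]) (intro always_eventually allI C(2) UNIV_I)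
qed

text \<open>Density of the test functions. The unit of exponent lost to the cutoff leads from step
  \<open>m\<close> to step \<open>Suc m\<close>, which the inductive limit permits.\<close>

lemma (in exp_functional) cutoff_tendsto:
  assumes "g \<in> topspace Cexp_top"
  shows "(\<lambda>N. \<Phi> (\<lambda>x. cutoff N x * g x)) \<longlonglongrightarrow> \<Phi> g"
proof -
  obtain m where m: "g \<in> exp_space m" using assms by (auto simp: topspace_Cexp_top)
  have cE: "(\<lambda>x. cutoff N x * g x) \<in> topspace Cexp_top" for N
    using cutoff_test_function[OF exp_spaceD(1)[OF m]] test_functions_subset by blast
  have "(\<lambda>N. \<Phi> (\<lambda>x. g x - cutoff N x * g x)) \<longlonglongrightarrow> 0"
  proof (rule tendsto_0_family[where m = "Suc m"])
    show "smooth (\<lambda>x. g x - cutoff N x * g x)" for N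
      by (intro smooth_diff smooth_cutoff_mult exp_spaceD(1)[OF m])
    show "\<exists>C. \<forall>N x. norm (iter_deriv n (\<lambda>x. g x - cutoff N x * g x) x) \<le> C * exp (- real N) * exp (real (Suc m) * \<bar>x\<bar>)" for n
      using cutoff_remainder_bound[OF exp_spaceD(1)[OF m], of "real m" n] exp_spaceD(2)[OF m]
      by (simp add: add.commute)
  qed
  then have "(\<lambda>N. \<Phi> g - \<Phi> (\<lambda>x. cutoff N x * g x)) \<longlonglongrightarrow> 0" by (simp add: diff[OF assms cE])
  then show ?thesis using tendsto_diff[OF tendsto_const[of "\<Phi> g"], of _ 0] by fastforce
qed

section \<open>Correlations with weighted functions\<close>

context weighted_function
begin

text \<open>Refines \<open>admissible\<close> by an exponential rate in \<open>y\<close>, which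
  becomes the growth rate of the correlation.\<close>

definition dominated :: "nat \<Rightarrow> (real \<Rightarrow> complex) \<Rightarrow> bool" where
  "dominated m g \<longleftrightarrow> smooth g \<and> (\<forall>n. \<exists>C. \<forall>t y. u t \<noteq> 0 \<longrightarrow>
     norm (iter_deriv n g (t + y)) \<le> C * exp (- (B * \<bar>t\<bar>)) * exp (real m * \<bar>y\<bar>))"

lemma dominated_admissible: "dominated m g \<Longrightarrow> admissible g"
  unfolding dominated_def by (intro admissibleI) auto

lemma correlation_in_exp_space:
  assumes "dominated m g"
  shows "correlation u g \<in> exp_space m"
  unfolding exp_space_def
proof (intro CollectI conjI allI)
  show "smooth (correlation u g)" by (intro smooth_correlation dominated_admissible[OF assms])
  fix n
  obtain C where "\<And>t y. u t \<noteq> 0 \<Longrightarrow> norm (iter_deriv n g (t + y)) \<le> C * exp (- (B * \<bar>t\<bar>)) * exp (real m * \<bar>y\<bar>)"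
    using assms unfolding dominated_def by blast
  from correlation_bound[OF dominated_admissible[OF assms] this]
  show "\<exists>C. \<forall>x. norm (iter_deriv n (correlation u g) x) \<le> C * exp (real m * \<bar>x\<bar>)" by blast
qed

lemma correlation_in_Cexp: "dominated m g \<Longrightarrow> correlation u g \<in> topspace Cexp_top"
  using correlation_in_exp_space by (auto simp: topspace_Cexp_top)

text \<open>Where \<open>\<bar>t\<bar> \<le> 1 + \<bar>y\<bar>\<close> one has \<open>l * \<bar>t +
  y\<bar> + B * \<bar>t\<bar> \<le> (B + l) * (1 + \<bar>y\<bar>) + l * \<bar>y\<bar>\<close>: the
  weight in \<open>t\<close> is paid by growth in \<open>y\<close>, at the rate
  \<open>b + 2 * l\<close>.\<close>

lemma shifted_growth_bound:
  assumes le: "\<And>x. norm (k x) \<le> C * exp (real l * \<bar>x\<bar>)" and B: "B = real b"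
    and supp: "k (t + y) \<noteq> 0 \<Longrightarrow> \<bar>t\<bar> \<le> 1 + \<bar>y\<bar>"
  shows "norm (k (t + y)) \<le> C * exp (B + real l) * exp (- (B * \<bar>t\<bar>)) * exp (real (b + 2 * l) * \<bar>y\<bar>)"
proof -
  have C: "C \<ge> 0" using order_trans[OF norm_ge_zero le[of 0]] by simp
  show ?thesis
  proof (cases "k (t + y) = 0")
    case False
    have "real l * \<bar>t + y\<bar> \<le> real l * (\<bar>t\<bar> + \<bar>y\<bar>)" by (intro mult_left_mono abs_triangle_ineq) auto
    moreover have "(B + real l) * \<bar>t\<bar> \<le> (B + real l) * (1 + \<bar>y\<bar>)"
      using supp[OF False] B by (intro mult_left_mono) auto
    ultimately have "real l * \<bar>t + y\<bar> \<le> (B + real l) + - (B * \<bar>t\<bar>) + real (b + 2 * l) * \<bar>y\<bar>"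
      using B by (simp add: algebra_simps)
    then have "exp (real l * \<bar>t + y\<bar>) \<le> exp (B + real l) * exp (- (B * \<bar>t\<bar>)) * exp (real (b + 2 * l) * \<bar>y\<bar>)"
      by (simp only: exp_add[symmetric] exp_le_cancel_iff)
    from mult_left_mono[OF this C] le[of "t + y"] show ?thesis by (simp add: mult.assoc)
  qed (use C in auto)
qed

lemma shifted_decay_bound:
  assumes le: "\<And>x. norm (k x) \<le> C * exp (- (B * \<bar>x\<bar>))" and B: "B = real b"
  shows "norm (k (t + y)) \<le> C * exp (- (B * \<bar>t\<bar>)) * exp (real b * \<bar>y\<bar>)"
proof -
  have C: "C \<ge> 0" using order_trans[OF norm_ge_zero le[of 0]] by simp
  have "B * \<bar>t\<bar> \<le> B * (\<bar>t + y\<bar> + \<bar>y\<bar>)" using B by (intro mult_left_mono) auto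
  then have "exp (- (B * \<bar>t + y\<bar>)) \<le> exp (- (B * \<bar>t\<bar>)) * exp (real b * \<bar>y\<bar>)"
    using B by (simp add: mult_exp_exp algebra_simps)
  from mult_left_mono[OF this C] le[of "t + y"] show ?thesis by (simp add: mult.assoc)
qed

lemma dominated_decay:
  assumes "smooth g" "\<And>n. \<exists>C. \<forall>x. norm (iter_deriv n g x) \<le> C * exp (- (B * \<bar>x\<bar>))" "B = real b"
  shows "dominated b g"
  unfolding dominated_def
proof (intro conjI allI assms(1))
  fix n
  obtain C where "\<And>x. norm (iter_deriv n g x) \<le> C * exp (- (B * \<bar>x\<bar>))" using assms(2) by blast
  from shifted_decay_bound[OF this assms(3)]
  show "\<exists>C. \<forall>t y. u t \<noteq> 0 \<longrightarrow> norm (iter_deriv n g (t + y)) \<le> C * exp (- (B * \<bar>t\<bar>)) * exp (real b * \<bar>y\<bar>)"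
    by blast
qed

lemma dominated_growth:
  assumes "smooth g" "\<And>n. \<exists>C. \<forall>x. norm (iter_deriv n g x) \<le> C * exp (real l * \<bar>x\<bar>)" "B = real b"
    and "\<And>n t y. u t \<noteq> 0 \<Longrightarrow> iter_deriv n g (t + y) \<noteq> 0 \<Longrightarrow> \<bar>t\<bar> \<le> 1 + \<bar>y\<bar>"
  shows "dominated (b + 2 * l) g"
  unfolding dominated_def
proof (intro conjI allI assms(1))
  fix n
  obtain C where C: "\<And>x. norm (iter_deriv n g x) \<le> C * exp (real l * \<bar>x\<bar>)" using assms(2) by blast
  have "norm (iter_deriv n g (t + y)) \<le> C * exp (B + real l) * exp (- (B * \<bar>t\<bar>)) * exp (real (b + 2 * l) * \<bar>y\<bar>)"
    if "u t \<noteq> 0" for t y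
    by (rule shifted_growth_bound[OF C assms(3) assms(4)[OF that]])
  then show "\<exists>C. \<forall>t y. u t \<noteq> 0 \<longrightarrow> norm (iter_deriv n g (t + y)) \<le> C * exp (- (B * \<bar>t\<bar>)) * exp (real (b + 2 * l) * \<bar>y\<bar>)"
    by blast
qed

end

section \<open>Exponentials are total\<close>

abbreviation expo :: "complex \<Rightarrow> real \<Rightarrow> complex" where
  "expo s \<equiv> (\<lambda>t. exp (- (s * complex_of_real t)))"

lemma expo_bound: "norm s \<le> R \<Longrightarrow> norm (iter_deriv n (expo s) x) \<le> R ^ n * exp (R * \<bar>x\<bar>)"
proof -
  assume R: "norm s \<le> R"
  have "- (Re s * x) \<le> R * \<bar>x\<bar>"
    using abs_Re_le_cmod[of s] R abs_mult[of "Re s" x] mult_right_mono[of "\<bar>Re s\<bar>" R "\<bar>x\<bar>"] by linarith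
  moreover have "R \<ge> 0" using order_trans[OF norm_ge_zero R] .
  ultimately show ?thesis
    unfolding iter_deriv_exp using R by (auto simp: norm_mult norm_power intro!: mult_mono power_mono)
qed

lemma expo_bound': "\<exists>m. \<forall>n. \<exists>C. \<forall>s x. norm s \<le> R \<longrightarrow>
   norm (iter_deriv n (expo s) x) \<le> C * exp (real m * \<bar>x\<bar>)"
proof (intro exI[of _ "nat \<lceil>R\<rceil>"] allI)
  fix n
  have "norm (iter_deriv n (expo s) x) \<le> real (nat \<lceil>R\<rceil>) ^ n * exp (real (nat \<lceil>R\<rceil>) * \<bar>x\<bar>)" if "norm s \<le> R" for s x
    using that by (intro expo_bound) linarith
  then show "\<exists>C. \<forall>s x. norm s \<le> R \<longrightarrow> norm (iter_deriv n (expo s) x) \<le> C * exp (real (nat \<lceil>R\<rceil>) * \<bar>x\<bar>)"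
    by blast
qed

lemma expo_in_Cexp: "expo s \<in> topspace Cexp_top"
proof -
  obtain m where "\<And>n. \<exists>C. \<forall>z x. norm z \<le> norm s \<longrightarrow> norm (iter_deriv n (expo z) x) \<le> C * exp (real m * \<bar>x\<bar>)"
    using expo_bound' by metis
  then have "expo s \<in> exp_space m" unfolding exp_space_def using smooth_exp by (blast intro: order_refl)
  then show ?thesis by (auto simp: topspace_Cexp_top)
qed

lemma (in exp_functional) laplace_functional_entire: "Laplace_functional \<Phi> holomorphic_on UNIV"
proof -
  have "(\<lambda>s. \<Phi> (expo s)) holomorphic_on UNIV"
    by (intro holomorphic_family smooth_exp expo_bound')
      (auto simp: iter_deriv_exp intro!: holomorphic_intros)
  then show ?thesis by (simp add: Laplace_functional_def[abs_def])
qed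

section \<open>One-sided exponentials\<close>

lemma integrable_exp_minus_abs: "integrable lebesgue (\<lambda>t::real. exp (- \<bar>t\<bar>))"
proof -
  have 1: "(\<lambda>t::real. exp (- \<bar>t\<bar>)) absolutely_integrable_on {0..}"
  proof (rule nonnegative_absolutely_integrable_1)
    have "(\<lambda>t::real. exp (- 1 * t)) integrable_on {0..}"
      using integrable_on_exp_minus_to_infinity[of 1 0] by simp
    then show "(\<lambda>t::real. exp (- \<bar>t\<bar>)) integrable_on {0..}"
      by (rule integrable_eq) auto
  qed auto
  have "(\<lambda>t::real. \<bar>-1\<bar> *\<^sub>R exp (- \<bar>- t\<bar>)) absolutely_integrable_on {..0} \<longleftrightarrow>
      (\<lambda>t::real. exp (- \<bar>t\<bar>)) absolutely_integrable_on uminus ` {..0}"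
    by (rule absolutely_integrable_change_of_variables_real[symmetric]) (auto intro!: derivative_eq_intros inj_onI)
  moreover have "uminus ` {..0::real} = {0..}"
    by (auto simp: image_iff intro: exI[of _ "- _"])
  ultimately have 2: "(\<lambda>t::real. exp (- \<bar>t\<bar>)) absolutely_integrable_on {..0}" using 1 by simp
  have "(\<lambda>t::real. exp (- \<bar>t\<bar>)) absolutely_integrable_on {..0} \<union> {0..}"
    by (intro set_integrable_Un 1 2) auto
  also have "{..0::real} \<union> {0..} = UNIV" by auto
  finally show ?thesis by (simp add: set_integrable_def)
qed

lemma test_function_shift_affine: "smooth r \<Longrightarrow> smooth (\<lambda>t. r (t + y))"
  using smooth_affine[of r 1 y] by simp

lemma test_function_deriv:
  assumes r: "r \<in> test_functions"
  shows "iter_deriv 1 r \<in> test_functions"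
proof -
  have smr: "smooth r" using r by (simp add: test_functions_def)
  obtain K where K: "compact K" "\<And>x. x \<notin> K \<Longrightarrow> r x = 0" using r by (auto simp: test_functions_def)
  have "iter_deriv 1 r x = 0" if "x \<notin> K" for x
    by (rule iter_deriv_zero_outside[OF compact_imp_closed[OF K(1)] K(2) that])
  then show ?thesis using K(1) smooth_iter_deriv[OF smr] by (auto simp: test_functions_def)
qed

lemma integral_derivative_test_function:
  assumes w: "w \<in> test_functions"
  shows "(LINT t|lebesgue. indicator {0..} t * iter_deriv 1 w t) = - w 0"
proof -
  obtain K where K: "compact K" "\<And>x. x \<notin> K \<Longrightarrow> w x = 0" using w by (auto simp: test_functions_def)
  have sm: "smooth w" using w by (simp add: test_functions_def)
  obtain T where T: "T > 0" "\<And>x. x \<in> K \<Longrightarrow> norm x \<le> T"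
    using compact_imp_bounded[OF K(1)] unfolding bounded_pos by blast
  have z: "iter_deriv n w x = 0" if "x > T" for n x
    by (rule iter_deriv_zero_outside[OF compact_imp_closed[OF K(1)] K(2)]) (use that T(2)[of x] in auto)
  have "(LINT t|lebesgue. indicator {0..} t * iter_deriv 1 w t) = (LINT t:{0..T+1}|lebesgue. iter_deriv 1 w t)"
    unfolding set_lebesgue_integral_def
    by (intro Bochner_Integration.integral_cong) (auto simp: indicator_def z)
  also have "\<dots> = integral {0..T+1} (iter_deriv 1 w)"
    by (intro set_lebesgue_integral_eq_integral absolutely_integrable_continuous_real smooth_continuous_on sm)
  also have "(iter_deriv 1 w has_integral w (T + 1) - w 0) {0..T+1}"
    using T(1) smooth_has_vector_derivative[OF sm, of 0]
    by (intro fundamental_theorem_of_calculus) (auto intro: has_vector_derivative_at_within)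
  then have "integral {0..T+1} (iter_deriv 1 w) = w (T + 1) - w 0" by (rule integral_unique)
  finally show ?thesis using z[of "T + 1" 0] by simp
qed

lemma lebesgue_integral_translate:
  fixes f :: "real \<Rightarrow> complex"
  assumes "f \<in> borel_measurable borel"
  shows "(LINT t|lebesgue. f (t + y)) = (LINT t|lebesgue. f t)"
proof -
  have "(\<lambda>t. f (t + y)) \<in> borel_measurable borel"
    by (intro measurable_compose[OF _ assms]) simp
  then show ?thesis
    using lborel_integral_real_affine[of 1 f y] assms
    by (simp add: integral_completion add.commute)
qed

text \<open>Used for \<open>{0..}\<close> and \<open>{..<0}\<close>: either half is bounded by 1 on
  the half-plane where \<open>Re s * t \<ge> 0\<close>.\<close>

definition half_exp :: "real set \<Rightarrow> complex \<Rightarrow> real \<Rightarrow> complex" where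
  "half_exp A s t = indicator A t * expo s t"

text \<open>One unit of exponent beyond the growth of \<open>expo s\<close> on \<open>A\<close>
  bounds \<open>W\<close> by a constant independent of \<open>s\<close> and \<open>A\<close>; the
  uniformity in \<open>s\<close> of \<open>half_exp_correlation_bound\<close> rests on it.\<close>

lemma half_exp_weighted:
  assumes A: "A \<in> sets borel" and le: "\<And>t. t \<in> A \<Longrightarrow> norm (expo s t) \<le> exp (real k * \<bar>t\<bar>)"
  shows "weighted_function (half_exp A s) (real (Suc k))"
    and "weighted_function.W (half_exp A s) (real (Suc k)) \<le> (LINT t|lebesgue. exp (- \<bar>t\<bar>))"
proof -
  note A[measurable] smooth_borel_measurable(2)[OF smooth_exp, measurable]
  have m: "half_exp A s \<in> borel_measurable lebesgue"
    unfolding half_exp_def[abs_def] by (intro borel_imp_lebesgue_measurable) measurable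
  have b: "norm (half_exp A s t) * exp (- (real (Suc k) * \<bar>t\<bar>)) \<le> exp (- \<bar>t\<bar>)" for t
  proof (cases "t \<in> A")
    case True
    have "norm (half_exp A s t) * exp (- (real (Suc k) * \<bar>t\<bar>)) \<le> exp (real k * \<bar>t\<bar>) * exp (- (real (Suc k) * \<bar>t\<bar>))"
      using le[OF True] True by (intro mult_right_mono) (auto simp: half_exp_def)
    also have "\<dots> = exp (- \<bar>t\<bar>)" by (simp add: mult_exp_exp algebra_simps)
    finally show ?thesis .
  qed (simp add: half_exp_def)
  have i: "integrable lebesgue (\<lambda>t. norm (half_exp A s t) * exp (- (real (Suc k) * \<bar>t\<bar>)))"
  proof (rule Bochner_Integration.integrable_bound[OF integrable_exp_minus_abs])
    have "(\<lambda>t. exp (- (real (Suc k) * \<bar>t\<bar>))) \<in> borel_measurable lebesgue"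
      by (intro borel_imp_lebesgue_measurable) measurable
    then show "(\<lambda>t. norm (half_exp A s t) * exp (- (real (Suc k) * \<bar>t\<bar>))) \<in> borel_measurable lebesgue"
      using m by measurable
    show "AE t in lebesgue. norm (norm (half_exp A s t) * exp (- (real (Suc k) * \<bar>t\<bar>))) \<le> norm (exp (- \<bar>t\<bar>))"
      using b by (intro AE_I2) simp
  qed
  show w: "weighted_function (half_exp A s) (real (Suc k))"
    using m i by unfold_locales
  show "weighted_function.W (half_exp A s) (real (Suc k)) \<le> (LINT t|lebesgue. exp (- \<bar>t\<bar>))"
    unfolding weighted_function.W_def[OF w] by (intro integral_mono i integrable_exp_minus_abs b)
qed

lemma half_exp_dominated:
  assumes A: "A \<in> sets borel" and le: "\<And>t. t \<in> A \<Longrightarrow> norm (expo s t) \<le> exp (real k * \<bar>t\<bar>)"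
    and r: "r \<in> test_functions"
  shows "weighted_function.dominated (half_exp A s) (real (Suc k)) (Suc k) r"
  by (rule weighted_function.dominated_decay[OF half_exp_weighted(1)[OF A le]])
    (use test_function_bounded[OF r] in auto)

lemma half_exp_correlation_bound:
  assumes A: "A \<in> sets borel" and r: "r \<in> test_functions"
  shows "\<exists>C. \<forall>s x. (\<forall>t\<in>A. norm (expo s t) \<le> exp (real k * \<bar>t\<bar>)) \<longrightarrow>
     norm (iter_deriv n (correlation (half_exp A s) r) x) \<le> C * exp (real (Suc k) * \<bar>x\<bar>)"
proof -
  obtain C where C: "\<And>x. norm (iter_deriv n r x) \<le> C * exp (- (real (Suc k) * \<bar>x\<bar>))"
    using test_function_bounded(2)[OF r] by blast
  have C0: "C \<ge> 0" using order_trans[OF norm_ge_zero C[of 0]] by simp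
  show ?thesis
  proof (intro exI allI impI)
    fix s x assume "\<forall>t\<in>A. norm (expo s t) \<le> exp (real k * \<bar>t\<bar>)"
    then have le: "\<And>t. t \<in> A \<Longrightarrow> norm (expo s t) \<le> exp (real k * \<bar>t\<bar>)" by blast
    interpret weighted_function "half_exp A s" "real (Suc k)" by (rule half_exp_weighted[OF A le])
    have "norm (iter_deriv n (correlation (half_exp A s) r) x) \<le> C * W * exp (real (Suc k) * \<bar>x\<bar>)"
      by (intro correlation_bound dominated_admissible[OF half_exp_dominated[OF A le r]] shifted_decay_bound C refl)
    also have "\<dots> \<le> C * (LINT t|lebesgue. exp (- \<bar>t\<bar>)) * exp (real (Suc k) * \<bar>x\<bar>)"
      by (intro mult_right_mono mult_left_mono half_exp_weighted(2) A le C0) auto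
    finally show "norm (iter_deriv n (correlation (half_exp A s) r) x)
        \<le> C * (LINT t|lebesgue. exp (- \<bar>t\<bar>)) * exp (real (Suc k) * \<bar>x\<bar>)" .
  qed
qed

lemma norm_expo: "norm (expo s t) = exp (- (Re s * t))"
  by simp

lemma expo_le_exp_ceiling: "norm s \<le> R \<Longrightarrow> norm (expo s t) \<le> exp (real (nat \<lceil>R\<rceil>) * \<bar>t\<bar>)"
  using expo_bound[of s "real (nat \<lceil>R\<rceil>)" 0 t] by (simp add: order_trans[OF _ real_nat_ceiling_ge])

context exp_functional
begin

text \<open>The growth rate of \<open>expo s\<close> depends on \<open>s\<close>, so the step of the
  limit depends on the radius \<open>R\<close>; \<open>holomorphic_family\<close> asks for no
  more.\<close>

lemma half_exp_holomorphic:
  assumes A: "A \<in> sets borel" and r: "r \<in> test_functions"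
  shows "(\<lambda>s. \<Phi> (correlation (half_exp A s) r)) holomorphic_on UNIV"
proof (rule holomorphic_family)
  note le = expo_le_exp_ceiling[OF order_refl]
  fix s
  interpret weighted_function "half_exp A s" "real (Suc (nat \<lceil>norm s\<rceil>))"
    by (rule half_exp_weighted[OF A le])
  show "smooth (correlation (half_exp A s) r)"
    by (intro smooth_correlation dominated_admissible[OF half_exp_dominated[OF A le r]])
next
  note le = expo_le_exp_ceiling[OF order_refl]
  fix n x
  have eq: "iter_deriv n (correlation (half_exp A s) r) x =
      (LINT t|lebesgue. (indicator A t * iter_deriv n r (t + x)) * exp (- (s * complex_of_real t)))"
    and int: "integrable lebesgue (\<lambda>t. (indicator A t * iter_deriv n r (t + x)) * exp (- (s * complex_of_real t)))" for s
  proof -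
    interpret weighted_function "half_exp A s" "real (Suc (nat \<lceil>norm s\<rceil>))"
      by (rule half_exp_weighted[OF A le])
    note adm = dominated_admissible[OF half_exp_dominated[OF A le r]]
    show "iter_deriv n (correlation (half_exp A s) r) x =
      (LINT t|lebesgue. (indicator A t * iter_deriv n r (t + x)) * exp (- (s * complex_of_real t)))"
      unfolding iter_deriv_correlation[OF adm] correlation_def by (simp add: half_exp_def mult_ac)
    show "integrable lebesgue (\<lambda>t. (indicator A t * iter_deriv n r (t + x)) * exp (- (s * complex_of_real t)))"
      using admissible_integrable[OF adm, of n x] by (simp add: half_exp_def mult_ac)
  qed
  show "(\<lambda>s. iter_deriv n (correlation (half_exp A s) r) x) holomorphic_on UNIV"
    unfolding eq using laplace_integral_holomorphic[OF open_UNIV int] by simp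
next
  fix R
  show "\<exists>m. \<forall>n. \<exists>C. \<forall>s x. norm s \<le> R \<longrightarrow>
      norm (iter_deriv n (correlation (half_exp A s) r) x) \<le> C * exp (real m * \<bar>x\<bar>)"
  proof (intro exI[of _ "Suc (nat \<lceil>R\<rceil>)"] allI)
    fix n
    show "\<exists>C. \<forall>s x. norm s \<le> R \<longrightarrow>
      norm (iter_deriv n (correlation (half_exp A s) r) x) \<le> C * exp (real (Suc (nat \<lceil>R\<rceil>)) * \<bar>x\<bar>)"
      using half_exp_correlation_bound[OF A r, of "nat \<lceil>R\<rceil>" n] expo_le_exp_ceiling by meson
  qed
qed

text \<open>Where \<open>Re s * t \<ge> 0\<close> the exponential has norm at most 1, so the rate
  \<open>k = 0\<close> serves for all of \<open>S\<close> at once.\<close>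

lemma half_exp_bounded:
  assumes A: "A \<in> sets borel" and r: "r \<in> test_functions"
    and S: "\<And>s t. s \<in> S \<Longrightarrow> t \<in> A \<Longrightarrow> Re s * t \<ge> 0"
  shows "\<exists>C. \<forall>s\<in>S. norm (\<Phi> (correlation (half_exp A s) r)) \<le> C"
proof -
  have le: "norm (expo s t) \<le> exp (real 0 * \<bar>t\<bar>)" if "s \<in> S" "t \<in> A" for s t
    using S[OF that] by simp
  obtain C where "C \<ge> 0" "\<And>s. s \<in> S \<Longrightarrow> norm (\<Phi> (correlation (half_exp A s) r)) \<le> C * 1"
  proof (rule bounded_family[of S "\<lambda>s. correlation (half_exp A s) r" "\<lambda>_. 1" 1])
    fix s assume s: "s \<in> S"
    interpret weighted_function "half_exp A s" "real (Suc 0)" by (rule half_exp_weighted[OF A le[OF s]])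
    show "smooth (correlation (half_exp A s) r)"
      by (intro smooth_correlation dominated_admissible[OF half_exp_dominated[OF A le[OF s] r]])
  next
    fix n
    obtain C where C: "\<And>s x. \<forall>t\<in>A. norm (expo s t) \<le> exp (real 0 * \<bar>t\<bar>) \<Longrightarrow>
       norm (iter_deriv n (correlation (half_exp A s) r) x) \<le> C * exp (real (Suc 0) * \<bar>x\<bar>)"
      using half_exp_correlation_bound[OF A r, of 0 n] by blast
    have "norm (iter_deriv n (correlation (half_exp A s) r) x) \<le> C * 1 * exp (real 1 * \<bar>x\<bar>)" if "s \<in> S" for s x
      using C[of s x] le[OF that] by simp
    then show "\<exists>C. \<forall>s\<in>S. \<forall>x. norm (iter_deriv n (correlation (half_exp A s) r) x) \<le> C * 1 * exp (real 1 * \<bar>x\<bar>)"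
      by blast
  qed auto
  then show ?thesis by auto
qed

text \<open>
  If all exponentials are annihilated, the one-sided transform below is bounded in both half-planes,
  hence constant; integration by parts then kills it.
\<close>

lemma exponentials_total:
  assumes zero: "\<And>s. Laplace_functional \<Phi> s = 0" and r: "r \<in> test_functions"
  shows "\<Phi> r = 0"
proof -
  define F where "F r s = \<Phi> (correlation (half_exp {0..} s) r)" for r s
  note le = expo_le_exp_ceiling[OF order_refl]
  have wf: "weighted_function (half_exp A s) (real (Suc (nat \<lceil>norm s\<rceil>)))"
    and dom: "weighted_function.dominated (half_exp A s) (real (Suc (nat \<lceil>norm s\<rceil>))) (Suc (nat \<lceil>norm s\<rceil>)) r"
    if "A \<in> sets borel" "r \<in> test_functions" for A s r
    by (rule half_exp_weighted half_exp_dominated; use that le in blast)+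
  have int: "integrable lebesgue (\<lambda>t. half_exp A s t * r (t + y))"
    if "A \<in> sets borel" "r \<in> test_functions" for A s r y
    using weighted_function.admissible_integrable[OF wf[OF that, of s]
        weighted_function.dominated_admissible[OF wf[OF that, of s] dom[OF that, of s]], of 0 y]
    by simp
  have inE: "correlation (half_exp A s) r \<in> topspace Cexp_top"
    if "A \<in> sets borel" "r \<in> test_functions" for A s r
    by (rule weighted_function.correlation_in_Cexp[OF wf[OF that] dom[OF that]])
  \<comment> \<open>The two halves add up to the correlation of the full exponential, a multiple of
    \<open>expo (- s)\<close>, which \<open>\<Phi>\<close> annihilates.\<close>
  have F_neg: "F r s = - \<Phi> (correlation (half_exp {..<0} s) r)" if r: "r \<in> test_functions" for r s
  proof -
    have smr: "smooth r" using r by (simp add: test_functions_def)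
    have "correlation (half_exp {0..} s) r y + correlation (half_exp {..<0} s) r y =
        (LINT t|lebesgue. r t * expo s t) * expo (- s) y" for y
    proof -
      have "correlation (half_exp {0..} s) r y + correlation (half_exp {..<0} s) r y =
         (LINT t|lebesgue. half_exp {0..} s t * r (t + y) + half_exp {..<0} s t * r (t + y))"
        unfolding correlation_def by (intro Bochner_Integration.integral_add[symmetric] int r) auto
      also have "\<dots> = (LINT t|lebesgue. (r (t + y) * expo s (t + y)) * expo (- s) y)"
        by (intro Bochner_Integration.integral_cong)
          (auto simp: half_exp_def indicator_def mult.assoc mult_exp_exp distrib_left)
      also have "\<dots> = (LINT t|lebesgue. r (t + y) * expo s (t + y)) * expo (- s) y" by simp
      also have "(LINT t|lebesgue. r (t + y) * expo s (t + y)) = (LINT t|lebesgue. r t * expo s t)"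
        by (rule lebesgue_integral_translate)
          (intro borel_measurable_times smooth_borel_measurable(2) smr smooth_exp)
      finally show ?thesis .
    qed
    then have "\<Phi> (\<lambda>y. (LINT t|lebesgue. r t * expo s t) * expo (- s) y) =
        \<Phi> (\<lambda>y. correlation (half_exp {0..} s) r y + correlation (half_exp {..<0} s) r y)" by simp
    also have "\<dots> = F r s + \<Phi> (correlation (half_exp {..<0} s) r)"
      unfolding F_def by (intro add inE r) auto
    also have "\<Phi> (\<lambda>y. (LINT t|lebesgue. r t * expo s t) * expo (- s) y) = 0"
      using cmult[OF expo_in_Cexp[of "- s"], of "LINT t|lebesgue. r t * expo s t"] zero[of "- s"]
      by (simp add: Laplace_functional_def)
    finally show ?thesis by (simp add: eq_neg_iff_add_eq_0)
  qed
  have const: "\<exists>c. \<forall>s. F r s = c" if r: "r \<in> test_functions" for r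
  proof -
    \<comment> \<open>Each of the two representations of \<open>F r\<close> is bounded on one closed
      half-plane; together these cover the plane, and Liouville's theorem applies.\<close>
    obtain C1 where C1: "\<And>s. Re s \<ge> 0 \<Longrightarrow> norm (F r s) \<le> C1"
      using half_exp_bounded[of "{0..}" r "{s. Re s \<ge> 0}"] r by (auto simp: F_def)
    obtain C2 where C2: "\<And>s. Re s \<le> 0 \<Longrightarrow> norm (F r s) \<le> C2"
      using half_exp_bounded[of "{..<0}" r "{s. Re s \<le> 0}"] r by (auto simp: F_neg[OF r] mult_nonpos_nonpos)
    have "norm (F r s) \<le> max C1 C2" for s
      using C1[of s] C2[of s] by (cases "Re s \<ge> 0") auto
    then have "bounded (range (F r))" by (auto simp: bounded_iff)
    moreover have "F r holomorphic_on UNIV"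
      unfolding F_def[abs_def] by (rule half_exp_holomorphic[OF _ r]) simp
    ultimately have "F r constant_on UNIV" by (intro Liouville_theorem)
    then show ?thesis by (auto simp: constant_on_def)
  qed
  \<comment> \<open>Integration by parts on \<open>{0..}\<close>: the boundary term at 0 is
    \<open>- r y\<close>, and there is none at infinity since \<open>r\<close> has compact
    support.\<close>
  have parts: "F (iter_deriv 1 r) s = s * F r s - \<Phi> r" if r: "r \<in> test_functions" for r s
  proof -
    have smr: "smooth r" using r by (simp add: test_functions_def)
    obtain K where K: "compact K" "\<And>x. x \<notin> K \<Longrightarrow> r x = 0" using r by (auto simp: test_functions_def)
    note r' = test_function_deriv[OF r]
    have "correlation (half_exp {0..} s) (iter_deriv 1 r) y = s * correlation (half_exp {0..} s) r y - r y" for y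
    proof -
      define w where "w t = r (t + y) * expo s t" for t
      have smw: "smooth w"
        unfolding w_def[abs_def] by (intro smooth_mult smooth_exp test_function_shift_affine smr)
      have "w x = 0" if "x \<notin> (\<lambda>x. x - y) ` K" for x
        using that K(2)[of "x + y"] by (force simp: w_def)
      moreover have "compact ((\<lambda>x. x - y) ` K)" using K(1) by (intro compact_continuous_image continuous_intros)
      ultimately have wt: "w \<in> test_functions" using smw by (auto simp: test_functions_def)
      have dw: "iter_deriv 1 w t = iter_deriv 1 r (t + y) * expo s t - s * (r (t + y) * expo s t)" for t
        unfolding w_def[abs_def] iter_deriv_mult[OF test_function_shift_affine[OF smr] smooth_exp]
        using iter_deriv_affine[OF smr, of 1 1 y] iter_deriv_exp[of 1 s] by simp
      have "(LINT t|lebesgue. indicator {0..} t * iter_deriv 1 w t) =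
         (LINT t|lebesgue. half_exp {0..} s t * iter_deriv 1 r (t + y) - s * (half_exp {0..} s t * r (t + y)))"
        unfolding dw by (intro Bochner_Integration.integral_cong) (auto simp: half_exp_def algebra_simps)
      also have "\<dots> = correlation (half_exp {0..} s) (iter_deriv 1 r) y - s * correlation (half_exp {0..} s) r y"
        unfolding correlation_def using int[OF _ r', of "{0..}"] int[OF _ r, of "{0..}"] by simp
      finally show ?thesis
        using integral_derivative_test_function[OF wt] by (simp add: w_def algebra_simps)
    qed
    then have "correlation (half_exp {0..} s) (iter_deriv 1 r) = (\<lambda>y. s * correlation (half_exp {0..} s) r y + (-1) * r y)"
      by (simp add: fun_eq_iff)
    then show ?thesis
      unfolding F_def using lincomb[OF inE[OF _ r, of "{0..}"], of r s s "-1"] test_functions_subset r by auto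
  qed
  have F0: "F r s = 0" if r: "r \<in> test_functions" for r s
  proof -
    obtain c d where c: "\<And>s. F r s = c" and d: "\<And>s. F (iter_deriv 1 r) s = d"
      using const[OF r] const[OF test_function_deriv[OF r]] by metis
    \<comment> \<open>Both transforms are constant in \<open>s\<close>, so comparing
      \<open>s = 0\<close> with \<open>s = 1\<close> gives \<open>c = 0\<close>.\<close>
    have "d = s * c - \<Phi> r" for s using parts[OF r, of s] c d by simp
    from this[of 0] this[of 1] show ?thesis by (simp add: c)
  qed
  show ?thesis
    using parts[OF r, of 0] F0[OF test_function_deriv[OF r]] by simp
qed

text \<open>Otherwise \<open>\<Phi>\<close> kills all test functions and, by density, everything.
  This is what makes the Carleman quotient meaningful.\<close>

lemma laplace_functional_nonzero:
  assumes "g \<in> topspace Cexp_top" "\<Phi> g \<noteq> 0"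
  shows "\<exists>s. Laplace_functional \<Phi> s \<noteq> 0"
proof (rule ccontr)
  assume "\<not> ?thesis"
  then have z: "\<Phi> r = 0" if "r \<in> test_functions" for r using exponentials_total[OF _ that] by blast
  obtain m where m: "g \<in> exp_space m" using assms(1) by (auto simp: topspace_Cexp_top)
  have "(\<lambda>N. \<Phi> (\<lambda>x. cutoff N x * g x)) = (\<lambda>_. 0)"
    using z cutoff_test_function[OF exp_spaceD(1)[OF m]] by blast
  then show False using cutoff_tendsto[OF assms(1)] assms(2) by (simp add: LIMSEQ_const_iff)
qed

end

section \<open>The Carleman transform of a functional\<close>

definition minus_part :: "(real \<Rightarrow> complex) \<Rightarrow> real \<Rightarrow> complex" where
  "minus_part f t = (if t < 0 then f t else 0)"

lemma weighted_function_restrict: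
  assumes "weighted_function u B" "A \<in> sets borel"
  shows "weighted_function (\<lambda>t. if t \<in> A then u t else 0) B"
proof -
  interpret weighted_function u B by fact
  have [measurable]: "A \<in> sets lebesgue" using assms(2) by simp
  show ?thesis
  proof
    show m: "(\<lambda>t. if t \<in> A then u t else 0) \<in> borel_measurable lebesgue" by measurable
    have e: "(\<lambda>t. exp (- (B * \<bar>t\<bar>))) \<in> borel_measurable lebesgue"
      by (intro borel_imp_lebesgue_measurable) measurable
    show "integrable lebesgue (\<lambda>t. norm (if t \<in> A then u t else 0) * exp (- (B * \<bar>t\<bar>)))"
      by (rule Bochner_Integration.integrable_bound[OF u_int])
        (use m e in \<open>auto intro!: AE_I2 borel_measurable_times borel_measurable_norm simp: abs_mult\<close>)
  qed
qed

lemma plus_part_weighted: "weighted_function u B \<Longrightarrow> weighted_function (plus_part u) B"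
  using weighted_function_restrict[of u B "{0..}"] by (simp add: plus_part_def[abs_def])

lemma minus_part_weighted: "weighted_function u B \<Longrightarrow> weighted_function (minus_part u) B"
  using weighted_function_restrict[of u B "{..<0}"] by (simp add: minus_part_def[abs_def])

lemma step_mult_bound:
  assumes "\<And>j::nat. smooth (g j)" "\<And>n. \<exists>C. \<forall>j x. norm (iter_deriv n (g j) x) \<le> C * exp (real l * \<bar>x\<bar>)"
  shows "\<exists>C. \<forall>j x. norm (iter_deriv n (\<lambda>x. smooth_step x * g j x) x) \<le> C * exp (real l * \<bar>x\<bar>)"
    and "\<exists>C. \<forall>j x. norm (iter_deriv n (\<lambda>x. g j x - smooth_step x * g j x) x) \<le> C * exp (real l * \<bar>x\<bar>)"
proof -
  obtain A where A: "\<And>n x. norm (iter_deriv n smooth_step x) \<le> A n" using smooth_step(4) by metis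
  obtain D where D: "\<And>n j x. norm (iter_deriv n (g j) x) \<le> D n * exp (real l * \<bar>x\<bar>)" using assms(2) by metis
  define C where "C = (\<Sum>j\<le>n. real (n choose j) * A j * D (n - j))"
  have C: "norm (iter_deriv n (\<lambda>x. smooth_step x * g j x) x) \<le> C * exp (real l * \<bar>x\<bar>)" for j x
    unfolding C_def by (intro iter_deriv_mult_bound smooth_step(1) assms(1) A D)
  then show "\<exists>C. \<forall>j x. norm (iter_deriv n (\<lambda>x. smooth_step x * g j x) x) \<le> C * exp (real l * \<bar>x\<bar>)" by blast
  have "norm (iter_deriv n (\<lambda>x. g j x - smooth_step x * g j x) x) \<le> (D n + C) * exp (real l * \<bar>x\<bar>)" for j x
    unfolding iter_deriv_diff[OF assms(1) smooth_mult[OF smooth_step(1) assms(1)]]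
    by (rule order_trans[OF norm_triangle_ineq4]) (simp add: distrib_right add_mono C D)
  then show "\<exists>C. \<forall>j x. norm (iter_deriv n (\<lambda>x. g j x - smooth_step x * g j x) x) \<le> C * exp (real l * \<bar>x\<bar>)" by blast
qed

lemma smooth_step_parts:
  assumes "smooth g"
  shows "smooth (\<lambda>x. smooth_step x * g x)" "smooth (\<lambda>x. g x - smooth_step x * g x)"
  by (intro smooth_diff smooth_mult smooth_step(1) assms)+

lemma step_mult_zero: "x < 0 \<Longrightarrow> iter_deriv n (\<lambda>x. smooth_step x * g x) x = 0"
  using iter_deriv_cong_open[of "{..<0}" "\<lambda>x. smooth_step x * g x" "\<lambda>_. 0" x n]
  by (simp add: smooth_step iter_deriv_const_0)

lemma step_remainder_zero: "x > 1 \<Longrightarrow> iter_deriv n (\<lambda>x. g x - smooth_step x * g x) x = 0"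
  using iter_deriv_cong_open[of "{1<..}" "\<lambda>x. g x - smooth_step x * g x" "\<lambda>_. 0" x n]
  by (simp add: smooth_step iter_deriv_const_0)

text \<open>Exponentials are eigenfunctions of correlation. No integrability is assumed: where it
  fails, both integrals are 0.\<close>

lemma correlation_expo: "correlation u (expo s) = (\<lambda>y. Laplace_fun u s * expo s y)"
proof
  fix y
  have "correlation u (expo s) y = (LINT t|lebesgue. (u t * expo s t) * expo s y)"
    unfolding correlation_def
    by (intro Bochner_Integration.integral_cong) (auto simp: mult.assoc mult_exp_exp distrib_left)
  then show "correlation u (expo s) y = Laplace_fun u s * expo s y"
    by (simp add: Laplace_fun_def)
qed

lemma (in weighted_function) dominated_expo:
  assumes le: "\<And>t. u t \<noteq> 0 \<Longrightarrow> - (Re s * t) \<le> - (B * \<bar>t\<bar>)"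
  shows "dominated (nat \<lceil>norm s\<rceil>) (expo s)"
  unfolding dominated_def
proof (intro conjI allI smooth_exp)
  fix n
  have "norm (iter_deriv n (expo s) (t + y)) \<le> norm s ^ n * exp (- (B * \<bar>t\<bar>)) * exp (real (nat \<lceil>norm s\<rceil>) * \<bar>y\<bar>)"
    if "u t \<noteq> 0" for t y
  proof -
    have "- (Re s * y) \<le> \<bar>Re s\<bar> * \<bar>y\<bar>" using abs_ge_minus_self[of "Re s * y"] by (simp add: abs_mult)
    also have "\<dots> \<le> real (nat \<lceil>norm s\<rceil>) * \<bar>y\<bar>"
      using abs_Re_le_cmod[of s] by (intro mult_right_mono) linarith+
    finally have "- (Re s * (t + y)) \<le> - (B * \<bar>t\<bar>) + real (nat \<lceil>norm s\<rceil>) * \<bar>y\<bar>"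
      using le[OF that] by (simp add: distrib_left)
    then have "exp (- (Re s * (t + y))) \<le> exp (- (B * \<bar>t\<bar>)) * exp (real (nat \<lceil>norm s\<rceil>) * \<bar>y\<bar>)"
      by (simp only: exp_add[symmetric] exp_le_cancel_iff)
    then show ?thesis
      unfolding iter_deriv_exp norm_mult norm_power norm_minus_cancel norm_expo mult.assoc
      by (intro mult_left_mono) auto
  qed
  then show "\<exists>C. \<forall>t y. u t \<noteq> 0 \<longrightarrow>
    norm (iter_deriv n (expo s) (t + y)) \<le> C * exp (- (B * \<bar>t\<bar>)) * exp (real (nat \<lceil>norm s\<rceil>) * \<bar>y\<bar>)"
    by blast
qed

text \<open>What is retained of mean-periodicity in a space of functions:
  \<open>H * \<Phi> = 0\<close>, tested on test functions, for a functional on functions of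
  exponential growth.\<close>

locale annihilated_function = exp_functional \<Phi> + weighted_function H "real b" for \<Phi> H b +
  assumes annihilates: "\<And>g. g \<in> test_functions \<Longrightarrow> \<Phi> (correlation H g) = 0"
begin

sublocale P: weighted_function "plus_part H" "real b"
  by (rule plus_part_weighted) unfold_locales

sublocale N: weighted_function "minus_part H" "real b"
  by (rule minus_part_weighted) unfold_locales

text \<open>\<open>0 \<le> t\<close> with \<open>t + y \<le> 1\<close>, and likewise
  \<open>t < 0\<close> with \<open>t + y \<ge> 0\<close>, confine \<open>t\<close>: the truncation
  acts on the side on which the half of \<open>H\<close> extends.\<close>

lemma step_support:
  shows "plus_part H t \<noteq> 0 \<Longrightarrow> iter_deriv n (\<lambda>x. g x - smooth_step x * g x) (t + y) \<noteq> 0 \<Longrightarrow> \<bar>t\<bar> \<le> 1 + \<bar>y\<bar>"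
    and "minus_part H t \<noteq> 0 \<Longrightarrow> iter_deriv n (\<lambda>x. smooth_step x * g x) (t + y) \<noteq> 0 \<Longrightarrow> \<bar>t\<bar> \<le> 1 + \<bar>y\<bar>"
  using step_remainder_zero[of "t + y" n g] step_mult_zero[of "t + y" n g]
  by (force simp: plus_part_def minus_part_def split: if_splits)+

text \<open>
  The extension of \<open>H\<^sup>+ * \<Phi>\<close> to all functions of exponential growth: near \<open>+\<infinity>\<close> it is replaced by
  \<open>- H\<^sup>- * \<Phi>\<close>, so that both integrals converge.
\<close>

definition extended :: "(real \<Rightarrow> complex) \<Rightarrow> complex" where
  "extended g = \<Phi> (correlation (plus_part H) (\<lambda>x. g x - smooth_step x * g x))
     - \<Phi> (correlation (minus_part H) (\<lambda>x. smooth_step x * g x))"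

lemma dominated_step:
  assumes "g \<in> exp_space l"
  shows "P.dominated (b + 2 * l) (\<lambda>x. g x - smooth_step x * g x)"
    and "N.dominated (b + 2 * l) (\<lambda>x. smooth_step x * g x)"
proof -
  note sm = exp_spaceD(1)[OF assms]
  have b: "\<And>n. \<exists>C. \<forall>(j::nat) x. norm (iter_deriv n g x) \<le> C * exp (real l * \<bar>x\<bar>)"
    using exp_spaceD(2)[OF assms] by blast
  have "\<exists>C. \<forall>x. norm (iter_deriv n (\<lambda>x. g x - smooth_step x * g x) x) \<le> C * exp (real l * \<bar>x\<bar>)" for n
    using step_mult_bound(2)[of "\<lambda>_. g", OF sm b] by blast
  then show "P.dominated (b + 2 * l) (\<lambda>x. g x - smooth_step x * g x)"
    by (rule P.dominated_growth[OF smooth_step_parts(2)[OF sm]]) (use step_support(1) in auto)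
  have "\<exists>C. \<forall>x. norm (iter_deriv n (\<lambda>x. smooth_step x * g x) x) \<le> C * exp (real l * \<bar>x\<bar>)" for n
    using step_mult_bound(1)[of "\<lambda>_. g", OF sm b] by blast
  then show "N.dominated (b + 2 * l) (\<lambda>x. smooth_step x * g x)"
    by (rule N.dominated_growth[OF smooth_step_parts(1)[OF sm]]) (use step_support(2) in auto)
qed

lemma (in weighted_function) correlation_family_bound:
  assumes sm: "\<And>j::nat. smooth (g j)" and b: "\<And>n. \<exists>C. \<forall>j x. norm (iter_deriv n (g j) x) \<le> C * exp (real l * \<bar>x\<bar>)"
    and B: "B = real b"
    and supp: "\<And>j n t y. u t \<noteq> 0 \<Longrightarrow> iter_deriv n (g j) (t + y) \<noteq> 0 \<Longrightarrow> \<bar>t\<bar> \<le> 1 + \<bar>y\<bar>"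
  shows "\<exists>C. \<forall>j x. norm (iter_deriv n (correlation u (g j)) x) \<le> C * exp (real (b + 2 * l) * \<bar>x\<bar>)"
proof -
  obtain C where C: "\<And>j x. norm (iter_deriv n (g j) x) \<le> C * exp (real l * \<bar>x\<bar>)" using b by blast
  have "norm (iter_deriv n (correlation u (g j)) x) \<le> (C * exp (B + real l)) * W * exp (real (b + 2 * l) * \<bar>x\<bar>)" for j x
  proof (rule correlation_bound)
    have "dominated (b + 2 * l) (g j)"
      by (rule dominated_growth[OF sm]) (use b B supp in blast)+
    then show "admissible (g j)" by (rule dominated_admissible)
    fix t y assume "u t \<noteq> 0"
    then show "norm (iter_deriv n (g j) (t + y)) \<le> C * exp (B + real l) * exp (- (B * \<bar>t\<bar>)) * exp (real (b + 2 * l) * \<bar>y\<bar>)"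
      by (intro shifted_growth_bound C B supp)
  qed
  then show ?thesis by blast
qed

text \<open>Both truncated arguments stay dominated uniformly along a bounded sequence, at the price
  of passing from the rate \<open>l\<close> to \<open>b + 2 * l\<close>; with linearity this is all
  that the continuity of the extension requires.\<close>

lemma exp_functional_extended: "exp_functional extended"
proof
  fix f g c d assume "f \<in> topspace Cexp_top" "g \<in> topspace Cexp_top"
  then obtain m1 m2 where "f \<in> exp_space m1" "g \<in> exp_space m2" by (auto simp: topspace_Cexp_top)
  then obtain m where f: "f \<in> exp_space m" and g: "g \<in> exp_space m"
    using exp_space_mono[of m1 "max m1 m2"] exp_space_mono[of m2 "max m1 m2"] by (meson max.cobounded1 max.cobounded2 subsetD)
  note df = dominated_step[OF f] and dg = dominated_step[OF g]
  have 1: "(\<lambda>x. (c * f x + d * g x) - smooth_step x * (c * f x + d * g x)) =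
      (\<lambda>x. c * (f x - smooth_step x * f x) + d * (g x - smooth_step x * g x))"
    and 2: "(\<lambda>x. smooth_step x * (c * f x + d * g x)) =
      (\<lambda>x. c * (smooth_step x * f x) + d * (smooth_step x * g x))"
    by (simp_all add: fun_eq_iff algebra_simps)
  show "extended (\<lambda>x. c * f x + d * g x) = c * extended f + d * extended g"
    unfolding extended_def 1 2
      P.correlation_lincomb[OF P.dominated_admissible[OF df(1)] P.dominated_admissible[OF dg(1)]]
      N.correlation_lincomb[OF N.dominated_admissible[OF df(2)] N.dominated_admissible[OF dg(2)]]
      lincomb[OF P.correlation_in_Cexp[OF df(1)] P.correlation_in_Cexp[OF dg(1)]]
      lincomb[OF N.correlation_in_Cexp[OF df(2)] N.correlation_in_Cexp[OF dg(2)]]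
    by (simp add: algebra_simps)
next
  fix l and g :: "nat \<Rightarrow> real \<Rightarrow> complex"
  assume g: "\<And>j. smooth (g j)" "\<And>n. \<exists>C. \<forall>j x. norm (iter_deriv n (g j) x) \<le> C * exp (real l * \<bar>x\<bar>)"
  have inl: "g j \<in> exp_space l" for j unfolding exp_space_def using g by blast
  have "\<exists>C. \<forall>j. norm (\<Phi> (correlation (plus_part H) (\<lambda>x. g j x - smooth_step x * g j x))) \<le> C"
  proof (rule bounded)
    show "smooth (correlation (plus_part H) (\<lambda>x. g j x - smooth_step x * g j x))" for j
      by (intro P.smooth_correlation P.dominated_admissible[OF dominated_step(1)[OF inl]])
    show "\<exists>C. \<forall>j x. norm (iter_deriv n (correlation (plus_part H) (\<lambda>x. g j x - smooth_step x * g j x)) x)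
        \<le> C * exp (real (b + 2 * l) * \<bar>x\<bar>)" for n
      by (rule P.correlation_family_bound[OF smooth_step_parts(2)[OF g(1)] step_mult_bound(2)[OF g] refl step_support(1)])
  qed
  moreover have "\<exists>C. \<forall>j. norm (\<Phi> (correlation (minus_part H) (\<lambda>x. smooth_step x * g j x))) \<le> C"
  proof (rule bounded)
    show "smooth (correlation (minus_part H) (\<lambda>x. smooth_step x * g j x))" for j
      by (intro N.smooth_correlation N.dominated_admissible[OF dominated_step(2)[OF inl]])
    show "\<exists>C. \<forall>j x. norm (iter_deriv n (correlation (minus_part H) (\<lambda>x. smooth_step x * g j x)) x)
        \<le> C * exp (real (b + 2 * l) * \<bar>x\<bar>)" for n
      by (rule N.correlation_family_bound[OF smooth_step_parts(1)[OF g(1)] step_mult_bound(1)[OF g] refl step_support(2)])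
  qed
  ultimately obtain C D where
    "\<And>j. norm (\<Phi> (correlation (plus_part H) (\<lambda>x. g j x - smooth_step x * g j x))) \<le> C"
    "\<And>j. norm (\<Phi> (correlation (minus_part H) (\<lambda>x. smooth_step x * g j x))) \<le> D" by metis
  then have "norm (extended (g j)) \<le> C + D" for j
    unfolding extended_def by (intro order_trans[OF norm_triangle_ineq4] add_mono)
  then show "\<exists>C. \<forall>j. norm (extended (g j)) \<le> C" by blast
qed

definition decays :: "real \<Rightarrow> (real \<Rightarrow> complex) \<Rightarrow> bool" where
  "decays \<kappa> g \<longleftrightarrow> smooth g \<and> (\<forall>n. \<exists>C. \<forall>x. norm (iter_deriv n g x) \<le> C * exp (- (\<kappa> * \<bar>x\<bar>)))"

lemma decays_mono:
  assumes "decays \<kappa> g" "\<kappa>' \<le> \<kappa>"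
  shows "decays \<kappa>' g"
  unfolding decays_def
proof (intro conjI allI)
  show "smooth g" using assms by (simp add: decays_def)
  fix n
  obtain C where C: "\<And>x. norm (iter_deriv n g x) \<le> C * exp (- (\<kappa> * \<bar>x\<bar>))"
    using assms(1) unfolding decays_def by blast
  have "C \<ge> 0" using order_trans[OF norm_ge_zero C[of 0]] by simp
  then have "C * exp (- (\<kappa> * \<bar>x\<bar>)) \<le> C * exp (- (\<kappa>' * \<bar>x\<bar>))" for x
    using assms(2) by (intro mult_left_mono) (auto intro: mult_right_mono)
  then show "\<exists>C. \<forall>x. norm (iter_deriv n g x) \<le> C * exp (- (\<kappa>' * \<bar>x\<bar>))"
    using C by (meson order_trans)
qed

lemma decays_test: "g \<in> test_functions \<Longrightarrow> decays \<kappa> g"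
  unfolding decays_def using test_function_bounded by blast

lemma decays_dominated:
  assumes "decays (real b) g"
  shows "dominated b g" "P.dominated b g" "N.dominated b g"
  using assms unfolding decays_def
  by (auto intro!: dominated_decay P.dominated_decay N.dominated_decay)

lemma correlation_split:
  assumes "decays (real b) g"
  shows "\<Phi> (correlation H g) = \<Phi> (correlation (plus_part H) g) + \<Phi> (correlation (minus_part H) g)"
proof -
  note d = decays_dominated[OF assms]
  have "correlation H g y = correlation (plus_part H) g y + correlation (minus_part H) g y" for y
  proof -
    have "correlation H g y = (LINT t|lebesgue. plus_part H t * g (t + y) + minus_part H t * g (t + y))"
      unfolding correlation_def
      by (intro Bochner_Integration.integral_cong) (auto simp: plus_part_def minus_part_def)
    also have "\<dots> = correlation (plus_part H) g y + correlation (minus_part H) g y"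
      unfolding correlation_def
      using P.admissible_integrable[OF P.dominated_admissible[OF d(2)], of 0]
        N.admissible_integrable[OF N.dominated_admissible[OF d(3)], of 0]
      by (intro Bochner_Integration.integral_add) simp_all
    finally show ?thesis .
  qed
  then have "correlation H g = (\<lambda>y. correlation (plus_part H) g y + correlation (minus_part H) g y)" by blast
  then show ?thesis
    using add[OF P.correlation_in_Cexp[OF d(2)] N.correlation_in_Cexp[OF d(3)]] by simp
qed

text \<open>Passes from test functions to functions decaying like
  \<open>exp (- (b + 1) * \<bar>x\<bar>)\<close>: the cutoff costs one unit of exponent, and the
  weight of \<open>H\<close> takes the remaining \<open>b\<close>.\<close>

lemma annihilates_decaying:
  assumes g: "decays (real b + 1) g"
  shows "\<Phi> (correlation H g) = 0"
proof -
  have sm: "smooth g" using g by (simp add: decays_def)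
  have cdec: "\<exists>C. \<forall>N x. norm (iter_deriv n (\<lambda>x. g x - cutoff N x * g x) x) \<le> C * exp (- real N) * exp (- (real b * \<bar>x\<bar>))" for n
  proof -
    have "\<exists>C. \<forall>x. norm (iter_deriv n g x) \<le> C * exp (- (real b + 1) * \<bar>x\<bar>)" for n
      using g by (simp only: decays_def mult_minus_left)
    from cutoff_remainder_bound[OF sm this, of n] show ?thesis by simp
  qed
  have smr: "smooth (\<lambda>x. g x - cutoff N x * g x)" for N
    by (intro smooth_diff sm smooth_cutoff_mult)
  have dec_r: "decays (real b) (\<lambda>x. g x - cutoff N x * g x)" for N
    unfolding decays_def
  proof (intro conjI allI smr)
    fix n
    obtain C where "\<forall>N x. norm (iter_deriv n (\<lambda>x. g x - cutoff N x * g x) x) \<le> C * exp (- real N) * exp (- (real b * \<bar>x\<bar>))"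
      using cdec by blast
    then show "\<exists>C. \<forall>x. norm (iter_deriv n (\<lambda>x. g x - cutoff N x * g x) x) \<le> C * exp (- (real b * \<bar>x\<bar>))"
      by blast
  qed
  have "(\<lambda>N. \<Phi> (correlation H (\<lambda>x. g x - cutoff N x * g x))) \<longlonglongrightarrow> 0"
  proof (rule tendsto_0_family[where m = b])
    show "smooth (correlation H (\<lambda>x. g x - cutoff N x * g x))" for N
      by (intro smooth_correlation dominated_admissible[OF decays_dominated(1)[OF dec_r]])
    fix n
    obtain C where C: "\<And>N x. norm (iter_deriv n (\<lambda>x. g x - cutoff N x * g x) x) \<le> C * exp (- real N) * exp (- (real b * \<bar>x\<bar>))"
      using cdec by blast
    have "norm (iter_deriv n (correlation H (\<lambda>x. g x - cutoff N x * g x)) y) \<le> C * exp (- real N) * W * exp (real b * \<bar>y\<bar>)" for N y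
      by (intro correlation_bound dominated_admissible[OF decays_dominated(1)[OF dec_r]] shifted_decay_bound C refl)
    then show "\<exists>C. \<forall>N x. norm (iter_deriv n (correlation H (\<lambda>x. g x - cutoff N x * g x)) x)
        \<le> C * exp (- real N) * exp (real b * \<bar>x\<bar>)"
      by (intro exI[of _ "C * W"]) (simp add: mult_ac)
  qed
  moreover have "\<Phi> (correlation H (\<lambda>x. g x - cutoff N x * g x)) = \<Phi> (correlation H g)" for N
  proof -
    have t: "(\<lambda>x. cutoff N x * g x) \<in> test_functions" by (rule cutoff_test_function[OF sm])
    note dg = decays_dominated(1)[OF decays_mono[OF g]] and dc = decays_dominated(1)[OF decays_test[OF t]]
    have dg: "dominated b g" by (rule dg) simp
    show ?thesis
      unfolding correlation_diff[OF dominated_admissible[OF dg] dominated_admissible[OF dc]]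
        diff[OF correlation_in_Cexp[OF dg] correlation_in_Cexp[OF dc]] annihilates[OF t] by simp
  qed
  ultimately show ?thesis by (simp add: LIMSEQ_const_iff)
qed

text \<open>The two sides differ by \<open>\<Phi>\<close> of the correlation of the whole
  \<open>H\<close> with \<open>smooth_step * g\<close>, and this product decays fast enough to be
  annihilated.\<close>

lemma extended_eq_plus:
  assumes g1: "P.dominated m g" and g2: "decays (real b + 1) (\<lambda>x. smooth_step x * g x)"
  shows "extended g = \<Phi> (correlation (plus_part H) g)"
proof -
  have d: "decays (real b) (\<lambda>x. smooth_step x * g x)" by (rule decays_mono[OF g2]) simp
  note d2 = decays_dominated(2)[OF d]
  show ?thesis
    unfolding extended_def
      P.correlation_diff[OF P.dominated_admissible[OF g1] P.dominated_admissible[OF d2]]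
      diff[OF P.correlation_in_Cexp[OF g1] P.correlation_in_Cexp[OF d2]]
    using correlation_split[OF d] annihilates_decaying[OF g2] by (simp add: eq_neg_iff_add_eq_0 algebra_simps)
qed

text \<open>The mirror image: annihilation moves the part \<open>g - smooth_step * g\<close> from
  \<open>H\<^sup>+\<close> to \<open>H\<^sup>-\<close>, with a change of sign.\<close>

lemma extended_eq_minus:
  assumes g1: "N.dominated m g" and g2: "decays (real b + 1) (\<lambda>x. g x - smooth_step x * g x)"
  shows "extended g = - \<Phi> (correlation (minus_part H) g)"
proof -
  have d: "decays (real b) (\<lambda>x. g x - smooth_step x * g x)" by (rule decays_mono[OF g2]) simp
  note d3 = decays_dominated(3)[OF d]
  have eq: "(\<lambda>x. smooth_step x * g x) = (\<lambda>x. g x - (g x - smooth_step x * g x))" by simp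
  have "\<Phi> (correlation (minus_part H) (\<lambda>x. smooth_step x * g x)) =
     \<Phi> (correlation (minus_part H) g) - \<Phi> (correlation (minus_part H) (\<lambda>x. g x - smooth_step x * g x))"
    by (subst eq, subst N.correlation_diff[OF N.dominated_admissible[OF g1] N.dominated_admissible[OF d3]])
      (rule diff[OF N.correlation_in_Cexp[OF g1] N.correlation_in_Cexp[OF d3]])
  then show ?thesis
    unfolding extended_def using correlation_split[OF d] annihilates_decaying[OF g2] by simp
qed

lemma extended_test: "g \<in> test_functions \<Longrightarrow> extended g = conv_distr (plus_part H) \<Phi> g"
proof -
  assume g: "g \<in> test_functions"
  then have "(\<lambda>x. smooth_step x * g x) \<in> test_functions"
    by (auto simp: test_functions_def intro!: smooth_step_parts) 
  from extended_eq_plus[OF decays_dominated(2)[OF decays_test[OF g]] decays_test[OF this]]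
  show ?thesis by (simp add: conv_distr_def correlation_def[abs_def])
qed

text \<open>Multiplied by the step, \<open>expo s\<close> vanishes on the negative half-line and
  decays at the rate \<open>Re s\<close> on the positive one; the eigenvalue of the correlation then
  splits off as the Laplace integral.\<close>

lemma extended_expo_plus:
  assumes s: "Re s \<ge> real b + 1"
  shows "extended (expo s) = Laplace_fun (plus_part H) s * \<Phi> (expo s)"
proof -
  have "P.dominated (nat \<lceil>norm s\<rceil>) (expo s)"
  proof (rule P.dominated_expo)
    fix t assume "plus_part H t \<noteq> 0"
    then have "t \<ge> 0" by (auto simp: plus_part_def split: if_splits)
    then show "- (Re s * t) \<le> - (real b * \<bar>t\<bar>)" using s mult_right_mono[of "real b" "Re s" t] by simp
  qed
  moreover have "decays (real b + 1) (\<lambda>x. smooth_step x * expo s x)"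
    unfolding decays_def
  proof (intro conjI allI smooth_step_parts(1) smooth_exp)
    fix n
    obtain A where A: "\<And>n x. norm (iter_deriv n smooth_step x) \<le> A n" using smooth_step(4) by metis
    define C where "C = (\<Sum>j\<le>n. real (n choose j) * A j * norm s ^ (n - j))"
    have C: "norm (iter_deriv n (\<lambda>x. smooth_step x * expo s x) x) \<le> C * exp (- (Re s * x))" for x
      unfolding C_def
      by (rule iter_deriv_mult_bound[OF smooth_step(1) smooth_exp A])
        (simp add: iter_deriv_exp norm_mult norm_power)
    have C0: "C \<ge> 0" using order_trans[OF norm_ge_zero C[of 0]] by simp
    have "norm (iter_deriv n (\<lambda>x. smooth_step x * expo s x) x) \<le> C * exp (- ((real b + 1) * \<bar>x\<bar>))" for x
    proof (cases "x < 0")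
      case False
      then have "(real b + 1) * x \<le> Re s * x" using s by (intro mult_right_mono) auto
      then show ?thesis using C0 False by (intro order_trans[OF C] mult_left_mono) auto
    qed (use step_mult_zero[of x n] C0 in simp)
    then show "\<exists>C. \<forall>x. norm (iter_deriv n (\<lambda>x. smooth_step x * expo s x) x) \<le> C * exp (- ((real b + 1) * \<bar>x\<bar>))" by blast
  qed
  ultimately have "extended (expo s) = \<Phi> (correlation (plus_part H) (expo s))" by (rule extended_eq_plus)
  then show ?thesis by (simp add: correlation_expo cmult[OF expo_in_Cexp])
qed

lemma extended_expo_minus:
  assumes s: "Re s \<le> - (real b + 1)"
  shows "extended (expo s) = - (Laplace_fun (minus_part H) s * \<Phi> (expo s))"
proof -
  have "N.dominated (nat \<lceil>norm s\<rceil>) (expo s)"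
  proof (rule N.dominated_expo)
    fix t assume "minus_part H t \<noteq> 0"
    then have "t < 0" by (auto simp: minus_part_def split: if_splits)
    then show "- (Re s * t) \<le> - (real b * \<bar>t\<bar>)" using s mult_right_mono_neg[of "Re s" "- real b" t] by simp
  qed
  moreover have "decays (real b + 1) (\<lambda>x. expo s x - smooth_step x * expo s x)"
    unfolding decays_def
  proof (intro conjI allI smooth_step_parts(2) smooth_exp)
    fix n
    obtain A where A: "\<And>n x. norm (iter_deriv n smooth_step x) \<le> A n" using smooth_step(4) by metis
    define C where "C = norm s ^ n + (\<Sum>j\<le>n. real (n choose j) * A j * norm s ^ (n - j))"
    have C: "norm (iter_deriv n (\<lambda>x. expo s x - smooth_step x * expo s x) x) \<le> C * exp (- (Re s * x))" for x
    proof -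
      have "norm (iter_deriv n (\<lambda>x. smooth_step x * expo s x) x)
          \<le> (\<Sum>j\<le>n. real (n choose j) * A j * norm s ^ (n - j)) * exp (- (Re s * x))"
        by (rule iter_deriv_mult_bound[OF smooth_step(1) smooth_exp A])
          (simp add: iter_deriv_exp norm_mult norm_power)
      moreover have "norm (iter_deriv n (expo s) x) = norm s ^ n * exp (- (Re s * x))"
        by (simp add: iter_deriv_exp norm_mult norm_power)
      ultimately show ?thesis
        unfolding iter_deriv_diff[OF smooth_exp smooth_step_parts(1)[OF smooth_exp]] C_def distrib_right
        by (intro order_trans[OF norm_triangle_ineq4]) linarith
    qed
    have C0: "C \<ge> 0" using order_trans[OF norm_ge_zero C[of 0]] by simp
    \<comment> \<open>The product does not yet vanish on \<open>{0..1}\<close>. There one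
      \<open>- Re s\<close> bounds the exponent \<open>- Re s * x\<close>, and a second one offsets
      the negative term \<open>Re s * \<bar>x\<bar>\<close>.\<close>
    have "norm (iter_deriv n (\<lambda>x. expo s x - smooth_step x * expo s x) x)
        \<le> (C * exp (2 * - Re s)) * exp (- ((real b + 1) * \<bar>x\<bar>))" for x
    proof (cases "x > 1")
      case False
      have "- (Re s * x) \<le> 2 * - Re s + Re s * \<bar>x\<bar>"
      proof (cases "x \<ge> 0")
        case True
        then have "(- Re s) * x \<le> (- Re s) * 1" using False s by (intro mult_left_mono) auto
        then show ?thesis using True by (simp add: mult.commute)
      qed (use s in auto)
      also have "Re s * \<bar>x\<bar> \<le> - ((real b + 1) * \<bar>x\<bar>)" using mult_right_mono[OF s abs_ge_zero[of x]]
        by (simp only: mult_minus_left)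
      finally have "exp (- (Re s * x)) \<le> exp (2 * - Re s) * exp (- ((real b + 1) * \<bar>x\<bar>))"
        by (simp add: mult_exp_exp)
      then show ?thesis unfolding mult.assoc using C0 by (intro order_trans[OF C] mult_left_mono)
    qed (use step_remainder_zero[of x n] C0 in simp)
    then show "\<exists>C. \<forall>x. norm (iter_deriv n (\<lambda>x. expo s x - smooth_step x * expo s x) x) \<le> C * exp (- ((real b + 1) * \<bar>x\<bar>))" by blast
  qed
  ultimately have "extended (expo s) = - \<Phi> (correlation (minus_part H) (expo s))" by (rule extended_eq_minus)
  then show ?thesis by (simp add: correlation_expo cmult[OF expo_in_Cexp])
qed

text \<open>The choice in \<^const>\<open>Laplace_distr\<close> is harmless because test functions are dense.\<close>

lemma Laplace_distr_eq: "Laplace_distr (conv_distr (plus_part H) \<Phi>) = Laplace_functional extended"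
proof -
  define \<Psi> where "\<Psi> = (SOME \<Psi>. \<Psi> \<in> top_dual Cexp_top \<and> (\<forall>g\<in>test_functions. \<Psi> g = conv_distr (plus_part H) \<Phi> g))"
  have "extended \<in> top_dual Cexp_top \<and> (\<forall>g\<in>test_functions. extended g = conv_distr (plus_part H) \<Phi> g)"
    by (simp add: exp_functional_imp_top_dual[OF exp_functional_extended] extended_test)
  then have "\<Psi> \<in> top_dual Cexp_top \<and> (\<forall>g\<in>test_functions. \<Psi> g = conv_distr (plus_part H) \<Phi> g)"
    unfolding \<Psi>_def
    by (rule someI[where P = "\<lambda>\<Psi>. \<Psi> \<in> top_dual Cexp_top \<and>
          (\<forall>g\<in>test_functions. \<Psi> g = conv_distr (plus_part H) \<Phi> g)"])
  then have \<Psi>: "\<Psi> \<in> top_dual Cexp_top" "\<And>g. g \<in> test_functions \<Longrightarrow> \<Psi> g = extended g"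
    by (simp_all add: extended_test)
  have "\<Psi> (expo s) = extended (expo s)" for s
  proof (rule LIMSEQ_unique)
    show "(\<lambda>N. \<Psi> (\<lambda>x. cutoff N x * expo s x)) \<longlonglongrightarrow> \<Psi> (expo s)"
      by (intro exp_functional.cutoff_tendsto top_dual_imp_exp_functional \<Psi> expo_in_Cexp)
    show "(\<lambda>N. \<Psi> (\<lambda>x. cutoff N x * expo s x)) \<longlonglongrightarrow> extended (expo s)"
      using exp_functional.cutoff_tendsto[OF exp_functional_extended expo_in_Cexp]
      by (simp add: \<Psi>(2)[OF cutoff_test_function[OF smooth_exp]])
  qed
  then show ?thesis
    unfolding Laplace_distr_def \<Psi>_def[symmetric] by (simp add: Laplace_functional_def fun_eq_iff)
qed

theorem carleman_numerator:
  shows "Laplace_distr (conv_distr (plus_part H) \<Phi>) holomorphic_on UNIV"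
    and "Re s \<ge> real b + 1 \<Longrightarrow> Laplace_distr (conv_distr (plus_part H) \<Phi>) s =
       Laplace_fun (plus_part H) s * Laplace_functional \<Phi> s"
    and "Re s \<le> - (real b + 1) \<Longrightarrow> Laplace_distr (conv_distr (plus_part H) \<Phi>) s =
       - (Laplace_fun (minus_part H) s * Laplace_functional \<Phi> s)"
  using exp_functional.laplace_functional_entire[OF exp_functional_extended]
    extended_expo_plus extended_expo_minus
  unfolding Laplace_distr_eq by (simp_all add: Laplace_functional_def)

end

section \<open>Annihilators of mean-periodic functions\<close>

text \<open>Bound and interval are explicit parameters because pieces of shrinking length have to
  obey estimates with one common \<open>M\<close>.\<close>

definition bounded_support :: "real \<Rightarrow> real \<Rightarrow> real \<Rightarrow> (real \<Rightarrow> complex) \<Rightarrow> bool" where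
  "bounded_support M a b u \<longleftrightarrow> u \<in> borel_measurable lebesgue \<and> (\<forall>t. norm (u t) \<le> M * indicator {a..b} t)"

lemma bounded_support_zero: "bounded_support M a b u \<Longrightarrow> t \<notin> {a..b} \<Longrightarrow> u t = 0"
  unfolding bounded_support_def by (metis indicator_simps(2) mult_zero_right norm_le_zero_iff)

lemma bounded_support_integrable:
  assumes u: "bounded_support M a b u" and k: "k \<in> borel_measurable lebesgue"
    and le: "\<And>t. t \<in> {a..b} \<Longrightarrow> norm (k t) \<le> C" and ab: "a \<le> b"
  shows "integrable lebesgue (\<lambda>t. u t * k t)" "norm (LINT t|lebesgue. u t * k t) \<le> M * C * (b - a)"
proof -
  have C: "C \<ge> 0" using order_trans[OF norm_ge_zero le[of a]] ab by simp
  have b: "norm (u t * k t) \<le> (M * C) * indicator {a..b} t" for t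
  proof (cases "t \<in> {a..b}")
    case True
    have "norm (u t) \<le> M" using u True unfolding bounded_support_def by (metis indicator_simps(1) mult.right_neutral)
    then have "norm (u t) * norm (k t) \<le> M * C" using le[OF True]
      by (intro mult_mono) (auto intro: order_trans[OF norm_ge_zero])
    then show ?thesis using True by (simp add: norm_mult)
  qed (simp add: bounded_support_zero[OF u])
  have i: "integrable lebesgue (\<lambda>t. (M * C) * indicator {a..b} t :: real)"
    by (intro integrable_mult_right integrable_real_indicator) (auto simp: emeasure_lborel_Icc_eq)
  have m: "(\<lambda>t. u t * k t) \<in> borel_measurable lebesgue"
    using u k by (intro borel_measurable_times) (auto simp: bounded_support_def)
  show 1: "integrable lebesgue (\<lambda>t. u t * k t)"
    by (rule Bochner_Integration.integrable_bound[OF i m]) (use b in \<open>auto intro!: AE_I2 order_trans[OF b]\<close>)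
  have "norm (LINT t|lebesgue. u t * k t) \<le> (LINT t|lebesgue. norm (u t * k t))" by (rule integral_norm_bound)
  also have "\<dots> \<le> (LINT t|lebesgue. (M * C) * indicator {a..b} t)"
    by (intro integral_mono integrable_norm 1 i b)
  also have "\<dots> = M * C * (b - a)" using ab by simp
  finally show "norm (LINT t|lebesgue. u t * k t) \<le> M * C * (b - a)" .
qed

lemma continuous_shift_lebesgue_measurable:
  "continuous_on UNIV k \<Longrightarrow> (\<lambda>t. k (t + y)) \<in> borel_measurable lebesgue"
  for k :: "real \<Rightarrow> complex"
  by (rule borel_imp_lebesgue_measurable, rule measurable_compose[OF _ borel_measurable_continuous_onI]) simp_all

lemma continuous_bounded_on_interval:
  fixes k :: "real \<Rightarrow> complex"
  assumes "continuous_on UNIV k"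
  shows "\<exists>C. \<forall>x\<in>{a..b}. norm (k x) \<le> C"
proof -
  have "compact (k ` {a..b})"
    by (intro compact_continuous_image continuous_on_subset[OF assms]) auto
  from compact_imp_bounded[OF this] show ?thesis unfolding bounded_iff by blast
qed

lemma correlation_integrable:
  assumes u: "bounded_support M a b u" and k: "continuous_on UNIV k" and ab: "a \<le> b"
  shows "integrable lebesgue (\<lambda>t. u t * k (t + y))"
proof -
  obtain C where C: "\<forall>x\<in>{a + y..b + y}. norm (k x) \<le> C" using continuous_bounded_on_interval[OF k] by blast
  show ?thesis
    by (rule bounded_support_integrable(1)[OF u continuous_shift_lebesgue_measurable[OF k] _ ab, of _ C]) (use C in auto)
qed

lemma correlation_continuous:
  assumes u: "bounded_support M a b u" and k: "continuous_on UNIV k" and ab: "a \<le> b"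
  shows "continuous_on UNIV (correlation u k)"
proof (rule continuous_at_imp_continuous_on, rule ballI)
  fix y
  obtain C where C: "\<forall>x\<in>{a + y - 1..b + y + 1}. norm (k x) \<le> C" using continuous_bounded_on_interval[OF k] by blast
  have C0: "C \<ge> 0" using C[rule_format, of "a + y"] ab by (auto intro: order_trans[OF norm_ge_zero])
  have "((\<lambda>z. LINT t|lebesgue. u t * k (t + z)) \<longlongrightarrow> (LINT t|lebesgue. u t * k (t + y))) (at y)"
  proof (rule integral_dominated_convergence_at[where d = 1 and b = "\<lambda>t. norm (u t) * C"])
    have m: "u \<in> borel_measurable lebesgue" using u by (simp add: bounded_support_def)
    show "(\<lambda>t. u t * k (t + z)) \<in> borel_measurable lebesgue" for z
      by (intro borel_measurable_times m continuous_shift_lebesgue_measurable k)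
    then show "(\<lambda>t. u t * k (t + y)) \<in> borel_measurable lebesgue" .
    show "((\<lambda>z. u t * k (t + z)) \<longlongrightarrow> u t * k (t + y)) (at y)" for t
    proof -
      have "continuous_on UNIV (\<lambda>z. u t * k (t + z))"
        by (intro continuous_intros continuous_on_compose2[OF k]) auto
      then show ?thesis by (simp add: continuous_on_eq_continuous_at isCont_def)
    qed
    show "norm (u t * k (t + z)) \<le> norm (u t) * C" if "z \<noteq> y" "dist z y < 1" for z t
    proof (cases "t \<in> {a..b}")
      case True
      then have "t + z \<in> {a + y - 1..b + y + 1}" using that(2) by (auto simp: dist_real_def)
      with C show ?thesis by (simp add: norm_mult mult_left_mono)
    qed (use bounded_support_zero[OF u] in simp)
    have "integrable lebesgue (\<lambda>t. u t * complex_of_real C)"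
      by (rule bounded_support_integrable(1)[OF u, of _ C]) (use C0 ab in auto)
    from integrable_norm[OF this] show "integrable lebesgue (\<lambda>t. norm (u t) * C)"
      using C0 by (simp add: norm_mult)
  qed simp
  then show "isCont (correlation u k) y" by (simp add: isCont_def correlation_def[abs_def])
qed

lemma
  assumes u: "bounded_support M a b u" and k: "smooth k" and ab: "a \<le> b"
  shows smooth_correlation_bounded_support: "smooth (correlation u k)"
    and iter_deriv_correlation_bounded_support: "iter_deriv n (correlation u k) = correlation u (iter_deriv n k)"
proof -
  have "integrable lebesgue (\<lambda>t. u t * 1)"
    by (rule bounded_support_integrable(1)[OF u, of _ 1]) (use ab in auto)
  then interpret weighted_function u 0
    using u by unfold_locales (auto simp: bounded_support_def)
  have "admissible k"
    unfolding admissible_def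
  proof (intro conjI allI k)
    fix n R
    obtain C where C: "\<forall>x\<in>{a - R..b + R}. norm (iter_deriv n k x) \<le> C"
      using continuous_bounded_on_interval[OF smooth_continuous_on[OF k]] by blast
    have "norm (iter_deriv n k (t + y)) \<le> C" if "u t \<noteq> 0" "\<bar>y\<bar> \<le> R" for t y
    proof -
      have "t \<in> {a..b}" using bounded_support_zero[OF u, of t] that(1) by blast
      then show ?thesis using that(2) by (intro C[rule_format]) auto
    qed
    then show "\<exists>C. \<forall>t y. u t \<noteq> 0 \<longrightarrow> \<bar>y\<bar> \<le> R \<longrightarrow> norm (iter_deriv n k (t + y)) \<le> C * exp (- (0 * \<bar>t\<bar>))"
      by auto
  qed
  then show "smooth (correlation u k)" "iter_deriv n (correlation u k) = correlation u (iter_deriv n k)"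
    by (rule smooth_correlation iter_deriv_correlation)+
qed

text \<open>A piece of width \<open>2 * h\<close> around \<open>- v\<close> acts like its mass
  placed at \<open>- v\<close>. The error carries the width besides the oscillation of
  \<open>k\<close>, so it is small compared with \<open>h\<close>, as a derivative requires.\<close>

lemma correlation_concentrated:
  assumes u: "bounded_support M (- v - h) (- v + h) u" and k: "continuous_on UNIV k" and h: "h > 0"
    and osc: "\<And>t. t \<in> {- v - h..- v + h} \<Longrightarrow> norm (k (t + y) - k (y - v)) \<le> \<eta>"
  shows "norm (correlation u k y - (LINT t|lebesgue. u t) * k (y - v)) \<le> M * \<eta> * (2 * h)"
proof -
  have ab: "- v - h \<le> - v + h" using h by simp
  have 1: "integrable lebesgue (\<lambda>t. u t * k (t + y))" by (rule correlation_integrable[OF u k ab])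
  have 2: "integrable lebesgue (\<lambda>t. u t * k (y - v))"
    by (rule bounded_support_integrable(1)[OF u, of _ "norm (k (y - v))"]) (use ab in auto)
  have "correlation u k y - (LINT t|lebesgue. u t) * k (y - v) =
      (LINT t|lebesgue. u t * k (t + y)) - (LINT t|lebesgue. u t * k (y - v))"
    by (simp add: correlation_def)
  also have "\<dots> = (LINT t|lebesgue. u t * (k (t + y) - k (y - v)))"
    by (subst Bochner_Integration.integral_diff[OF 1 2, symmetric]) (simp add: right_diff_distrib)
  also have "norm \<dots> \<le> M * \<eta> * ((- v + h) - (- v - h))"
    by (rule bounded_support_integrable(2)[OF u _ osc ab])
      (intro borel_measurable_diff continuous_shift_lebesgue_measurable k borel_measurable_const, simp)
  finally show ?thesis by (simp add: algebra_simps)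
qed

lemma lebesgue_integral_reflect:
  fixes f :: "real \<Rightarrow> complex"
  assumes "f \<in> borel_measurable borel"
  shows "(LINT t|lebesgue. f (- t)) = (LINT t|lebesgue. f t)"
proof -
  have "(\<lambda>t. f (- t)) \<in> borel_measurable borel" by (intro measurable_compose[OF _ assms]) simp
  then show ?thesis
    using lborel_integral_real_affine[of "-1" f 0] assms by (simp add: integral_completion)
qed

text \<open>
  If \<open>\<phi>\<close> annihilates the translates of \<open>k\<close> then \<open>v \<mapsto> \<phi> (correlation (u \<cdot> 1\<^bsub>[-v,\<infinity>)\<^esub>) k)\<close> has derivative
  zero; this replaces the interchange of \<open>\<phi>\<close> with an integral.
\<close>

lemma functional_annihilates_correlation:
  fixes \<phi> :: "(real \<Rightarrow> complex) \<Rightarrow> complex"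
  assumes lin: "\<And>f g a b. f \<in> V \<Longrightarrow> g \<in> V \<Longrightarrow> \<phi> (\<lambda>x. a * f x + b * g x) = a * \<phi> f + b * \<phi> g"
    and k: "continuous_on UNIV k" and V: "\<And>M a b u. bounded_support M a b u \<Longrightarrow> a \<le> b \<Longrightarrow> correlation u k \<in> V"
    and shift: "\<And>v. (\<lambda>y. k (y - v)) \<in> V" "\<And>v. \<phi> (\<lambda>y. k (y - v)) = 0"
    and small: "\<And>v M \<epsilon>. \<epsilon> > 0 \<Longrightarrow> M > 0 \<Longrightarrow> \<exists>\<delta>>0. \<forall>h u. 0 < h \<longrightarrow> h < \<delta> \<longrightarrow>
      bounded_support M (- v - h) (- v + h) u \<longrightarrow>
      norm (\<phi> (\<lambda>y. correlation u k y - (LINT t|lebesgue. u t) * k (y - v))) \<le> \<epsilon> * h"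
    and u: "bounded_support M (- T) T u" and T: "T > 0"
  shows "\<phi> (correlation u k) = 0"
proof -
  \<comment> \<open>\<open>M\<close> may fail to be positive, whereas the smallness hypothesis asks
    for a positive bound.\<close>
  define M' where "M' = \<bar>M\<bar> + 1"
  have M': "M' > 0" by (simp add: M'_def)
  have nu: "norm (u t) \<le> M' * indicator {- T..T} t" for t
  proof -
    have "norm (u t) \<le> M * indicator {- T..T} t" using u by (simp add: bounded_support_def)
    also have "\<dots> \<le> M' * indicator {- T..T} t" unfolding M'_def by (intro mult_right_mono) auto
    finally show ?thesis .
  qed
  have mu: "u \<in> borel_measurable lebesgue" using u by (simp add: bounded_support_def)
  define U where "U v t = indicator {- v..} t * u t" for v t
  have mI: "(\<lambda>t. indicator A t :: complex) \<in> borel_measurable lebesgue" if "A \<in> sets borel" for A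
    using that by (intro borel_imp_lebesgue_measurable borel_measurable_indicator)
  have bU: "bounded_support M' (- T) T (U v)" for v
    unfolding bounded_support_def
  proof (intro conjI allI)
    show "U v \<in> borel_measurable lebesgue"
      unfolding U_def[abs_def] by (intro borel_measurable_times mI mu) simp
    have "norm (U v t) \<le> norm (u t)" for t by (simp add: U_def indicator_def)
    then show "norm (U v t) \<le> M' * indicator {- T..T} t" for t using nu order_trans by blast
  qed
  have TT: "- T \<le> T" using T by simp
  note intU = correlation_integrable[OF bU k TT]
  have d: "\<exists>\<delta>>0. \<forall>v'. \<bar>v' - v\<bar> < \<delta> \<longrightarrow> norm (\<phi> (correlation (U v') k) - \<phi> (correlation (U v) k)) \<le> \<epsilon> * \<bar>v' - v\<bar>"
    if \<epsilon>: "\<epsilon> > 0" for v \<epsilon>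
  proof -
    obtain \<delta> where \<delta>: "\<delta> > 0" "\<And>h u. 0 < h \<Longrightarrow> h < \<delta> \<Longrightarrow> bounded_support M' (- v - h) (- v + h) u \<Longrightarrow>
      norm (\<phi> (\<lambda>y. correlation u k y - (LINT t|lebesgue. u t) * k (y - v))) \<le> \<epsilon> * h"
      using small[OF \<epsilon> M'] by blast
    have "norm (\<phi> (correlation (U v') k) - \<phi> (correlation (U v) k)) \<le> \<epsilon> * \<bar>v' - v\<bar>" if v': "\<bar>v' - v\<bar> < \<delta>" for v'
    proof (cases "v' = v")
      case False
      \<comment> \<open>The two truncations differ only between \<open>- v\<close> and
        \<open>- v'\<close>, so the difference is supported within distance
        \<open>\<bar>v' - v\<bar>\<close> of \<open>- v\<close>.\<close>
      define w where "w t = U v' t - U v t" for t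
      have bw: "bounded_support M' (- v - \<bar>v' - v\<bar>) (- v + \<bar>v' - v\<bar>) w"
        unfolding bounded_support_def
      proof (intro conjI allI)
        show "w \<in> borel_measurable lebesgue"
          unfolding w_def[abs_def] using bU by (intro borel_measurable_diff) (auto simp: bounded_support_def)
        fix t
        have "norm (u t) \<le> M'" using nu[of t] M' by (cases "t \<in> {- T..T}") auto
        then show "norm (w t) \<le> M' * indicator {- v - \<bar>v' - v\<bar>..- v + \<bar>v' - v\<bar>} t"
          using M' by (auto simp: w_def U_def indicator_def)
      qed
      have ab: "- v - \<bar>v' - v\<bar> \<le> - v + \<bar>v' - v\<bar>" by simp
      have cw: "correlation w k = (\<lambda>y. 1 * correlation (U v') k y + (-1) * correlation (U v) k y)"
        unfolding correlation_def w_def using intU by (simp add: left_diff_distrib)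
      have "\<phi> (correlation w k) = \<phi> (correlation (U v') k) - \<phi> (correlation (U v) k)"
        unfolding cw lin[OF V[OF bU TT] V[OF bU TT]] by simp
      \<comment> \<open>Subtracting a multiple of a translate of \<open>k\<close> is free, since
        \<open>\<phi>\<close> annihilates it; this brings in the smallness hypothesis.\<close>
      moreover have "\<phi> (\<lambda>y. correlation w k y - (LINT t|lebesgue. w t) * k (y - v)) = \<phi> (correlation w k)"
        using lin[OF V[OF bw ab] shift(1)[of v], of 1 "- (LINT t|lebesgue. w t)"] shift(2)[of v] by simp
      ultimately show ?thesis using \<delta>(2)[OF _ v' bw] False by simp
    qed simp
    with \<delta>(1) show ?thesis by blast
  qed
  have deriv: "((\<lambda>v. \<phi> (correlation (U v) k)) has_derivative (\<lambda>h. 0)) (at v)" for v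
    unfolding has_derivative_at_alt
  proof (intro conjI allI impI)
    fix e :: real assume "0 < e"
    from d[OF this, of v] obtain \<delta> where "\<delta> > 0"
      "\<And>v'. \<bar>v' - v\<bar> < \<delta> \<Longrightarrow> norm (\<phi> (correlation (U v') k) - \<phi> (correlation (U v) k)) \<le> e * \<bar>v' - v\<bar>" by blast
    then show "\<exists>d>0. \<forall>y. norm (y - v) < d \<longrightarrow>
        norm (\<phi> (correlation (U y) k) - \<phi> (correlation (U v) k) - 0) \<le> e * norm (y - v)"
      by (intro exI[of _ \<delta>]) auto
  qed auto
  have const: "\<exists>c. \<forall>v\<in>UNIV. \<phi> (correlation (U v) k) = c"
    by (rule has_derivative_zero_constant) (use deriv in auto)
  \<comment> \<open>At \<open>v = T\<close> nothing is cut off. At \<open>v = - T - 1\<close> the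
    half-line starts at \<open>T + 1\<close>; starting at \<open>T\<close> would leave the endpoint
    of the support.\<close>
  have "\<phi> (correlation (U T) k) = \<phi> (correlation (U (- T - 1)) k)" using const by (metis UNIV_I)
  also have "U (- T - 1) = (\<lambda>_. 0)"
    using bounded_support_zero[OF u] by (auto simp: U_def indicator_def fun_eq_iff)
  also have "correlation (\<lambda>_. 0) k = (\<lambda>y. 0 * k (y - 0) + 0 * k (y - 0))" by (simp add: correlation_def fun_eq_iff)
  also have "\<phi> \<dots> = 0" using lin[OF shift(1)[of 0] shift(1)[of 0], of 0 0] by simp
  also have "U T = u"
    using bounded_support_zero[OF u] by (auto simp: U_def indicator_def fun_eq_iff)
  finally show ?thesis .
qed

text \<open>Exchanges the roles: the compactly supported \<open>g\<close> becomes the weight that is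
  cut into pieces, and the reflected \<open>H\<close> the kernel whose translates are
  annihilated.\<close>

lemma correlation_commute:
  assumes H: "continuous_on UNIV H" and g: "continuous_on UNIV g"
  shows "correlation (\<lambda>t. g (- t)) (\<lambda>z. H (- z)) y = correlation H g y"
proof -
  have mH: "H \<in> borel_measurable borel" and mg: "g \<in> borel_measurable borel"
    using H g by (auto intro: borel_measurable_continuous_onI)
  note [measurable] = mH mg
  have m1: "(\<lambda>t. g t * H (t - y)) \<in> borel_measurable borel" by measurable
  have m2: "(\<lambda>t. H t * g (t + y)) \<in> borel_measurable borel" by measurable
  have "correlation (\<lambda>t. g (- t)) (\<lambda>z. H (- z)) y = (LINT t|lebesgue. (\<lambda>t. g t * H (t - y)) (- t))"
    by (simp add: correlation_def algebra_simps)
  also have "\<dots> = (LINT t|lebesgue. g t * H (t - y))" by (rule lebesgue_integral_reflect[OF m1])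
  also have "\<dots> = (LINT t|lebesgue. (\<lambda>t. g t * H (t - y)) (t + y))" by (rule lebesgue_integral_translate[OF m1, symmetric])
  finally show ?thesis by (simp add: correlation_def mult.commute)
qed

lemma test_function_reflect_bounded_support:
  assumes g: "g \<in> test_functions"
  obtains M T where "T > 0" "bounded_support M (- T) T (\<lambda>t. g (- t))"
proof -
  obtain K where K: "compact K" "\<And>x. x \<notin> K \<Longrightarrow> g x = 0" using g by (auto simp: test_functions_def)
  obtain T where T: "T > 0" "\<And>x. x \<in> K \<Longrightarrow> norm x \<le> T"
    using compact_imp_bounded[OF K(1)] unfolding bounded_pos by blast
  have sm: "smooth g" using g by (simp add: test_functions_def)
  obtain C where C: "\<forall>x\<in>{-T..T}. norm (g x) \<le> C"
    using continuous_bounded_on_interval[OF smooth_continuous_on[OF sm, of UNIV 0], of "-T" T]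
    unfolding iter_deriv_0 by blast
  have z: "g x = 0" if "\<bar>x\<bar> > T" for x using K(2)[of x] T(2)[of x] that by force
  have "smooth (\<lambda>t. g (- t))" using smooth_affine[OF sm, of "-1" 0] by simp
  then have "(\<lambda>t. g (- t)) \<in> borel_measurable lebesgue"
    by (intro borel_imp_lebesgue_measurable smooth_borel_measurable(2))
  then have "bounded_support C (- T) T (\<lambda>t. g (- t))"
    unfolding bounded_support_def using C z by (auto simp: indicator_def abs_if split: if_splits)
  with T(1) that show ?thesis by blast
qed

subsection \<open>Continuous and smooth functions\<close>

text \<open>
  \<open>S\<close> is the set of orders of the derivatives that enter the seminorms: \<open>{0}\<close> for continuous and
  \<open>UNIV\<close> for smooth functions.
\<close>

lemma local_dual_bound:
  assumes \<phi>: "\<phi> \<in> top_dual (seminorm_topology V P)" and "P \<noteq> {}"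
    and V: "\<And>f g a b. f \<in> V \<Longrightarrow> g \<in> V \<Longrightarrow> (\<lambda>x. a * f x + b * g x) \<in> V"
    and P: "\<And>p. p \<in> P \<Longrightarrow> is_seminorm V p"
    and loc: "\<And>p. p \<in> P \<Longrightarrow> \<exists>n\<in>S. \<exists>R. \<forall>g\<in>V. \<forall>M. (\<forall>x. \<bar>x\<bar> \<le> R \<longrightarrow> norm (iter_deriv n g x) \<le> M) \<longrightarrow> p g \<le> M"
  obtains C R S' where "C \<ge> 0" "finite S'" "S' \<subseteq> S" "\<And>g M. g \<in> V \<Longrightarrow>
     (\<And>n x. n \<in> S' \<Longrightarrow> \<bar>x\<bar> \<le> R \<Longrightarrow> norm (iter_deriv n g x) \<le> M) \<Longrightarrow> norm (\<phi> g) \<le> C * M"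
proof -
  have top: "topspace (seminorm_topology V P) = V" by (rule topspace_seminorm_topology) fact
  have lin: "\<phi> (\<lambda>x. a * f x + b * g x) = a * \<phi> f + b * \<phi> g" if "f \<in> V" "g \<in> V" for f g a b
    using \<phi> that by (auto simp: top_dual_def top)
  obtain P' C where P': "finite P'" "P' \<subseteq> P" "C \<ge> 0" "\<And>g. g \<in> V \<Longrightarrow> norm (\<phi> g) \<le> C * (\<Sum>p\<in>P'. p g)"
  proof (rule continuous_homogeneous_bound[of V P "\<lambda>f. norm (\<phi> f)"])
    have "continuous_map euclidean euclideanreal (norm :: complex \<Rightarrow> real)"
      by (simp add: continuous_on_norm)
    from continuous_map_compose[OF _ this, of "seminorm_topology V P" \<phi>] \<phi>
    show "continuous_map (seminorm_topology V P) euclideanreal (\<lambda>f. norm (\<phi> f))"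
      by (simp add: top_dual_def o_def)
    show "norm (\<phi> (\<lambda>x. c * f x)) = norm c * norm (\<phi> f)" if "f \<in> V" for c f
      using lin[OF that that, of c 0] by (simp add: norm_mult)
  qed (use assms in auto)
  obtain n R where nR: "\<And>p. p \<in> P' \<Longrightarrow> n p \<in> S" "\<And>p g M. p \<in> P' \<Longrightarrow> g \<in> V \<Longrightarrow>
      (\<And>x. \<bar>x\<bar> \<le> R p \<Longrightarrow> norm (iter_deriv (n p) g x) \<le> M) \<Longrightarrow> p g \<le> M"
    using loc P'(2) by (metis subsetD)
  \<comment> \<open>One window for all the finitely many seminorms; the absolute values let the sum
    dominate each term.\<close>
  define R' where "R' = (\<Sum>p\<in>P'. \<bar>R p\<bar>)"
  have R': "R p \<le> R'" if "p \<in> P'" for p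
    unfolding R'_def using member_le_sum[OF that, of "\<lambda>p. \<bar>R p\<bar>"] P'(1) by simp
  show ?thesis
  proof (rule that[of "C * card P'" "n ` P'" R'])
    fix g M assume g: "g \<in> V" and le: "\<And>m x. m \<in> n ` P' \<Longrightarrow> \<bar>x\<bar> \<le> R' \<Longrightarrow> norm (iter_deriv m g x) \<le> M"
    have "p g \<le> M" if "p \<in> P'" for p
    proof (rule nR(2)[OF that g])
      fix x assume "\<bar>x\<bar> \<le> R p"
      then show "norm (iter_deriv (n p) g x) \<le> M" using le[of "n p" x] that R'[OF that] by simp
    qed
    then have "(\<Sum>p\<in>P'. p g) \<le> card P' * M" using sum_bounded_above[of P' "\<lambda>p. p g" M] by simp
    then have "C * (\<Sum>p\<in>P'. p g) \<le> C * (card P' * M)" using P'(3) by (rule mult_left_mono)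
    with P'(4)[OF g] show "norm (\<phi> g) \<le> C * card P' * M" by simp
  qed (use P' nR in auto)
qed

section \<open>Seminorms given by suprema over compact sets\<close>

lemma is_seminorm_SUP:
  assumes add: "\<And>f g x. f \<in> V \<Longrightarrow> g \<in> V \<Longrightarrow> L (\<lambda>x. f x + g x) x = L f x + L g x"
    and cmult: "\<And>f c x. f \<in> V \<Longrightarrow> L (\<lambda>x. c * f x) x = c * (L f x :: complex)"
    and bdd: "\<And>f. f \<in> V \<Longrightarrow> bdd_above ((\<lambda>x. norm (L f x)) ` K)" and "K \<noteq> {}"
  shows "is_seminorm V (\<lambda>f. SUP x\<in>K. norm (L f x))"
  unfolding is_seminorm_def
proof (intro conjI ballI allI)
  fix f g assume f: "f \<in> V" and g: "g \<in> V"
  show "(SUP x\<in>K. norm (L (\<lambda>x. f x + g x) x)) \<le> (SUP x\<in>K. norm (L f x)) + (SUP x\<in>K. norm (L g x))"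
    unfolding add[OF f g]
    by (intro cSUP_least \<open>K \<noteq> {}\<close> order_trans[OF norm_triangle_ineq] add_mono cSUP_upper bdd f g)
next
  fix f and c :: complex assume f: "f \<in> V"
  have "(SUP x\<in>K. norm c * norm (L f x)) = norm c * (SUP x\<in>K. norm (L f x))"
  proof (cases "c = 0")
    case False
    show ?thesis
    proof (rule antisym)
      show "(SUP x\<in>K. norm c * norm (L f x)) \<le> norm c * (SUP x\<in>K. norm (L f x))"
        by (intro cSUP_least \<open>K \<noteq> {}\<close> mult_left_mono cSUP_upper bdd f) auto
      obtain B where B: "\<And>x. x \<in> K \<Longrightarrow> norm (L f x) \<le> B" using bdd[OF f] by (auto simp: bdd_above_def)
      have "(SUP x\<in>K. norm (L f x)) \<le> (SUP x\<in>K. norm c * norm (L f x)) / norm c"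
      proof (rule cSUP_least[OF \<open>K \<noteq> {}\<close>])
        fix x assume x: "x \<in> K"
        have "bdd_above ((\<lambda>x. norm c * norm (L f x)) ` K)"
          using B by (intro bdd_aboveI2[where M = "norm c * B"] mult_left_mono) auto
        then have "norm c * norm (L f x) \<le> (SUP x\<in>K. norm c * norm (L f x))" using x by (intro cSUP_upper)
        then show "norm (L f x) \<le> (SUP x\<in>K. norm c * norm (L f x)) / norm c" using False by (simp add: field_simps)
      qed
      then show "norm c * (SUP x\<in>K. norm (L f x)) \<le> (SUP x\<in>K. norm c * norm (L f x))"
        using False by (simp add: field_simps)
    qed
  qed (use \<open>K \<noteq> {}\<close> in simp)
  then show "(SUP x\<in>K. norm (L (\<lambda>x. c * f x) x)) = norm c * (SUP x\<in>K. norm (L f x))"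
    by (simp add: cmult[OF f] norm_mult)
qed

lemma compact_SUP_le:
  assumes "compact K" "K \<noteq> {}"
  shows "\<exists>R. \<forall>L :: real \<Rightarrow> complex. \<forall>M. (\<forall>x. \<bar>x\<bar> \<le> R \<longrightarrow> norm (L x) \<le> M) \<longrightarrow> (SUP x\<in>K. norm (L x)) \<le> M"
proof -
  obtain R where R: "\<And>x. x \<in> K \<Longrightarrow> \<bar>x\<bar> \<le> R" using compact_imp_bounded[OF assms(1)] by (auto simp: bounded_iff)
  then show ?thesis using assms(2) by (intro exI[of _ R] allI impI cSUP_least) auto
qed

lemma bdd_above_norm_compact:
  fixes k :: "real \<Rightarrow> complex"
  assumes "continuous_on UNIV k" "compact K"
  shows "bdd_above ((\<lambda>x. norm (k x)) ` K)"
  by (intro compact_imp_bounded[THEN bounded_imp_bdd_above] compact_continuous_image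
      continuous_on_subset[OF continuous_on_norm[OF assms(1)]] assms(2)) auto

lemma topspace_C_top: "topspace C_top = {f. continuous_on UNIV f}"
  unfolding C_top_def by (rule topspace_seminorm_topology) (use compact_sing in blast)

lemma topspace_Cinf_top: "topspace Cinf_top = {f. smooth f}"
  unfolding Cinf_top_def by (rule topspace_seminorm_topology) (use compact_sing in blast)

lemma C_dual_bound:
  assumes "\<phi> \<in> top_dual C_top"
  obtains C R S' where "C \<ge> 0" "finite S'" "S' \<subseteq> {0::nat}" "\<And>g M. continuous_on UNIV g \<Longrightarrow>
     (\<And>n x. n \<in> S' \<Longrightarrow> \<bar>x\<bar> \<le> R \<Longrightarrow> norm (iter_deriv n g x) \<le> M) \<Longrightarrow> norm (\<phi> g) \<le> C * M"
proof (rule local_dual_bound[where S = "{0}", OF assms[unfolded C_top_def]])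
  show "{\<lambda>f :: real \<Rightarrow> complex. SUP x\<in>K. norm (f x) | K. compact K \<and> K \<noteq> {}} \<noteq> {}" using compact_sing by blast
  fix p assume "p \<in> {\<lambda>f :: real \<Rightarrow> complex. SUP x\<in>K. norm (f x) | K. compact K \<and> K \<noteq> {}}"
  then obtain K where K: "compact K" "K \<noteq> {}" "p = (\<lambda>f. SUP x\<in>K. norm (f x))" by blast
  show "is_seminorm {f. continuous_on UNIV f} p"
    unfolding K(3) using K(1,2) by (intro is_seminorm_SUP[where L = "\<lambda>f. f"] bdd_above_norm_compact) auto
  show "\<exists>n\<in>{0}. \<exists>R. \<forall>g\<in>{f. continuous_on UNIV f}. \<forall>M. (\<forall>x. \<bar>x\<bar> \<le> R \<longrightarrow> norm (iter_deriv n g x) \<le> M) \<longrightarrow> p g \<le> M"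
    using compact_SUP_le[OF K(1,2)] unfolding K(3) by (metis insertI1 iter_deriv_0)
qed (use that in \<open>auto intro!: continuous_intros\<close>)

lemma Cinf_dual_bound:
  assumes "\<phi> \<in> top_dual Cinf_top"
  obtains C R S' where "C \<ge> 0" "finite S'" "S' \<subseteq> (UNIV :: nat set)" "\<And>g M. smooth g \<Longrightarrow>
     (\<And>n x. n \<in> S' \<Longrightarrow> \<bar>x\<bar> \<le> R \<Longrightarrow> norm (iter_deriv n g x) \<le> M) \<Longrightarrow> norm (\<phi> g) \<le> C * M"
proof (rule local_dual_bound[where S = UNIV, OF assms[unfolded Cinf_top_def]])
  show "{\<lambda>f. SUP x\<in>K. norm (iter_deriv n f x) | n K. compact K \<and> K \<noteq> {}} \<noteq> {}" using compact_sing by blast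
  fix p assume "p \<in> {\<lambda>f. SUP x\<in>K. norm (iter_deriv n f x) | n K. compact K \<and> K \<noteq> {}}"
  then obtain n K where K: "compact K" "K \<noteq> {}" "p = (\<lambda>f. SUP x\<in>K. norm (iter_deriv n f x))" by blast
  show "is_seminorm {f. smooth f} p"
    unfolding K(3) using K(1,2)
    by (intro is_seminorm_SUP[where L = "iter_deriv n"] bdd_above_norm_compact)
      (auto intro: smooth_continuous_on simp: iter_deriv_add iter_deriv_cmult)
  show "\<exists>n\<in>UNIV. \<exists>R. \<forall>g\<in>{f. smooth f}. \<forall>M. (\<forall>x. \<bar>x\<bar> \<le> R \<longrightarrow> norm (iter_deriv n g x) \<le> M) \<longrightarrow> p g \<le> M"
    using compact_SUP_le[OF K(1,2)] unfolding K(3) by (metis UNIV_I)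
qed (use that in \<open>auto intro!: smooth_lincomb\<close>)

lemma Cexp_smooth: "f \<in> topspace Cexp_top \<Longrightarrow> smooth f"
  by (auto simp: topspace_Cexp_top dest: exp_spaceD)

text \<open>A functional that sees only a window \<open>\<bar>x\<bar> \<le> R\<close> is bounded on
  sequences of controlled growth, the weight being at most \<open>exp (m * R)\<close> on the
  window.\<close>

lemma local_functional_exp_functional:
  assumes lin: "\<And>f g a b. smooth f \<Longrightarrow> smooth g \<Longrightarrow> \<phi> (\<lambda>x. a * f x + b * g x) = a * \<phi> f + b * \<phi> g"
    and S': "finite S'" and C: "C \<ge> 0"
    and bound: "\<And>g M. smooth g \<Longrightarrow> (\<And>n x. n \<in> S' \<Longrightarrow> \<bar>x\<bar> \<le> R \<Longrightarrow> norm (iter_deriv n g x) \<le> M) \<Longrightarrow> norm (\<phi> g) \<le> C * M"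
  shows "exp_functional \<phi>"
proof
  show "\<phi> (\<lambda>x. a * f x + b * g x) = a * \<phi> f + b * \<phi> g"
    if "f \<in> topspace Cexp_top" "g \<in> topspace Cexp_top" for f g a b
    using that by (intro lin Cexp_smooth)
  fix m and g :: "nat \<Rightarrow> real \<Rightarrow> complex"
  assume g: "\<And>j. smooth (g j)" "\<And>n. \<exists>C. \<forall>j x. norm (iter_deriv n (g j) x) \<le> C * exp (real m * \<bar>x\<bar>)"
  then obtain D where D: "\<And>n j x. norm (iter_deriv n (g j) x) \<le> D n * exp (real m * \<bar>x\<bar>)" by metis
  have D0: "D n \<ge> 0" for n using order_trans[OF norm_ge_zero D[of n 0 0]] by simp
  have "norm (\<phi> (g j)) \<le> C * ((\<Sum>n\<in>S'. D n) * exp (real m * R))" for j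
  proof (rule bound[OF g(1)])
    fix n x assume n: "n \<in> S'" and x: "\<bar>x\<bar> \<le> R"
    have "D n \<le> (\<Sum>n\<in>S'. D n)" using S' n D0 by (intro member_le_sum) auto
    then have "D n * exp (real m * \<bar>x\<bar>) \<le> (\<Sum>n\<in>S'. D n) * exp (real m * R)"
      using x D0 by (intro mult_mono) (auto intro: mult_left_mono sum_nonneg)
    with D[of n j x] show "norm (iter_deriv n (g j) x) \<le> (\<Sum>n\<in>S'. D n) * exp (real m * R)" by linarith
  qed
  then show "\<exists>C. \<forall>j. norm (\<phi> (g j)) \<le> C" by blast
qed

text \<open>Uniform continuity on compact sets gives the smallness required above for local seminorms.\<close>

lemma local_functional_small:
  assumes bound: "\<And>g M. g \<in> V \<Longrightarrow> (\<And>n x. n \<in> S' \<Longrightarrow> \<bar>x\<bar> \<le> R \<Longrightarrow> norm (iter_deriv n g x) \<le> M) \<Longrightarrow> norm (\<phi> g) \<le> C * M"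
    and S': "finite S'" and C: "C \<ge> 0"
    and cont: "\<And>n. n \<in> S' \<Longrightarrow> continuous_on UNIV (iter_deriv n k)"
    and V: "\<And>f g a b. f \<in> V \<Longrightarrow> g \<in> V \<Longrightarrow> (\<lambda>x. a * f x + b * g x) \<in> V"
      "\<And>M a b u. bounded_support M a b u \<Longrightarrow> a \<le> b \<Longrightarrow> correlation u k \<in> V" "\<And>v. (\<lambda>y. k (y - v)) \<in> V"
    and D: "\<And>n M a b u c v. n \<in> S' \<Longrightarrow> bounded_support M a b u \<Longrightarrow> a \<le> b \<Longrightarrow>
       iter_deriv n (\<lambda>y. correlation u k y - c * k (y - v)) =
       (\<lambda>y. correlation u (iter_deriv n k) y - c * iter_deriv n k (y - v))"
    and \<epsilon>: "\<epsilon> > 0" and M: "M > 0"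
  shows "\<exists>\<delta>>0. \<forall>h u. 0 < h \<longrightarrow> h < \<delta> \<longrightarrow> bounded_support M (- v - h) (- v + h) u \<longrightarrow>
      norm (\<phi> (\<lambda>y. correlation u k y - (LINT t|lebesgue. u t) * k (y - v))) \<le> \<epsilon> * h"
proof -
  \<comment> \<open>Chosen so that \<open>C * (M * \<eta> * (2 * h)) \<le> \<epsilon> * h\<close>;
    the 1 covers \<open>C = 0\<close>.\<close>
  define \<eta> where "\<eta> = \<epsilon> / (2 * M * (C + 1))"
  have \<eta>: "\<eta> > 0" using \<epsilon> M C by (simp add: \<eta>_def)
  have "\<exists>\<delta>>0. \<forall>x y. \<bar>x\<bar> \<le> R + \<bar>v\<bar> + 1 \<longrightarrow> \<bar>y\<bar> \<le> R + \<bar>v\<bar> + 1 \<longrightarrow> \<bar>x - y\<bar> < \<delta> \<longrightarrow>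
      norm (iter_deriv n k x - iter_deriv n k y) \<le> \<eta>" if n: "n \<in> S'" for n
  proof -
    have "uniformly_continuous_on {- (R + \<bar>v\<bar> + 1)..R + \<bar>v\<bar> + 1} (iter_deriv n k)"
      by (intro compact_uniformly_continuous continuous_on_subset[OF cont[OF n]]) auto
    then obtain \<delta> where "\<delta> > 0" "\<And>x y. x \<in> {- (R + \<bar>v\<bar> + 1)..R + \<bar>v\<bar> + 1} \<Longrightarrow>
        y \<in> {- (R + \<bar>v\<bar> + 1)..R + \<bar>v\<bar> + 1} \<Longrightarrow> dist x y < \<delta> \<Longrightarrow> dist (iter_deriv n k x) (iter_deriv n k y) < \<eta>"
      using \<eta> unfolding uniformly_continuous_on_def by metis
    then show ?thesis by (intro exI[of _ \<delta>]) (auto simp: dist_norm abs_le_iff intro!: less_imp_le)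
  qed
  then obtain \<delta> where \<delta>: "\<And>n. n \<in> S' \<Longrightarrow> \<delta> n > 0" "\<And>n x y. n \<in> S' \<Longrightarrow> \<bar>x\<bar> \<le> R + \<bar>v\<bar> + 1 \<Longrightarrow>
      \<bar>y\<bar> \<le> R + \<bar>v\<bar> + 1 \<Longrightarrow> \<bar>x - y\<bar> < \<delta> n \<Longrightarrow> norm (iter_deriv n k x - iter_deriv n k y) \<le> \<eta>"
    by metis
  \<comment> \<open>Capped at 1 so that the points \<open>t + x\<close> stay within
    \<open>R + \<bar>v\<bar> + 1\<close>, where uniform continuity was invoked; the minimum is then
    also over a nonempty set.\<close>
  define d where "d = Min (insert 1 (\<delta> ` S'))"
  have d: "d > 0" "d \<le> 1" "\<And>n. n \<in> S' \<Longrightarrow> d \<le> \<delta> n" unfolding d_def using S' \<delta>(1) by auto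
  show ?thesis
  proof (intro exI[of _ d] conjI d(1) allI impI)
    fix h u assume h: "0 < h" "h < d" and u: "bounded_support M (- v - h) (- v + h) u"
    have ab: "- v - h \<le> - v + h" using h by simp
    have "norm (\<phi> (\<lambda>y. correlation u k y - (LINT t|lebesgue. u t) * k (y - v))) \<le> C * (M * \<eta> * (2 * h))"
    proof (rule bound)
      show "(\<lambda>y. correlation u k y - (LINT t|lebesgue. u t) * k (y - v)) \<in> V"
        using V(1)[OF V(2)[OF u ab] V(3)[of v], of 1 "- (LINT t|lebesgue. u t)"] by simp
      fix n x assume n: "n \<in> S'" and x: "\<bar>x\<bar> \<le> R"
      show "norm (iter_deriv n (\<lambda>y. correlation u k y - (LINT t|lebesgue. u t) * k (y - v)) x) \<le> M * \<eta> * (2 * h)"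
        unfolding D[OF n u ab]
      proof (rule correlation_concentrated[OF u cont[OF n] h(1)])
        fix t assume "t \<in> {- v - h..- v + h}"
        then have "\<bar>t + v\<bar> \<le> h" by (auto simp: abs_le_iff)
        then show "norm (iter_deriv n k (t + x) - iter_deriv n k (x - v)) \<le> \<eta>"
          using x h d(2) d(3)[OF n] by (intro \<delta>(2)[OF n]) (auto simp: abs_le_iff abs_less_iff)
      qed
    qed
    also have "\<dots> = (2 * M * \<eta>) * (C * h)" by (simp add: mult_ac)
    also have "2 * M * \<eta> = \<epsilon> / (C + 1)" using M C by (simp add: \<eta>_def)
    also have "\<epsilon> / (C + 1) * (C * h) = (C / (C + 1)) * (\<epsilon> * h)" by simp
    also have "\<dots> \<le> 1 * (\<epsilon> * h)" using C \<epsilon> h by (intro mult_right_mono) auto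
    finally show "norm (\<phi> (\<lambda>y. correlation u k y - (LINT t|lebesgue. u t) * k (y - v))) \<le> \<epsilon> * h" by simp
  qed
qed

lemma reflect_smooth:
  assumes "smooth H"
  shows "smooth (\<lambda>z. H (- z))" "iter_deriv n (\<lambda>z. H (- z)) = (\<lambda>z. (-1) ^ n * iter_deriv n H (- z))"
  using smooth_affine[OF assms, of "-1" 0] iter_deriv_affine[OF assms, of n "-1" 0] by simp_all

lemma smooth_shift:
  assumes "smooth k"
  shows "smooth (\<lambda>y. k (y - v))" "iter_deriv n (\<lambda>y. k (y - v)) = (\<lambda>y. iter_deriv n k (y - v))"
  using smooth_affine[OF assms, of 1 "- v"] iter_deriv_affine[OF assms, of n 1 "- v"] by simp_all

lemma iter_deriv_correlation_minus:
  assumes k: "smooth k" and u: "bounded_support M a b u" "a \<le> b"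
  shows "iter_deriv n (\<lambda>y. correlation u k y - c * k (y - v)) =
     (\<lambda>y. correlation u (iter_deriv n k) y - c * iter_deriv n k (y - v))"
  using iter_deriv_lincomb[OF smooth_correlation_bounded_support[OF u(1) k u(2)] smooth_shift(1)[OF k, of v], of n 1 "- c"]
  by (simp add: iter_deriv_correlation_bounded_support[OF u(1) k u(2)] smooth_shift(2)[OF k])

section \<open>Annihilators in the three spaces of functions\<close>

lemma annihilators_addD:
  assumes "\<phi> \<in> annihilators_add T H"
  shows "\<phi> \<in> top_dual T" "\<exists>g\<in>topspace T. \<phi> g \<noteq> 0" "\<phi> (\<lambda>y. H (v - y)) = 0"
  using assms by (auto simp: annihilators_add_def conv_add_def)

lemma top_dual_linear:
  "\<phi> \<in> top_dual T \<Longrightarrow> f \<in> topspace T \<Longrightarrow> g \<in> topspace T \<Longrightarrow> \<phi> (\<lambda>x. a * f x + b * g x) = a * \<phi> f + b * \<phi> g"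
  by (auto simp: top_dual_def)

text \<open>Choosing one polynomial derivative for each polynomial function and iterating the choice
  gives the sequence of derivatives.\<close>

lemma polynomial_function_smooth:
  fixes p :: "real \<Rightarrow> complex"
  assumes "polynomial_function p"
  shows "smooth p"
proof -
  define F where "F p = (SOME p'. polynomial_function p' \<and> (\<forall>x. (p has_vector_derivative p' x) (at x)))"
    for p :: "real \<Rightarrow> complex"
  have F: "polynomial_function (F p) \<and> (\<forall>x. (p has_vector_derivative F p x) (at x))"
    if pf: "polynomial_function p" for p :: "real \<Rightarrow> complex"
  proof -
    obtain p' where "polynomial_function p'" "\<And>x. (p has_vector_derivative p' x) (at x)"
      by (rule has_vector_derivative_polynomial_function[OF pf], rule that) auto
    then have "polynomial_function p' \<and> (\<forall>x. (p has_vector_derivative p' x) (at x))" by simp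
    then show ?thesis
      unfolding F_def
      by (rule someI[where P = "\<lambda>p'. polynomial_function p' \<and> (\<forall>x. (p has_vector_derivative p' x) (at x))"])
  qed
  have pn: "polynomial_function ((F ^^ n) p)" for n
    by (induction n) (use assms F in auto)
  have "((F ^^ n) p has_vector_derivative (F ^^ Suc n) p x) (at x)" for n x
    using F[OF pn[of n]] by simp
  from smoothI[of "\<lambda>n. (F ^^ n) p", OF this] show ?thesis by simp
qed

text \<open>For the nonvanishing on functions of exponential growth, a continuous function is
  approximated on the window of \<open>\<phi>\<close> by a polynomial, which a cutoff makes into a
  test function.\<close>

lemma C_annihilator:
  assumes H: "H \<in> topspace C_top" and \<phi>: "\<phi> \<in> annihilators_add C_top H" and w: "weighted_function H (real b)"
  shows "annihilated_function \<phi> H b" "\<exists>g\<in>topspace Cexp_top. \<phi> g \<noteq> 0"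
proof -
  note dual = annihilators_addD(1)[OF \<phi>]
  have cH: "continuous_on UNIV H" using H by (simp add: topspace_C_top)
  obtain C R S' where b: "C \<ge> 0" "finite S'" "S' \<subseteq> {0::nat}" "\<And>g M. continuous_on UNIV g \<Longrightarrow>
     (\<And>n x. n \<in> S' \<Longrightarrow> \<bar>x\<bar> \<le> R \<Longrightarrow> norm (iter_deriv n g x) \<le> M) \<Longrightarrow> norm (\<phi> g) \<le> C * M"
    using C_dual_bound[OF dual] by metis
  have lin: "\<phi> (\<lambda>x. c * f x + d * g x) = c * \<phi> f + d * \<phi> g"
    if "continuous_on UNIV f" "continuous_on UNIV g" for f g c d
    using that by (intro top_dual_linear[OF dual]) (simp_all add: topspace_C_top)
  have sc: "continuous_on UNIV f" if "smooth f" for f using smooth_continuous_on[OF that, of UNIV 0] by simp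
  have ef: "exp_functional \<phi>"
    by (rule local_functional_exp_functional[OF _ b(2,1), of _ R]) (use lin sc b(4) in blast)+
  interpret exp_functional \<phi> by (rule ef)
  have ck: "continuous_on UNIV (\<lambda>z. H (- z))"
    by (intro continuous_on_compose2[OF cH] continuous_intros) auto
  have cs: "continuous_on UNIV (\<lambda>y. H (- (y - v)))" for v
    by (intro continuous_on_compose2[OF cH] continuous_intros) auto
  have "\<phi> (correlation H g) = 0" if g: "g \<in> test_functions" for g
  proof -
    have sg: "smooth g" using g by (simp add: test_functions_def)
    obtain M T where MT: "T > 0" "bounded_support M (- T) T (\<lambda>t. g (- t))"
      by (rule test_function_reflect_bounded_support[OF g])
    have eq: "correlation H g = correlation (\<lambda>t. g (- t)) (\<lambda>z. H (- z))"
      using correlation_commute[OF cH sc[OF sg]] by (simp add: fun_eq_iff)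
    show ?thesis
      unfolding eq
    proof (rule functional_annihilates_correlation[where V = "{f. continuous_on UNIV f}", OF _ ck _ _ _ _ MT(2,1)])
      fix v M \<epsilon> :: real assume "\<epsilon> > 0" "M > 0"
      then show "\<exists>\<delta>>0. \<forall>h u. 0 < h \<longrightarrow> h < \<delta> \<longrightarrow> bounded_support M (- v - h) (- v + h) u \<longrightarrow>
         norm (\<phi> (\<lambda>y. correlation u (\<lambda>z. H (- z)) y - (LINT t|lebesgue. u t) * H (- (y - v)))) \<le> \<epsilon> * h"
        by (intro local_functional_small[where V = "{f. continuous_on UNIV f}" and S' = S' and R = R and C = C and k = "\<lambda>z. H (- z)"])
          (use b ck cs in \<open>auto intro!: continuous_intros correlation_continuous\<close>)
    qed (use lin cs annihilators_addD(3)[OF \<phi>] in \<open>auto intro: correlation_continuous[OF _ ck]\<close>)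
  qed
  then show "annihilated_function \<phi> H b"
    using ef w by (intro annihilated_function.intro annihilated_function_axioms.intro)
  show "\<exists>g\<in>topspace Cexp_top. \<phi> g \<noteq> 0"
  proof (rule ccontr)
    assume "\<not> ?thesis"
    then have z: "\<And>g. g \<in> topspace Cexp_top \<Longrightarrow> \<phi> g = 0" by blast
    obtain g where g: "continuous_on UNIV g" "\<phi> g \<noteq> 0"
      using annihilators_addD(2)[OF \<phi>] by (auto simp: topspace_C_top)
    obtain N :: nat where N: "R \<le> real N" using real_arch_simple by blast
    have "norm (\<phi> g) \<le> C * \<epsilon>" if \<epsilon>: "\<epsilon> > 0" for \<epsilon>
    proof -
      obtain p where p: "polynomial_function p" "\<And>x. x \<in> {- R..R} \<Longrightarrow> norm (g x - p x) < \<epsilon>"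
        using Stone_Weierstrass_polynomial_function[of "{- R..R}" g \<epsilon>] continuous_on_subset[OF g(1)] \<epsilon> by auto
      have t: "(\<lambda>x. cutoff N x * p x) \<in> test_functions"
        by (intro cutoff_test_function polynomial_function_smooth p)
      then have sm: "smooth (\<lambda>x. cutoff N x * p x)" by (simp add: test_functions_def)
      have "norm (\<phi> (\<lambda>x. g x - cutoff N x * p x)) \<le> C * \<epsilon>"
      proof (rule b(4))
        show "continuous_on UNIV (\<lambda>x. g x - cutoff N x * p x)" by (intro continuous_on_diff g sc sm)
        fix n x assume "n \<in> S'" "\<bar>x\<bar> \<le> R"
        then show "norm (iter_deriv n (\<lambda>x. g x - cutoff N x * p x) x) \<le> \<epsilon>"
          using b(3) N p(2)[of x] by (auto simp: cutoff_eq_1 abs_le_iff intro!: less_imp_le)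
      qed
      moreover have "\<phi> (\<lambda>x. g x - cutoff N x * p x) = \<phi> g - \<phi> (\<lambda>x. cutoff N x * p x)"
        using lin[OF g(1) sc[OF sm], of 1 "-1"] by simp
      moreover have "\<phi> (\<lambda>x. cutoff N x * p x) = 0" using z t test_functions_subset by blast
      ultimately show ?thesis by simp
    qed
    \<comment> \<open>This accuracy gives \<open>norm (\<phi> g) \<le> norm (\<phi> g) / 2\<close>,
      absurd since \<open>\<phi> g \<noteq> 0\<close>.\<close>
    from this[of "norm (\<phi> g) / (2 * (C + 1))"] have "norm (\<phi> g) \<le> C * (norm (\<phi> g) / (2 * (C + 1)))"
      using g(2) b(1) by simp
    also have "\<dots> \<le> norm (\<phi> g) / 2"
    proof -
      have "C / (C + 1) * (norm (\<phi> g) / 2) \<le> 1 * (norm (\<phi> g) / 2)" using b(1) by (intro mult_right_mono) auto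
      moreover have "C * (norm (\<phi> g) / (2 * (C + 1))) = C / (C + 1) * (norm (\<phi> g) / 2)" by simp
      ultimately show ?thesis by (simp only: mult_1)
    qed
    finally show False using g(2) by simp
  qed
qed

lemma Cinf_annihilator:
  assumes H: "H \<in> topspace Cinf_top" and \<phi>: "\<phi> \<in> annihilators_add Cinf_top H" and w: "weighted_function H (real b)"
  shows "annihilated_function \<phi> H b" "\<exists>g\<in>topspace Cexp_top. \<phi> g \<noteq> 0"
proof -
  note dual = annihilators_addD(1)[OF \<phi>]
  have sH: "smooth H" using H by (simp add: topspace_Cinf_top)
  obtain C R S' where b: "C \<ge> 0" "finite S'" "S' \<subseteq> (UNIV :: nat set)" "\<And>g M. smooth g \<Longrightarrow>
     (\<And>n x. n \<in> S' \<Longrightarrow> \<bar>x\<bar> \<le> R \<Longrightarrow> norm (iter_deriv n g x) \<le> M) \<Longrightarrow> norm (\<phi> g) \<le> C * M"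
    using Cinf_dual_bound[OF dual] by metis
  have lin: "\<phi> (\<lambda>x. c * f x + d * g x) = c * \<phi> f + d * \<phi> g" if "smooth f" "smooth g" for f g c d
    using that by (intro top_dual_linear[OF dual]) (simp_all add: topspace_Cinf_top)
  have sc: "continuous_on UNIV f" if "smooth f" for f using smooth_continuous_on[OF that, of UNIV 0] by simp
  have ef: "exp_functional \<phi>"
    by (rule local_functional_exp_functional[OF _ b(2,1), of _ R]) (use lin b(4) in blast)+
  interpret exp_functional \<phi> by (rule ef)
  note sk = reflect_smooth(1)[OF sH]
  note ss = smooth_shift[OF sk]
  note D = iter_deriv_correlation_minus[OF sk]
  have "\<phi> (correlation H g) = 0" if g: "g \<in> test_functions" for g
  proof -
    have sg: "smooth g" using g by (simp add: test_functions_def)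
    obtain M T where MT: "T > 0" "bounded_support M (- T) T (\<lambda>t. g (- t))"
      by (rule test_function_reflect_bounded_support[OF g])
    have eq: "correlation H g = correlation (\<lambda>t. g (- t)) (\<lambda>z. H (- z))"
      using correlation_commute[OF sc[OF sH] sc[OF sg]] by (simp add: fun_eq_iff)
    show ?thesis
      unfolding eq
    proof (rule functional_annihilates_correlation[where V = "{f. smooth f}", OF _ sc[OF sk] _ _ _ _ MT(2,1)])
      fix v M \<epsilon> :: real assume "\<epsilon> > 0" "M > 0"
      then show "\<exists>\<delta>>0. \<forall>h u. 0 < h \<longrightarrow> h < \<delta> \<longrightarrow> bounded_support M (- v - h) (- v + h) u \<longrightarrow>
         norm (\<phi> (\<lambda>y. correlation u (\<lambda>z. H (- z)) y - (LINT t|lebesgue. u t) * H (- (y - v)))) \<le> \<epsilon> * h"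
        by (intro local_functional_small[where V = "{f. smooth f}" and S' = S' and R = R and C = C and k = "\<lambda>z. H (- z)"])
          (use b D ss(1) in \<open>auto intro!: smooth_lincomb smooth_correlation_bounded_support[OF _ sk] smooth_continuous_on[OF sk]\<close>)
    qed (use lin ss(1) annihilators_addD(3)[OF \<phi>] in \<open>auto intro: smooth_correlation_bounded_support[OF _ sk]\<close>)
  qed
  then show "annihilated_function \<phi> H b"
    using ef w by (intro annihilated_function.intro annihilated_function_axioms.intro)
  obtain g where g: "smooth g" "\<phi> g \<noteq> 0"
    using annihilators_addD(2)[OF \<phi>] by (auto simp: topspace_Cinf_top)
  \<comment> \<open>Strictly larger than \<open>R\<close>: the cutoff is then 1 on a neighbourhood
    of the window, so that all derivatives of the remainder vanish there.\<close>
  obtain N :: nat where N: "R < real N" using reals_Archimedean2 by blast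
  have t: "(\<lambda>x. cutoff N x * g x) \<in> test_functions" by (rule cutoff_test_function[OF g(1)])
  then have sm: "smooth (\<lambda>x. cutoff N x * g x)" by (simp add: test_functions_def)
  have "norm (\<phi> (\<lambda>x. g x - cutoff N x * g x)) \<le> C * 0"
  proof (rule b(4)[OF smooth_diff[OF g(1) sm]])
    fix n x assume "\<bar>x\<bar> \<le> R"
    then have "iter_deriv n (\<lambda>x. g x - cutoff N x * g x) x = iter_deriv n (\<lambda>_. 0) x"
      using N by (intro iter_deriv_cong_open[of "{- real N<..<real N}"]) (auto simp: cutoff_eq_1 abs_le_iff)
    then show "norm (iter_deriv n (\<lambda>x. g x - cutoff N x * g x) x) \<le> 0" by (simp add: iter_deriv_const_0)
  qed
  moreover have "\<phi> (\<lambda>x. g x - cutoff N x * g x) = \<phi> g - \<phi> (\<lambda>x. cutoff N x * g x)"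
    using lin[OF g(1) sm, of 1 "-1"] by simp
  ultimately have "\<phi> (\<lambda>x. cutoff N x * g x) \<noteq> 0" using g(2) by simp
  then show "\<exists>g\<in>topspace Cexp_top. \<phi> g \<noteq> 0" using t test_functions_subset by blast
qed

text \<open>No compact window is available, so uniform continuity is replaced by a global mean value
  estimate with exponential weights, which \<open>bounded_family\<close> turns into a bound for
  \<open>\<phi>\<close>.\<close>

lemma Cexp_annihilator:
  assumes H: "H \<in> topspace Cexp_top" and \<phi>: "\<phi> \<in> annihilators_add Cexp_top H" and w: "weighted_function H (real b)"
  shows "annihilated_function \<phi> H b" "\<exists>g\<in>topspace Cexp_top. \<phi> g \<noteq> 0"
proof -
  note dual = annihilators_addD(1)[OF \<phi>]
  have ef: "exp_functional \<phi>" by (rule top_dual_imp_exp_functional[OF dual])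
  interpret exp_functional \<phi> by (rule ef)
  obtain m where m: "H \<in> exp_space m" using H by (auto simp: topspace_Cexp_top)
  note sH = exp_spaceD(1)[OF m]
  have sc: "continuous_on UNIV f" if "smooth f" for f using smooth_continuous_on[OF that, of UNIV 0] by simp
  define k where "k = (\<lambda>z. H (- z))"
  have sk: "smooth k" unfolding k_def by (rule reflect_smooth(1)[OF sH])
  obtain B where B: "\<And>n x. norm (iter_deriv n k x) \<le> B n * exp (real m * \<bar>x\<bar>)"
  proof -
    have "\<exists>C. \<forall>x. norm (iter_deriv n k x) \<le> C * exp (real m * \<bar>x\<bar>)" for n
    proof -
      obtain C where "\<And>x. norm (iter_deriv n H x) \<le> C * exp (real m * \<bar>x\<bar>)" using exp_spaceD(2)[OF m] by blast
      from this[of "- _"] show ?thesis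
        unfolding k_def reflect_smooth(2)[OF sH] by (auto simp: norm_mult norm_power)
    qed
    then show ?thesis using that by metis
  qed
  have B0: "B n \<ge> 0" for n using order_trans[OF norm_ge_zero B[of n 0]] by simp
  have Bs: "norm (iter_deriv n k x) \<le> (B n * exp (real m * r)) * exp (real m * \<bar>y\<bar>)" if "\<bar>x\<bar> \<le> r + \<bar>y\<bar>" for n x y r
  proof -
    have "real m * \<bar>x\<bar> \<le> real m * (r + \<bar>y\<bar>)" using that by (intro mult_left_mono) auto
    then have "exp (real m * \<bar>x\<bar>) \<le> exp (real m * r) * exp (real m * \<bar>y\<bar>)"
      by (simp add: mult_exp_exp distrib_left)
    from order_trans[OF B mult_left_mono[OF this B0]] show ?thesis by (simp add: mult.assoc)
  qed
  have corrE: "correlation u k \<in> topspace Cexp_top" if u: "bounded_support M a' b' u" "a' \<le> b'" for M a' b' u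
  proof -
    have "norm (iter_deriv n (correlation u k) y) \<le> (M * (B n * exp (real m * max \<bar>a'\<bar> \<bar>b'\<bar>)) * (b' - a')) * exp (real m * \<bar>y\<bar>)" for n y
    proof -
      have "norm (correlation u (iter_deriv n k) y) \<le> M * ((B n * exp (real m * max \<bar>a'\<bar> \<bar>b'\<bar>)) * exp (real m * \<bar>y\<bar>)) * (b' - a')"
        unfolding correlation_def
        by (rule bounded_support_integrable(2)[OF u(1) continuous_shift_lebesgue_measurable _ u(2)])
          (auto intro!: smooth_continuous_on[OF sk] Bs)
      then show ?thesis
        unfolding iter_deriv_correlation_bounded_support[OF u(1) sk u(2)] by (simp add: mult_ac)
    qed
    then have "correlation u k \<in> exp_space m"
      unfolding exp_space_def using smooth_correlation_bounded_support[OF u(1) sk u(2)] by blast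
    then show ?thesis by (auto simp: topspace_Cexp_top)
  qed
  have shiftE: "(\<lambda>y. k (y - v)) \<in> topspace Cexp_top" for v
  proof -
    have "norm (iter_deriv n (\<lambda>y. k (y - v)) y) \<le> (B n * exp (real m * \<bar>v\<bar>)) * exp (real m * \<bar>y\<bar>)" for n y
      unfolding smooth_shift(2)[OF sk] by (rule Bs) linarith
    then have "(\<lambda>y. k (y - v)) \<in> exp_space m"
      unfolding exp_space_def using smooth_shift(1)[OF sk] by blast
    then show ?thesis by (auto simp: topspace_Cexp_top)
  qed
  have small: "\<exists>\<delta>>0. \<forall>h u. 0 < h \<longrightarrow> h < \<delta> \<longrightarrow> bounded_support M (- v - h) (- v + h) u \<longrightarrow>
      norm (\<phi> (\<lambda>y. correlation u k y - (LINT t|lebesgue. u t) * k (y - v))) \<le> \<epsilon> * h"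
    if \<epsilon>: "\<epsilon> > 0" and M: "M > 0" for v M \<epsilon> :: real
  proof -
    define K where "K = {(h, u). 0 < h \<and> h < 1 \<and> bounded_support M (- v - h) (- v + h) u}"
    define g where "g p = (\<lambda>y. correlation (snd p) k y - (LINT t|lebesgue. snd p t) * k (y - v))" for p :: "real \<times> (real \<Rightarrow> complex)"
    obtain C where C: "C \<ge> 0" "\<And>p. p \<in> K \<Longrightarrow> norm (\<phi> (g p)) \<le> C * (fst p)\<^sup>2"
    proof (rule bounded_family[of K g "\<lambda>p. (fst p)\<^sup>2" m])
      fix p assume "p \<in> K"
      then obtain h u where p: "p = (h, u)" "0 < h" "bounded_support M (- v - h) (- v + h) u"
        by (auto simp: K_def)
      have "- v - h \<le> - v + h" using p(2) by simp
      note sm = smooth_correlation_bounded_support[OF p(3) sk this]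
      show "smooth (g p)"
        using smooth_lincomb[OF sm smooth_shift(1)[OF sk, of v], of 1 "- (LINT t|lebesgue. u t)"] by (simp add: g_def p)
    next
      fix n
      \<comment> \<open>One factor \<open>h\<close> is the oscillation of the derivatives over the
        distance \<open>h\<close>, the other the width of the support; together they give the
        square.\<close>
      have "norm (iter_deriv n (g p) y) \<le> (2 * M * (B (Suc n) * exp (real m * (\<bar>v\<bar> + 1)))) * (fst p)\<^sup>2 * exp (real m * \<bar>y\<bar>)"
        if pK: "p \<in> K" for p y
      proof -
        obtain h u where p: "p = (h, u)" "0 < h" "h < 1" and u: "bounded_support M (- v - h) (- v + h) u"
          using pK by (cases p) (simp add: K_def)
        have ab: "- v - h \<le> - v + h" using p(2) by simp
        have "iter_deriv n (g p) y = correlation u (iter_deriv n k) y - (LINT t|lebesgue. u t) * iter_deriv n k (y - v)"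
          by (simp add: g_def p iter_deriv_correlation_minus[OF sk u ab])
        also have "norm \<dots> \<le> M * (((B (Suc n) * exp (real m * (\<bar>v\<bar> + 1))) * exp (real m * \<bar>y\<bar>)) * h) * (2 * h)"
        proof (rule correlation_concentrated[OF u smooth_continuous_on[OF sk] p(2)])
          fix t assume t: "t \<in> {- v - h..- v + h}"
          have "norm (iter_deriv n k (t + y) - iter_deriv n k (y - v))
            \<le> (B (Suc n) * exp (real m * (\<bar>v\<bar> + 1))) * exp (real m * \<bar>y\<bar>) * \<bar>(t + y) - (y - v)\<bar>"
          proof (rule vector_mvt_bound[OF smooth_has_vector_derivative[OF sk]])
            fix x assume "x \<in> closed_segment (y - v) (t + y)"
            then have "\<bar>x - (y - v)\<bar> \<le> h" using t by (auto simp: closed_segment_eq_real_ivl abs_le_iff split: if_splits)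
            then have "\<bar>x\<bar> \<le> (\<bar>v\<bar> + 1) + \<bar>y\<bar>" using p(3) by linarith
            then show "norm (iter_deriv (Suc n) k x) \<le> (B (Suc n) * exp (real m * (\<bar>v\<bar> + 1))) * exp (real m * \<bar>y\<bar>)"
              by (rule Bs)
          qed
          also have "\<dots> \<le> (B (Suc n) * exp (real m * (\<bar>v\<bar> + 1))) * exp (real m * \<bar>y\<bar>) * h"
            using t B0[of "Suc n"] by (intro mult_left_mono) (auto simp: abs_le_iff)
          finally show "norm (iter_deriv n k (t + y) - iter_deriv n k (y - v))
            \<le> (B (Suc n) * exp (real m * (\<bar>v\<bar> + 1))) * exp (real m * \<bar>y\<bar>) * h" .
        qed
        finally show ?thesis by (simp add: p(1) power2_eq_square mult_ac)
      qed
      then show "\<exists>C. \<forall>p\<in>K. \<forall>x. norm (iter_deriv n (g p) x) \<le> C * (fst p)\<^sup>2 * exp (real m * \<bar>x\<bar>)" by blast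
    qed auto
    \<comment> \<open>Below 1 the family \<open>K\<close> applies; the second entry makes
      \<open>C * h\<^sup>2 \<le> \<epsilon> * h\<close>.\<close>
    define \<delta> where "\<delta> = min 1 (\<epsilon> / (C + 1))"
    show ?thesis
    proof (intro exI[of _ \<delta>] conjI allI impI)
      show "\<delta> > 0" using \<epsilon> C(1) by (simp add: \<delta>_def)
      fix h u assume h: "0 < h" "h < \<delta>" and u: "bounded_support M (- v - h) (- v + h) u"
      have "norm (\<phi> (g (h, u))) \<le> C * h\<^sup>2" using C(2)[of "(h, u)"] h u by (simp add: K_def \<delta>_def)
      also have "\<dots> \<le> ((C + 1) * h) * h" using h by (simp add: power2_eq_square algebra_simps)
      also have "(C + 1) * h \<le> \<epsilon>"
      proof -
        have "h \<le> \<epsilon> / (C + 1)" using h by (simp add: \<delta>_def)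
        then show ?thesis using C(1) by (simp add: field_simps)
      qed
      then have "((C + 1) * h) * h \<le> \<epsilon> * h" using h by (intro mult_right_mono) auto
      finally show "norm (\<phi> (\<lambda>y. correlation u k y - (LINT t|lebesgue. u t) * k (y - v))) \<le> \<epsilon> * h"
        by (simp add: g_def)
    qed
  qed
  have "\<phi> (correlation H g) = 0" if g: "g \<in> test_functions" for g
  proof -
    have sg: "smooth g" using g by (simp add: test_functions_def)
    obtain M T where MT: "T > 0" "bounded_support M (- T) T (\<lambda>t. g (- t))"
      by (rule test_function_reflect_bounded_support[OF g])
    have eq: "correlation H g = correlation (\<lambda>t. g (- t)) k"
      using correlation_commute[OF sc[OF sH] sc[OF sg]] by (simp add: fun_eq_iff k_def)
    show ?thesis
      unfolding eq
    proof (rule functional_annihilates_correlation[where V = "topspace Cexp_top", OF lincomb sc[OF sk] corrE shiftE _ small MT(2,1)])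
      show "\<phi> (\<lambda>y. k (y - v)) = 0" for v using annihilators_addD(3)[OF \<phi>, of v] by (simp add: k_def)
    qed
  qed
  then show "annihilated_function \<phi> H b"
    using ef w by (intro annihilated_function.intro annihilated_function_axioms.intro)
  show "\<exists>g\<in>topspace Cexp_top. \<phi> g \<noteq> 0" by (rule annihilators_addD(2)[OF \<phi>])
qed

section \<open>Meromorphic continuation and functional equation\<close>

lemma holomorphic_UNIV_meromorphic: "f holomorphic_on UNIV \<Longrightarrow> f meromorphic_on A"
  by (meson analytic_on_holomorphic analytic_on_imp_meromorphic_on meromorphic_on_subset open_UNIV subset_UNIV)

text \<open>The plane is connected, so the behaviour on one open set decides between the two
  alternatives everywhere.\<close>

lemma meromorphic_zero_or_nonzero:
  assumes "f meromorphic_on UNIV"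
  shows "(\<forall>s. \<forall>\<^sub>F z in at s. f z = 0) \<or> (\<forall>s. \<forall>\<^sub>F z in at s. f z \<noteq> 0)"
  using meromorphic_imp_constant_or_avoid[OF assms open_UNIV connected_UNIV, of 0]
  by (simp add: eventually_cosparse_open_eq)

lemma
  assumes f: "f meromorphic_on UNIV" and S: "open S" "z0 \<in> S"
  shows meromorphic_eventually_nonzero: "(\<And>z. z \<in> S \<Longrightarrow> f z \<noteq> 0) \<Longrightarrow> \<forall>\<^sub>F z in at s. f z \<noteq> 0"
    and meromorphic_identity: "(\<And>z. z \<in> S \<Longrightarrow> f z = 0) \<Longrightarrow> \<forall>\<^sub>F z in at s. f z = 0"
proof -
  have ev: "\<forall>\<^sub>F z in at z0. z \<in> S" using S by (rule eventually_at_in_open')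
  show "\<forall>\<^sub>F z in at s. f z \<noteq> 0" if "\<And>z. z \<in> S \<Longrightarrow> f z \<noteq> 0"
  proof (rule ccontr)
    assume "\<not> ?thesis"
    then have "\<forall>\<^sub>F z in at z0. f z = 0" using meromorphic_zero_or_nonzero[OF f] by blast
    with ev have "\<forall>\<^sub>F z in at z0. False" by eventually_elim (use that in blast)
    then show False by simp
  qed
  show "\<forall>\<^sub>F z in at s. f z = 0" if "\<And>z. z \<in> S \<Longrightarrow> f z = 0"
  proof (rule ccontr)
    assume "\<not> ?thesis"
    then have "\<forall>\<^sub>F z in at z0. f z \<noteq> 0" using meromorphic_zero_or_nonzero[OF f] by blast
    with ev have "\<forall>\<^sub>F z in at z0. False" by eventually_elim (use that in blast)
    then show False by simp
  qed
qed

lemma reflect_at: "filterlim (\<lambda>s. 1 - s :: complex) (at (1 - s)) (at s)"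
  by (auto simp: filterlim_at eventually_at_filter intro!: tendsto_eq_intros)

lemma is_pole_reflect:
  fixes f :: "complex \<Rightarrow> complex"
  assumes "\<And>s. f s = c * f (1 - s)" "c \<noteq> 0" "is_pole f s"
  shows "is_pole f (1 - s)"
proof -
  have "is_pole (\<lambda>z. f (1 - z)) (1 - s)"
    using filterlim_compose[OF assms(3)[unfolded is_pole_def], of "\<lambda>z. 1 - z" "at (1 - s)"] reflect_at[of "1 - s"]
    by (simp add: is_pole_def)
  then have "is_pole (\<lambda>z. c * f (1 - z)) (1 - s)"
    using tendsto_mult_filterlim_at_infinity[OF tendsto_const assms(2)] by (auto simp: is_pole_def)
  then show ?thesis by (simp only: assms(1)[symmetric])
qed

text \<open>The identity theorem gives the equation in a punctured neighbourhood of each point. At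
  the point itself a nicely meromorphic function takes its limit, or 0 at a pole, and the equation
  carries poles to poles.\<close>

lemma nicely_meromorphic_functional_equation:
  assumes f: "f nicely_meromorphic_on UNIV" and S: "open S" "z0 \<in> S" "\<And>s. s \<in> S \<Longrightarrow> f s = c * f (1 - s)" and c: "c \<noteq> 0"
  shows "f s = c * f (1 - s)"
proof -
  have mero: "f meromorphic_on UNIV" using f by (simp add: nicely_meromorphic_on_def)
  have "(\<lambda>s. f s - c * f (1 - s)) meromorphic_on UNIV"
    by (intro meromorphic_on_diff meromorphic_on_mult mero meromorphic_on_compose[OF mero]
        meromorphic_on_const analytic_intros) auto
  then have "\<forall>\<^sub>F z in at s. f z - c * f (1 - z) = 0"
    by (rule meromorphic_identity[OF _ S(1,2)]) (simp add: S(3)[symmetric])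
  then have ev: "\<forall>\<^sub>F z in at s. c * f (1 - z) = f z" by eventually_elim simp
  have 1: "is_pole f s \<and> f s = 0 \<or> f \<midarrow>s\<rightarrow> f s" using f by (simp add: nicely_meromorphic_on_def)
  have 2: "is_pole f (1 - s) \<and> f (1 - s) = 0 \<or> f \<midarrow>1 - s\<rightarrow> f (1 - s)" using f by (simp add: nicely_meromorphic_on_def)
  from 2 show ?thesis
  proof
    assume p: "is_pole f (1 - s) \<and> f (1 - s) = 0"
    have "filterlim (\<lambda>z. f (1 - z)) at_infinity (at s)"
      using p filterlim_compose[OF _ reflect_at] unfolding is_pole_def by blast
    then have "filterlim (\<lambda>z. c * f (1 - z)) at_infinity (at s)"
      using tendsto_mult_filterlim_at_infinity[OF tendsto_const c] by blast
    then have "is_pole f s" unfolding is_pole_def using filterlim_cong[OF refl refl ev] by blast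
    then have "f s = 0" using 1 unfolding is_pole_def by (meson at_neq_bot not_tendsto_and_filterlim_at_infinity)
    then show ?thesis using p by simp
  next
    assume l: "f \<midarrow>1 - s\<rightarrow> f (1 - s)"
    have "((\<lambda>z. c * f (1 - z)) \<longlongrightarrow> c * f (1 - s)) (at s)"
      by (intro tendsto_mult tendsto_const filterlim_compose[OF l reflect_at])
    then have l2: "f \<midarrow>s\<rightarrow> c * f (1 - s)" using filterlim_cong[OF refl refl ev] by blast
    then have "\<not> is_pole f s" unfolding is_pole_def by (meson at_neq_bot not_tendsto_and_filterlim_at_infinity)
    then have "f \<midarrow>s\<rightarrow> f s" using 1 by blast
    with l2 show ?thesis using LIM_unique by blast
  qed
qed

text \<open>The interface between the spaces and the continuation: whether \<open>N\<close> and
  \<open>D\<close> come from a functional or from a Schwartz function is forgotten here.\<close>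

definition carleman_quotient ::
  "(real \<Rightarrow> complex) \<Rightarrow> (complex \<Rightarrow> complex) \<Rightarrow> (complex \<Rightarrow> complex) \<Rightarrow> bool" where
  "carleman_quotient H N D \<longleftrightarrow> N holomorphic_on UNIV \<and> D holomorphic_on UNIV \<and> (\<exists>s. D s \<noteq> 0) \<and>
     (\<exists>\<beta>. \<forall>s. (Re s \<ge> \<beta> \<longrightarrow> N s = Laplace_fun (plus_part H) s * D s) \<and>
       (Re s \<le> - \<beta> \<longrightarrow> N s = - (Laplace_fun (minus_part H) s * D s)))"

section \<open>Change of variables in Lebesgue integrals on the line\<close>

lemma lebesgue_integral_eq_HK:
  fixes f :: "real \<Rightarrow> complex"
  assumes "integrable lebesgue f"
  shows "f absolutely_integrable_on UNIV" "integral UNIV f = integral\<^sup>L lebesgue f"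
proof -
  show 1: "f absolutely_integrable_on UNIV" using assms by (simp add: set_integrable_def)
  show "integral UNIV f = integral\<^sup>L lebesgue f"
    using set_lebesgue_integral_eq_integral(2)[OF 1] by (simp add: set_lebesgue_integral_def)
qed

text \<open>Taken from the change-of-variables theorem for absolute integrals, so that it applies to
  any \<open>f\<close>, without a Borel version.\<close>

lemma
  fixes f :: "real \<Rightarrow> complex"
  shows integrable_lebesgue_affine: "integrable lebesgue (\<lambda>t. f (a - t)) \<longleftrightarrow> integrable lebesgue f"
    and integral_lebesgue_affine: "(LINT t|lebesgue. f (a - t)) = (LINT t|lebesgue. f t)"
proof -
  have img: "(\<lambda>t. a - t) ` UNIV = (UNIV :: real set)" by (auto simp: image_iff intro!: exI[of _ "a - _"])
  have d: "\<And>x. x \<in> UNIV \<Longrightarrow> ((\<lambda>t. a - t) has_field_derivative -1) (at x within UNIV)"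
    by (auto intro!: derivative_eq_intros)
  have inj: "inj_on (\<lambda>t. a - t) (UNIV :: real set)" by (auto intro: inj_onI)
  have u: "UNIV \<in> sets (lebesgue :: real measure)" by simp
  note cv = has_absolute_integral_change_of_variables_real[OF u d inj, of f, unfolded img]
  note ci = absolutely_integrable_change_of_variables_real[OF u d inj, of f, unfolded img]
  show i: "integrable lebesgue (\<lambda>t. f (a - t)) \<longleftrightarrow> integrable lebesgue f"
    using ci by (simp add: set_integrable_def)
  show "(LINT t|lebesgue. f (a - t)) = (LINT t|lebesgue. f t)"
  proof (cases "integrable lebesgue f")
    case True
    then have "integral UNIV (\<lambda>t. f (a - t)) = integral UNIV f"
      using cv[of "integral UNIV f"] lebesgue_integral_eq_HK(1)[OF True] by simp
    then show ?thesis using lebesgue_integral_eq_HK(2) True i by metis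
  next
    case False
    then show ?thesis using i by (simp add: not_integrable_integral_eq)
  qed
qed

lemma AE_lebesgue_nonzero: "AE t in lebesgue. t \<noteq> (0::real)"
  by (intro AE_completion AE_lborel_singleton)

text \<open>Reflection exchanges \<open>{0..}\<close> and \<open>{..<0}\<close> only up to the null
  set \<open>{0}\<close>.\<close>

lemma
  fixes f g :: "real \<Rightarrow> complex"
  assumes "f \<in> borel_measurable lebesgue" "g \<in> borel_measurable lebesgue" "\<And>t. t \<noteq> 0 \<Longrightarrow> f t = g t"
  shows integral_lebesgue_cong_nonzero: "(LINT t|lebesgue. f t) = (LINT t|lebesgue. g t)"
    and integrable_lebesgue_cong_nonzero: "integrable lebesgue f \<longleftrightarrow> integrable lebesgue g"
proof -
  have ae: "AE t in lebesgue. f t = g t"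
    using AE_lebesgue_nonzero by eventually_elim (rule assms(3))
  show "(LINT t|lebesgue. f t) = (LINT t|lebesgue. g t)" by (rule integral_cong_AE[OF assms(1,2) ae])
  show "integrable lebesgue f \<longleftrightarrow> integrable lebesgue g" by (rule integrable_cong_AE[OF assms(1,2) ae])
qed

lemma expo_lebesgue_measurable [measurable]: "expo s \<in> borel_measurable lebesgue"
  by (intro borel_imp_lebesgue_measurable smooth_borel_measurable(2) smooth_exp)

lemma measurable_reflect:
  fixes f :: "real \<Rightarrow> complex"
  assumes "f \<in> borel_measurable lebesgue"
  shows "(\<lambda>t. f (- t)) \<in> borel_measurable lebesgue"
proof -
  have "(\<lambda>t. - t) \<in> lebesgue \<rightarrow>\<^sub>M (lebesgue :: real measure)"
  proof -
    have "(\<lambda>t :: real. - t) = (*\<^sub>R) (- 1)" by (auto simp: fun_eq_iff)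
    then show ?thesis using lebesgue_measurable_scaling[of "-1", where 'a = real] by metis
  qed
  from measurable_compose[OF this assms] show ?thesis .
qed

text \<open>Under \<open>t \<mapsto> - t\<close> the factor \<open>exp (- t)\<close> of the symmetry
  turns \<open>exp (s * t)\<close> into \<open>exp (- (1 - s) * t)\<close>: this is where
  \<open>s\<close> becomes \<open>1 - s\<close>.\<close>

lemma Laplace_fun_minus_part:
  assumes H: "H \<in> borel_measurable lebesgue"
    and sym: "\<And>t. H (- t) = - (complex_of_real \<epsilon> * exp (- complex_of_real t) * H t)"
  shows "Laplace_fun (minus_part H) s = - (complex_of_real \<epsilon> * Laplace_fun (plus_part H) (1 - s))"
proof -
  have mI: "(\<lambda>t. indicator A t :: complex) \<in> borel_measurable lebesgue" if "A \<in> sets borel" for A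
    using that by (intro borel_imp_lebesgue_measurable borel_measurable_indicator)
  have p: "plus_part H = (\<lambda>t. indicator {0..} t * H t)" and m: "minus_part H = (\<lambda>t. indicator {..<0} t * H t)"
    by (auto simp: plus_part_def minus_part_def indicator_def fun_eq_iff)
  have mp: "plus_part H \<in> borel_measurable lebesgue" and mm: "minus_part H \<in> borel_measurable lebesgue"
    unfolding p m by (intro borel_measurable_times mI H; simp)+
  have "Laplace_fun (minus_part H) s = (LINT t|lebesgue. minus_part H (- t) * expo s (- t))"
    unfolding Laplace_fun_def using integral_lebesgue_affine[of "\<lambda>t. minus_part H t * exp (- (s * complex_of_real t))" 0] by simp
  also have "\<dots> = (LINT t|lebesgue. - complex_of_real \<epsilon> * (plus_part H t * expo (1 - s) t))"
  proof (rule integral_lebesgue_cong_nonzero)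
    show "(\<lambda>t. minus_part H (- t) * expo s (- t)) \<in> borel_measurable lebesgue"
      by (intro borel_measurable_times measurable_reflect mm expo_lebesgue_measurable)
    show "(\<lambda>t. - complex_of_real \<epsilon> * (plus_part H t * expo (1 - s) t)) \<in> borel_measurable lebesgue"
      by (intro borel_measurable_times borel_measurable_const mp expo_lebesgue_measurable)
    fix t :: real assume "t \<noteq> 0"
    have "exp (- complex_of_real t) * expo s (- t) = expo (1 - s) t" by (simp add: mult_exp_exp algebra_simps)
    then show "minus_part H (- t) * expo s (- t) = - complex_of_real \<epsilon> * (plus_part H t * expo (1 - s) t)"
      using \<open>t \<noteq> 0\<close> by (cases "t > 0") (auto simp: minus_part_def plus_part_def sym mult_ac)
  qed
  also have "\<dots> = - (complex_of_real \<epsilon> * Laplace_fun (plus_part H) (1 - s))"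
    by (simp add: Laplace_fun_def)
  finally show ?thesis .
qed

section \<open>Continuation of the one-sided Laplace transform\<close>

lemma laplace_eq_Laplace_fun: "laplace H s = Laplace_fun (plus_part H) s"
  unfolding laplace_def Laplace_fun_def set_lebesgue_integral_def
  by (intro Bochner_Integration.integral_cong) (auto simp: plus_part_def)

lemma laplace_integrable_iff: "laplace_integrable H s \<longleftrightarrow> integrable lebesgue (\<lambda>t. plus_part H t * expo s t)"
  unfolding laplace_integrable_def set_integrable_def
  by (intro Bochner_Integration.integrable_cong) (auto simp: plus_part_def)

lemma (in weighted_function) laplace_integrable_plus_part:
  assumes "Re s \<ge> B"
  shows "laplace_integrable u s"
proof -
  interpret P: weighted_function "plus_part u" B by (rule plus_part_weighted) unfold_locales
  show ?thesis
    unfolding laplace_integrable_iff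
  proof (rule P.integrable_weighted(1)[where C = 1])
    fix t assume "plus_part u t \<noteq> 0"
    then have "t \<ge> 0" by (auto simp: plus_part_def split: if_splits)
    then show "norm (expo s t) \<le> 1 * exp (- (B * \<bar>t\<bar>))"
      using mult_right_mono[OF assms, of t] by simp
  qed measurable
qed

theorem carleman_quotient_continuation:
  assumes w: "weighted_function H B" and q: "carleman_quotient H N D"
    and sym: "\<And>t. H (- t) = - (complex_of_real \<epsilon> * exp (- complex_of_real t) * H t)" and \<epsilon>: "\<epsilon> \<noteq> 0"
  defines "\<omega> \<equiv> remove_sings (\<lambda>s. N s / D s)"
  shows "\<omega> nicely_meromorphic_on UNIV"
    and "\<exists>\<sigma>. \<forall>s. Re s > \<sigma> \<longrightarrow> laplace_integrable H s \<and> \<omega> s = laplace H s"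
    and "\<omega> s = complex_of_real \<epsilon> * \<omega> (1 - s)"
proof -
  interpret weighted_function H B by fact
  have N: "N holomorphic_on UNIV" and D: "D holomorphic_on UNIV" using q by (auto simp: carleman_quotient_def)
  obtain s0 where s0: "D s0 \<noteq> 0" using q by (auto simp: carleman_quotient_def)
  obtain \<beta> where \<beta>: "\<And>s. Re s \<ge> \<beta> \<Longrightarrow> N s = Laplace_fun (plus_part H) s * D s"
     "\<And>s. Re s \<le> - \<beta> \<Longrightarrow> N s = - (Laplace_fun (minus_part H) s * D s)"
    using q by (auto simp: carleman_quotient_def)
  \<comment> \<open>\<open>D\<close> may have zeros, but they are isolated, and limits along
    punctured neighbourhoods do not see them.\<close>
  have evD: "\<forall>\<^sub>F z in at s. D z \<noteq> 0" for s
  proof (rule meromorphic_eventually_nonzero[OF holomorphic_UNIV_meromorphic[OF D], of "{z. D z \<noteq> 0}" s0])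
    show "open {z. D z \<noteq> 0}"
      using holomorphic_on_imp_continuous_on[OF D] by (intro open_Collect_neq continuous_on_const)
  qed (use s0 in auto)
  show nm: "\<omega> nicely_meromorphic_on UNIV"
    unfolding \<omega>_def by (intro remove_sings_nicely_meromorphic meromorphic_on_divide holomorphic_UNIV_meromorphic N D)
  \<comment> \<open>The absolute values make one number serve on both sides: it is at least
    \<open>B\<close> and \<open>\<beta>\<close>, and its negative is at most
    \<open>- \<beta>\<close>.\<close>
  define \<sigma> where "\<sigma> = \<bar>B\<bar> + \<bar>\<beta>\<bar>"
  have holL: "Laplace_fun (plus_part H) holomorphic_on {s. Re s \<in> {B<..}}"
    unfolding Laplace_fun_def[abs_def]
    using laplace_integrable_plus_part laplace_integrable_iff
    by (intro laplace_integral_holomorphic) auto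
  have oB: "open {s. Re s \<in> {B<..}}" by (simp add: open_halfspace_Re_gt)
  have eqL: "\<omega> s = Laplace_fun (plus_part H) s" if s: "Re s > \<sigma>" for s
    unfolding \<omega>_def
  proof (rule remove_sings_eqI)
    have "isCont (Laplace_fun (plus_part H)) s"
      using holomorphic_on_imp_continuous_on[OF holL] s oB
      by (auto simp: continuous_on_eq_continuous_at \<sigma>_def)
    then have l: "Laplace_fun (plus_part H) \<midarrow>s\<rightarrow> Laplace_fun (plus_part H) s" by (simp add: isCont_def)
    have "\<forall>\<^sub>F z in at s. z \<in> {z. Re z > \<sigma>}"
      using s by (intro eventually_at_in_open' open_halfspace_Re_gt) auto
    then have "\<forall>\<^sub>F z in at s. Laplace_fun (plus_part H) z = N z / D z"
      using evD by eventually_elim (use \<beta>(1) in \<open>auto simp: \<sigma>_def\<close>)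
    with l show "(\<lambda>z. N z / D z) \<midarrow>s\<rightarrow> Laplace_fun (plus_part H) s" by (rule Lim_transform_eventually)
  qed
  show "\<exists>\<sigma>. \<forall>s. Re s > \<sigma> \<longrightarrow> laplace_integrable H s \<and> \<omega> s = laplace H s"
    using eqL laplace_integrable_plus_part
    by (intro exI[of _ \<sigma>]) (auto simp: laplace_eq_Laplace_fun \<sigma>_def)
  show "\<omega> s = complex_of_real \<epsilon> * \<omega> (1 - s)"
  proof (rule nicely_meromorphic_functional_equation[OF nm])
    \<comment> \<open>The equation is checked far to the left, where the second formula for
      \<open>N\<close> holds at \<open>s\<close> and the convergent integral is available at
      \<open>1 - s\<close>.\<close>
    show "open {s. Re s < - \<sigma>}" by (rule open_halfspace_Re_lt)
    show "- complex_of_real (\<sigma> + 1) \<in> {s. Re s < - \<sigma>}" by simp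
    fix s assume "s \<in> {s. Re s < - \<sigma>}"
    then have s: "Re s < - \<sigma>" by simp
    have s': "Re (1 - s) > \<sigma>" using s by simp
    have "\<omega> s = complex_of_real \<epsilon> * Laplace_fun (plus_part H) (1 - s)"
      unfolding \<omega>_def
    proof (rule remove_sings_eqI)
      have "isCont (Laplace_fun (plus_part H)) (1 - s)"
        using holomorphic_on_imp_continuous_on[OF holL] s' oB
        by (auto simp: continuous_on_eq_continuous_at \<sigma>_def)
      then have "Laplace_fun (plus_part H) \<midarrow>1 - s\<rightarrow> Laplace_fun (plus_part H) (1 - s)" by (simp add: isCont_def)
      then have l: "((\<lambda>z. complex_of_real \<epsilon> * Laplace_fun (plus_part H) (1 - z))
          \<longlongrightarrow> complex_of_real \<epsilon> * Laplace_fun (plus_part H) (1 - s)) (at s)"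
        by (intro tendsto_mult tendsto_const filterlim_compose[OF _ reflect_at])
      have "\<forall>\<^sub>F z in at s. z \<in> {z. Re z < - \<sigma>}"
        using s by (intro eventually_at_in_open' open_halfspace_Re_lt) auto
      then have "\<forall>\<^sub>F z in at s. complex_of_real \<epsilon> * Laplace_fun (plus_part H) (1 - z) = N z / D z"
        using evD
      proof eventually_elim
        case (elim z)
        then have "N z = - (Laplace_fun (minus_part H) z * D z)" by (intro \<beta>(2)) (auto simp: \<sigma>_def)
        then show ?case using elim(2) Laplace_fun_minus_part[OF u_meas sym, of z] by simp
      qed
      with l show "(\<lambda>z. N z / D z) \<midarrow>s\<rightarrow> complex_of_real \<epsilon> * Laplace_fun (plus_part H) (1 - s)"
        by (rule Lim_transform_eventually)
    qed
    then show "\<omega> s = complex_of_real \<epsilon> * \<omega> (1 - s)" using eqL[OF s'] by simp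
  qed (use \<epsilon> in simp)
qed

text \<open>Adding an entire function keeps the poles of \<open>\<omega>\<close>. There
  \<open>M\<close> has the value 0, at \<open>s\<close> and at \<open>1 - s\<close> alike, so its
  equation holds at poles as well.\<close>

lemma completed_continuation:
  assumes E: "E holomorphic_on UNIV" "\<And>s. E s = c * E (1 - s)" and c: "c \<noteq> 0"
    and \<omega>: "\<omega> nicely_meromorphic_on UNIV" "\<And>s. \<omega> s = c * \<omega> (1 - s)"
  defines "M \<equiv> remove_sings (\<lambda>s. E s + \<omega> s)"
  shows "M nicely_meromorphic_on UNIV" "\<And>s. M s = c * M (1 - s)"
    and "\<And>s. \<not> is_pole \<omega> s \<Longrightarrow> M s = E s + \<omega> s"
proof -
  have mero: "\<omega> meromorphic_on UNIV" using \<omega>(1) by (simp add: nicely_meromorphic_on_def)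
  show "M nicely_meromorphic_on UNIV"
    unfolding M_def by (intro remove_sings_nicely_meromorphic meromorphic_on_add holomorphic_UNIV_meromorphic E mero)
  show np: "M s = E s + \<omega> s" if "\<not> is_pole \<omega> s" for s
  proof -
    have "\<omega> analytic_on {s}" using nicely_meromorphic_on_imp_analytic_at[OF \<omega>(1) _ that] by simp
    moreover have "E analytic_on {s}" using E(1) by (meson analytic_on_holomorphic open_UNIV subset_UNIV)
    ultimately show ?thesis unfolding M_def by (intro remove_sings_at_analytic analytic_on_add)
  qed
  have p: "M s = 0" if "is_pole \<omega> s" for s
  proof -
    have "isCont E s" using holomorphic_on_imp_continuous_on[OF E(1)] by (simp add: continuous_on_eq_continuous_at)
    then have "is_pole (\<lambda>s. E s + \<omega> s) s"
      using that tendsto_add_filterlim_at_infinity[of E "E s" "at s" \<omega>] by (simp add: is_pole_def isCont_def)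
    then show ?thesis unfolding M_def by (rule remove_sings_at_pole)
  qed
  fix s
  show "M s = c * M (1 - s)"
  proof (cases "is_pole \<omega> s")
    case True
    then show ?thesis using p[OF True] p[OF is_pole_reflect[of \<omega> c s, OF \<omega>(2) c True]] by simp
  next
    case False
    then have "\<not> is_pole \<omega> (1 - s)" using is_pole_reflect[of \<omega> c "1 - s", OF \<omega>(2) c] by auto
    then show ?thesis using np[OF False] np[of "1 - s"] E(2)[of s] \<omega>(2)[of s] by (simp add: distrib_left)
  qed
qed

section \<open>Annihilators in the Schwartz space\<close>

lemma topspace_Schwartz_mult_top: "topspace Schwartz_mult_top = {f. smooth_fun_on {0<..} f \<and>
         (\<forall>(m::int) n. bdd_above ((\<lambda>x. x powi m * norm (iter_deriv n f x)) ` {0<..}))}"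
  unfolding Schwartz_mult_top_def by (rule topspace_seminorm_topology) blast

lemma topspace_Schwartz_add_top: "g \<in> topspace Schwartz_add_top \<longleftrightarrow> (\<lambda>x. g (- ln x)) \<in> topspace Schwartz_mult_top"
  unfolding Schwartz_add_top_def topspace_pullback_topology by simp

lemma Schwartz_add_continuous:
  assumes "g \<in> topspace Schwartz_add_top"
  shows "continuous_on UNIV g"
proof -
  have "\<forall>x\<in>{0<..}. (\<lambda>x. g (- ln x)) differentiable (at x)"
    using assms unfolding topspace_Schwartz_add_top topspace_Schwartz_mult_top smooth_fun_on_def
    by (auto dest: spec[of _ 0])
  then have "continuous_on {0<..} (\<lambda>x. g (- ln x))"
    by (meson continuous_at_imp_continuous_on differentiable_imp_continuous_within)
  then have "continuous_on UNIV (\<lambda>t. g (- ln (exp (- t))))"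
    by (rule continuous_on_compose2) (auto intro!: continuous_intros)
  then show ?thesis by simp
qed

text \<open>With \<open>x = exp (- t)\<close>, positive powers of \<open>x\<close> control negative
  \<open>t\<close>, and negative powers control positive \<open>t\<close>.\<close>

lemma Schwartz_add_decay:
  assumes "g \<in> topspace Schwartz_add_top"
  obtains C where "\<And>t. norm (g t) \<le> C * exp (- (real m * \<bar>t\<bar>))"
proof -
  have b: "bdd_above ((\<lambda>x. x powi k * norm (g (- ln x))) ` {0<..})" for k :: int
  proof -
    have "\<forall>(m::int) n. bdd_above ((\<lambda>x. x powi m * norm (iter_deriv n (\<lambda>x. g (- ln x)) x)) ` {0<..})"
      using assms unfolding topspace_Schwartz_add_top topspace_Schwartz_mult_top by simp
    from this[rule_format, of k 0] show ?thesis by simp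
  qed
  have e: "exp (- t) powi int m = exp (- (real m * t))" "exp (- t) powi (- int m) = exp (real m * t)" for t :: real
    by (simp_all add: power_int_minus exp_of_nat_mult exp_minus power_inverse)
  obtain C1 C2 where C1: "\<And>x. x > 0 \<Longrightarrow> x powi (int m) * norm (g (- ln x)) \<le> C1"
    and C2: "\<And>x. x > 0 \<Longrightarrow> x powi (- int m) * norm (g (- ln x)) \<le> C2"
    using b[of "int m"] b[of "- int m"] unfolding bdd_above_def by auto
  have 1: "exp (- (real m * t)) * norm (g t) \<le> C1" and 2: "exp (real m * t) * norm (g t) \<le> C2" for t
    using C1[of "exp (- t)"] C2[of "exp (- t)"] by (simp_all add: e del: power_int_of_nat)
  have "exp (real m * \<bar>t\<bar>) * norm (g t) \<le> max C1 C2" for t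
    using 1[of t] 2[of t] by (cases "t \<ge> 0") auto
  then have "norm (g t) \<le> max C1 C2 * exp (- (real m * \<bar>t\<bar>))" for t
    by (simp add: exp_minus field_simps)
  then show ?thesis using that by blast
qed

lemma continuous_integral_pos:
  fixes f :: "real \<Rightarrow> real"
  assumes f: "continuous_on UNIV f" "\<And>x. f x \<ge> 0" "f x0 > 0" "integrable lebesgue f"
  shows "(LINT x|lebesgue. f x) > 0"
proof -
  have "isCont f x0" using f(1) by (simp add: continuous_on_eq_continuous_at)
  then have "\<forall>\<^sub>F x in nhds x0. f x > f x0 / 2"
    using f(3) by (intro order_tendstoD(1)[of f "f x0"]) (auto simp: continuous_at_imp_continuous_within isCont_def tendsto_at_iff_tendsto_nhds)
  then obtain d where d: "d > 0" "\<And>x. dist x x0 < d \<Longrightarrow> f x > f x0 / 2"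
    unfolding eventually_nhds_metric by blast
  let ?A = "{x0 - d/2..x0 + d/2}"
  have i: "integrable lebesgue (\<lambda>x. f x0 / 2 * indicator ?A x :: real)"
    by (intro integrable_mult_right integrable_real_indicator) (auto simp: emeasure_lborel_Icc_eq)
  have "0 < f x0 / 2 * d" using f(3) d(1) by simp
  also have "\<dots> = (LINT x|lebesgue. f x0 / 2 * indicator ?A x)" using d(1) by simp
  also have "\<dots> \<le> (LINT x|lebesgue. f x)"
  proof (rule integral_mono[OF i f(4)])
    fix x show "f x0 / 2 * indicator ?A x \<le> f x"
      using d(2)[of x] d(1) f(2)[of x] by (cases "x \<in> ?A") (auto simp: dist_real_def abs_less_iff less_imp_le)
  qed
  finally show ?thesis .
qed

context
  fixes g :: "real \<Rightarrow> complex"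
  assumes g: "g \<in> topspace Schwartz_add_top"
begin

lemma Schwartz_measurable: "g \<in> borel_measurable borel"
  by (intro borel_measurable_continuous_onI Schwartz_add_continuous g)

lemma Schwartz_weighted: "weighted_function g B"
proof
  show m: "g \<in> borel_measurable lebesgue" by (intro borel_imp_lebesgue_measurable Schwartz_measurable)
  \<comment> \<open>Large enough that \<open>k + B \<ge> 1\<close> for either sign of
    \<open>B\<close>, which leaves the integrable function
    \<open>exp (- \<bar>t\<bar>)\<close>.\<close>
  define k where "k = nat \<lceil>\<bar>B\<bar>\<rceil> + 1"
  obtain C where C: "\<And>t. norm (g t) \<le> C * exp (- (real k * \<bar>t\<bar>))" using Schwartz_add_decay[OF g] by blast
  have C0: "C \<ge> 0" using order_trans[OF norm_ge_zero C[of 0]] by simp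
  show "integrable lebesgue (\<lambda>t. norm (g t) * exp (- (B * \<bar>t\<bar>)))"
  proof (rule Bochner_Integration.integrable_bound[OF integrable_mult_right[OF integrable_exp_minus_abs, of C]])
    have "(\<lambda>t. exp (- (B * \<bar>t\<bar>))) \<in> borel_measurable lebesgue"
      by (intro borel_imp_lebesgue_measurable) measurable
    then show "(\<lambda>t. norm (g t) * exp (- (B * \<bar>t\<bar>))) \<in> borel_measurable lebesgue" using m by measurable
    have "norm (g t) * exp (- (B * \<bar>t\<bar>)) \<le> C * exp (- \<bar>t\<bar>)" for t
    proof -
      have "1 \<le> real k + B" unfolding k_def by linarith
      then have "\<bar>t\<bar> \<le> (real k + B) * \<bar>t\<bar>" using mult_right_mono[of 1 "real k + B" "\<bar>t\<bar>"] by simp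
      then have "exp (- (real k * \<bar>t\<bar>)) * exp (- (B * \<bar>t\<bar>)) \<le> exp (- \<bar>t\<bar>)"
        by (simp add: mult_exp_exp algebra_simps)
      from mult_left_mono[OF this C0] mult_right_mono[OF C[of t], of "exp (- (B * \<bar>t\<bar>))"]
      show ?thesis unfolding mult.assoc using exp_ge_zero by (blast intro: order_trans)
    qed
    then show "AE t in lebesgue. norm (norm (g t) * exp (- (B * \<bar>t\<bar>))) \<le> norm (C * exp (- \<bar>t\<bar>))"
      by (intro AE_I2) (simp add: abs_mult, metis C0 abs_of_nonneg)
  qed
qed

text \<open>Makes a Schwartz annihilator an instance of the theory of functionals: its Laplace
  transform is entire, and nonzero somewhere as soon as the functional is nonzero.\<close>

lemma Schwartz_exp_functional: "exp_functional (\<lambda>w. LINT t|lebesgue. g t * w t)"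
proof
  have int: "integrable lebesgue (\<lambda>t. g t * w t)" "norm (LINT t|lebesgue. g t * w t) \<le> C * weighted_function.W g (- real m)"
    if "smooth w" "\<And>t. norm (w t) \<le> C * exp (real m * \<bar>t\<bar>)" for w C m
  proof -
    interpret weighted_function g "- real m" by (rule Schwartz_weighted)
    have "w \<in> borel_measurable lebesgue" by (intro borel_imp_lebesgue_measurable smooth_borel_measurable(2) that)
    from integrable_weighted[OF this, of C] that(2)
    show "integrable lebesgue (\<lambda>t. g t * w t)" "norm (LINT t|lebesgue. g t * w t) \<le> C * W" by simp_all
  qed
  have intE: "integrable lebesgue (\<lambda>t. g t * w t)" if w: "w \<in> topspace Cexp_top" for w
  proof -
    obtain m where m: "w \<in> exp_space m" using w by (auto simp: topspace_Cexp_top)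
    obtain C where C: "\<And>t. norm (iter_deriv 0 w t) \<le> C * exp (real m * \<bar>t\<bar>)" using exp_spaceD(2)[OF m] by blast
    show ?thesis by (rule int(1)[OF exp_spaceD(1)[OF m]]) (use C in simp)
  qed
  show "(LINT t|lebesgue. g t * (a * f t + b * w t)) = a * (LINT t|lebesgue. g t * f t) + b * (LINT t|lebesgue. g t * w t)"
    if "f \<in> topspace Cexp_top" "w \<in> topspace Cexp_top" for f w a b
  proof -
    have "(LINT t|lebesgue. g t * (a * f t + b * w t)) = (LINT t|lebesgue. a * (g t * f t) + b * (g t * w t))"
      by (simp add: algebra_simps)
    then show ?thesis using intE[OF that(1)] intE[OF that(2)] by simp
  qed
  show "\<exists>C. \<forall>j. norm (LINT t|lebesgue. g t * w j t) \<le> C"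
    if sm: "\<And>j::nat. smooth (w j)" and bd: "\<And>n. \<exists>C. \<forall>j x. norm (iter_deriv n (w j) x) \<le> C * exp (real m * \<bar>x\<bar>)" for m w
  proof -
    obtain C where C: "\<And>j x. norm (iter_deriv 0 (w j) x) \<le> C * exp (real m * \<bar>x\<bar>)" using bd by blast
    have "norm (LINT t|lebesgue. g t * w j t) \<le> C * weighted_function.W g (- real m)" for j
      by (rule int(2)[OF sm]) (use C in simp)
    then show ?thesis by blast
  qed
qed

lemma Schwartz_Laplace_fun: "Laplace_fun g = Laplace_functional (\<lambda>w. LINT t|lebesgue. g t * w t)"
  by (simp add: Laplace_fun_def Laplace_functional_def fun_eq_iff)

lemma Schwartz_Laplace_entire: "Laplace_fun g holomorphic_on UNIV"
  unfolding Schwartz_Laplace_fun by (rule exp_functional.laplace_functional_entire[OF Schwartz_exp_functional])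

lemma Schwartz_Laplace_nonzero:
  assumes "g x0 \<noteq> 0"
  shows "\<exists>s. Laplace_fun g s \<noteq> 0"
proof -
  interpret \<Phi>: exp_functional "\<lambda>w. LINT t|lebesgue. g t * w t" by (rule Schwartz_exp_functional)
  have contg: "continuous_on UNIV g" by (rule Schwartz_add_continuous[OF g])
  \<comment> \<open>Multiplying \<open>g\<close> by the conjugate of \<open>g x0\<close> makes the
    real part positive near \<open>x0\<close>; against a nonnegative bump there the integral cannot
    vanish.\<close>
  define q where "q x = Re (cnj (g x0) * g x)" for x
  have q: "continuous_on UNIV q" unfolding q_def[abs_def] by (intro continuous_intros contg)
  have q0: "q x0 > 0" using assms by (auto simp: q_def complex_eq_iff sum_squares_gt_zero_iff)
  have "isCont q x0" using q by (simp add: continuous_on_eq_continuous_at)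
  then have "\<forall>\<^sub>F x in nhds x0. q x > 0"
    using q0 by (intro order_tendstoD(1)[of q "q x0"]) (auto simp: isCont_def tendsto_at_iff_tendsto_nhds)
  then obtain d where d: "d > 0" "\<And>x. dist x x0 < d \<Longrightarrow> q x > 0"
    unfolding eventually_nhds_metric by blast
  \<comment> \<open>The affine map sends \<open>x0\<close> to the centre 1/2 of
    \<open>{0..1}\<close>, so the bump lives within \<open>d / 2\<close> of
    \<open>x0\<close>.\<close>
  define r where "r x = bump_real (inverse d * x + (1/2 - x0 / d))" for x
  have rx: "inverse d * x + (1/2 - x0 / d) = (x - x0) / d + 1/2" for x using d(1) by (simp add: field_simps)
  have r0: "r x = 0" if "dist x x0 \<ge> d" for x
    unfolding r_def rx by (rule bump_real_zero) (use that d(1) in \<open>auto simp: dist_real_def abs_if field_simps split: if_splits\<close>)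
  have rn: "r x \<ge> 0" for x
  proof -
    have "bump_real z \<ge> 0" for z
      using bump_real_pos[of z] bump_real_zero[of z] by (cases "0 < z \<and> z < 1") auto
    then show ?thesis by (simp add: r_def)
  qed
  have rp: "r x0 > 0" unfolding r_def rx by (rule bump_real_pos) auto
  have smr: "smooth (\<lambda>x. complex_of_real (r x))"
    unfolding r_def[abs_def] by (rule smooth_affine[OF smooth_bump])
  have "(\<lambda>x. complex_of_real (r x)) \<in> test_functions"
    unfolding test_functions_def using smr r0
    by (auto intro!: exI[of _ "cball x0 d"] simp: dist_commute not_le less_imp_le)
  then have rE: "(\<lambda>x. complex_of_real (r x)) \<in> topspace Cexp_top" using test_functions_subset by blast
  obtain C where C: "\<And>t. norm (g t) \<le> C * exp (- (real 1 * \<bar>t\<bar>))" using Schwartz_add_decay[OF g] by blast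
  have int: "integrable lebesgue (\<lambda>t. g t * complex_of_real (r t))"
  proof -
    interpret weighted_function g 0 by (rule Schwartz_weighted)
    have t: "(\<lambda>x. complex_of_real (r x)) \<in> test_functions" by fact
    obtain D where D: "\<And>x. norm (iter_deriv 0 (\<lambda>x. complex_of_real (r x)) x) \<le> D * exp (- (0 * \<bar>x\<bar>))"
      using test_function_bounded(2)[OF t] by blast
    show ?thesis
      by (rule integrable_weighted(1)[of _ D])
        (use D in \<open>auto intro!: borel_imp_lebesgue_measurable smooth_borel_measurable(2)[OF smr]\<close>)
  qed
  have "cnj (g x0) * (LINT t|lebesgue. g t * complex_of_real (r t)) = (LINT t|lebesgue. cnj (g x0) * (g t * complex_of_real (r t)))"
    by simp
  then have "Re (cnj (g x0) * (LINT t|lebesgue. g t * complex_of_real (r t))) =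
      (LINT t|lebesgue. Re (cnj (g x0) * (g t * complex_of_real (r t))))"
    using integral_Re[OF integrable_mult_right[OF int, of "cnj (g x0)"]] by simp
  also have "\<dots> = (LINT t|lebesgue. q t * r t)"
    by (intro Bochner_Integration.integral_cong) (simp_all add: q_def algebra_simps)
  also have "\<dots> > 0"
  proof (rule continuous_integral_pos[of _ x0])
    have "continuous_on UNIV (\<lambda>x. Re (complex_of_real (r x)))"
      using smooth_continuous_on[OF smr, of UNIV 0] by (intro continuous_intros) simp
    then show "continuous_on UNIV (\<lambda>t. q t * r t)" using q by (intro continuous_intros) simp_all
    show "q x * r x \<ge> 0" for x using d(2)[of x] r0[of x] rn[of x] by (cases "dist x x0 < d") auto
    show "q x0 * r x0 > 0" using q0 rp by simp
    have "integrable lebesgue (\<lambda>t. Re (cnj (g x0) * (g t * complex_of_real (r t))))"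
      by (rule integrable_bounded_linear[OF bounded_linear_Re integrable_mult_right[OF int]])
    then show "integrable lebesgue (\<lambda>t. q t * r t)" by (simp add: q_def algebra_simps)
  qed
  finally have "(LINT t|lebesgue. g t * complex_of_real (r t)) \<noteq> 0" by auto
  from \<Phi>.laplace_functional_nonzero[OF rE this] show ?thesis by (simp add: Schwartz_Laplace_fun)
qed

end

section \<open>Convolution and Fubini's theorem\<close>

lemma lborel_translate:
  fixes G :: "real \<Rightarrow> 'a :: {banach, second_countable_topology}"
  assumes "G \<in> borel_measurable borel"
  shows "(LINT x|lborel. G (x - t)) = (LINT x|lborel. G x)"
    and "integrable lborel G \<Longrightarrow> integrable lborel (\<lambda>x. G (x - t))"
  using lborel_integral_real_affine[of 1 G "- t"] lborel_integrable_real_affine[of G 1 "- t"] assms by simp_all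

text \<open>Distributing the exponential as \<open>expo s x = expo s t * expo s (x - t)\<close>
  leaves an ordinary convolution of two integrable functions.\<close>

lemma convolution_laplace:
  fixes u g :: "real \<Rightarrow> complex"
  assumes [measurable]: "u \<in> borel_measurable borel" "g \<in> borel_measurable borel"
    and u: "integrable lborel (\<lambda>t. u t * expo s t)" and g: "integrable lborel (\<lambda>t. g t * expo s t)"
  shows "integrable lborel (\<lambda>x. (LINT t|lborel. u t * g (x - t)) * expo s x)"
    and "(LINT x|lborel. (LINT t|lborel. u t * g (x - t)) * expo s x) =
      (LINT t|lborel. u t * expo s t) * (LINT t|lborel. g t * expo s t)"
proof -
  have [measurable]: "expo s \<in> borel_measurable borel" by (intro smooth_borel_measurable(2) smooth_exp)
  define U where "U t = u t * expo s t" for t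
  define G where "G t = g t * expo s t" for t
  have [measurable]: "U \<in> borel_measurable borel" "G \<in> borel_measurable borel"
    unfolding U_def[abs_def] G_def[abs_def] by measurable
  have iU: "integrable lborel U" and iG: "integrable lborel G" using u g by (simp_all add: U_def[abs_def] G_def[abs_def])
  have F: "integrable (lborel \<Otimes>\<^sub>M lborel) (\<lambda>(t, x). U t * G (x - t))"
  proof (rule lborel_pair.Fubini_integrable)
    show "(\<lambda>(t, x). U t * G (x - t)) \<in> borel_measurable (lborel \<Otimes>\<^sub>M lborel)" by measurable
    have "(LINT x|lborel. norm (case (t, x) of (t, x) \<Rightarrow> U t * G (x - t))) = norm (U t) * (LINT x|lborel. norm (G x))" for t
      using lborel_translate(1)[of "\<lambda>x. norm (G x)" t] by (simp add: norm_mult)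
    then show "integrable lborel (\<lambda>t. LINT x|lborel. norm (case (t, x) of (t, x) \<Rightarrow> U t * G (x - t)))"
      using iU by simp
    show "AE t in lborel. integrable lborel (\<lambda>x. case (t, x) of (t, x) \<Rightarrow> U t * G (x - t))"
      using lborel_translate(2)[OF _ iG] by (intro AE_I2) simp
  qed
  have eq: "(LINT t|lborel. U t * G (x - t)) = (LINT t|lborel. u t * g (x - t)) * expo s x" for x
  proof -
    have "U t * G (x - t) = (u t * g (x - t)) * expo s x" for t
      by (simp add: U_def G_def mult_exp_exp mult_ac) (simp add: algebra_simps mult_exp_exp)
    then show ?thesis by simp
  qed
  show "integrable lborel (\<lambda>x. (LINT t|lborel. u t * g (x - t)) * expo s x)"
    using lborel_pair.integrable_snd[OF F] by (simp add: eq)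
  have "(LINT x|lborel. (LINT t|lborel. U t * G (x - t))) = (LINT t|lborel. (LINT x|lborel. U t * G (x - t)))"
    by (rule lborel_pair.Fubini_integral[OF F])
  also have "\<dots> = (LINT t|lborel. U t * (LINT x|lborel. G x))" using lborel_translate(1)[of G] by simp
  also have "\<dots> = (LINT t|lborel. U t) * (LINT x|lborel. G x)" by simp
  finally show "(LINT x|lborel. (LINT t|lborel. u t * g (x - t)) * expo s x) =
      (LINT t|lborel. u t * expo s t) * (LINT t|lborel. g t * expo s t)"
    unfolding eq by (simp add: U_def G_def)
qed

lemma (in weighted_function) integrable_minus_part_expo:
  assumes "Re s \<le> - B"
  shows "integrable lebesgue (\<lambda>t. minus_part u t * expo s t)"
proof -
  interpret N: weighted_function "minus_part u" B by (rule minus_part_weighted) unfold_locales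
  show ?thesis
  proof (rule N.integrable_weighted(1)[where C = 1])
    fix t assume "minus_part u t \<noteq> 0"
    then have "t < 0" by (auto simp: minus_part_def split: if_splits)
    then show "norm (expo s t) \<le> 1 * exp (- (B * \<bar>t\<bar>))"
      using mult_right_mono_neg[OF assms, of t] by simp
  qed measurable
qed

text \<open>Fubini's theorem is applied on a product of Borel measures, for which \<open>H\<close>,
  merely Lebesgue measurable, has to be changed on a null set.\<close>

lemma complex_borel_version:
  fixes H :: "real \<Rightarrow> complex"
  assumes "H \<in> borel_measurable lebesgue"
  obtains H' where "H' \<in> borel_measurable borel" "AE t in lebesgue. H t = H' t"
proof -
  have "(\<lambda>t. Re (H t)) \<in> borel_measurable lebesgue" "(\<lambda>t. Im (H t)) \<in> borel_measurable lebesgue"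
    using assms by measurable
  from this[THEN completion_ex_borel_measurable_real]
  obtain R I where RI: "R \<in> borel_measurable lborel" "AE t in lborel. Re (H t) = R t"
    "I \<in> borel_measurable lborel" "AE t in lborel. Im (H t) = I t" by blast
  have "AE t in lborel. H t = Complex (R t) (I t)"
    using RI(2,4) by eventually_elim (simp add: complex_eq_iff)
  moreover have "(\<lambda>t. Complex (R t) (I t)) \<in> borel_measurable borel"
  proof -
    have "(\<lambda>t. complex_of_real (R t) + \<i> * complex_of_real (I t)) \<in> borel_measurable borel"
      using RI(1,3) by measurable
    then show ?thesis by (simp add: Complex_eq)
  qed
  ultimately show ?thesis using that AE_completion by blast
qed

text \<open>The numerator is the transform of one function \<open>c\<close>, equal to
  \<open>H\<^sup>+ * g\<close> and to \<open>- H\<^sup>- * g\<close>. The first form gives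
  convergence far to the right, the second far to the left, and both together convergence
  everywhere, so the numerator is entire.\<close>

lemma Schwartz_carleman_quotient:
  assumes w: "weighted_function H (real b)" and g: "g \<in> Schwartz_annihilators_add (regular_add H)"
  shows "carleman_quotient H
     (Laplace_fun (\<lambda>x. LINT y|lebesgue. plus_part H (x - y) * g y)) (Laplace_fun g)"
proof -
  interpret W: weighted_function H "real b" by fact
  have gS: "g \<in> topspace Schwartz_add_top" and ann: "\<And>x. (LINT t|lebesgue. g (x - t) * H t) = 0"
    using g by (auto simp: Schwartz_annihilators_add_def conv_add_def regular_add_def)
  obtain x0 where x0: "g x0 \<noteq> 0" using g by (auto simp: Schwartz_annihilators_add_def)
  obtain H' where mH'[measurable]: "H' \<in> borel_measurable borel" and ae: "AE t in lebesgue. H t = H' t"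
    by (rule complex_borel_version[OF W.u_meas])
  have mH'l [measurable]: "H' \<in> borel_measurable lebesgue" by (rule borel_imp_lebesgue_measurable[OF mH'])
  have mg [measurable]: "g \<in> borel_measurable borel" by (rule Schwartz_measurable[OF gS])
  have me [measurable]: "(\<lambda>t. exp (- (real b * \<bar>t\<bar>))) \<in> borel_measurable lebesgue"
    by (intro borel_imp_lebesgue_measurable) measurable
  have ex [measurable]: "expo s \<in> borel_measurable borel" for s by (intro smooth_borel_measurable(2) smooth_exp)
  have w': "weighted_function H' (real b)"
  proof
    have "integrable lebesgue (\<lambda>t. norm (H t) * exp (- (real b * \<bar>t\<bar>))) \<longleftrightarrow>
        integrable lebesgue (\<lambda>t. norm (H' t) * exp (- (real b * \<bar>t\<bar>)))"
      by (rule integrable_cong_AE) (use ae in \<open>auto elim: eventually_mono\<close>)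
    then show "integrable lebesgue (\<lambda>t. norm (H' t) * exp (- (real b * \<bar>t\<bar>)))" using W.u_int by simp
  qed measurable
  interpret W': weighted_function H' "real b" by fact
  interpret WP': weighted_function "plus_part H'" "real b" by (rule plus_part_weighted[OF w'])
  interpret WN': weighted_function "minus_part H'" "real b" by (rule minus_part_weighted[OF w'])
  interpret WP: weighted_function "plus_part H" "real b" by (rule plus_part_weighted[OF w])
  interpret WN: weighted_function "minus_part H" "real b" by (rule minus_part_weighted[OF w])
  have pb [measurable]: "plus_part H' \<in> borel_measurable borel" "minus_part H' \<in> borel_measurable borel"
    unfolding plus_part_def[abs_def] minus_part_def[abs_def] by measurable
  have aep: "AE t in lebesgue. plus_part H t = plus_part H' t"
    and aem: "AE t in lebesgue. minus_part H t = minus_part H' t"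
    using ae by (auto elim!: eventually_mono simp: plus_part_def minus_part_def)
  have gs [measurable]: "(\<lambda>t. g (x - t)) \<in> borel_measurable borel" for x by measurable
  have gsl [measurable]: "(\<lambda>t. g (x - t)) \<in> borel_measurable lebesgue" for x by (rule borel_imp_lebesgue_measurable[OF gs])
  define c where "c x = (LINT t|lborel. plus_part H' t * g (x - t))" for x
  define d where "d x = (LINT t|lborel. minus_part H' t * g (x - t))" for x
  have c_eq: "(LINT y|lebesgue. plus_part H (x - y) * g y) = c x" for x
  proof -
    have "(LINT y|lebesgue. plus_part H (x - y) * g y) = (LINT t|lebesgue. plus_part H t * g (x - t))"
      using integral_lebesgue_affine[of "\<lambda>t. plus_part H t * g (x - t)" x] by simp
    also have "\<dots> = (LINT t|lebesgue. plus_part H' t * g (x - t))"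
      by (rule integral_cong_AE) (use aep in \<open>auto elim: eventually_mono\<close>)
    also have "\<dots> = c x" unfolding c_def by (rule integral_completion) measurable
    finally show ?thesis .
  qed
  obtain C where C: "\<And>t. norm (g t) \<le> C * exp (- (real b * \<bar>t\<bar>))" using Schwartz_add_decay[OF gS] by blast
  have C0: "C \<ge> 0" using order_trans[OF norm_ge_zero C[of 0]] by simp
  have gb: "norm (g (x - t)) \<le> (C * exp (real b * \<bar>x\<bar>)) * exp (- (real b * \<bar>t\<bar>))" for x t
  proof -
    have "real b * \<bar>t\<bar> \<le> real b * (\<bar>x - t\<bar> + \<bar>x\<bar>)" by (intro mult_left_mono) auto
    then have "exp (- (real b * \<bar>x - t\<bar>)) \<le> exp (real b * \<bar>x\<bar>) * exp (- (real b * \<bar>t\<bar>))"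
      by (simp add: mult_exp_exp algebra_simps)
    from mult_left_mono[OF this C0] C[of "x - t"] show ?thesis by (simp add: mult.assoc)
  qed
  have cd: "c x = - d x" for x
  proof -
    have i: "integrable lebesgue (\<lambda>t. plus_part H' t * g (x - t))" "integrable lebesgue (\<lambda>t. minus_part H' t * g (x - t))"
      by (rule WP'.integrable_weighted(1)[OF gsl gb] WN'.integrable_weighted(1)[OF gsl gb])+
    have "c x + d x = (LINT t|lebesgue. plus_part H' t * g (x - t)) + (LINT t|lebesgue. minus_part H' t * g (x - t))"
      unfolding c_def d_def by (subst (1 2) integral_completion) measurable
    also have "\<dots> = (LINT t|lebesgue. plus_part H' t * g (x - t) + minus_part H' t * g (x - t))"
      by (rule Bochner_Integration.integral_add[OF i, symmetric])
    also have "\<dots> = (LINT t|lebesgue. g (x - t) * H t)"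
    proof (rule integral_cong_AE)
      show "(\<lambda>t. plus_part H' t * g (x - t) + minus_part H' t * g (x - t)) \<in> borel_measurable lebesgue"
        by measurable
      show "AE t in lebesgue. plus_part H' t * g (x - t) + minus_part H' t * g (x - t) = g (x - t) * H t"
        using ae by eventually_elim (simp add: plus_part_def minus_part_def)
    qed measurable
    finally show ?thesis using ann[of x] by (simp add: eq_neg_iff_add_eq_0)
  qed
  have ig: "integrable lborel (\<lambda>t. g t * expo s t)" for s
  proof -
    interpret G: weighted_function g "- norm s" by (rule Schwartz_weighted[OF gS])
    have "integrable lebesgue (\<lambda>t. g t * expo s t)"
      by (rule G.integrable_weighted(1)[of _ 1]) (use expo_bound[of s "norm s" 0] in auto)
    then show ?thesis by (subst (asm) integrable_completion) measurable
  qed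
  have iP: "integrable lborel (\<lambda>t. plus_part H' t * expo s t)" if "Re s \<ge> real b" for s
  proof -
    have "integrable lebesgue (\<lambda>t. plus_part H' t * expo s t)"
      using W'.laplace_integrable_plus_part[OF that] by (simp add: laplace_integrable_iff)
    then show ?thesis by (subst (asm) integrable_completion) measurable
  qed
  have iN: "integrable lborel (\<lambda>t. minus_part H' t * expo s t)" if "Re s \<le> - real b" for s
    using W'.integrable_minus_part_expo[OF that] by (subst (asm) integrable_completion) measurable
  have LP: "Laplace_fun (plus_part H) s = (LINT t|lborel. plus_part H' t * expo s t)" for s
  proof -
    have "Laplace_fun (plus_part H) s = (LINT t|lebesgue. plus_part H' t * expo s t)"
      unfolding Laplace_fun_def by (rule integral_cong_AE) (use aep in \<open>auto elim: eventually_mono\<close>)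
    also have "\<dots> = (LINT t|lborel. plus_part H' t * expo s t)" by (rule integral_completion) measurable
    finally show ?thesis .
  qed
  have LN: "Laplace_fun (minus_part H) s = (LINT t|lborel. minus_part H' t * expo s t)" for s
  proof -
    have "Laplace_fun (minus_part H) s = (LINT t|lebesgue. minus_part H' t * expo s t)"
      unfolding Laplace_fun_def by (rule integral_cong_AE) (use aem in \<open>auto elim: eventually_mono\<close>)
    also have "\<dots> = (LINT t|lborel. minus_part H' t * expo s t)" by (rule integral_completion) measurable
    finally show ?thesis .
  qed
  have Lg: "Laplace_fun g s = (LINT t|lborel. g t * expo s t)" for s
    unfolding Laplace_fun_def by (rule integral_completion) measurable
  have mc [measurable]: "c \<in> borel_measurable borel"
    unfolding c_def[abs_def] by measurable
  have Lc: "Laplace_fun c s = (LINT x|lborel. c x * expo s x)" for s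
    unfolding Laplace_fun_def by (rule integral_completion) measurable
  have icP: "integrable lborel (\<lambda>x. c x * expo s x)"
    and LcP: "Laplace_fun c s = Laplace_fun (plus_part H) s * Laplace_fun g s" if "Re s \<ge> real b" for s
    unfolding Lc LP Lg unfolding c_def using convolution_laplace[OF pb(1) mg iP[OF that] ig] by blast+
  have icN: "integrable lborel (\<lambda>x. c x * expo s x)"
    and LcN: "Laplace_fun c s = - (Laplace_fun (minus_part H) s * Laplace_fun g s)" if "Re s \<le> - real b" for s
    unfolding Lc LN Lg cd unfolding d_def using convolution_laplace[OF pb(2) mg iN[OF that] ig] by simp_all
  have ic: "integrable lebesgue (\<lambda>x. c x * expo s x)" for s
  proof -
    \<comment> \<open>\<open>k\<close> and \<open>- k\<close> lie in the two half-planes of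
      convergence and \<open>k \<ge> \<bar>Re s\<bar>\<close>; the norms of the two integrands there
      add up to a majorant of the one at \<open>s\<close>.\<close>
    define k where "k = \<bar>Re s\<bar> + real b"
    have "integrable lborel (\<lambda>x. norm (c x * expo (complex_of_real k) x) + norm (c x * expo (- complex_of_real k) x))"
      using icP[of "complex_of_real k"] icN[of "- complex_of_real k"]
      by (intro Bochner_Integration.integrable_add integrable_norm) (auto simp: k_def)
    then have "integrable lborel (\<lambda>x. c x * expo s x)"
    proof (rule Bochner_Integration.integrable_bound)
      have "norm (c x * expo s x) \<le> norm (c x * expo (complex_of_real k) x) + norm (c x * expo (- complex_of_real k) x)" for x
      proof -
        have "- (Re s * x) \<le> \<bar>Re s\<bar> * \<bar>x\<bar>" using abs_ge_minus_self[of "Re s * x"] by (simp add: abs_mult)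
        also have "\<dots> \<le> k * \<bar>x\<bar>" unfolding k_def by (intro mult_right_mono) auto
        finally have "exp (- (Re s * x)) \<le> exp (k * \<bar>x\<bar>)" by simp
        also have "\<dots> \<le> exp (- (k * x)) + exp (k * x)" by (cases "x \<ge> 0") (auto simp: add_increasing add_increasing2)
        finally have "norm (c x) * exp (- (Re s * x)) \<le> norm (c x) * (exp (- (k * x)) + exp (k * x))"
          by (intro mult_left_mono) auto
        then show ?thesis by (simp add: norm_mult distrib_left)
      qed
      then show "AE x in lborel. norm (c x * expo s x) \<le>
          norm (norm (c x * expo (complex_of_real k) x) + norm (c x * expo (- complex_of_real k) x))"
        by (intro AE_I2) (metis abs_ge_self order_trans real_norm_def)
    qed measurable
    then show ?thesis by (subst integrable_completion) measurable
  qed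
  have "Laplace_fun c holomorphic_on UNIV"
    unfolding Laplace_fun_def[abs_def] using laplace_integral_holomorphic[OF open_UNIV ic] by simp
  then show ?thesis
    unfolding carleman_quotient_def c_eq
    using Schwartz_Laplace_entire[OF gS] Schwartz_Laplace_nonzero[OF gS x0] LcP LcN by blast
qed

section \<open>The Carleman transform in all four spaces\<close>

lemma functional_carleman_quotient:
  assumes a: "annihilated_function \<phi> H b" and nz: "\<exists>g\<in>topspace Cexp_top. \<phi> g \<noteq> 0"
  shows "carleman_quotient H (Laplace_distr (conv_distr (plus_part H) \<phi>)) (Laplace_functional \<phi>)"
proof -
  interpret annihilated_function \<phi> H b by fact
  show ?thesis
    unfolding carleman_quotient_def
    using carleman_numerator laplace_functional_entire laplace_functional_nonzero nz by blast
qed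

text \<open>In the tempered case it asks for an annihilator alone; this is what gets transported
  from the multiplicative group.\<close>

definition has_annihilator :: "mp_space \<Rightarrow> (real \<Rightarrow> complex) \<Rightarrow> bool" where
  "has_annihilator X H \<longleftrightarrow>
     (if X = Schwartz_dual then Schwartz_annihilators_add (regular_add H) \<noteq> {} else mean_periodic_add X H)"

lemma mean_periodic_add_has_annihilator: "mean_periodic_add X H \<Longrightarrow> has_annihilator X H"
  by (cases X) (auto simp: has_annihilator_def)

theorem Laplace_Carleman_quotient:
  assumes mp: "has_annihilator X H" and w: "weighted_function H (real b)"
  shows "\<exists>N D. carleman_quotient H N D \<and> Laplace_Carleman X H = remove_sings (\<lambda>s. N s / D s)"
proof (cases X)
  case Cont
  \<comment> \<open>The annihilator selected inside the definition of the transform; the quotient is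
    established for this very choice.\<close>
  define \<phi> where "\<phi> = (SOME \<phi>. \<phi> \<in> annihilators_add C_top H)"
  have "\<phi> \<in> annihilators_add C_top H"
    unfolding \<phi>_def some_in_eq using mp Cont by (simp add: has_annihilator_def)
  moreover have "H \<in> topspace C_top" using mp Cont by (simp add: has_annihilator_def)
  ultimately have "carleman_quotient H (Laplace_distr (conv_distr (plus_part H) \<phi>)) (Laplace_functional \<phi>)"
    using w by (intro functional_carleman_quotient C_annihilator)
  then show ?thesis
    unfolding Cont Laplace_Carleman.simps Laplace_Carleman_fun_def Let_def \<phi>_def[symmetric] by blast
next
  case Cinf
  define \<phi> where "\<phi> = (SOME \<phi>. \<phi> \<in> annihilators_add Cinf_top H)"
  have "\<phi> \<in> annihilators_add Cinf_top H"
    unfolding \<phi>_def some_in_eq using mp Cinf by (simp add: has_annihilator_def)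
  moreover have "H \<in> topspace Cinf_top" using mp Cinf by (simp add: has_annihilator_def)
  ultimately have "carleman_quotient H (Laplace_distr (conv_distr (plus_part H) \<phi>)) (Laplace_functional \<phi>)"
    using w by (intro functional_carleman_quotient Cinf_annihilator)
  then show ?thesis
    unfolding Cinf Laplace_Carleman.simps Laplace_Carleman_fun_def Let_def \<phi>_def[symmetric] by blast
next
  case Cinf_growth
  define \<phi> where "\<phi> = (SOME \<phi>. \<phi> \<in> annihilators_add Cexp_top H)"
  have "\<phi> \<in> annihilators_add Cexp_top H"
    unfolding \<phi>_def some_in_eq using mp Cinf_growth by (simp add: has_annihilator_def)
  moreover have "H \<in> topspace Cexp_top" using mp Cinf_growth by (simp add: has_annihilator_def)
  ultimately have "carleman_quotient H (Laplace_distr (conv_distr (plus_part H) \<phi>)) (Laplace_functional \<phi>)"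
    using w by (intro functional_carleman_quotient Cexp_annihilator)
  then show ?thesis
    unfolding Cinf_growth Laplace_Carleman.simps Laplace_Carleman_fun_def Let_def \<phi>_def[symmetric] by blast
next
  case Schwartz_dual
  define g where "g = (SOME g. g \<in> Schwartz_annihilators_add (regular_add H))"
  have "g \<in> Schwartz_annihilators_add (regular_add H)"
    unfolding g_def some_in_eq using mp Schwartz_dual by (simp add: has_annihilator_def)
  from Schwartz_carleman_quotient[OF w this]
  show ?thesis
    unfolding Schwartz_dual Laplace_Carleman.simps Laplace_Carleman_Schwartz_def Let_def g_def[symmetric] by blast
qed

section \<open>From the multiplicative to the additive group\<close>

lemma topspace_mult_of_add: "h \<in> topspace (mult_of_add T) \<longleftrightarrow> (\<lambda>t. h (exp (- t))) \<in> topspace T"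
  unfolding mult_of_add_def topspace_pullback_topology by simp

text \<open>Functions that agree on the positive reals are topologically indistinguishable.\<close>

lemma top_dual_mult_of_add_cong:
  assumes \<phi>: "\<phi> \<in> top_dual (mult_of_add T)" and h: "h \<in> topspace (mult_of_add T)"
    and eq: "\<And>x. x > 0 \<Longrightarrow> h x = h' x"
  shows "\<phi> h = \<phi> h'"
proof -
  have e: "(\<lambda>t. h (exp (- t))) = (\<lambda>t. h' (exp (- t)))" using eq by simp
  have c: "continuous_map (mult_of_add T) euclidean \<phi>" using \<phi> by (simp add: top_dual_def)
  let ?U = "{k \<in> topspace (mult_of_add T). \<phi> k \<in> - {\<phi> h'}}"
  have "openin (mult_of_add T) ?U"
    by (rule openin_continuous_map_preimage[OF c]) auto
  then obtain V where V: "?U = (\<lambda>h t. h (exp (- t))) -` V"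
    unfolding mult_of_add_def openin_pullback_topology by auto
  have "h \<in> ?U \<longleftrightarrow> h' \<in> ?U" unfolding V using e by simp
  then show ?thesis using h by auto
qed

text \<open>Pulls the functional back along \<open>g \<mapsto> (\<lambda>x. g (- ln x))\<close>,
  which inverts the change of variables except for values outside the positive reals.\<close>

lemma annihilators_mult_imp_add:
  assumes trans: "\<And>x. (\<lambda>t. h (exp (- (x - t)))) \<in> topspace T" and ne: "annihilators_mult (mult_of_add T) h \<noteq> {}"
  shows "annihilators_add T (\<lambda>t. h (exp (- t))) \<noteq> {}"
proof -
  obtain \<phi> where \<phi>: "\<phi> \<in> top_dual (mult_of_add T)" "\<exists>k\<in>topspace (mult_of_add T). \<phi> k \<noteq> 0"
    "\<And>x. x > 0 \<Longrightarrow> \<phi> (\<lambda>y. h (x / y)) = 0"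
    using ne by (auto simp: annihilators_mult_def conv_mult_def)
  define \<psi> where "\<psi> = (\<lambda>g. \<phi> (\<lambda>x. g (- ln x)))"
  have in_top: "(\<lambda>x. g (- ln x)) \<in> topspace (mult_of_add T)" if "g \<in> topspace T" for g
    using that by (simp add: topspace_mult_of_add)
  have "continuous_map T (mult_of_add T) (\<lambda>g x. g (- ln x))"
    unfolding continuous_map_def
  proof (intro conjI allI impI)
    show "(\<lambda>g x. g (- ln x)) \<in> topspace T \<rightarrow> topspace (mult_of_add T)" using in_top by auto
    fix U assume "openin (mult_of_add T) U"
    then obtain V where V: "openin T V" "U = (\<lambda>h t. h (exp (- t))) -` V"
      unfolding mult_of_add_def openin_pullback_topology by auto
    have "{g \<in> topspace T. (\<lambda>x. g (- ln x)) \<in> U} = topspace T \<inter> V" unfolding V(2) by auto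
    then show "openin T {g \<in> topspace T. (\<lambda>x. g (- ln x)) \<in> U}" using V(1) by auto
  qed
  from continuous_map_compose[OF this, of euclidean \<phi>] \<phi>(1)
  have "continuous_map T euclidean \<psi>" by (simp add: top_dual_def \<psi>_def o_def)
  moreover have "\<psi> (\<lambda>x. a * f x + b * g x) = a * \<psi> f + b * \<psi> g" if "f \<in> topspace T" "g \<in> topspace T" for f g a b
    unfolding \<psi>_def using \<phi>(1) in_top[OF that(1)] in_top[OF that(2)] by (simp add: top_dual_def)
  ultimately have "\<psi> \<in> top_dual T" by (simp add: top_dual_def)
  moreover have "\<exists>g\<in>topspace T. \<psi> g \<noteq> 0"
  proof -
    obtain k where k: "k \<in> topspace (mult_of_add T)" "\<phi> k \<noteq> 0" using \<phi>(2) by blast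
    have "\<phi> k = \<psi> (\<lambda>t. k (exp (- t)))"
      unfolding \<psi>_def by (rule top_dual_mult_of_add_cong[OF \<phi>(1) k(1)]) simp
    then show ?thesis using k by (intro bexI[of _ "\<lambda>t. k (exp (- t))"]) (simp_all add: topspace_mult_of_add)
  qed
  moreover have "conv_add (\<lambda>t. h (exp (- t))) \<psi> x = 0" for x
  proof -
    \<comment> \<open>For \<open>y > 0\<close> the multiplicative translate and the pulled-back
      additive one coincide; elsewhere they may differ, which \<open>\<phi>\<close> cannot see. The
      hypothesis \<open>trans\<close> supplies membership in the domain.\<close>
    have eq: "h (exp (- (x + ln y))) = h (exp (- x) / y)" if "y > 0" for y
      using that by (simp add: exp_diff exp_minus divide_inverse exp_add)
    have "(\<lambda>t. h (exp (- x) / exp (- t))) = (\<lambda>t. h (exp (- (x - t))))"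
      by (simp add: exp_diff[symmetric])
    then have "(\<lambda>y. h (exp (- x) / y)) \<in> topspace (mult_of_add T)"
      using trans[of x] by (simp add: topspace_mult_of_add)
    then have "\<phi> (\<lambda>y. h (exp (- x) / y)) = conv_add (\<lambda>t. h (exp (- t))) \<psi> x"
      unfolding conv_add_def \<psi>_def
      by (rule top_dual_mult_of_add_cong[OF \<phi>(1)]) (use eq in \<open>simp add: algebra_simps\<close>)
    then show ?thesis using \<phi>(3)[of "exp (- x)"] by simp
  qed
  ultimately show ?thesis by (auto simp: annihilators_add_def)
qed

lemma Cexp_reflect_shift:
  assumes "H \<in> topspace Cexp_top"
  shows "(\<lambda>t. H (x - t)) \<in> topspace Cexp_top"
proof -
  obtain m where m: "H \<in> exp_space m" using assms by (auto simp: topspace_Cexp_top)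
  have eq: "(\<lambda>t. H (x - t)) = (\<lambda>t. H ((-1) * t + x))" by simp
  have "(\<lambda>t. H (x - t)) \<in> exp_space m"
    unfolding exp_space_def eq
  proof (intro CollectI conjI allI smooth_affine exp_spaceD(1)[OF m])
    fix n
    obtain C where C: "\<And>y. norm (iter_deriv n H y) \<le> C * exp (real m * \<bar>y\<bar>)" using exp_spaceD(2)[OF m] by blast
    have C0: "C \<ge> 0" using order_trans[OF norm_ge_zero C[of 0]] by simp
    have "norm (iter_deriv n H ((-1) * t + x)) \<le> (C * exp (real m * \<bar>x\<bar>)) * exp (real m * \<bar>t\<bar>)" for t
    proof -
      have "real m * \<bar>(-1) * t + x\<bar> \<le> real m * (\<bar>x\<bar> + \<bar>t\<bar>)" by (intro mult_left_mono) auto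
      then have "exp (real m * \<bar>(-1) * t + x\<bar>) \<le> exp (real m * \<bar>x\<bar>) * exp (real m * \<bar>t\<bar>)"
        by (simp add: mult_exp_exp distrib_left)
      from order_trans[OF C mult_left_mono[OF this C0]] show ?thesis by (simp add: mult.assoc)
    qed
    then show "\<exists>C. \<forall>t. norm (iter_deriv n (\<lambda>t. H ((-1) * t + x)) t) \<le> C * exp (real m * \<bar>t\<bar>)"
      unfolding iter_deriv_affine[OF exp_spaceD(1)[OF m]] by (auto simp: norm_mult norm_power)
  qed
  then show ?thesis by (auto simp: topspace_Cexp_top)
qed

section \<open>The Mellin transform in the additive variable\<close>

lemma
  fixes F :: "real \<Rightarrow> complex"
  assumes S: "S \<in> sets lebesgue"
  shows exp_substitution_integrable: "set_integrable lebesgue ((\<lambda>t. exp (- t)) ` S) F \<longleftrightarrow>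
      set_integrable lebesgue S (\<lambda>t. exp (- t) *\<^sub>R F (exp (- t)))"
    and exp_substitution_integral: "(LINT x:(\<lambda>t. exp (- t)) ` S|lebesgue. F x) =
      (LINT t:S|lebesgue. exp (- t) *\<^sub>R F (exp (- t)))"
proof -
  have d: "\<And>x. x \<in> S \<Longrightarrow> ((\<lambda>t. exp (- t)) has_field_derivative - exp (- x)) (at x within S)"
    by (auto intro!: derivative_eq_intros)
  have inj: "inj_on (\<lambda>t::real. exp (- t)) S" by (auto intro: inj_onI)
  note cv = has_absolute_integral_change_of_variables_real[OF S d inj, of F]
  note ci = absolutely_integrable_change_of_variables_real[OF S d inj, of F]
  show i: "set_integrable lebesgue ((\<lambda>t. exp (- t)) ` S) F \<longleftrightarrow>
      set_integrable lebesgue S (\<lambda>t. exp (- t) *\<^sub>R F (exp (- t)))"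
    using ci by simp
  show "(LINT x:(\<lambda>t. exp (- t)) ` S|lebesgue. F x) = (LINT t:S|lebesgue. exp (- t) *\<^sub>R F (exp (- t)))"
  proof (cases "set_integrable lebesgue ((\<lambda>t. exp (- t)) ` S) F")
    case True
    then have "integral S (\<lambda>t. exp (- t) *\<^sub>R F (exp (- t))) = integral ((\<lambda>t. exp (- t)) ` S) F"
      using cv[of "integral ((\<lambda>t. exp (- t)) ` S) F"] by simp
    then show ?thesis using set_lebesgue_integral_eq_integral(2) True i by metis
  next
    case False
    then show ?thesis using i by (simp add: set_integrable_def set_lebesgue_integral_def not_integrable_integral_eq)
  qed
qed

text \<open>The Jacobian \<open>exp (- t)\<close> cancels the \<open>1 / x\<close> of the
  multiplicative Haar measure.\<close>

lemma mellin_integrand: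
  "exp (- t) *\<^sub>R (c * complex_of_real (exp (- t)) powr s / complex_of_real (exp (- t))) = c * expo s t"
proof -
  have "complex_of_real (exp (- t)) powr s = expo s t"
    using Ln_of_real[of "exp (- t)"] by (simp add: powr_def)
  then show ?thesis by (simp add: scaleR_conv_of_real)
qed

lemma
  assumes S: "S \<in> sets lebesgue"
  shows mellin_integrable_substitution: "mellin_integrable ((\<lambda>t. exp (- t)) ` S) F s \<longleftrightarrow>
      integrable lebesgue (\<lambda>t. indicator S t * F (exp (- t)) * expo s t)"
    and mellin_substitution: "mellin ((\<lambda>t. exp (- t)) ` S) F s =
      Laplace_fun (\<lambda>t. indicator S t * F (exp (- t))) s"
proof -
  have eq: "indicator S t *\<^sub>R (exp (- t) *\<^sub>R (F (exp (- t)) * complex_of_real (exp (- t)) powr s / complex_of_real (exp (- t))))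
      = indicator S t * F (exp (- t)) * expo s t" for t
    unfolding mellin_integrand by (simp add: indicator_def)
  show "mellin_integrable ((\<lambda>t. exp (- t)) ` S) F s \<longleftrightarrow>
      integrable lebesgue (\<lambda>t. indicator S t * F (exp (- t)) * expo s t)"
    unfolding mellin_integrable_def exp_substitution_integrable[OF S] unfolding set_integrable_def eq ..
  show "mellin ((\<lambda>t. exp (- t)) ` S) F s = Laplace_fun (\<lambda>t. indicator S t * F (exp (- t))) s"
    unfolding mellin_def exp_substitution_integral[OF S] unfolding set_lebesgue_integral_def eq Laplace_fun_def ..
qed

lemma exp_uminus_images:
  "(\<lambda>t. exp (- t)) ` UNIV = {0::real<..}" "(\<lambda>t. exp (- t)) ` {..<0} = {1::real<..}"
  "(\<lambda>t. exp (- t)) ` {0<..} = {0::real<..<1}" "(\<lambda>t. exp (- t)) ` {- T..T} = {exp (- T)..exp T :: real}"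
proof -
  have x: "x \<in> (\<lambda>t. exp (- t)) ` S" if "x > 0" "- ln x \<in> S" for x :: real and S
    using that by (intro image_eqI[of _ _ "- ln x"]) simp_all
  show "(\<lambda>t. exp (- t)) ` UNIV = {0::real<..}"
    by (auto intro!: x)
  show "(\<lambda>t. exp (- t)) ` {..<0} = {1::real<..}"
    by (auto intro!: x)
  show "(\<lambda>t. exp (- t)) ` {0<..} = {0::real<..<1}"
    by (auto intro!: x)
  show "(\<lambda>t. exp (- t)) ` {- T..T} = {exp (- T)..exp T :: real}"
  proof (intro equalityI subsetI)
    fix y :: real assume y: "y \<in> {exp (- T)..exp T}"
    then have y0: "y > 0" using less_le_trans[OF exp_gt_zero[of "- T"], of y] by simp
    have "- T \<le> ln y" "ln y \<le> T" using y y0 ln_le_cancel_iff[of y "exp T"] by (simp_all add: ln_ge_iff)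
    then show "y \<in> (\<lambda>t. exp (- t)) ` {- T..T}" using y0 by (intro x) auto
  qed auto
qed

lemma mean_periodic_mult_has_annihilator:
  assumes "mean_periodic_mult X h"
  shows "has_annihilator X (\<lambda>t. h (exp (- t)))"
proof (cases X)
  case Cont
  then have h: "(\<lambda>t. h (exp (- t))) \<in> topspace C_top" and "annihilators_mult (mult_of_add C_top) h \<noteq> {}"
    using assms by (auto simp: topspace_mult_of_add)
  moreover have "(\<lambda>t. h (exp (- (x - t)))) \<in> topspace C_top" for x
  proof -
    have "continuous_on UNIV (\<lambda>t::real. x - t)" by (intro continuous_intros)
    from continuous_on_compose2[OF _ this, of UNIV "\<lambda>t. h (exp (- t))"] h
    show ?thesis by (simp add: topspace_C_top)
  qed
  ultimately show ?thesis using Cont annihilators_mult_imp_add by (simp add: has_annihilator_def)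
next
  case Cinf
  then have h: "(\<lambda>t. h (exp (- t))) \<in> topspace Cinf_top" and "annihilators_mult (mult_of_add Cinf_top) h \<noteq> {}"
    using assms by (auto simp: topspace_mult_of_add)
  moreover have "(\<lambda>t. h (exp (- (x - t)))) \<in> topspace Cinf_top" for x
    using smooth_affine[of "\<lambda>t. h (exp (- t))" "-1" x] h by (simp add: topspace_Cinf_top)
  ultimately show ?thesis using Cinf annihilators_mult_imp_add by (simp add: has_annihilator_def)
next
  case Cinf_growth
  then have h: "(\<lambda>t. h (exp (- t))) \<in> topspace Cexp_top" and "annihilators_mult (mult_of_add Cexp_top) h \<noteq> {}"
    using assms by (auto simp: topspace_mult_of_add)
  moreover have "(\<lambda>t. h (exp (- (x - t)))) \<in> topspace Cexp_top" for x
    by (rule Cexp_reflect_shift[OF h])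
  ultimately show ?thesis using Cinf_growth annihilators_mult_imp_add by (simp add: has_annihilator_def)
next
  case Schwartz_dual
  then obtain g where g: "g \<in> topspace Schwartz_mult_top" "\<exists>x>0. g x \<noteq> 0"
    "\<And>x. x > 0 \<Longrightarrow> regular_mult h (\<lambda>y. g (x / y)) = 0"
    using assms by (auto simp: Schwartz_annihilators_mult_def conv_mult_def)
  define k where "k t = g (exp (- t))" for t
  have "(\<lambda>x. k (- ln x)) \<in> topspace Schwartz_mult_top"
  proof -
    \<comment> \<open>\<open>k\<close> forgets the values of \<open>g\<close> outside the positive
      reals; agreement on an open set carries over to all derivatives there.\<close>
    have eq: "g x = k (- ln x)" if "x \<in> {0<..}" for x using that by (simp add: k_def)
    have d: "iter_deriv n (\<lambda>x. k (- ln x)) x = iter_deriv n g x" if "x \<in> {0<..}" for n x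
      by (rule iter_deriv_cong_open[of "{0<..}", symmetric]) (use eq that in auto)
    have "smooth_fun_on {0<..} (\<lambda>x. k (- ln x))"
      by (rule smooth_fun_on_cong[of "{0<..}" g]) (use g(1) eq in \<open>auto simp: topspace_Schwartz_mult_top\<close>)
    moreover have "(\<lambda>x. x powi m * norm (iter_deriv n (\<lambda>x. k (- ln x)) x)) ` {0<..} =
        (\<lambda>x. x powi m * norm (iter_deriv n g x)) ` {0<..}" for m n
      by (intro image_cong refl) (simp add: d)
    ultimately show ?thesis using g(1) by (simp add: topspace_Schwartz_mult_top)
  qed
  then have "k \<in> topspace Schwartz_add_top" by (simp add: topspace_Schwartz_add_top)
  moreover have "\<exists>t. k t \<noteq> 0"
  proof -
    obtain x where "x > 0" "g x \<noteq> 0" using g(2) by blast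
    then show ?thesis by (intro exI[of _ "- ln x"]) (simp add: k_def)
  qed
  moreover have "conv_add k (regular_add (\<lambda>t. h (exp (- t)))) x = 0" for x
  proof -
    have eq: "exp (- t) *\<^sub>R (g (exp (- x) / exp (- t)) * h (exp (- t)) / complex_of_real (exp (- t))) =
        k (x - t) * h (exp (- t))" for t
      by (simp add: k_def scaleR_conv_of_real exp_diff exp_minus field_simps)
    have "regular_mult h (\<lambda>y. g (exp (- x) / y)) =
        (LINT t:UNIV|lebesgue. k (x - t) * h (exp (- t)))"
      unfolding regular_mult_def exp_uminus_images(1)[symmetric]
      by (subst exp_substitution_integral) (simp, simp only: eq)
    also have "\<dots> = conv_add k (regular_add (\<lambda>t. h (exp (- t)))) x"
      by (simp add: conv_add_def regular_add_def set_lebesgue_integral_def)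
    finally show ?thesis using g(3)[of "exp (- x)"] by simp
  qed
  ultimately have "k \<in> Schwartz_annihilators_add (regular_add (\<lambda>t. h (exp (- t))))"
    by (auto simp: Schwartz_annihilators_add_def)
  then show ?thesis using Schwartz_dual by (auto simp: has_annihilator_def)
qed

section \<open>Functions of rapid decay at infinity\<close>

text \<open>Uses \<open>\<epsilon>\<^sup>2 = 1\<close>; in the original variable this is
  \<open>h (1 / x) = - \<epsilon> * x * h x\<close>.\<close>

lemma H_fun_reflect:
  assumes "\<epsilon> \<in> {1, -1}"
  shows "H_fun f \<epsilon> (- t) = - (complex_of_real \<epsilon> * exp (- complex_of_real t) * H_fun f \<epsilon> t)"
proof -
  have "f (exp t) - \<epsilon> * (inverse (exp t) * f (inverse (exp t))) =
      - (\<epsilon> * exp (- t) * (f (exp (- t)) - \<epsilon> * (inverse (exp (- t)) * f (inverse (exp (- t))))))"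
    using assms by (auto simp: exp_minus field_simps)
  then have "H_fun f \<epsilon> (- t) = complex_of_real (- (\<epsilon> * exp (- t) * (f (exp (- t)) - \<epsilon> * (inverse (exp (- t)) * f (inverse (exp (- t)))))))"
    by (simp add: H_fun_def h_fun_def)
  then show ?thesis by (simp add: H_fun_def h_fun_def exp_of_real[symmetric])
qed

locale mellin_function =
  fixes f :: "real \<Rightarrow> real" and \<epsilon> :: real
  assumes loc_int: "\<And>K. compact K \<Longrightarrow> K \<subseteq> {0<..} \<Longrightarrow> f absolutely_integrable_on K"
    and decay_top: "\<And>A. A > 0 \<Longrightarrow> f \<in> O[at_top](\<lambda>x. x powr (- A))"
    and growth_0: "\<exists>A>0. f \<in> O[at_right 0](\<lambda>x. x powr (- A))"
    and eps: "\<epsilon> \<in> {1, -1}"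
begin

text \<open>The orientation is reversed: rapid decay of \<open>f\<close> at infinity becomes decay
  at \<open>- \<infinity>\<close>, and polynomial order at 0 becomes exponential order at
  \<open>+ \<infinity>\<close>.\<close>

definition u :: "real \<Rightarrow> complex" where
  "u t = complex_of_real (f (exp (- t)))"

lemma u_local: "integrable lebesgue (\<lambda>t. indicator {- T..T} t * (exp (- complex_of_real t) * u t))"
proof -
  have "f absolutely_integrable_on {exp (- T)..exp T}"
    by (rule loc_int) (auto intro: less_le_trans[OF exp_gt_zero])
  then have "set_integrable lebesgue {exp (- T)..exp T} (\<lambda>x. complex_of_real (f x))"
    unfolding set_integrable_def
    using integrable_bounded_linear[OF bounded_linear_of_real, of lebesgue "\<lambda>x. indicator {exp (- T)..exp T} x *\<^sub>R f x"]
    by (simp add: scaleR_conv_of_real)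
  then have "set_integrable lebesgue {- T..T} (\<lambda>t. exp (- t) *\<^sub>R complex_of_real (f (exp (- t))))"
    unfolding exp_uminus_images(4)[symmetric] by (subst (asm) exp_substitution_integrable) auto
  then show ?thesis
    unfolding set_integrable_def
    by (rule Bochner_Integration.integrable_cong[THEN iffD1, rotated -1])
      (auto simp: u_def indicator_def scaleR_conv_of_real exp_of_real[symmetric])
qed

text \<open>Measurability is extracted from local integrability, by exhausting the line with the
  intervals \<open>{- n..n}\<close> and removing the Jacobian.\<close>

lemma u_measurable [measurable]: "u \<in> borel_measurable lebesgue"
proof (rule borel_measurable_LIMSEQ_metric)
  have [measurable]: "(\<lambda>t. exp (complex_of_real t)) \<in> borel_measurable lebesgue"
    using expo_lebesgue_measurable[of "-1"] by simp
  fix n :: nat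
  have "(\<lambda>t. exp (complex_of_real t) * (indicator {- real n..real n} t * (exp (- complex_of_real t) * u t))) \<in> borel_measurable lebesgue"
    using u_local[of "real n"] by measurable
  moreover have "exp (complex_of_real t) * (indicator {- real n..real n} t * (exp (- complex_of_real t) * u t)) =
      indicator {- real n..real n} t * u t" for t
    by (simp add: mult_exp_exp exp_minus)
  ultimately show "(\<lambda>t. indicator {- real n..real n} t * u t) \<in> borel_measurable lebesgue" by simp
next
  fix t :: real
  obtain N :: nat where N: "\<bar>t\<bar> \<le> real N" using real_arch_simple by blast
  have "\<forall>\<^sub>F n in sequentially. indicator {- real n..real n} t * u t = u t"
    using eventually_ge_at_top[of N]
  proof eventually_elim
    case (elim n)
    then have "\<bar>t\<bar> \<le> real n" using N by linarith
    then show ?case by (auto simp: indicator_def abs_le_iff)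
  qed
  then show "(\<lambda>n. indicator {- real n..real n} t * u t) \<longlonglongrightarrow> u t" by (rule tendsto_eventually)
qed

lemma u_left:
  assumes "A > 0"
  shows "\<exists>T C. \<forall>t\<le>-T. norm (u t) \<le> C * exp (A * t)"
proof -
  obtain c where "c > 0" "\<forall>\<^sub>F x in at_top. norm (f x) \<le> c * norm (x powr (- A))"
    using landau_o.bigE[OF decay_top[OF assms]] by blast
  then obtain X where X: "\<And>x. x \<ge> X \<Longrightarrow> norm (f x) \<le> c * norm (x powr (- A))"
    by (auto simp: eventually_at_top_linorder)
  have "norm (u t) \<le> c * exp (A * t)" if "t \<le> - X" for t
  proof -
    have "X \<le> exp (- t)" using exp_ge_add_one_self[of "- t"] that by linarith
    from X[OF this] show ?thesis by (simp add: u_def powr_def)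
  qed
  then show ?thesis by blast
qed

lemma u_right: "\<exists>A T C. A > 0 \<and> (\<forall>t\<ge>T. norm (u t) \<le> C * exp (A * t))"
proof -
  obtain A where A: "A > 0" "f \<in> O[at_right 0](\<lambda>x. x powr (- A))" using growth_0 by blast
  obtain c where "c > 0" "\<forall>\<^sub>F x in at_right 0. norm (f x) \<le> c * norm (x powr (- A))"
    using landau_o.bigE[OF A(2)] by blast
  then obtain d where d: "d > 0" "\<And>x. 0 < x \<Longrightarrow> x < d \<Longrightarrow> norm (f x) \<le> c * norm (x powr (- A))"
    unfolding eventually_at_right_field by blast
  have "norm (u t) \<le> c * exp (A * t)" if "t \<ge> - ln d + 1" for t
  proof -
    have "- t < ln d" using that by simp
    then have "exp (- t) < d" using d(1) by (metis exp_less_cancel_iff exp_ln)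
    from d(2)[OF exp_gt_zero this] show ?thesis by (simp add: u_def powr_def)
  qed
  then show ?thesis using A(1) by blast
qed

lemma u_integrable:
  assumes q: "q \<in> borel_measurable lebesgue" "\<And>T. \<exists>D. \<forall>t\<in>{- T..T}. norm (q t) \<le> D"
    and far: "\<And>t. \<bar>t\<bar> \<ge> T \<Longrightarrow> norm (u t * q t) \<le> C * exp (- \<bar>t\<bar>)"
  shows "integrable lebesgue (\<lambda>t. u t * q t)"
proof -
  obtain D where D: "\<forall>t\<in>{- T..T}. norm (q t) \<le> D" using q(2) by blast
  note q(1)[measurable]
  \<comment> \<open>On \<open>{- T..T}\<close> local integrability controls
    \<open>exp (- t) * u t\<close>; the factor \<open>exp T\<close> makes up for the Jacobian and
    \<open>D\<close> for \<open>q\<close>. Outside, the exponential tail takes over.\<close>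
  define k where "k t = exp T * \<bar>D\<bar> * norm (indicator {- T..T} t * (exp (- complex_of_real t) * u t)) + \<bar>C\<bar> * exp (- \<bar>t\<bar>)" for t
  have ik: "integrable lebesgue k"
    unfolding k_def[abs_def]
    by (intro Bochner_Integration.integrable_add integrable_mult_right integrable_norm u_local integrable_exp_minus_abs)
  show ?thesis
  proof (rule Bochner_Integration.integrable_bound[OF ik])
    have "norm (u t * q t) \<le> k t" for t
    proof (cases "\<bar>t\<bar> \<ge> T")
      case True
      have "C * exp (- \<bar>t\<bar>) \<le> \<bar>C\<bar> * exp (- \<bar>t\<bar>)" by (intro mult_right_mono) auto
      with far[OF True] have "norm (u t * q t) \<le> \<bar>C\<bar> * exp (- \<bar>t\<bar>)" by (rule order_trans)
      then show ?thesis unfolding k_def by (rule add_increasing[rotated]) simp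
    next
      case False
      then have t: "t \<in> {- T..T}" by auto
      have "norm (u t * q t) = exp t * norm (q t) * (exp (- t) * norm (u t))" by (simp add: norm_mult exp_minus)
      also have "\<dots> \<le> exp T * \<bar>D\<bar> * (exp (- t) * norm (u t))"
        using t D by (intro mult_right_mono mult_mono) force+
      also have "\<dots> \<le> k t" using t by (simp add: k_def norm_mult)
      finally show ?thesis .
    qed
    then show "AE t in lebesgue. norm (u t * q t) \<le> norm (k t)"
      by (intro AE_I2) (metis abs_ge_self order_trans real_norm_def)
  qed measurable
qed

lemma continuous_locally_bounded:
  fixes q :: "real \<Rightarrow> complex"
  assumes "continuous_on UNIV q"
  shows "q \<in> borel_measurable lebesgue" "\<exists>D. \<forall>t\<in>{- T..T}. norm (q t) \<le> D"
  using continuous_bounded_on_interval[OF assms]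
  by (auto intro: borel_imp_lebesgue_measurable borel_measurable_continuous_onI assms)

text \<open>
  Integrability of \<open>u\<close> against a weight: \<open>u\<close> decays faster than any exponential at \<open>-\<infinity>\<close>, so only the
  exponential order of the weight at \<open>+\<infinity>\<close> matters.
\<close>

lemma weight_order: "\<exists>a. \<forall>q l. continuous_on UNIV q \<longrightarrow> (\<forall>t\<ge>0. norm (q t) \<le> exp (- (a * t))) \<longrightarrow>
    (\<forall>t\<le>0. norm (q t) \<le> exp (- (l * t))) \<longrightarrow> integrable lebesgue (\<lambda>t. u t * q t)"
proof -
  obtain A T1 C1 where 1: "A > 0" "\<And>t. t \<ge> T1 \<Longrightarrow> norm (u t) \<le> C1 * exp (A * t)" using u_right by blast
  \<comment> \<open>\<open>A\<close> is the order of growth of \<open>u\<close> at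
    \<open>+ \<infinity>\<close>; one unit more leaves \<open>exp (- t)\<close>, while the rate
    \<open>l\<close> on the left is arbitrary.\<close>
  show ?thesis
  proof (intro exI[of _ "A + 1"] allI impI)
    fix q :: "real \<Rightarrow> complex" and l
    assume q: "continuous_on UNIV q" and qr: "\<forall>t\<ge>0. norm (q t) \<le> exp (- ((A + 1) * t))"
      and ql: "\<forall>t\<le>0. norm (q t) \<le> exp (- (l * t))"
    have "\<bar>l\<bar> + 1 > 0" by linarith
    from u_left[OF this] obtain T2 C2
      where 2: "\<And>t. t \<le> - T2 \<Longrightarrow> norm (u t) \<le> C2 * exp ((\<bar>l\<bar> + 1) * t)" by blast
    show "integrable lebesgue (\<lambda>t. u t * q t)"
    proof (rule u_integrable[OF continuous_locally_bounded[OF q], of "max 0 (max T1 T2)" "max \<bar>C1\<bar> \<bar>C2\<bar>"])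
      fix t assume t: "\<bar>t\<bar> \<ge> max 0 (max T1 T2)"
      show "norm (u t * q t) \<le> max \<bar>C1\<bar> \<bar>C2\<bar> * exp (- \<bar>t\<bar>)"
      proof (cases "t \<ge> 0")
        case True
        have "norm (u t) * norm (q t) \<le> (\<bar>C1\<bar> * exp (A * t)) * exp (- ((A + 1) * t))"
        proof (rule mult_mono)
          have "norm (u t) \<le> C1 * exp (A * t)" using t True by (intro 1(2)) auto
          also have "\<dots> \<le> \<bar>C1\<bar> * exp (A * t)" by (intro mult_right_mono) auto
          finally show "norm (u t) \<le> \<bar>C1\<bar> * exp (A * t)" .
        qed (use qr True in auto)
        also have "\<dots> = \<bar>C1\<bar> * exp (- t)" by (simp add: mult.assoc mult_exp_exp algebra_simps)
        also have "\<dots> \<le> max \<bar>C1\<bar> \<bar>C2\<bar> * exp (- t)" by (intro mult_right_mono) auto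
        finally show ?thesis using True by (simp add: norm_mult)
      next
        case False
        have "norm (u t) * norm (q t) \<le> (\<bar>C2\<bar> * exp ((\<bar>l\<bar> + 1) * t)) * exp (- (l * t))"
        proof (rule mult_mono)
          have "norm (u t) \<le> C2 * exp ((\<bar>l\<bar> + 1) * t)" using t False by (intro 2) auto
          also have "\<dots> \<le> \<bar>C2\<bar> * exp ((\<bar>l\<bar> + 1) * t)" by (intro mult_right_mono) auto
          finally show "norm (u t) \<le> \<bar>C2\<bar> * exp ((\<bar>l\<bar> + 1) * t)" .
        qed (use ql False in auto)
        also have "\<dots> = \<bar>C2\<bar> * exp ((\<bar>l\<bar> - l) * t + t)" by (simp add: mult.assoc mult_exp_exp algebra_simps)
        also have "\<dots> \<le> max \<bar>C1\<bar> \<bar>C2\<bar> * exp t"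
        proof (intro mult_mono)
          have "(\<bar>l\<bar> - l) * t \<le> 0" using False by (intro mult_nonneg_nonpos) auto
          then show "exp ((\<bar>l\<bar> - l) * t + t) \<le> exp t" by simp
        qed auto
        finally show ?thesis using False by (simp add: norm_mult)
      qed
    qed
  qed
qed

lemma left_part_integrable: "integrable lebesgue (\<lambda>t. (indicator {..<0} t * u t) * expo s t)"
proof -
  have "\<bar>Re s\<bar> + 1 > 0" by linarith
  from u_left[OF this] obtain T C
    where 1: "\<And>t. t \<le> - T \<Longrightarrow> norm (u t) \<le> C * exp ((\<bar>Re s\<bar> + 1) * t)" by blast
  have mI: "(\<lambda>t::real. indicator {..<0} t :: complex) \<in> borel_measurable lebesgue"
    by (intro borel_imp_lebesgue_measurable borel_measurable_indicator) simp
  have "integrable lebesgue (\<lambda>t. u t * (indicator {..<0} t * expo s t))"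
  proof (rule u_integrable[of _ "max 0 T" "\<bar>C\<bar>"])
    show "(\<lambda>t. indicator {..<0} t * expo s t) \<in> borel_measurable lebesgue"
      by (intro borel_measurable_times mI expo_lebesgue_measurable)
    fix T'
    obtain D where D: "\<forall>t\<in>{- T'..T'}. norm (expo s t) \<le> D"
      using continuous_bounded_on_interval[OF smooth_continuous_on[OF smooth_exp, of UNIV 0]] unfolding iter_deriv_0 by blast
    have "norm (indicator {..<0} t * expo s t) \<le> \<bar>D\<bar>" if "t \<in> {- T'..T'}" for t
    proof -
      have "norm (indicator {..<0} t * expo s t) \<le> norm (expo s t)" by (simp add: norm_mult indicator_def)
      also have "\<dots> \<le> \<bar>D\<bar>" using D that abs_ge_self[of D] order_trans by blast
      finally show ?thesis .
    qed
    then show "\<exists>D. \<forall>t\<in>{- T'..T'}. norm (indicator {..<0} t * expo s t) \<le> D" by blast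
  next
    fix t assume t: "\<bar>t\<bar> \<ge> max 0 T"
    show "norm (u t * (indicator {..<0} t * expo s t)) \<le> \<bar>C\<bar> * exp (- \<bar>t\<bar>)"
    proof (cases "t < 0")
      case True
      have "norm (u t) * exp (- (Re s * t)) \<le> (\<bar>C\<bar> * exp ((\<bar>Re s\<bar> + 1) * t)) * exp (- (Re s * t))"
      proof (rule mult_right_mono)
        have "norm (u t) \<le> C * exp ((\<bar>Re s\<bar> + 1) * t)" using t True by (intro 1) auto
        also have "\<dots> \<le> \<bar>C\<bar> * exp ((\<bar>Re s\<bar> + 1) * t)" by (intro mult_right_mono) auto
        finally show "norm (u t) \<le> \<bar>C\<bar> * exp ((\<bar>Re s\<bar> + 1) * t)" .
      qed auto
      also have "\<dots> = \<bar>C\<bar> * exp ((\<bar>Re s\<bar> - Re s) * t + t)" by (simp add: mult.assoc mult_exp_exp algebra_simps)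
      also have "\<dots> \<le> \<bar>C\<bar> * exp t"
      proof (intro mult_left_mono)
        have "(\<bar>Re s\<bar> - Re s) * t \<le> 0" using True by (intro mult_nonneg_nonpos) auto
        then show "exp ((\<bar>Re s\<bar> - Re s) * t + t) \<le> exp t" by simp
      qed auto
      finally show ?thesis using True by (simp add: norm_mult)
    qed simp
  qed
  then show ?thesis by (simp add: mult_ac)
qed

section \<open>Splitting the Mellin integral at 1\<close>

definition left_transform :: "complex \<Rightarrow> complex" where
  "left_transform = Laplace_fun (\<lambda>t. indicator {..<0} t * u t)"

lemma left_transform_entire: "left_transform holomorphic_on UNIV"
  unfolding left_transform_def Laplace_fun_def[abs_def]
  using laplace_integral_holomorphic[OF open_UNIV left_part_integrable] by simp

lemma mellin_left: "mellin_integrable {1<..} (\<lambda>x. complex_of_real (f x)) s"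
  "mellin {1<..} (\<lambda>x. complex_of_real (f x)) s = left_transform s"
proof -
  have S: "{..<0::real} \<in> sets lebesgue" by simp
  note mellin_integrable_substitution[OF S, of "\<lambda>x. complex_of_real (f x)" s, unfolded exp_uminus_images]
  then show "mellin_integrable {1<..} (\<lambda>x. complex_of_real (f x)) s"
    using left_part_integrable[of s] by (simp add: u_def)
  note mellin_substitution[OF S, of "\<lambda>x. complex_of_real (f x)" s, unfolded exp_uminus_images]
  then show "mellin {1<..} (\<lambda>x. complex_of_real (f x)) s = left_transform s"
    by (simp add: left_transform_def u_def)
qed

lemma H_fun_eq: "H_fun f \<epsilon> t = u t - complex_of_real \<epsilon> * (exp (complex_of_real t) * u (- t))"
  by (simp add: H_fun_def h_fun_def u_def exp_minus exp_of_real)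

lemma H_weighted_and_mellin:
  "\<exists>b. weighted_function (H_fun f \<epsilon>) (real b) \<and>
    (\<forall>s. Re s \<ge> real b \<longrightarrow> integrable lebesgue (\<lambda>t. u t * expo s t))"
proof -
  obtain a where a: "\<And>q l. continuous_on UNIV q \<Longrightarrow> (\<And>t. t \<ge> 0 \<Longrightarrow> norm (q t) \<le> exp (- (a * t))) \<Longrightarrow>
    (\<And>t. t \<le> 0 \<Longrightarrow> norm (q t) \<le> exp (- (l * t))) \<Longrightarrow> integrable lebesgue (\<lambda>t. u t * q t)"
    using weight_order by blast
  \<comment> \<open>A natural number not below the critical order \<open>a\<close>, because growth
    rates of the function spaces are indexed by naturals.\<close>
  define b where "b = nat \<lceil>\<bar>a\<bar>\<rceil>"
  have b: "real b \<ge> a" unfolding b_def by linarith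
  have ba: "exp (- (real b * t)) \<le> exp (- (a * t))" if "t \<ge> 0" for t
    using mult_right_mono[OF b that] by simp
  define w where "w t = complex_of_real (exp (- (real b * \<bar>t\<bar>)))" for t
  have cw: "continuous_on UNIV w" unfolding w_def[abs_def] by (intro continuous_intros)
  have w0: "w (- t) = w t" for t by (simp add: w_def)
  have i1: "integrable lebesgue (\<lambda>t. u t * w t)"
    by (rule a[OF cw, of "- real b"]) (auto simp: w_def intro: mult_right_mono[OF b])
  have cw2: "continuous_on UNIV (\<lambda>t. exp (- complex_of_real t) * w t)" by (intro continuous_intros cw)
  \<comment> \<open>The reflected term of \<open>H\<close> is \<open>exp t * u (- t)\<close>. After
    \<open>t \<mapsto> - t\<close> its integrability is that of \<open>u\<close> against
    \<open>exp (- t) * w t\<close>, which decays even faster at \<open>+ \<infinity>\<close> and has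
    exponential order at \<open>- \<infinity>\<close>.\<close>
  have "integrable lebesgue (\<lambda>t. u t * (exp (- complex_of_real t) * w t))"
  proof (rule a[OF cw2, of "1 - real b"])
    fix t :: real assume "t \<ge> 0"
    then have "exp (- t) * exp (- (real b * t)) \<le> 1 * exp (- (a * t))" by (intro mult_mono ba) auto
    then show "norm (exp (- complex_of_real t) * w t) \<le> exp (- (a * t))"
      using \<open>t \<ge> 0\<close> by (simp add: w_def norm_mult)
  next
    fix t :: real assume "t \<le> 0"
    then show "norm (exp (- complex_of_real t) * w t) \<le> exp (- ((1 - real b) * t))"
      by (simp add: w_def norm_mult mult_exp_exp algebra_simps)
  qed
  then have "integrable lebesgue (\<lambda>t. u (0 - t) * (exp (- complex_of_real (0 - t)) * w (0 - t)))"
    unfolding integrable_lebesgue_affine[of "\<lambda>t. u t * (exp (- complex_of_real t) * w t)" 0] .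
  then have i2: "integrable lebesgue (\<lambda>t. u (- t) * (exp (complex_of_real t) * w t))" by (simp add: w0)
  have iH: "integrable lebesgue (\<lambda>t. H_fun f \<epsilon> t * w t)"
  proof -
    have "integrable lebesgue (\<lambda>t. u t * w t - complex_of_real \<epsilon> * (u (- t) * (exp (complex_of_real t) * w t)))"
      by (intro Bochner_Integration.integrable_diff integrable_mult_right i1 i2)
    then show ?thesis by (simp add: H_fun_eq algebra_simps)
  qed
  have "weighted_function (H_fun f \<epsilon>) (real b)"
  proof
    have m: "(\<lambda>t. complex_of_real (exp (real b * \<bar>t\<bar>))) \<in> borel_measurable lebesgue"
      by (intro continuous_locally_bounded(1) continuous_intros)
    have "(\<lambda>t. complex_of_real (exp (real b * \<bar>t\<bar>)) * (H_fun f \<epsilon> t * w t)) \<in> borel_measurable lebesgue"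
      using m iH by measurable
    moreover have "complex_of_real (exp (real b * \<bar>t\<bar>)) * (H_fun f \<epsilon> t * w t) = H_fun f \<epsilon> t" for t
      by (simp add: w_def exp_minus)
    ultimately show "H_fun f \<epsilon> \<in> borel_measurable lebesgue" by simp
    show "integrable lebesgue (\<lambda>t. norm (H_fun f \<epsilon> t) * exp (- (real b * \<bar>t\<bar>)))"
      using integrable_norm[OF iH] by (simp add: norm_mult w_def)
  qed
  moreover have "integrable lebesgue (\<lambda>t. u t * expo s t)" if "Re s \<ge> real b" for s
  proof (rule a[of _ "Re s"])
    show "continuous_on UNIV (expo s)" by (intro continuous_intros)
    fix t :: real assume "t \<ge> 0"
    then have "a * t \<le> Re s * t" using that b by (intro mult_right_mono) auto
    then show "norm (expo s t) \<le> exp (- (a * t))" by simp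
  qed simp
  ultimately show ?thesis by blast
qed

text \<open>For \<open>t > 0\<close> write \<open>u t = H t + \<epsilon> * exp t * u (- t)\<close>;
  reflected, the last term becomes the left transform at \<open>1 - s\<close>.\<close>

lemma mellin_decomposition:
  assumes iu: "integrable lebesgue (\<lambda>t. u t * expo s t)"
    and iH: "laplace_integrable (H_fun f \<epsilon>) s" and mH: "H_fun f \<epsilon> \<in> borel_measurable lebesgue"
  shows "mellin_integrable {0<..} (\<lambda>x. complex_of_real (f x)) s"
    and "mellin {0<..} (\<lambda>x. complex_of_real (f x)) s =
      (left_transform s + complex_of_real \<epsilon> * left_transform (1 - s)) + laplace (H_fun f \<epsilon>) s"
proof -
  have S: "(UNIV :: real set) \<in> sets lebesgue" by simp
  show "mellin_integrable {0<..} (\<lambda>x. complex_of_real (f x)) s"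
    using mellin_integrable_substitution[OF S, of "\<lambda>x. complex_of_real (f x)" s, unfolded exp_uminus_images] iu
    by (simp add: u_def)
  have iP: "integrable lebesgue (\<lambda>t. plus_part (H_fun f \<epsilon>) t * expo s t)" using iH by (simp add: laplace_integrable_iff)
  have iL: "integrable lebesgue (\<lambda>t. (indicator {..<0} t * u t) * expo s t)" by (rule left_part_integrable)
  have iR: "integrable lebesgue (\<lambda>t. (indicator {..<0} (- t) * u (- t)) * expo (1 - s) (- t))"
    using integrable_lebesgue_affine[of "\<lambda>t. (indicator {..<0} t * u t) * expo (1 - s) t" 0] left_part_integrable[of "1 - s"]
    by simp
  have LR: "(LINT t|lebesgue. (indicator {..<0} (- t) * u (- t)) * expo (1 - s) (- t)) = left_transform (1 - s)"
    using integral_lebesgue_affine[of "\<lambda>t. (indicator {..<0} t * u t) * expo (1 - s) t" 0]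
    by (simp add: left_transform_def Laplace_fun_def)
  have mp: "plus_part (H_fun f \<epsilon>) \<in> borel_measurable lebesgue"
  proof -
    have "(\<lambda>t::real. indicator {0..} t :: complex) \<in> borel_measurable lebesgue"
      by (intro borel_imp_lebesgue_measurable borel_measurable_indicator) simp
    moreover have "plus_part (H_fun f \<epsilon>) = (\<lambda>t. indicator {0..} t * H_fun f \<epsilon> t)"
      by (auto simp: plus_part_def indicator_def)
    ultimately show ?thesis using mH by simp
  qed
  have "mellin {0<..} (\<lambda>x. complex_of_real (f x)) s = (LINT t|lebesgue. u t * expo s t)"
    using mellin_substitution[OF S, of "\<lambda>x. complex_of_real (f x)" s, unfolded exp_uminus_images]
    by (simp add: u_def Laplace_fun_def)
  also have "\<dots> = (LINT t|lebesgue. ((indicator {..<0} t * u t) * expo s t +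
      complex_of_real \<epsilon> * ((indicator {..<0} (- t) * u (- t)) * expo (1 - s) (- t))) + plus_part (H_fun f \<epsilon>) t * expo s t)"
  proof (rule integral_lebesgue_cong_nonzero)
    show "(\<lambda>t. u t * expo s t) \<in> borel_measurable lebesgue" using iu by measurable
    show "(\<lambda>t. ((indicator {..<0} t * u t) * expo s t +
      complex_of_real \<epsilon> * ((indicator {..<0} (- t) * u (- t)) * expo (1 - s) (- t))) + plus_part (H_fun f \<epsilon>) t * expo s t)
      \<in> borel_measurable lebesgue"
      using iL iR iP by measurable
    fix t :: real assume "t \<noteq> 0"
    have "exp (complex_of_real t) * expo s t = expo (1 - s) (- t)" by (simp add: mult_exp_exp algebra_simps)
    then have "complex_of_real \<epsilon> * (exp (complex_of_real t) * u (- t)) * expo s t = complex_of_real \<epsilon> * (u (- t) * expo (1 - s) (- t))"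
      by (metis mult.assoc mult.commute)
    then show "u t * expo s t = ((indicator {..<0} t * u t) * expo s t +
      complex_of_real \<epsilon> * ((indicator {..<0} (- t) * u (- t)) * expo (1 - s) (- t))) + plus_part (H_fun f \<epsilon>) t * expo s t"
      using \<open>t \<noteq> 0\<close> by (cases "t < 0") (auto simp: plus_part_def H_fun_eq left_diff_distrib)
  qed
  also have "\<dots> = (left_transform s + complex_of_real \<epsilon> * left_transform (1 - s)) + laplace (H_fun f \<epsilon>) s"
    using iL iR iP LR
    by (simp add: left_transform_def Laplace_fun_def laplace_eq_Laplace_fun)
  finally show "mellin {0<..} (\<lambda>x. complex_of_real (f x)) s =
      (left_transform s + complex_of_real \<epsilon> * left_transform (1 - s)) + laplace (H_fun f \<epsilon>) s" .
qed

lemma mellin_unit_interval: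
  assumes mH: "H_fun f \<epsilon> \<in> borel_measurable lebesgue"
  shows "mellin_integrable {0<..<1} (h_fun f \<epsilon>) s \<longleftrightarrow> laplace_integrable (H_fun f \<epsilon>) s"
    and "mellin {0<..<1} (h_fun f \<epsilon>) s = laplace (H_fun f \<epsilon>) s"
proof -
  have S: "{0<..} \<in> sets (lebesgue :: real measure)" by simp
  have mI: "(\<lambda>t::real. indicator A t :: complex) \<in> borel_measurable lebesgue" if "A \<in> sets borel" for A
    using that by (intro borel_imp_lebesgue_measurable borel_measurable_indicator)
  have p: "plus_part (H_fun f \<epsilon>) = (\<lambda>t. indicator {0..} t * H_fun f \<epsilon> t)"
    by (auto simp: plus_part_def indicator_def)
  have m1: "(\<lambda>t. indicator {0<..} t * H_fun f \<epsilon> t * expo s t) \<in> borel_measurable lebesgue"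
    by (intro borel_measurable_times mI mH expo_lebesgue_measurable) simp
  have m2: "(\<lambda>t. plus_part (H_fun f \<epsilon>) t * expo s t) \<in> borel_measurable lebesgue"
    unfolding p by (intro borel_measurable_times mI mH expo_lebesgue_measurable) simp
  have eq: "indicator {0<..} t * H_fun f \<epsilon> t * expo s t = plus_part (H_fun f \<epsilon>) t * expo s t" if "t \<noteq> 0" for t
    using that by (auto simp: plus_part_def indicator_def)
  show "mellin_integrable {0<..<1} (h_fun f \<epsilon>) s \<longleftrightarrow> laplace_integrable (H_fun f \<epsilon>) s"
    using mellin_integrable_substitution[OF S, of "h_fun f \<epsilon>" s, unfolded exp_uminus_images]
      integrable_lebesgue_cong_nonzero[OF m1 m2 eq]
    by (simp add: laplace_integrable_iff H_fun_def)
  show "mellin {0<..<1} (h_fun f \<epsilon>) s = laplace (H_fun f \<epsilon>) s"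
    using mellin_substitution[OF S, of "h_fun f \<epsilon>" s, unfolded exp_uminus_images]
      integral_lebesgue_cong_nonzero[OF m1 m2 eq]
    by (simp add: laplace_eq_Laplace_fun Laplace_fun_def H_fun_def)
qed

theorem continuation:
  assumes mp: "has_annihilator X (H_fun f \<epsilon>)"
  defines "\<omega> \<equiv> Laplace_Carleman X (H_fun f \<epsilon>)" and "fc \<equiv> \<lambda>x. complex_of_real (f x)"
  shows "\<exists>M. M nicely_meromorphic_on UNIV \<and>
      (\<exists>\<sigma>. \<forall>s. Re s > \<sigma> \<longrightarrow> mellin_integrable {0<..} fc s \<and> M s = mellin {0<..} fc s) \<and>
      (\<forall>s. M s = complex_of_real \<epsilon> * M (1 - s)) \<and>
      (\<forall>s. mellin_integrable {1<..} fc s) \<and>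
      (\<forall>s. \<not> is_pole \<omega> s \<longrightarrow>
         M s = mellin {1<..} fc s + complex_of_real \<epsilon> * mellin {1<..} fc (1 - s) + \<omega> s)"
    and "\<omega> nicely_meromorphic_on UNIV"
    and "\<exists>\<sigma>. \<forall>s. Re s > \<sigma> \<longrightarrow> laplace_integrable (H_fun f \<epsilon>) s \<and> \<omega> s = laplace (H_fun f \<epsilon>) s"
    and "\<exists>\<sigma>. \<forall>s. Re s > \<sigma> \<longrightarrow> mellin_integrable {0<..<1} (h_fun f \<epsilon>) s \<and> \<omega> s = mellin {0<..<1} (h_fun f \<epsilon>) s"
    and "\<forall>s. \<omega> s = complex_of_real \<epsilon> * \<omega> (1 - s)"
proof -
  obtain b where w: "weighted_function (H_fun f \<epsilon>) (real b)"
    and iu: "\<And>s. Re s \<ge> real b \<Longrightarrow> integrable lebesgue (\<lambda>t. u t * expo s t)"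
    using H_weighted_and_mellin by blast
  have mH: "H_fun f \<epsilon> \<in> borel_measurable lebesgue" using w by (simp add: weighted_function_def)
  obtain N D where ND: "carleman_quotient (H_fun f \<epsilon>) N D" "\<omega> = remove_sings (\<lambda>s. N s / D s)"
    using Laplace_Carleman_quotient[OF mp w] unfolding \<omega>_def by blast
  have e0: "\<epsilon> \<noteq> 0" using eps by auto
  note C = carleman_quotient_continuation[OF w ND(1) H_fun_reflect[OF eps] e0, folded ND(2)]
  show nm: "\<omega> nicely_meromorphic_on UNIV" by (rule C(1))
  show lap: "\<exists>\<sigma>. \<forall>s. Re s > \<sigma> \<longrightarrow> laplace_integrable (H_fun f \<epsilon>) s \<and> \<omega> s = laplace (H_fun f \<epsilon>) s" by (rule C(2))
  then show "\<exists>\<sigma>. \<forall>s. Re s > \<sigma> \<longrightarrow> mellin_integrable {0<..<1} (h_fun f \<epsilon>) s \<and> \<omega> s = mellin {0<..<1} (h_fun f \<epsilon>) s"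
    unfolding mellin_unit_interval[OF mH] .
  show fe: "\<forall>s. \<omega> s = complex_of_real \<epsilon> * \<omega> (1 - s)" using C(3) by blast
  \<comment> \<open>Symmetric under reflection because \<open>\<epsilon>\<^sup>2 = 1\<close>, and
    entire because the rapid decay of \<open>f\<close> makes \<open>left_transform\<close>
    entire.\<close>
  define E where "E s = left_transform s + complex_of_real \<epsilon> * left_transform (1 - s)" for s
  have "(\<lambda>s. left_transform (1 - s)) holomorphic_on UNIV"
    using holomorphic_on_compose_gen[of "\<lambda>s. 1 - s" UNIV left_transform UNIV] left_transform_entire
    by (simp add: o_def holomorphic_intros)
  then have E: "E holomorphic_on UNIV"
    unfolding E_def[abs_def] by (intro holomorphic_intros left_transform_entire)
  have Efe: "E s = complex_of_real \<epsilon> * E (1 - s)" for s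
    using eps by (auto simp: E_def algebra_simps)
  define M where "M = remove_sings (\<lambda>s. E s + \<omega> s)"
  have e0': "complex_of_real \<epsilon> \<noteq> 0" using e0 by simp
  note cc = completed_continuation[OF E Efe e0' nm fe[rule_format], folded M_def]
  obtain \<sigma> where \<sigma>: "\<And>s. Re s > \<sigma> \<Longrightarrow> laplace_integrable (H_fun f \<epsilon>) s \<and> \<omega> s = laplace (H_fun f \<epsilon>) s"
    using lap by blast
  have "M s = mellin {0<..} fc s \<and> mellin_integrable {0<..} fc s" if s: "Re s > max \<sigma> (real b)" for s
  proof -
    \<comment> \<open>Far to the right \<open>\<omega>\<close> is a convergent Laplace integral,
      hence holomorphic; the absence of poles there permits the pointwise formula for
      \<open>M\<close>.\<close>
    have "Laplace_fun (plus_part (H_fun f \<epsilon>)) holomorphic_on {s. Re s \<in> {\<sigma><..}}"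
      unfolding Laplace_fun_def[abs_def] using \<sigma> laplace_integrable_iff
      by (intro laplace_integral_holomorphic) auto
    then have "\<omega> holomorphic_on {s. Re s \<in> {\<sigma><..}}"
      by (rule holomorphic_transform) (use \<sigma> laplace_eq_Laplace_fun in auto)
    moreover have "open {s. Re s \<in> {\<sigma><..}}" by (simp add: open_halfspace_Re_gt)
    ultimately have "\<not> is_pole \<omega> s" using s by (intro not_is_pole_holomorphic) auto
    then have "M s = E s + \<omega> s" by (rule cc(3))
    then show ?thesis
      using mellin_decomposition[OF iu _ mH, of s] \<sigma>[of s] s by (simp add: E_def fc_def)
  qed
  note M = this
  show "\<exists>M. M nicely_meromorphic_on UNIV \<and>
      (\<exists>\<sigma>. \<forall>s. Re s > \<sigma> \<longrightarrow> mellin_integrable {0<..} fc s \<and> M s = mellin {0<..} fc s) \<and>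
      (\<forall>s. M s = complex_of_real \<epsilon> * M (1 - s)) \<and>
      (\<forall>s. mellin_integrable {1<..} fc s) \<and>
      (\<forall>s. \<not> is_pole \<omega> s \<longrightarrow>
         M s = mellin {1<..} fc s + complex_of_real \<epsilon> * mellin {1<..} fc (1 - s) + \<omega> s)"
  proof (rule exI[of _ M], intro conjI allI impI)
    show "M nicely_meromorphic_on UNIV" by (rule cc(1))
    show "\<exists>\<sigma>. \<forall>s. Re s > \<sigma> \<longrightarrow> mellin_integrable {0<..} fc s \<and> M s = mellin {0<..} fc s"
      using M by blast
    show "M s = complex_of_real \<epsilon> * M (1 - s)" for s by (rule cc(2))
    show "mellin_integrable {1<..} fc s" for s unfolding fc_def by (rule mellin_left(1))
    show "M s = mellin {1<..} fc s + complex_of_real \<epsilon> * mellin {1<..} fc (1 - s) + \<omega> s"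
      if "\<not> is_pole \<omega> s" for s
      using cc(3)[OF that] unfolding fc_def mellin_left(2) E_def .
  qed
qed

end

theorem theorem3p2:
  fixes f :: "real \<Rightarrow> real" and \<epsilon> :: real and X_mult X_add :: mp_space
    and fc :: "real \<Rightarrow> complex"
  defines "fc \<equiv> \<lambda>x. complex_of_real (f x)"
  assumes loc_int: "\<And>K. compact K \<Longrightarrow> K \<subseteq> {0<..} \<Longrightarrow> f absolutely_integrable_on K"
    and decay_top: "\<And>A. A > 0 \<Longrightarrow> f \<in> O[at_top](\<lambda>x. x powr (- A))"
    and growth_0: "\<exists>A>0. f \<in> O[at_right 0](\<lambda>x. x powr (- A))"
    and eps: "\<epsilon> \<in> {1, -1}"
  shows
    "(mean_periodic_mult X_mult (h_fun f \<epsilon>) \<longrightarrow>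
       (\<exists>M \<omega>. M nicely_meromorphic_on UNIV \<and>
          (\<exists>\<sigma>. \<forall>s. Re s > \<sigma> \<longrightarrow> mellin_integrable {0<..} fc s \<and> M s = mellin {0<..} fc s) \<and>
          (\<forall>s. M s = complex_of_real \<epsilon> * M (1 - s)) \<and>
          (\<forall>s. mellin_integrable {1<..} fc s) \<and>
          (\<forall>s. \<not> is_pole \<omega> s \<longrightarrow>
             M s = mellin {1<..} fc s + complex_of_real \<epsilon> * mellin {1<..} fc (1 - s) + \<omega> s) \<and>
          \<omega> nicely_meromorphic_on UNIV \<and>
          \<omega> = Mellin_Carleman X_mult (h_fun f \<epsilon>) \<and>
          (\<exists>\<sigma>. \<forall>s. Re s > \<sigma> \<longrightarrow>
             mellin_integrable {0<..<1} (h_fun f \<epsilon>) s \<and> \<omega> s = mellin {0<..<1} (h_fun f \<epsilon>) s) \<and>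
          (\<forall>s. \<omega> s = complex_of_real \<epsilon> * \<omega> (1 - s)))) \<and>
     (mean_periodic_add X_add (H_fun f \<epsilon>) \<longrightarrow>
       (\<exists>M \<omega>. M nicely_meromorphic_on UNIV \<and>
          (\<exists>\<sigma>. \<forall>s. Re s > \<sigma> \<longrightarrow> mellin_integrable {0<..} fc s \<and> M s = mellin {0<..} fc s) \<and>
          (\<forall>s. M s = complex_of_real \<epsilon> * M (1 - s)) \<and>
          (\<forall>s. mellin_integrable {1<..} fc s) \<and>
          (\<forall>s. \<not> is_pole \<omega> s \<longrightarrow>
             M s = mellin {1<..} fc s + complex_of_real \<epsilon> * mellin {1<..} fc (1 - s) + \<omega> s) \<and>
          \<omega> nicely_meromorphic_on UNIV \<and>
          \<omega> = Laplace_Carleman X_add (H_fun f \<epsilon>) \<and>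
          (\<exists>\<sigma>. \<forall>s. Re s > \<sigma> \<longrightarrow>
             laplace_integrable (H_fun f \<epsilon>) s \<and> \<omega> s = laplace (H_fun f \<epsilon>) s) \<and>
          (\<forall>s. \<omega> s = complex_of_real \<epsilon> * \<omega> (1 - s))))"
proof -
  interpret mellin_function f \<epsilon>
    by unfold_locales (use loc_int decay_top growth_0 eps in auto)
  have H: "H_fun f \<epsilon> = (\<lambda>t. h_fun f \<epsilon> (exp (- t)))" by (simp add: H_fun_def fun_eq_iff)
  have MC: "Mellin_Carleman X (h_fun f \<epsilon>) = Laplace_Carleman X (H_fun f \<epsilon>)" for X
    unfolding Mellin_Carleman_def H ..
  show ?thesis
  proof (intro conjI impI, goal_cases)
    case 1
    \<comment> \<open>Only the hypothesis has to be transported: the Mellin-Carleman transform of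
      \<open>h_fun\<close> is by definition the Laplace-Carleman transform of
      \<open>H_fun\<close>.\<close>
    then have "has_annihilator X_mult (H_fun f \<epsilon>)" unfolding H by (rule mean_periodic_mult_has_annihilator)
    note c = continuation[OF this, folded fc_def MC]
    from c(1) c(2,4,5) show ?case by blast
  next
    case 2
    note c = continuation[OF mean_periodic_add_has_annihilator[OF 2], folded fc_def]
    from c(1) c(2,3,5) show ?case by blast
  qed
qed

end
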